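(* Let $M$ be a Poisson manifold, let $\mathcal A=C^\infty(M)$ (complex-valued smooth functions), and let $E\to M$ be a complex vector bundle of fiber dimension $\ge 1$. (i) Let $\boldsymbol{\mathcal A}=(C^\infty(M)[[\lambda]],\star)$ be a deformation quantization of $\mathcal A$. Then there exists a deformation quantization of $E$ corresponding to $\boldsymbol{\mathcal A}$, and it is unique up to equivalence. (ii) If $E$ carries a Hermitian fiber metric $h_0$ and $\boldsymbol{\mathcal A}=(C^\infty(M)[[\lambda]],\star)$ is a Hermitian deformation quantization of $\mathcal A$, then there exists a Hermitian deformation quantization of $(E,h_0)$ corresponding to $\boldsymbol{\mathcal A}$, and it is unique up to equivalence of Hermitian deformations. (iii) Moreover, in each of the cases (i), (ii): if $\star$ is local (respectively differential, respectively of Vey type), then the deformation of $E$ can be chosen to be local (respectively differential, respectively of Vey type).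
   Context: Star-products. A formal deformation of a unital algebra $\mathcal A$ over $\mathbb C$ is an associative $\mathbb C[[\lambda]]$-bilinear product $\star$ on $\mathcal A[[\lambda]]$ of the form $A\star A'=\sum_{r\ge 0}C_r(A,A')\lambda^r$ for $A,A'\in\mathcal A$, with $C_r$ $\mathbb C$-bilinear, $C_0$ the original product, and the unit $1$ of $\mathcal A$ still a unit for $\star$. A deformation quantization (star-product) on a Poisson manifold $M$ is a formal deformation of $C^\infty(M)$ with $\frac{1}{\mathrm i}(C_1(f,g)-C_1(g,f))=\{f,g\}$. It is Hermitian if $\overline{f\star g}=\overline g\star\overline f$ ($\lambda$ real). It is local/differential/of Vey type if each $C_r$ is local (i.e. does not increase supports in either argument)/bidifferential/bidifferential of order (at most) $r$ in each argument. Deformations of bundles. $\mathcal E=\Gamma^\infty(E)$ is the right $\mathcal A$-module of smooth sections. A deformation quantization of $E$ corresponding to $\boldsymbol{\mathcal A}$ is a right $\boldsymbol{\mathcal A}$-module structure $\boldsymbol{\mathcal E}=(\mathcal E[[\lambda]],\bullet)$ of the form $x\bullet A=\sum_{r\ge0}R_r(x,A)\lambda^r$ ($x\in\mathcal E$, $A\in\mathcal A$), with $R_r:\mathcal E\times\mathcal A\to\mathcal E$ $\mathbb C$-bilinear and $R_0(x,A)=x\cdot A$ the original module structure. Two deformations $(\mathcal E[[\lambda]],\bullet)$ and $(\mathcal E[[\lambda]],\bullet')$ are equivalent if there is an $\boldsymbol{\mathcal A}$-module isomorphism between them of the form $\boldsymbol T=\mathrm{id}+\sum_{r\ge1}T_r\lambda^r$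 with $T_r:\mathcal E\to\mathcal E$ $\mathbb C$-linear. Hermitian case. $h_0$ also denotes the induced $\mathcal A$-valued inner product on $\mathcal E$, which is linear in the second argument. A Hermitian deformation quantization of $(E,h_0)$ is a deformation $(\mathcal E[[\lambda]],\bullet)$ of $\mathcal E$ together with $\boldsymbol h=\sum_{r\ge0}h_r\lambda^r$, $h_r:\mathcal E\times\mathcal E\to\mathcal A$, with zeroth order term the given $h_0$, defining a positive definite $\boldsymbol{\mathcal A}$-valued, $\boldsymbol{\mathcal A}$-right linear inner product on $\mathcal E[[\lambda]]$: $\boldsymbol h$ is $\mathbb C[[\lambda]]$-linear in the second argument, $\boldsymbol h(x,y)^*=\boldsymbol h(y,x)$, $\boldsymbol h(x,y\bullet A)=\boldsymbol h(x,y)\star A$, $\boldsymbol h(x,x)\in\boldsymbol{\mathcal A}^+$, and $\boldsymbol h(x,x)=0$ implies $x=0$. Here $\mathbb R[[\lambda]]$ is ordered by declaring $\sum_r a_r\lambda^r>0$ if its first nonvanishing coefficient is positive; a $\mathbb C[[\lambda]]$-linear functional $\omega:\boldsymbol{\mathcal A}\to\mathbb C[[\lambda]]$ is positive if $\omega(A^*\star A)\ge0$ for all $A$; and $\boldsymbol{\mathcal A}^+$ is the set of $A\in\boldsymbol{\mathcal A}$ with $\omega(A)\ge0$ for all positive $\omega$. Two Hermitian deformations $(\mathcal E[[\lambda]],\bullet,\boldsymbol h)$ and $(\mathcal E[[\lambda]],\bullet',\boldsymbol h')$ are equivalent if there is an $\boldsymbol{\mathcal A}$-module isomorphism $\boldsymbol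 T:(\mathcal E[[\lambda]],\bullet)\to(\mathcal E[[\lambda]],\bullet')$ of the form $\boldsymbol T=\mathrm{id}+\sum_{r\ge1}T_r\lambda^r$, with $T_r:\mathcal E\to\mathcal E$ $\mathbb C$-linear, satisfying $\boldsymbol h'(\boldsymbol T(x),\boldsymbol T(y))=\boldsymbol h(x,y)$. A (Hermitian) deformation of $E$ is local/differential/of Vey type if all $R_r$ (and, in the Hermitian case, all $h_r$) are local/differential/differential of order (at most) $r$ in each argument. *)

theory Defs
  imports
    "HOL-Analysis.Analysis"
    "HOL-Computational_Algebra.Formal_Power_Series"
    "HOL-Library.Function_Algebras"
begin

section \<open>Smooth manifolds\<close>

text \<open>Iterated Frechet differentiability; to be used on open sets \<open>S\<close> of a finite-dimensional
  space only.\<close>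

primrec Ck_on :: "nat \<Rightarrow> 'e::real_normed_vector set \<Rightarrow> ('e \<Rightarrow> 'f::real_normed_vector) \<Rightarrow> bool" where
  "Ck_on 0 S f \<longleftrightarrow> continuous_on S f"
| "Ck_on (Suc k) S f \<longleftrightarrow>
     (\<forall>x\<in>S. f differentiable (at x)) \<and> (\<forall>v. Ck_on k S (\<lambda>x. frechet_derivative f (at x) v))"

definition Cinf_on :: "'e::real_normed_vector set \<Rightarrow> ('e \<Rightarrow> 'f::real_normed_vector) \<Rightarrow> bool" where
  "Cinf_on S f \<longleftrightarrow> (\<forall>k. Ck_on k S f)"

text \<open>The manifold is the whole type \<open>'m\<close>; in the theorem \<open>'m\<close> is Hausdorff and second countable.
  A chart is a pair \<open>(U, \<phi>)\<close>, where only the values of \<open>\<phi>\<close> on \<open>U\<close> matter. The model space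
  is any finite-dimensional real inner product space; unlike \<open>euclidean_space\<close> this includes
  dimension zero.\<close>

type_synonym ('m, 'e) atlas = "('m set \<times> ('m \<Rightarrow> 'e)) set"

definition smooth_manifold :: "('m::topological_space, 'e::real_inner) atlas \<Rightarrow> bool" where
  "smooth_manifold atlas \<longleftrightarrow>
     (\<exists>B::'e set. finite B \<and> span B = UNIV) \<and>
     (\<Union>(U, \<phi>)\<in>atlas. U) = UNIV \<and>
     (\<forall>(U, \<phi>)\<in>atlas. open U \<and> open (\<phi> ` U) \<and> homeomorphism U (\<phi> ` U) \<phi> (inv_into U \<phi>)) \<and>
     (\<forall>(U, \<phi>)\<in>atlas. \<forall>(V, \<eta>)\<in>atlas. Cinf_on (\<phi> ` (U \<inter> V)) (\<lambda>z. \<eta> (inv_into U \<phi> z)))"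

definition smooth_map_on ::
  "('m, 'e::real_normed_vector) atlas \<Rightarrow> 'm set \<Rightarrow> ('m \<Rightarrow> 'w::real_normed_vector) \<Rightarrow> bool" where
  "smooth_map_on atlas W f \<longleftrightarrow>
     (\<forall>(U, \<phi>)\<in>atlas. Cinf_on (\<phi> ` (U \<inter> W)) (\<lambda>z. f (inv_into U \<phi> z)))"

definition smooth_functions :: "('m, 'e::real_normed_vector) atlas \<Rightarrow> ('m \<Rightarrow> complex) set" where
  "smooth_functions atlas = {f. smooth_map_on atlas UNIV f}"


section \<open>Complex-linear operations on functions and sections\<close>

text \<open>Sections of a bundle are functions \<open>'m \<Rightarrow> 'v\<close>, added pointwise, where \<open>'v\<close> is a complex vector
  space with scalar multiplication \<open>sc\<close>; for functions on the manifold \<open>sc\<close> is multiplication.\<close>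

definition fscale :: "(complex \<Rightarrow> 'v \<Rightarrow> 'v) \<Rightarrow> complex \<Rightarrow> ('m \<Rightarrow> 'v) \<Rightarrow> 'm \<Rightarrow> 'v" where
  "fscale sc c x = (\<lambda>p. sc c (x p))"

definition clinear_on ::
  "(complex \<Rightarrow> 'v::plus \<Rightarrow> 'v) \<Rightarrow> (complex \<Rightarrow> 'w::plus \<Rightarrow> 'w) \<Rightarrow> ('m \<Rightarrow> 'v) set \<Rightarrow>
   (('m \<Rightarrow> 'v) \<Rightarrow> 'm \<Rightarrow> 'w) \<Rightarrow> bool" where
  "clinear_on sc1 sc2 X T \<longleftrightarrow>
     (\<forall>x\<in>X. \<forall>y\<in>X. T (x + y) = T x + T y) \<and>
     (\<forall>c. \<forall>x\<in>X. T (fscale sc1 c x) = fscale sc2 c (T x))"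

definition cbilinear_on ::
  "(complex \<Rightarrow> 'u::plus \<Rightarrow> 'u) \<Rightarrow> (complex \<Rightarrow> 'v::plus \<Rightarrow> 'v) \<Rightarrow> (complex \<Rightarrow> 'w::plus \<Rightarrow> 'w) \<Rightarrow>
   ('m \<Rightarrow> 'u) set \<Rightarrow> ('m \<Rightarrow> 'v) set \<Rightarrow> (('m \<Rightarrow> 'u) \<Rightarrow> ('m \<Rightarrow> 'v) \<Rightarrow> 'm \<Rightarrow> 'w) \<Rightarrow> bool" where
  "cbilinear_on sc1 sc2 sc3 X Y B \<longleftrightarrow>
     (\<forall>x\<in>X. clinear_on sc2 sc3 Y (B x)) \<and> (\<forall>y\<in>Y. clinear_on sc1 sc3 X (\<lambda>x. B x y))"

definition fcnj :: "('m \<Rightarrow> complex) \<Rightarrow> 'm \<Rightarrow> complex" where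
  "fcnj f = (\<lambda>p. cnj (f p))"


section \<open>Poisson manifolds\<close>

text \<open>The bracket is the complex-bilinear extension to complex-valued functions of a Poisson bracket
  on the real-valued ones; this is expressed by its compatibility with complex conjugation.\<close>

definition poisson_manifold ::
  "('m::topological_space, 'e::real_inner) atlas \<Rightarrow>
   (('m \<Rightarrow> complex) \<Rightarrow> ('m \<Rightarrow> complex) \<Rightarrow> 'm \<Rightarrow> complex) \<Rightarrow> bool" where
  "poisson_manifold atlas pb \<longleftrightarrow> smooth_manifold atlas \<and>
     (let A = smooth_functions atlas in
       (\<forall>f\<in>A. \<forall>g\<in>A. pb f g \<in> A) \<and>
       cbilinear_on (*) (*) (*) A A pb \<and>
       (\<forall>f\<in>A. \<forall>g\<in>A. pb f g = - pb g f) \<and>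
       (\<forall>f\<in>A. \<forall>g\<in>A. \<forall>k\<in>A. pb f (g * k) = pb f g * k + g * pb f k) \<and>
       (\<forall>f\<in>A. \<forall>g\<in>A. \<forall>k\<in>A. pb f (pb g k) + pb g (pb k f) + pb k (pb f g) = 0) \<and>
       (\<forall>f\<in>A. \<forall>g\<in>A. fcnj (pb f g) = pb (fcnj f) (fcnj g)))"


section \<open>Complex vector bundles\<close>

text \<open>The fibres \<open>E p\<close> are subspaces of one complex vector space \<open>'v\<close>, which carries no topology and
  serves only to have common operations \<open>+\<close> and \<open>sc\<close>. Every bundle is isomorphic to one of this
  form: choose a linear isomorphism of each fibre with the standard fibre and transport the
  trivializations.

  A local trivialization \<open>(U, \<psi>)\<close> consists of an open set \<open>U\<close> and linear isomorphisms
  \<open>\<psi> p : E p \<rightarrow> complex ^ 'n\<close> for \<open>p \<in> U\<close>. The smooth structure of the bundle is the one given by the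
  smoothly compatible trivializations. The rank is \<open>CARD('n)\<close>, hence at least one.\<close>

type_synonym ('m, 'v, 'w) trivializations = "('m set \<times> ('m \<Rightarrow> 'v \<Rightarrow> 'w)) set"

definition complex_vector_bundle ::
  "('m::topological_space, 'e::real_inner) atlas \<Rightarrow> (complex \<Rightarrow> 'v::ab_group_add \<Rightarrow> 'v) \<Rightarrow>
   ('m \<Rightarrow> 'v set) \<Rightarrow> ('m, 'v, complex ^ 'n) trivializations \<Rightarrow> bool" where
  "complex_vector_bundle atlas sc E triv \<longleftrightarrow>
     vector_space sc \<and>
     (\<forall>p. module.subspace sc (E p)) \<and>
     (\<Union>(U, \<psi>)\<in>triv. U) = UNIV \<and>
     (\<forall>(U, \<psi>)\<in>triv. open U \<and>
        (\<forall>p\<in>U. bij_betw (\<psi> p) (E p) UNIV \<and>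
           (\<forall>u\<in>E p. \<forall>v\<in>E p. \<psi> p (u + v) = \<psi> p u + \<psi> p v) \<and>
           (\<forall>c. \<forall>u\<in>E p. \<psi> p (sc c u) = c *s \<psi> p u))) \<and>
     (\<forall>(U, \<psi>)\<in>triv. \<forall>(V, \<eta>)\<in>triv. \<forall>w.
        smooth_map_on atlas (U \<inter> V) (\<lambda>p. \<eta> p (inv_into (E p) (\<psi> p) w)))"

definition smooth_sections ::
  "('m, 'e::real_normed_vector) atlas \<Rightarrow> ('m \<Rightarrow> 'v set) \<Rightarrow>
   ('m, 'v, 'w::real_normed_vector) trivializations \<Rightarrow> ('m \<Rightarrow> 'v) set" where
  "smooth_sections atlas E triv =
     {s. (\<forall>p. s p \<in> E p) \<and> (\<forall>(U, \<psi>)\<in>triv. smooth_map_on atlas U (\<lambda>p. \<psi> p (s p)))}"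

definition hermitian_fibre_metric ::
  "('m, 'e::real_normed_vector) atlas \<Rightarrow> (complex \<Rightarrow> 'v::ab_group_add \<Rightarrow> 'v) \<Rightarrow> ('m \<Rightarrow> 'v set) \<Rightarrow>
   ('m, 'v, complex ^ 'n) trivializations \<Rightarrow> ('m \<Rightarrow> 'v \<Rightarrow> 'v \<Rightarrow> complex) \<Rightarrow> bool" where
  "hermitian_fibre_metric atlas sc E triv H \<longleftrightarrow>
     (\<forall>p. \<forall>u\<in>E p. \<forall>v\<in>E p. \<forall>w\<in>E p. H p u (v + w) = H p u v + H p u w) \<and>
     (\<forall>p c. \<forall>u\<in>E p. \<forall>v\<in>E p. H p u (sc c v) = c * H p u v) \<and>
     (\<forall>p. \<forall>u\<in>E p. \<forall>v\<in>E p. cnj (H p u v) = H p v u) \<and>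
     (\<forall>p. \<forall>u\<in>E p. u \<noteq> 0 \<longrightarrow> Re (H p u u) > 0) \<and>
     (\<forall>(U, \<psi>)\<in>triv. \<forall>w w'. smooth_map_on atlas U
        (\<lambda>p. H p (inv_into (E p) (\<psi> p) w) (inv_into (E p) (\<psi> p) w')))"


section \<open>Local and bidifferential operators\<close>

definition fsupp :: "('m::topological_space \<Rightarrow> 'v::zero) \<Rightarrow> 'm set" where
  "fsupp x = closure {p. x p \<noteq> 0}"

definition local_op ::
  "('m::topological_space \<Rightarrow> 'u::zero) set \<Rightarrow> ('m \<Rightarrow> 'v::zero) set \<Rightarrow>
   (('m \<Rightarrow> 'u) \<Rightarrow> ('m \<Rightarrow> 'v) \<Rightarrow> 'm \<Rightarrow> 'w::zero) \<Rightarrow> bool" where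
  "local_op X Y B \<longleftrightarrow> (\<forall>x\<in>X. \<forall>y\<in>Y. fsupp (B x y) \<subseteq> fsupp x \<inter> fsupp y)"

primrec iter_deriv ::
  "'e::real_normed_vector list \<Rightarrow> ('e \<Rightarrow> 'f::real_normed_vector) \<Rightarrow> 'e \<Rightarrow> 'f" where
  "iter_deriv [] f = f"
| "iter_deriv (v # vs) f = (\<lambda>z. frechet_derivative (iter_deriv vs f) (at z) v)"

definition loc_rep ::
  "'m set \<Rightarrow> ('m \<Rightarrow> 'e) \<Rightarrow> ('m \<Rightarrow> 'v \<Rightarrow> 'w) \<Rightarrow> ('m \<Rightarrow> 'v) \<Rightarrow> 'e \<Rightarrow> 'w" where
  "loc_rep U \<phi> \<psi> x = (\<lambda>z. \<psi> (inv_into U \<phi> z) (x (inv_into U \<phi> z)))"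

text \<open>Bidifferential operators \<open>X \<times> Y \<rightarrow> Z\<close> of order at most \<open>k\<close> in each argument, where \<open>X\<close>, \<open>Y\<close>, \<open>Z\<close>
  are spaces of sections with trivializations \<open>tX\<close>, \<open>tY\<close>, \<open>tZ\<close>: in local coordinates and local
  frames, with respect to a basis \<open>D\<close> of the model space, they are
  \<open>B(x, y) = \<Sum> c\<^bsub>a b\<^esub> (\<partial>\<^sup>a x, \<partial>\<^sup>b y)\<close> with smooth coefficients. Multi-indices are
  lists over \<open>D\<close>. The coefficients are only required to be real bilinear, so that the definition
  also applies to maps which are antilinear in the first argument.\<close>

definition bidiff_op ::
  "('m::topological_space, 'e::real_normed_vector) atlas \<Rightarrow>
   ('m, 'u, 'u1::real_normed_vector) trivializations \<Rightarrow>
   ('m, 'v, 'v1::real_normed_vector) trivializations \<Rightarrow>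
   ('m, 'w, 'w1::real_normed_vector) trivializations \<Rightarrow>
   ('m \<Rightarrow> 'u) set \<Rightarrow> ('m \<Rightarrow> 'v) set \<Rightarrow> nat \<Rightarrow> (('m \<Rightarrow> 'u) \<Rightarrow> ('m \<Rightarrow> 'v) \<Rightarrow> 'm \<Rightarrow> 'w) \<Rightarrow> bool" where
  "bidiff_op atlas tX tY tZ X Y k B \<longleftrightarrow>
     (\<forall>(U, \<phi>)\<in>atlas. \<forall>(U1, \<psi>1)\<in>tX. \<forall>(U2, \<psi>2)\<in>tY. \<forall>(U3, \<psi>3)\<in>tZ.
        let W = U \<inter> U1 \<inter> U2 \<inter> U3 in
        \<exists>D (c :: 'e list \<Rightarrow> 'e list \<Rightarrow> 'm \<Rightarrow> 'u1 \<Rightarrow> 'v1 \<Rightarrow> 'w1).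
          finite D \<and> independent D \<and> span D = UNIV \<and>
          (\<forall>a b. \<forall>p\<in>W. bilinear (c a b p)) \<and>
          (\<forall>a b u v. smooth_map_on atlas W (\<lambda>p. c a b p u v)) \<and>
          (\<forall>x\<in>X. \<forall>y\<in>Y. \<forall>p\<in>W.
             \<psi>3 p (B x y p) =
               (\<Sum>a\<in>{a. set a \<subseteq> D \<and> length a \<le> k}. \<Sum>b\<in>{b. set b \<subseteq> D \<and> length b \<le> k}.
                  c a b p (iter_deriv a (loc_rep U \<phi> \<psi>1 x) (\<phi> p))
                          (iter_deriv b (loc_rep U \<phi> \<psi>2 y) (\<phi> p)))))"

text \<open>Functions are sections of the trivial line bundle.\<close>

definition fun_triv :: "('m, complex, complex) trivializations" where
  "fun_triv = {(UNIV, \<lambda>p z. z)}"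


section \<open>Formal power series\<close>

text \<open>The series in \<open>X[[\<lambda>]]\<close>.\<close>

definition series_in :: "'a set \<Rightarrow> 'a fps set" where
  "series_in X = {F. \<forall>r. fps_nth F r \<in> X}"

text \<open>Extension of a family of additive (biadditive) maps to formal power series, i.e. of
  \<open>T(x) = \<Sum> T\<^sub>r(x) \<lambda>\<^sup>r\<close> and \<open>B(x, y) = \<Sum> B\<^sub>r(x, y) \<lambda>\<^sup>r\<close>. Since \<open>\<lambda>\<close> is real this is also the right
  extension for sesquilinear maps.\<close>

definition series_map :: "(nat \<Rightarrow> 'a \<Rightarrow> 'b::comm_monoid_add) \<Rightarrow> 'a fps \<Rightarrow> 'b fps" where
  "series_map T F = Abs_fps (\<lambda>n. \<Sum>i\<le>n. T (n - i) (fps_nth F i))"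

definition series_bimap ::
  "(nat \<Rightarrow> 'a \<Rightarrow> 'b \<Rightarrow> 'c::comm_monoid_add) \<Rightarrow> 'a fps \<Rightarrow> 'b fps \<Rightarrow> 'c fps" where
  "series_bimap B F G =
     Abs_fps (\<lambda>n. \<Sum>i\<le>n. \<Sum>j\<le>n - i. B (n - i - j) (fps_nth F i) (fps_nth G j))"

definition series_scale :: "complex fps \<Rightarrow> ('m \<Rightarrow> complex) fps \<Rightarrow> ('m \<Rightarrow> complex) fps" where
  "series_scale a F = Abs_fps (\<lambda>n. \<Sum>i\<le>n. fscale (*) (fps_nth a i) (fps_nth F (n - i)))"

definition series_cnj :: "('m \<Rightarrow> complex) fps \<Rightarrow> ('m \<Rightarrow> complex) fps" where
  "series_cnj F = Abs_fps (\<lambda>n. fcnj (fps_nth F n))"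

text \<open>The elements of \<open>\<complex>[[\<lambda>]]\<close> lying in \<open>\<real>[[\<lambda>]]\<close> and nonnegative there; \<open>subdegree\<close> is the index of
  the first nonvanishing coefficient.\<close>

definition series_nonneg :: "complex fps \<Rightarrow> bool" where
  "series_nonneg a \<longleftrightarrow> (\<forall>r. fps_nth a r \<in> \<real>) \<and> (a = 0 \<or> Re (fps_nth a (subdegree a)) > 0)"


section \<open>Star products\<close>

text \<open>A star product is given by the family \<open>C\<close> of its cochains; the product on formal power series
  is \<open>series_bimap C\<close>.\<close>

type_synonym 'm cochains = "nat \<Rightarrow> ('m \<Rightarrow> complex) \<Rightarrow> ('m \<Rightarrow> complex) \<Rightarrow> 'm \<Rightarrow> complex"

definition formal_deformation :: "('m \<Rightarrow> complex) set \<Rightarrow> 'm cochains \<Rightarrow> bool" where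
  "formal_deformation A C \<longleftrightarrow>
     (\<forall>r. \<forall>f\<in>A. \<forall>g\<in>A. C r f g \<in> A) \<and>
     (\<forall>r. cbilinear_on (*) (*) (*) A A (C r)) \<and>
     (\<forall>f\<in>A. \<forall>g\<in>A. C 0 f g = f * g) \<and>
     (\<forall>F\<in>series_in A. \<forall>G\<in>series_in A. \<forall>K\<in>series_in A.
        series_bimap C (series_bimap C F G) K = series_bimap C F (series_bimap C G K)) \<and>
     (\<forall>F\<in>series_in A. series_bimap C 1 F = F \<and> series_bimap C F 1 = F)"

definition star_product ::
  "('m, 'e::real_normed_vector) atlas \<Rightarrow> (('m \<Rightarrow> complex) \<Rightarrow> ('m \<Rightarrow> complex) \<Rightarrow> 'm \<Rightarrow> complex) \<Rightarrow>
   'm cochains \<Rightarrow> bool" where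
  "star_product atlas pb C \<longleftrightarrow>
     formal_deformation (smooth_functions atlas) C \<and>
     (\<forall>f\<in>smooth_functions atlas. \<forall>g\<in>smooth_functions atlas. \<forall>p.
        (1 / \<i>) * (C 1 f g p - C 1 g f p) = pb f g p)"

definition hermitian_star :: "('m \<Rightarrow> complex) set \<Rightarrow> 'm cochains \<Rightarrow> bool" where
  "hermitian_star A C \<longleftrightarrow>
     (\<forall>F\<in>series_in A. \<forall>G\<in>series_in A.
        series_cnj (series_bimap C F G) = series_bimap C (series_cnj G) (series_cnj F))"

definition positive_functional ::
  "('m \<Rightarrow> complex) set \<Rightarrow> 'm cochains \<Rightarrow> (('m \<Rightarrow> complex) fps \<Rightarrow> complex fps) \<Rightarrow> bool" where
  "positive_functional A C \<omega> \<longleftrightarrow>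
     (\<forall>F\<in>series_in A. \<forall>G\<in>series_in A. \<omega> (F + G) = \<omega> F + \<omega> G) \<and>
     (\<forall>a. \<forall>F\<in>series_in A. \<omega> (series_scale a F) = a * \<omega> F) \<and>
     (\<forall>F\<in>series_in A. series_nonneg (\<omega> (series_bimap C (series_cnj F) F)))"

definition positive_elements ::
  "('m \<Rightarrow> complex) set \<Rightarrow> 'm cochains \<Rightarrow> ('m \<Rightarrow> complex) fps set" where
  "positive_elements A C =
     {F\<in>series_in A. \<forall>\<omega>. positive_functional A C \<omega> \<longrightarrow> series_nonneg (\<omega> F)}"


section \<open>Deformations of vector bundles\<close>

text \<open>In this section \<open>A\<close> is the algebra of smooth functions and \<open>X\<close> the module of smooth sections.\<close>

definition bundle_deformation ::
  "('m \<Rightarrow> complex) set \<Rightarrow> 'm cochains \<Rightarrow> (complex \<Rightarrow> 'v::ab_group_add \<Rightarrow> 'v) \<Rightarrow> ('m \<Rightarrow> 'v) set \<Rightarrow>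
   (nat \<Rightarrow> ('m \<Rightarrow> 'v) \<Rightarrow> ('m \<Rightarrow> complex) \<Rightarrow> 'm \<Rightarrow> 'v) \<Rightarrow> bool" where
  "bundle_deformation A C sc X R \<longleftrightarrow>
     (\<forall>r. \<forall>x\<in>X. \<forall>f\<in>A. R r x f \<in> X) \<and>
     (\<forall>r. cbilinear_on sc (*) sc X A (R r)) \<and>
     (\<forall>x\<in>X. \<forall>f\<in>A. R 0 x f = (\<lambda>p. sc (f p) (x p))) \<and>
     (\<forall>x\<in>series_in X. \<forall>F\<in>series_in A. \<forall>G\<in>series_in A.
        series_bimap R (series_bimap R x F) G = series_bimap R x (series_bimap C F G)) \<and>
     (\<forall>x\<in>series_in X. series_bimap R x 1 = x)"

definition deformation_iso ::
  "('m \<Rightarrow> complex) set \<Rightarrow> (complex \<Rightarrow> 'v::ab_group_add \<Rightarrow> 'v) \<Rightarrow> ('m \<Rightarrow> 'v) set \<Rightarrow>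
   (nat \<Rightarrow> ('m \<Rightarrow> 'v) \<Rightarrow> ('m \<Rightarrow> complex) \<Rightarrow> 'm \<Rightarrow> 'v) \<Rightarrow>
   (nat \<Rightarrow> ('m \<Rightarrow> 'v) \<Rightarrow> ('m \<Rightarrow> complex) \<Rightarrow> 'm \<Rightarrow> 'v) \<Rightarrow>
   (nat \<Rightarrow> ('m \<Rightarrow> 'v) \<Rightarrow> 'm \<Rightarrow> 'v) \<Rightarrow> bool" where
  "deformation_iso A sc X R R' T \<longleftrightarrow>
     (\<forall>r. \<forall>x\<in>X. T r x \<in> X) \<and>
     (\<forall>r. clinear_on sc sc X (T r)) \<and>
     (\<forall>x\<in>X. T 0 x = x) \<and>
     bij_betw (series_map T) (series_in X) (series_in X) \<and>
     (\<forall>x\<in>series_in X. \<forall>F\<in>series_in A.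
        series_map T (series_bimap R x F) = series_bimap R' (series_map T x) F)"

definition equivalent_deformations ::
  "('m \<Rightarrow> complex) set \<Rightarrow> (complex \<Rightarrow> 'v::ab_group_add \<Rightarrow> 'v) \<Rightarrow> ('m \<Rightarrow> 'v) set \<Rightarrow>
   (nat \<Rightarrow> ('m \<Rightarrow> 'v) \<Rightarrow> ('m \<Rightarrow> complex) \<Rightarrow> 'm \<Rightarrow> 'v) \<Rightarrow>
   (nat \<Rightarrow> ('m \<Rightarrow> 'v) \<Rightarrow> ('m \<Rightarrow> complex) \<Rightarrow> 'm \<Rightarrow> 'v) \<Rightarrow> bool" where
  "equivalent_deformations A sc X R R' \<longleftrightarrow> (\<exists>T. deformation_iso A sc X R R' T)"

text \<open>The inner product \<open>series_bimap h\<close> is \<open>\<complex>[[\<lambda>]]\<close>-linear in the second argument because each \<open>h r\<close>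
  is complex linear there; antilinearity in the first argument follows from the symmetry.\<close>

definition hermitian_deformation ::
  "('m \<Rightarrow> complex) set \<Rightarrow> 'm cochains \<Rightarrow> (complex \<Rightarrow> 'v::ab_group_add \<Rightarrow> 'v) \<Rightarrow> ('m \<Rightarrow> 'v) set \<Rightarrow>
   ('m \<Rightarrow> 'v \<Rightarrow> 'v \<Rightarrow> complex) \<Rightarrow>
   (nat \<Rightarrow> ('m \<Rightarrow> 'v) \<Rightarrow> ('m \<Rightarrow> complex) \<Rightarrow> 'm \<Rightarrow> 'v) \<Rightarrow>
   (nat \<Rightarrow> ('m \<Rightarrow> 'v) \<Rightarrow> ('m \<Rightarrow> 'v) \<Rightarrow> 'm \<Rightarrow> complex) \<Rightarrow> bool" where
  "hermitian_deformation A C sc X H R h \<longleftrightarrow>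
     bundle_deformation A C sc X R \<and>
     (\<forall>r. \<forall>x\<in>X. \<forall>y\<in>X. h r x y \<in> A) \<and>
     (\<forall>x\<in>X. \<forall>y\<in>X. h 0 x y = (\<lambda>p. H p (x p) (y p))) \<and>
     (\<forall>r. \<forall>x\<in>X. clinear_on sc (*) X (h r x)) \<and>
     (\<forall>x\<in>series_in X. \<forall>y\<in>series_in X. series_cnj (series_bimap h x y) = series_bimap h y x) \<and>
     (\<forall>x\<in>series_in X. \<forall>y\<in>series_in X. \<forall>F\<in>series_in A.
        series_bimap h x (series_bimap R y F) = series_bimap C (series_bimap h x y) F) \<and>
     (\<forall>x\<in>series_in X. series_bimap h x x \<in> positive_elements A C) \<and>
     (\<forall>x\<in>series_in X. series_bimap h x x = 0 \<longrightarrow> x = 0)"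

definition equivalent_hermitian_deformations ::
  "('m \<Rightarrow> complex) set \<Rightarrow> (complex \<Rightarrow> 'v::ab_group_add \<Rightarrow> 'v) \<Rightarrow> ('m \<Rightarrow> 'v) set \<Rightarrow>
   (nat \<Rightarrow> ('m \<Rightarrow> 'v) \<Rightarrow> ('m \<Rightarrow> complex) \<Rightarrow> 'm \<Rightarrow> 'v) \<Rightarrow>
   (nat \<Rightarrow> ('m \<Rightarrow> 'v) \<Rightarrow> ('m \<Rightarrow> 'v) \<Rightarrow> 'm \<Rightarrow> complex) \<Rightarrow>
   (nat \<Rightarrow> ('m \<Rightarrow> 'v) \<Rightarrow> ('m \<Rightarrow> complex) \<Rightarrow> 'm \<Rightarrow> 'v) \<Rightarrow>
   (nat \<Rightarrow> ('m \<Rightarrow> 'v) \<Rightarrow> ('m \<Rightarrow> 'v) \<Rightarrow> 'm \<Rightarrow> complex) \<Rightarrow> bool" where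
  "equivalent_hermitian_deformations A sc X R h R' h' \<longleftrightarrow>
     (\<exists>T. deformation_iso A sc X R R' T \<and>
        (\<forall>x\<in>series_in X. \<forall>y\<in>series_in X.
           series_bimap h' (series_map T x) (series_map T y) = series_bimap h x y))"

end

theory Submission
  imports Defs
begin

text \<open>There are finitely many global sections \<open>e\<^sub>i\<close> and dual cosections \<open>l\<^sub>i\<close> with
  \<open>\<Sum>\<^sub>i e\<^sub>i l\<^sub>i(x) = x\<close>. Finitely many suffice also on a noncompact manifold: it is covered by small
  open sets in finitely many colours such that sets of one colour are disjoint, so that the local
  frames over the sets of one colour can be glued after being cut off. In the Hermitian case local
  orthonormal frames give \<open>l\<^sub>i = h\<^sub>0(e\<^sub>i, -)\<close>.

  The frame makes the obstruction spaces vanish by explicit homotopies. If \<open>R\<^sub>0, \<dots>, R\<^sub>r\<close> are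
  associative up to order \<open>r\<close>, the defect \<open>D\<close> of associativity in order \<open>r + 1\<close> is a cocycle, and
  \<open>R\<^sub>r\<^sub>+\<^sub>1(x, f) = - \<Sum>\<^sub>i D(e\<^sub>i, l\<^sub>i(x), f)\<close> removes it. Likewise a module map in order zero is lifted to a
  map of the deformed modules by adding \<open>\<Sum>\<^sub>i D(e\<^sub>i, l\<^sub>i(x))\<close>, where now \<open>D\<close> is the defect of linearity;
  lifting the identity gives uniqueness. Lifting \<open>l\<^sub>i\<close> to module maps \<open>\<Phi>\<^sub>i\<close> with values in the deformed
  algebra gives the deformed metric \<open>h(x, y) = \<Sum>\<^sub>i \<Phi>\<^sub>i(x)\<^sup>* \<star> \<Phi>\<^sub>i(y)\<close>, which is positive by its form. An
  isomorphism is made isometric order by order, correcting it by half of the difference of the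
  metrics.

  All operators obtained are composed of the cochains \<open>C\<^sub>s\<close>, the frame and the dual frame, and the
  total order in \<open>\<lambda>\<close> is additive. Hence they are local with the \<open>C\<^sub>s\<close>, and if \<open>C\<^sub>s\<close> has differential
  order \<open>\<kappa>(s)\<close> with \<open>\<kappa>\<close> superadditive, then so have they.\<close>

section \<open>Additive maps and formal power series\<close>

text \<open>The \<open>e\<^sub>i\<close> may be linearly dependent: what is used is the dual basis
  property of a finitely generated projective module. A homotopy works because the cocycle identity,
  evaluated at \<open>e\<^sub>i\<close> and \<open>l\<^sub>i(x)\<close>, has one term that sums to
  the full defect by the frame expansion, while \<open>l\<^sub>i(x f) = l\<^sub>i(x) f\<close> turns
  the other terms into the coboundary of the correction. The cocycle identities themselves are
  formal cancellations between power series; their lowest coefficient is read off afterwards, which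
  needs a reduction of statements on series to constant series. Two more things must survive every
  step. The unit has to act as the identity, which holds since the defect vanishes when its last
  argument is 1. The correction to an isometry has to be linear over the functions, which holds
  since the difference of the metrics is so in its lowest order; the factor one half appears because
  the correction enters both arguments of the metric. For the gluing, squares of bump functions are
  normalized to sum 1, so that \<open>e\<^sub>i\<close> and \<open>l\<^sub>i\<close> carry the same
  real smooth factor and metric duality is preserved.\<close>

definition add_closed :: "'a::ab_group_add set \<Rightarrow> bool" where
  "add_closed X \<longleftrightarrow> 0 \<in> X \<and> (\<forall>x\<in>X. \<forall>y\<in>X. x + y \<in> X) \<and> (\<forall>x\<in>X. - x \<in> X)"

lemma add_closedD:
  assumes "add_closed X"
  shows "0 \<in> X" "\<And>x y. x \<in> X \<Longrightarrow> y \<in> X \<Longrightarrow> x + y \<in> X" "\<And>x. x \<in> X \<Longrightarrow> - x \<in> X"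
    "\<And>x y. x \<in> X \<Longrightarrow> y \<in> X \<Longrightarrow> x - y \<in> X"
proof -
  show 0: "0 \<in> X" "\<And>x y. x \<in> X \<Longrightarrow> y \<in> X \<Longrightarrow> x + y \<in> X" "\<And>x. x \<in> X \<Longrightarrow> - x \<in> X"
    using assms by (auto simp: add_closed_def)
  show "x - y \<in> X" if "x \<in> X" "y \<in> X" for x y
    using 0(2)[OF that(1) 0(3)[OF that(2)]] by simp
qed

lemma add_closed_sum:
  assumes "add_closed X" "\<And>i. i \<in> I \<Longrightarrow> f i \<in> X"
  shows "sum f I \<in> X"
  using assms(2) by (induction I rule: infinite_finite_induct) (auto intro: add_closedD[OF assms(1)])

text \<open>Additivity alone is recorded, so that the same lemmas also serve the cochains
  \<open>h r\<close> of an inner product, which are antilinear in the first argument.\<close>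

definition biadditive :: "'a::ab_group_add set \<Rightarrow> 'b::ab_group_add set \<Rightarrow> 'c::ab_group_add set \<Rightarrow>
    ('a \<Rightarrow> 'b \<Rightarrow> 'c) \<Rightarrow> bool" where
  "biadditive X Y Z B \<longleftrightarrow> (\<forall>x\<in>X. \<forall>y\<in>Y. B x y \<in> Z) \<and>
     (\<forall>x\<in>X. \<forall>x'\<in>X. \<forall>y\<in>Y. B (x + x') y = B x y + B x' y) \<and>
     (\<forall>x\<in>X. \<forall>y\<in>Y. \<forall>y'\<in>Y. B x (y + y') = B x y + B x y')"

definition additive_map :: "'a::ab_group_add set \<Rightarrow> 'b::ab_group_add set \<Rightarrow> ('a \<Rightarrow> 'b) \<Rightarrow> bool" where
  "additive_map X Y T \<longleftrightarrow> (\<forall>x\<in>X. T x \<in> Y) \<and> (\<forall>x\<in>X. \<forall>x'\<in>X. T (x + x') = T x + T x')"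

lemma additive_map_0:
  assumes "additive_map X Y T" "0 \<in> X"
  shows "T 0 = 0"
proof -
  have "T (0 + 0) = T 0 + T 0" using assms unfolding additive_map_def by blast
  then show ?thesis by simp
qed

lemma additive_map_neg:
  assumes "additive_map X Y T" "add_closed X" "x \<in> X"
  shows "T (- x) = - T x"
proof -
  have "T (x + - x) = T x + T (- x)"
    using assms add_closedD(3) unfolding additive_map_def by blast
  then show ?thesis
    using additive_map_0[OF assms(1) add_closedD(1)[OF assms(2)]]
    by (simp add: minus_unique)
qed

lemma additive_map_diff:
  assumes "additive_map X Y T" "add_closed X" "x \<in> X" "y \<in> X"
  shows "T (x - y) = T x - T y"
proof -
  have "T (x + - y) = T x + T (- y)"
    using assms add_closedD(3) unfolding additive_map_def by blast
  then show ?thesis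
    using additive_map_neg[OF assms(1,2,4)] by simp
qed

lemma additive_map_sum:
  assumes "additive_map X Y T" "add_closed X" "\<And>i. i \<in> I \<Longrightarrow> f i \<in> X"
  shows "T (sum f I) = (\<Sum>i\<in>I. T (f i))"
  using assms(3)
proof (induction I rule: infinite_finite_induct)
  case (insert i I)
  have "T (f i + sum f I) = T (f i) + T (sum f I)"
    using assms(1) insert.prems add_closed_sum[OF assms(2), of I f] unfolding additive_map_def by blast
  then show ?case using insert by simp
qed (use additive_map_0[OF assms(1) add_closedD(1)[OF assms(2)]] in auto)

lemma biadditive_left: "biadditive X Y Z B \<Longrightarrow> y \<in> Y \<Longrightarrow> additive_map X Z (\<lambda>x. B x y)"
  and biadditive_right: "biadditive X Y Z B \<Longrightarrow> x \<in> X \<Longrightarrow> additive_map Y Z (B x)"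
  and biadditive_in: "biadditive X Y Z B \<Longrightarrow> x \<in> X \<Longrightarrow> y \<in> Y \<Longrightarrow> B x y \<in> Z"
  by (auto simp: biadditive_def additive_map_def)

lemma biadditive_add_left: "biadditive X Y Z B \<Longrightarrow> x \<in> X \<Longrightarrow> x' \<in> X \<Longrightarrow> y \<in> Y \<Longrightarrow> B (x + x') y = B x y + B x' y"
  and biadditive_add_right: "biadditive X Y Z B \<Longrightarrow> x \<in> X \<Longrightarrow> y \<in> Y \<Longrightarrow> y' \<in> Y \<Longrightarrow> B x (y + y') = B x y + B x y'"
  by (auto simp: biadditive_def)

lemma additive_map_in: "additive_map X Y T \<Longrightarrow> x \<in> X \<Longrightarrow> T x \<in> Y"
  and additive_map_add: "additive_map X Y T \<Longrightarrow> x \<in> X \<Longrightarrow> x' \<in> X \<Longrightarrow> T (x + x') = T x + T x'"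
  by (auto simp: additive_map_def)

text \<open>Multiplication by \<lambda>. The coefficients form only an additive group, so it cannot
  be written as a product of power series.\<close>

definition series_shift :: "'a::zero fps \<Rightarrow> 'a fps" where
  "series_shift F = Abs_fps (\<lambda>n. if n = 0 then 0 else fps_nth F (n - 1))"

lemma series_shift_nth [simp]:
  "fps_nth (series_shift F) 0 = 0" "fps_nth (series_shift F) (Suc n) = fps_nth F n"
  by (simp_all add: series_shift_def)

lemma series_decomp: "F = fps_const (fps_nth F 0) + series_shift (fps_shift 1 F)"
  for F :: "'a::ab_group_add fps"
proof (rule fps_ext)
  fix n show "fps_nth F n = fps_nth (fps_const (fps_nth F 0) + series_shift (fps_shift 1 F)) n"
    by (cases n) auto
qed

lemma series_in_nth: "F \<in> series_in X \<Longrightarrow> fps_nth F n \<in> X"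
  by (simp add: series_in_def)

lemma series_in_closed:
  assumes "add_closed X"
  shows "F \<in> series_in X \<Longrightarrow> G \<in> series_in X \<Longrightarrow> F + G \<in> series_in X"
    "F \<in> series_in X \<Longrightarrow> G \<in> series_in X \<Longrightarrow> F - G \<in> series_in X"
    "F \<in> series_in X \<Longrightarrow> series_shift F \<in> series_in X"
    "F \<in> series_in X \<Longrightarrow> fps_shift k F \<in> series_in X"
    "a \<in> X \<Longrightarrow> fps_const a \<in> series_in X"
  unfolding series_in_def series_shift_def by (simp_all add: add_closedD[OF assms])

lemma add_closed_series_in: "add_closed X \<Longrightarrow> add_closed (series_in X)"
  by (simp add: series_in_def add_closed_def)

text \<open>Compatibility with \<lambda> takes the place of \<lambda>-adic continuity: coefficient
  \<open>n\<close> of \<open>\<Phi> F\<close> depends only on the coefficients of \<open>F\<close>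
  up to \<open>n\<close>, and \<open>\<Phi>\<close> is determined by its values on constant
  series.\<close>

definition shift_linear :: "'a::ab_group_add set \<Rightarrow> 'b::ab_group_add set \<Rightarrow> ('a fps \<Rightarrow> 'b fps) \<Rightarrow> bool" where
  "shift_linear X Y \<Phi> \<longleftrightarrow> additive_map (series_in X) (series_in Y) \<Phi> \<and>
     (\<forall>F\<in>series_in X. \<Phi> (series_shift F) = series_shift (\<Phi> F))"

lemma shift_linear_in: "shift_linear X Y \<Phi> \<Longrightarrow> F \<in> series_in X \<Longrightarrow> \<Phi> F \<in> series_in Y"
  by (auto simp: shift_linear_def additive_map_def)

lemma shift_linear_additive: "shift_linear X Y \<Phi> \<Longrightarrow> additive_map (series_in X) (series_in Y) \<Phi>"
  by (auto simp: shift_linear_def)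

lemma shift_linear_comp:
  assumes "shift_linear X Y \<Phi>" "shift_linear Y Z \<Psi>"
  shows "shift_linear X Z (\<lambda>F. \<Psi> (\<Phi> F))"
  using assms unfolding shift_linear_def additive_map_def by auto

lemma series_shift_add: "series_shift (F + G) = series_shift F + series_shift G"
  for F :: "'a::ab_group_add fps"
  by (rule fps_ext) (auto simp: series_shift_def)

lemma series_shift_diff: "series_shift (F - G) = series_shift F - series_shift G"
  for F :: "'a::ab_group_add fps"
  by (rule fps_ext) (auto simp: series_shift_def)

lemma shift_linear_add:
  assumes "shift_linear X Y \<Phi>" "shift_linear X Y \<Psi>" "add_closed Y"
  shows "shift_linear X Y (\<lambda>F. \<Phi> F + \<Psi> F)"
  using assms(1,2) unfolding shift_linear_def additive_map_def
  by (auto simp: series_shift_add intro: series_in_closed[OF assms(3)])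

lemma shift_linear_diff:
  assumes "shift_linear X Y \<Phi>" "shift_linear X Y \<Psi>" "add_closed Y"
  shows "shift_linear X Y (\<lambda>F. \<Phi> F - \<Psi> F)"
  using assms(1,2) unfolding shift_linear_def additive_map_def
  by (auto simp: series_shift_diff intro: series_in_closed[OF assms(3)])

lemma shift_linear_zero: "add_closed Y \<Longrightarrow> shift_linear X Y (\<lambda>F. 0)"
  by (auto simp: shift_linear_def additive_map_def series_in_def add_closed_def series_shift_def fps_eq_iff)

lemma shift_linear_sum:
  assumes "finite I" "\<And>i. i \<in> I \<Longrightarrow> shift_linear X Y (\<Phi> i)" "add_closed Y"
  shows "shift_linear X Y (\<lambda>F. \<Sum>i\<in>I. \<Phi> i F)"
  using assms(1,2)
proof (induction I rule: finite_induct)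
  case (insert i I)
  then have "shift_linear X Y (\<lambda>F. \<Phi> i F + (\<Sum>i\<in>I. \<Phi> i F))"
    by (intro shift_linear_add assms(3)) simp_all
  then show ?case using insert.hyps by simp
qed (simp add: shift_linear_zero[OF assms(3)])

text \<open>Splitting off the constant term leaves \<lambda> times a series, and for that part the
  index drops by one. This recursion drives the comparisons that follow.\<close>

lemma shift_linear_nth:
  assumes "shift_linear X Y \<Phi>" "add_closed X" "F \<in> series_in X"
  shows "fps_nth (\<Phi> F) n = fps_nth (\<Phi> (fps_const (fps_nth F 0))) n +
    (if n = 0 then 0 else fps_nth (\<Phi> (fps_shift 1 F)) (n - 1))"
proof -
  have *: "fps_const (fps_nth F 0) \<in> series_in X" "fps_shift 1 F \<in> series_in X"
    using series_in_closed(4,5)[OF assms(2)] series_in_nth[OF assms(3)] assms(3) by simp_all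
  have "\<Phi> F = \<Phi> (fps_const (fps_nth F 0)) + series_shift (\<Phi> (fps_shift 1 F))"
    using assms(1) additive_map_add[OF shift_linear_additive[OF assms(1)] *(1) series_in_closed(3)[OF assms(2) *(2)]] *(2)
    by (subst series_decomp[of F]) (simp add: shift_linear_def)
  then show ?thesis by (cases n) auto
qed

lemma shift_linear_eq_upto:
  assumes "shift_linear X Y \<Phi>" "shift_linear X Y \<Psi>" "add_closed X"
    and "\<And>x n. x \<in> X \<Longrightarrow> n \<le> N \<Longrightarrow> fps_nth (\<Phi> (fps_const x)) n = fps_nth (\<Psi> (fps_const x)) n"
  shows "F \<in> series_in X \<Longrightarrow> n \<le> N \<Longrightarrow> fps_nth (\<Phi> F) n = fps_nth (\<Psi> F) n"
proof (induction n arbitrary: F)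
  case 0
  then show ?case
    using assms(4)[OF series_in_nth[OF 0(1)]] shift_linear_nth[OF assms(1,3) 0(1), of 0]
      shift_linear_nth[OF assms(2,3) 0(1), of 0] by simp
next
  case (Suc n)
  have "fps_shift 1 F \<in> series_in X" using series_in_closed(4)[OF assms(3)] Suc.prems by blast
  then have "fps_nth (\<Phi> (fps_shift 1 F)) n = fps_nth (\<Psi> (fps_shift 1 F)) n"
    using Suc by auto
  then show ?case
    using assms(4)[OF series_in_nth[OF Suc.prems(1)] Suc.prems(2)]
      shift_linear_nth[OF assms(1,3) Suc.prems(1), of "Suc n"]
      shift_linear_nth[OF assms(2,3) Suc.prems(1), of "Suc n"] by simp
qed

lemma shift_linear_eq:
  assumes "shift_linear X Y \<Phi>" "shift_linear X Y \<Psi>" "add_closed X"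
    and "\<And>x. x \<in> X \<Longrightarrow> \<Phi> (fps_const x) = \<Psi> (fps_const x)" and "F \<in> series_in X"
  shows "\<Phi> F = \<Psi> F"
  by (rule fps_ext, rule shift_linear_eq_upto[OF assms(1-3) _ assms(5) order_refl])
    (simp add: assms(4))

text \<open>If constants contribute nothing below order \<open>r\<close>, then the part of
  \<open>F\<close> divisible by \<lambda> contributes nothing in order \<open>r\<close>. This turns
  an identity between series into an identity for the leading defects, with undeformed products as
  their arguments.\<close>

lemma shift_linear_leading:
  assumes "shift_linear X Y \<Phi>" "add_closed X" "add_closed Y" "F \<in> series_in X"
    and "\<And>x n. x \<in> X \<Longrightarrow> n < r \<Longrightarrow> fps_nth (\<Phi> (fps_const x)) n = 0"
  shows "fps_nth (\<Phi> F) r = fps_nth (\<Phi> (fps_const (fps_nth F 0))) r"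
proof -
  have "fps_nth (\<Phi> (fps_shift 1 F)) (r - 1) = 0" if "r \<noteq> 0"
  proof -
    have "fps_nth (\<Phi> (fps_shift 1 F)) (r - 1) = fps_nth (0 :: 'b fps) (r - 1)"
      by (rule shift_linear_eq_upto[OF assms(1) shift_linear_zero[OF assms(3)] assms(2), where N = "r - 1"])
        (use that assms series_in_closed(4)[OF assms(2,4)] in auto)
    then show ?thesis by simp
  qed
  then show ?thesis using shift_linear_nth[OF assms(1,2,4), of r] by simp
qed

lemma shift_linear_low:
  assumes "shift_linear X Y \<Phi>" "add_closed X" "add_closed Y" "F \<in> series_in X"
    and "\<And>x n. x \<in> X \<Longrightarrow> n \<le> r \<Longrightarrow> fps_nth (\<Phi> (fps_const x)) n = 0" and "n \<le> r"
  shows "fps_nth (\<Phi> F) n = 0"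
  using shift_linear_eq_upto[OF assms(1) shift_linear_zero[OF assms(3)] assms(2) _ assms(4,6)] assms(5)
  by auto

section \<open>Cochain families acting on power series\<close>

lemma series_bimap_nth:
  "fps_nth (series_bimap B F G) n = (\<Sum>i\<le>n. \<Sum>j\<le>n - i. B (n - i - j) (fps_nth F i) (fps_nth G j))"
  by (simp add: series_bimap_def)

lemma series_map_nth: "fps_nth (series_map T F) n = (\<Sum>i\<le>n. T (n - i) (fps_nth F i))"
  by (simp add: series_map_def)

lemma series_bimap_left:
  assumes B: "\<And>r. biadditive X Y Z (B r)" and "add_closed X" "add_closed Z" and G: "G \<in> series_in Y"
  shows "shift_linear X Z (\<lambda>F. series_bimap B F G)"
  unfolding shift_linear_def additive_map_def
proof (intro conjI ballI)
  fix F assume F: "F \<in> series_in X"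
  show "series_bimap B F G \<in> series_in Z"
    using biadditive_in[OF B series_in_nth[OF F] series_in_nth[OF G]]
    by (simp add: series_in_def[of Z] series_bimap_nth add_closed_sum[OF assms(3)])
  fix F' assume F': "F' \<in> series_in X"
  show "series_bimap B (F + F') G = series_bimap B F G + series_bimap B F' G"
    by (intro fps_ext)
      (simp add: series_bimap_nth sum.distrib biadditive_add_left[OF B series_in_nth[OF F] series_in_nth[OF F'] series_in_nth[OF G]])
next
  fix F assume F: "F \<in> series_in X"
  have 0: "B r 0 y = 0" if "y \<in> Y" for r y
    using additive_map_0[OF biadditive_left[OF B that]] add_closedD(1)[OF assms(2)] .
  show "series_bimap B (series_shift F) G = series_shift (series_bimap B F G)"
  proof (rule fps_ext)
    fix n
    show "fps_nth (series_bimap B (series_shift F) G) n = fps_nth (series_shift (series_bimap B F G)) n"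
      using G by (cases n) (simp_all add: series_bimap_nth sum.atMost_Suc_shift 0 series_in_nth del: sum.atMost_Suc)
  qed
qed

lemma series_bimap_right:
  assumes B: "\<And>r. biadditive X Y Z (B r)" and "add_closed Y" "add_closed Z" and F: "F \<in> series_in X"
  shows "shift_linear Y Z (series_bimap B F)"
  unfolding shift_linear_def additive_map_def
proof (intro conjI ballI)
  fix G assume G: "G \<in> series_in Y"
  show "series_bimap B F G \<in> series_in Z"
    using biadditive_in[OF B series_in_nth[OF F] series_in_nth[OF G]]
    by (simp add: series_in_def[of Z] series_bimap_nth add_closed_sum[OF assms(3)])
  fix G' assume G': "G' \<in> series_in Y"
  show "series_bimap B F (G + G') = series_bimap B F G + series_bimap B F G'"
    by (intro fps_ext)
      (simp add: series_bimap_nth sum.distrib biadditive_add_right[OF B series_in_nth[OF F] series_in_nth[OF G] series_in_nth[OF G']])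
next
  fix G assume G: "G \<in> series_in Y"
  have 0: "B r x 0 = 0" if "x \<in> X" for r x
    using additive_map_0[OF biadditive_right[OF B that]] add_closedD(1)[OF assms(2)] .
  show "series_bimap B F (series_shift G) = series_shift (series_bimap B F G)"
  proof (rule fps_ext)
    fix n
    show "fps_nth (series_bimap B F (series_shift G)) n = fps_nth (series_shift (series_bimap B F G)) n"
    proof (cases n)
      case 0
      then show ?thesis using F by (simp add: series_bimap_nth assms 0 series_in_nth \<open>\<And>x r. x \<in> X \<Longrightarrow> B r x 0 = 0\<close>)
    next
      case (Suc m)
      have "(\<Sum>j\<le>Suc m - i. B (Suc m - i - j) (fps_nth F i) (fps_nth (series_shift G) j)) =
         (\<Sum>j\<le>m - i. B (m - i - j) (fps_nth F i) (fps_nth G j))" if "i \<le> m" for i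
      proof -
        from that have "Suc m - i = Suc (m - i)" by simp
        then show ?thesis using F
          by (simp add: sum.atMost_Suc_shift 0 series_in_nth del: sum.atMost_Suc)
      qed
      then show ?thesis using Suc F
        by (simp add: series_bimap_nth 0 series_in_nth)
    qed
  qed
qed

lemma series_map_shift_linear:
  assumes T: "\<And>r. additive_map X Y (T r)" and "add_closed X" "add_closed Y"
  shows "shift_linear X Y (series_map T)"
  unfolding shift_linear_def additive_map_def
proof (intro conjI ballI)
  fix F assume F: "F \<in> series_in X"
  show "series_map T F \<in> series_in Y"
    using additive_map_in[OF T series_in_nth[OF F]]
    by (simp add: series_in_def[of Y] series_map_nth add_closed_sum[OF assms(3)])
  fix F' assume F': "F' \<in> series_in X"
  show "series_map T (F + F') = series_map T F + series_map T F'"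
    by (intro fps_ext)
      (simp add: series_map_nth sum.distrib additive_map_add[OF T series_in_nth[OF F] series_in_nth[OF F']])
next
  fix F assume F: "F \<in> series_in X"
  have 0: "T r 0 = 0" for r
    using additive_map_0[OF T] add_closedD(1)[OF assms(2)] by blast
  show "series_map T (series_shift F) = series_shift (series_map T F)"
  proof (rule fps_ext)
    fix n
    show "fps_nth (series_map T (series_shift F)) n = fps_nth (series_shift (series_map T F)) n"
      by (cases n) (simp_all add: series_map_nth sum.atMost_Suc_shift 0 del: sum.atMost_Suc)
  qed
qed

lemma sum_delta_atMost: "(\<Sum>i\<le>(n::nat). if i = 0 then a i else 0) = a 0"
  for a :: "nat \<Rightarrow> 'a::comm_monoid_add"
  by (simp add: sum.delta)

lemma series_bimap_const_right:
  assumes B: "\<And>r. biadditive X Y Z (B r)" "F \<in> series_in X" "g \<in> Y" "0 \<in> Y"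
  shows "fps_nth (series_bimap B F (fps_const g)) n = (\<Sum>i\<le>n. B (n - i) (fps_nth F i) g)"
proof -
  have 0: "B r (fps_nth F i) 0 = 0" for r i
    using additive_map_0[OF biadditive_right[OF B(1)]] assms series_in_nth by blast
  have "(\<Sum>j\<le>n - i. B (n - i - j) (fps_nth F i) (fps_nth (fps_const g) j)) = B (n - i) (fps_nth F i) g" for i
    using sum_delta_atMost[of "\<lambda>j. B (n - i - j) (fps_nth F i) g" "n - i"]
    by (simp add: 0 if_distrib cong: if_cong)
  then show ?thesis by (simp add: series_bimap_nth)
qed

lemma series_bimap_const_left:
  assumes B: "\<And>r. biadditive X Y Z (B r)" "G \<in> series_in Y" "x \<in> X" "0 \<in> X"
  shows "fps_nth (series_bimap B (fps_const x) G) n = (\<Sum>i\<le>n. B (n - i) x (fps_nth G i))"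
proof -
  have 0: "B r 0 (fps_nth G i) = 0" for r i
    using additive_map_0[OF biadditive_left[OF B(1)]] assms series_in_nth by blast
  have "(\<Sum>j\<le>n - i. B (n - i - j) (fps_nth (fps_const x) i) (fps_nth G j)) =
    (if i = 0 then (\<Sum>j\<le>n - i. B (n - i - j) x (fps_nth G j)) else 0)" for i
    by (auto simp: 0)
  then show ?thesis
    using sum_delta_atMost[of "\<lambda>i. (\<Sum>j\<le>n - i. B (n - i - j) x (fps_nth G j))" n]
    by (simp add: series_bimap_nth)
qed

lemma fps_const_in: "x \<in> X \<Longrightarrow> 0 \<in> X \<Longrightarrow> fps_const x \<in> series_in X"
  by (simp add: series_in_def)

lemma series_bimap_const:
  assumes B: "\<And>r. biadditive X Y Z (B r)" "x \<in> X" "g \<in> Y" "0 \<in> X" "0 \<in> Y"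
  shows "fps_nth (series_bimap B (fps_const x) (fps_const g)) n = B n x g"
proof -
  have 0: "B r 0 g = 0" for r
    using additive_map_0[OF biadditive_left[OF B(1,3)]] assms by blast
  have "(\<Sum>i\<le>n. B (n - i) (fps_nth (fps_const x) i) g) = B n x g"
    using sum_delta_atMost[of "\<lambda>i. B (n - i) x g" n] by (simp add: 0 if_distrib if_distribR cong: if_cong)
  then show ?thesis
    using series_bimap_const_right[OF B(1) fps_const_in[OF B(2,4)] B(3,5)] by simp
qed

lemma series_map_const:
  assumes "\<And>r. additive_map X Y (T r)" "0 \<in> X"
  shows "fps_nth (series_map T (fps_const x)) n = T n x"
proof -
  have 0: "T r 0 = 0" for r
    using additive_map_0[OF assms] by blast
  show ?thesis
    using sum_delta_atMost[of "\<lambda>i. T (n - i) x" n] by (simp add: series_map_nth 0 if_distrib cong: if_cong)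
qed

text \<open>The scheme behind all constructions order by order. Dependent choice gives stages that
  differ only in the newest entry, so the diagonal agrees with stage \<open>n\<close> up to
  \<open>n\<close>; by \<open>cong\<close> the property \<open>P n\<close> looks no further.\<close>

lemma prefix_extend:
  fixes P :: "nat \<Rightarrow> (nat \<Rightarrow> 'a) \<Rightarrow> bool"
  assumes cong: "\<And>n f g. P n f \<Longrightarrow> (\<And>i. i \<le> n \<Longrightarrow> f i = g i) \<Longrightarrow> P n g"
    and base: "P 0 f0"
    and step: "\<And>n f. P n f \<Longrightarrow> \<exists>a. P (Suc n) (f(Suc n := a))"
  shows "\<exists>f. \<forall>n. P n f"
proof -
  have "\<exists>F. \<forall>n. P n (F n) \<and> (\<exists>a. F (Suc n) = (F n)(Suc n := a))"
  proof (rule dependent_nat_choice)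
    show "\<exists>f. P 0 f" by (rule exI[where x = f0], rule base)
    fix f n assume "P n f"
    show "\<exists>g. P (Suc n) g \<and> (\<exists>a. g = f(Suc n := a))"
      by (rule exE[OF step[OF \<open>P n f\<close>]]) (rule exI, rule conjI, assumption, rule exI, rule refl)
  qed
  then obtain F where F: "\<And>n. P n (F n)" "\<And>n. \<exists>a. F (Suc n) = (F n)(Suc n := a)" by blast
  have agree: "i \<le> n \<Longrightarrow> F n i = F i i" for i n
  proof (induction n)
    case (Suc n)
    obtain a where a: "F (Suc n) = (F n)(Suc n := a)" using F(2)[of n] by blast
    show ?case
    proof (cases "i = Suc n")
      case False
      have "F (Suc n) i = F n i" unfolding a by (rule fun_upd_other[OF False])
      also have "F n i = F i i" using Suc False by (intro Suc.IH) simp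
      finally show ?thesis .
    qed simp
  qed simp
  have "P n (\<lambda>i. F i i)" for n
  proof (rule cong[OF F(1)[of n]])
    fix i assume "i \<le> n"
    then show "F n i = F i i" by (rule agree)
  qed
  then show ?thesis by blast
qed

section \<open>Deformations of modules over a star product\<close>

text \<open>The arguments stand in the order of a right module, because the deformed algebra acting
  on sections is noncommutative.\<close>

definition act :: "(complex \<Rightarrow> 'v \<Rightarrow> 'v) \<Rightarrow> ('m \<Rightarrow> 'v) \<Rightarrow> ('m \<Rightarrow> complex) \<Rightarrow> 'm \<Rightarrow> 'v" where
  "act sc x f = (\<lambda>p. sc (f p) (x p))"

lemma fscale_act: "fscale sc c x = act sc x (\<lambda>_. c)"
  by (simp add: fscale_def act_def)

lemma act_times: "act (*) f g = f * g"
  by (auto simp: act_def)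

locale section_space =
  fixes sc :: "complex \<Rightarrow> 'v::ab_group_add \<Rightarrow> 'v" and X :: "('m \<Rightarrow> 'v) set"
  assumes vs: "vector_space sc"
    and zero_in: "0 \<in> X"
    and add_in: "x \<in> X \<Longrightarrow> y \<in> X \<Longrightarrow> x + y \<in> X"
    and scale_in: "x \<in> X \<Longrightarrow> fscale sc c x \<in> X"
begin

sublocale vs: vector_space sc by (rule vs)

lemma fscale_simps:
  "fscale sc c (x + y) = fscale sc c x + fscale sc c y"
  "fscale sc c (x - y) = fscale sc c x - fscale sc c y"
  "fscale sc c (- x) = - fscale sc c x"
  "fscale sc c 0 = 0"
  "fscale sc (-1) x = - x"
  by (auto simp: fscale_def vs.scale_right_distrib vs.scale_right_diff_distrib)

lemma fscale_sum: "fscale sc c (\<Sum>i\<in>I. x i) = (\<Sum>i\<in>I. fscale sc c (x i))"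
  by (rule additive_map_sum[of UNIV UNIV "fscale sc c"])
    (simp_all add: additive_map_def add_closed_def fscale_simps del: plus_fun_apply)

lemma add_closed_X: "add_closed X"
  using scale_in[of _ "-1"] by (simp add: add_closed_def zero_in add_in fscale_simps)

lemmas closed = add_closedD[OF add_closed_X] add_closed_sum[OF add_closed_X]

lemma act_simps:
  "act sc (x + y) f = act sc x f + act sc y f"
  "act sc (x - y) f = act sc x f - act sc y f"
  "act sc (- x) f = - act sc x f"
  "act sc 0 f = 0"
  "act sc x (f + g) = act sc x f + act sc x g"
  "act sc x (- f) = - act sc x f"
  "act sc x 1 = x"
  "act sc (act sc x f) g = act sc x (f * g)"
  "act sc (fscale sc c x) f = fscale sc c (act sc x f)"
  "act sc x (fscale (*) c f) = fscale sc c (act sc x f)"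
  by (auto simp: act_def fscale_def vs.scale_right_distrib vs.scale_right_diff_distrib
      vs.scale_left_distrib mult.commute)

lemma act_sum: "act sc (\<Sum>i\<in>I. x i) f = (\<Sum>i\<in>I. act sc (x i) f)"
  by (rule additive_map_sum[of UNIV UNIV "\<lambda>x. act sc x f"])
    (simp_all add: additive_map_def add_closed_def act_simps)

end

definition section_lin ::
  "(complex \<Rightarrow> 'v::plus \<Rightarrow> 'v) \<Rightarrow> (complex \<Rightarrow> 'w::plus \<Rightarrow> 'w) \<Rightarrow> ('m \<Rightarrow> 'v) set \<Rightarrow> ('m \<Rightarrow> 'w) set \<Rightarrow>
   (('m \<Rightarrow> 'v) \<Rightarrow> 'm \<Rightarrow> 'w) \<Rightarrow> bool" where
  "section_lin sc sc' X Y T \<longleftrightarrow> (\<forall>x\<in>X. T x \<in> Y) \<and> clinear_on sc sc' X T"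

text \<open>Phrased through the partial maps, so that composite cochains are handled by composition
  rules for linear maps; \<open>section_bilin_iff\<close> gives back the form in which deformations
  are defined.\<close>

definition section_bilin ::
  "(complex \<Rightarrow> 'u::plus \<Rightarrow> 'u) \<Rightarrow> (complex \<Rightarrow> 'v::plus \<Rightarrow> 'v) \<Rightarrow> (complex \<Rightarrow> 'w::plus \<Rightarrow> 'w) \<Rightarrow>
   ('m \<Rightarrow> 'u) set \<Rightarrow> ('m \<Rightarrow> 'v) set \<Rightarrow> ('m \<Rightarrow> 'w) set \<Rightarrow> (('m \<Rightarrow> 'u) \<Rightarrow> ('m \<Rightarrow> 'v) \<Rightarrow> 'm \<Rightarrow> 'w) \<Rightarrow> bool" where
  "section_bilin sc1 sc2 sc3 X Y Z B \<longleftrightarrow>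
     (\<forall>x\<in>X. section_lin sc2 sc3 Y Z (B x)) \<and> (\<forall>y\<in>Y. section_lin sc1 sc3 X Z (\<lambda>x. B x y))"

lemma section_bilin_iff:
  "section_bilin sc1 sc2 sc3 X Y Z B \<longleftrightarrow>
     (\<forall>x\<in>X. \<forall>y\<in>Y. B x y \<in> Z) \<and> cbilinear_on sc1 sc2 sc3 X Y B"
  by (auto simp: section_bilin_def section_lin_def cbilinear_on_def)

lemma section_lin_in: "section_lin sc sc' X Y T \<Longrightarrow> x \<in> X \<Longrightarrow> T x \<in> Y"
  by (simp add: section_lin_def)

lemma section_lin_additive:
  "section_lin sc sc' X Y T \<Longrightarrow> additive_map X Y T"
  by (simp add: section_lin_def clinear_on_def additive_map_def)

lemma section_bilin_left: "section_bilin sc1 sc2 sc3 X Y Z B \<Longrightarrow> y \<in> Y \<Longrightarrow> section_lin sc1 sc3 X Z (\<lambda>x. B x y)"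
  and section_bilin_right: "section_bilin sc1 sc2 sc3 X Y Z B \<Longrightarrow> x \<in> X \<Longrightarrow> section_lin sc2 sc3 Y Z (B x)"
  by (simp_all add: section_bilin_def)

lemma section_bilin_in: "section_bilin sc1 sc2 sc3 X Y Z B \<Longrightarrow> x \<in> X \<Longrightarrow> y \<in> Y \<Longrightarrow> B x y \<in> Z"
  by (simp add: section_bilin_def section_lin_def)

lemma section_bilin_biadditive:
  "section_bilin sc1 sc2 sc3 X Y Z B \<Longrightarrow> biadditive X Y Z B"
  by (simp add: section_bilin_iff cbilinear_on_def clinear_on_def biadditive_def)

lemma section_lin_comp:
  assumes "section_lin sc1 sc2 X Y T" "section_lin sc2 sc3 Y Z S"
  shows "section_lin sc1 sc3 X Z (\<lambda>x. S (T x))"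
  using assms by (simp add: section_lin_def clinear_on_def)

lemma section_bilin_comp_left:
  assumes "section_lin sc1 sc1' X X' T" "section_bilin sc1' sc2 sc3 X' Y Z B"
  shows "section_bilin sc1 sc2 sc3 X Y Z (\<lambda>x. B (T x))"
  using assms by (simp add: section_bilin_def section_lin_def clinear_on_def)

lemma section_bilin_comp_out:
  assumes "section_bilin sc1 sc2 sc3 X Y Z B" "section_lin sc3 sc4 Z Z' T"
  shows "section_bilin sc1 sc2 sc4 X Y Z' (\<lambda>x y. T (B x y))"
  using assms by (simp add: section_bilin_def section_lin_def clinear_on_def)

context section_space
begin

lemma section_lin_zero_map: "section_lin sc1 sc X1 X (\<lambda>x. 0)"
  by (simp add: section_lin_def clinear_on_def zero_in fscale_simps)

lemma section_lin_add_map: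
  assumes "section_lin sc1 sc X1 X S" "section_lin sc1 sc X1 X T"
  shows "section_lin sc1 sc X1 X (\<lambda>x. S x + T x)"
  using assms by (simp add: section_lin_def clinear_on_def add_in fscale_simps)

lemma section_lin_diff_map:
  assumes "section_lin sc1 sc X1 X S" "section_lin sc1 sc X1 X T"
  shows "section_lin sc1 sc X1 X (\<lambda>x. S x - T x)"
  using assms by (simp add: section_lin_def clinear_on_def closed(4) fscale_simps)

lemma section_lin_neg_map:
  assumes "section_lin sc1 sc X1 X S"
  shows "section_lin sc1 sc X1 X (\<lambda>x. - S x)"
  using section_lin_diff_map[OF section_lin_zero_map assms] by simp

lemma section_lin_sum_map:
  assumes "\<And>i. i \<in> I \<Longrightarrow> section_lin sc1 sc X1 X (S i)"
  shows "section_lin sc1 sc X1 X (\<lambda>x. \<Sum>i\<in>I. S i x)"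
  using assms
  by (induction I rule: infinite_finite_induct)
    (simp_all add: section_lin_zero_map section_lin_add_map)

lemma section_bilin_zero_map: "section_bilin sc1 sc2 sc X1 X2 X (\<lambda>x y. 0)"
  by (simp add: section_bilin_def section_lin_zero_map)

lemma section_bilin_diff_map:
  assumes "section_bilin sc1 sc2 sc X1 X2 X S" "section_bilin sc1 sc2 sc X1 X2 X T"
  shows "section_bilin sc1 sc2 sc X1 X2 X (\<lambda>x y. S x y - T x y)"
  using assms by (simp add: section_bilin_def section_lin_diff_map)

lemma section_bilin_neg_map:
  assumes "section_bilin sc1 sc2 sc X1 X2 X S"
  shows "section_bilin sc1 sc2 sc X1 X2 X (\<lambda>x y. - S x y)"
  using assms by (simp add: section_bilin_def section_lin_neg_map)

lemma section_bilin_sum_map: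
  assumes "\<And>i. i \<in> I \<Longrightarrow> section_bilin sc1 sc2 sc X1 X2 X (S i)"
  shows "section_bilin sc1 sc2 sc X1 X2 X (\<lambda>x y. \<Sum>i\<in>I. S i x y)"
  using assms by (simp add: section_bilin_def section_lin_sum_map)

end

locale section_module = section_space sc X + A: section_space "(*)" A
  for A :: "('m \<Rightarrow> complex) set" and sc :: "complex \<Rightarrow> 'v::ab_group_add \<Rightarrow> 'v" and X :: "('m \<Rightarrow> 'v) set" +
  assumes one_in: "1 \<in> A"
    and mult_in: "f \<in> A \<Longrightarrow> g \<in> A \<Longrightarrow> f * g \<in> A"
    and act_in: "x \<in> X \<Longrightarrow> f \<in> A \<Longrightarrow> act sc x f \<in> X"
begin

lemma section_bilin_act: "section_bilin sc (*) sc X A X (act sc)"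
  by (simp add: section_bilin_def section_lin_def clinear_on_def act_in act_simps)

lemma module_self: "section_module A (*) A"
  by unfold_locales (auto simp: one_in mult_in act_times)

lemma const_in: "(\<lambda>_. c) \<in> A"
  using A.scale_in[OF one_in, of c] by (simp add: fscale_def one_fun_def)

end

locale star_module = section_module A sc X
  for A :: "('m \<Rightarrow> complex) set" and sc :: "complex \<Rightarrow> 'v::ab_group_add \<Rightarrow> 'v" and X :: "('m \<Rightarrow> 'v) set" +
  fixes C :: "'m cochains"
  assumes formal: "formal_deformation A C"
begin

lemma C_bilin: "section_bilin (*) (*) (*) A A A (C r)"
  and C_0: "f \<in> A \<Longrightarrow> g \<in> A \<Longrightarrow> C 0 f g = f * g"
  and star_assoc: "F \<in> series_in A \<Longrightarrow> G \<in> series_in A \<Longrightarrow> K \<in> series_in A \<Longrightarrow>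
     series_bimap C (series_bimap C F G) K = series_bimap C F (series_bimap C G K)"
  and star_1: "F \<in> series_in A \<Longrightarrow> series_bimap C F 1 = F" "F \<in> series_in A \<Longrightarrow> series_bimap C 1 F = F"
  using formal by (simp_all add: formal_deformation_def section_bilin_iff)

lemmas C_biadd = section_bilin_biadditive[OF C_bilin]

lemma star_in: "F \<in> series_in A \<Longrightarrow> G \<in> series_in A \<Longrightarrow> series_bimap C F G \<in> series_in A"
  using shift_linear_in[OF series_bimap_right[OF C_biadd A.add_closed_X A.add_closed_X]] .

lemma const_series: "f \<in> A \<Longrightarrow> fps_const f \<in> series_in A" "x \<in> X \<Longrightarrow> fps_const x \<in> series_in X"
  by (simp_all add: fps_const_in A.zero_in zero_in)

lemma C_1: "f \<in> A \<Longrightarrow> r > 0 \<Longrightarrow> C r f 1 = 0"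
  using arg_cong[OF star_1(1)[OF const_series(1)], of f "\<lambda>F. fps_nth F r"]
    series_bimap_const[OF C_biadd, where x = f and g = 1 and n = r] by (simp add: one_in A.zero_in)

text \<open>Coefficient \<open>n\<close> of
  \<open>(x \<bullet> f) \<bullet> g - x \<bullet> (f \<star> g)\<close> on constant series;
  \<open>series_defect\<close> is the same expression for arbitrary series.\<close>

definition assoc_defect :: "(nat \<Rightarrow> ('m \<Rightarrow> 'v) \<Rightarrow> ('m \<Rightarrow> complex) \<Rightarrow> 'm \<Rightarrow> 'v) \<Rightarrow> nat \<Rightarrow>
    ('m \<Rightarrow> 'v) \<Rightarrow> ('m \<Rightarrow> complex) \<Rightarrow> ('m \<Rightarrow> complex) \<Rightarrow> 'm \<Rightarrow> 'v" where
  "assoc_defect R n x f g = (\<Sum>i\<le>n. R (n - i) (R i x f) g) - (\<Sum>i\<le>n. R (n - i) x (C i f g))"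

definition series_defect :: "(nat \<Rightarrow> ('m \<Rightarrow> 'v) \<Rightarrow> ('m \<Rightarrow> complex) \<Rightarrow> 'm \<Rightarrow> 'v) \<Rightarrow>
    ('m \<Rightarrow> 'v) fps \<Rightarrow> ('m \<Rightarrow> complex) fps \<Rightarrow> ('m \<Rightarrow> complex) fps \<Rightarrow> ('m \<Rightarrow> 'v) fps" where
  "series_defect R x F G =
     series_bimap R (series_bimap R x F) G - series_bimap R x (series_bimap C F G)"

lemma C_const: "f \<in> A \<Longrightarrow> g \<in> A \<Longrightarrow> fps_nth (series_bimap C (fps_const f) (fps_const g)) n = C n f g"
  by (rule series_bimap_const[OF C_biadd]) (simp_all add: A.zero_in)

context
  fixes R :: "nat \<Rightarrow> ('m \<Rightarrow> 'v) \<Rightarrow> ('m \<Rightarrow> complex) \<Rightarrow> 'm \<Rightarrow> 'v"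
  assumes R: "\<And>r. section_bilin sc (*) sc X A X (R r)"
begin

lemmas R_biadd = section_bilin_biadditive[OF R]

lemmas R_left = series_bimap_left[OF R_biadd add_closed_X add_closed_X]

lemmas R_right = series_bimap_right[OF R_biadd A.add_closed_X add_closed_X]

lemma R_in: "x \<in> series_in X \<Longrightarrow> F \<in> series_in A \<Longrightarrow> series_bimap R x F \<in> series_in X"
  using shift_linear_in[OF R_right] .

lemma R_const: "x \<in> X \<Longrightarrow> f \<in> A \<Longrightarrow> fps_nth (series_bimap R (fps_const x) (fps_const f)) n = R n x f"
  by (rule series_bimap_const[OF R_biadd]) (simp_all add: A.zero_in zero_in)

lemma defect_1:
  assumes "F \<in> series_in A" "G \<in> series_in A"
  shows "shift_linear X X (\<lambda>x. series_defect R x F G)"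
  unfolding series_defect_def
  by (intro shift_linear_diff[OF _ _ add_closed_X] R_left star_in assms
      shift_linear_comp[OF R_left R_left])

lemma defect_2:
  assumes "x \<in> series_in X" "G \<in> series_in A"
  shows "shift_linear A X (\<lambda>F. series_defect R x F G)"
  unfolding series_defect_def
  by (intro shift_linear_diff[OF _ _ add_closed_X] assms shift_linear_comp[OF R_right R_left]
     shift_linear_comp[OF series_bimap_left[OF C_biadd A.add_closed_X A.add_closed_X] R_right])

lemma defect_3:
  assumes "x \<in> series_in X" "F \<in> series_in A"
  shows "shift_linear A X (\<lambda>G. series_defect R x F G)"
  unfolding series_defect_def
  by (intro shift_linear_diff[OF _ _ add_closed_X] assms R_right R_in
     shift_linear_comp[OF series_bimap_right[OF C_biadd A.add_closed_X A.add_closed_X] R_right])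

lemma series_defect_const:
  assumes "x \<in> X" "f \<in> A" "g \<in> A"
  shows "fps_nth (series_defect R (fps_const x) (fps_const f) (fps_const g)) n = assoc_defect R n x f g"
proof -
  have 1: "fps_nth (series_bimap R (series_bimap R (fps_const x) (fps_const f)) (fps_const g)) n =
      (\<Sum>i\<le>n. R (n - i) (R i x f) g)"
    using series_bimap_const_right[OF R_biadd R_in[OF const_series(2,1)] _ A.zero_in] assms
    by (simp add: R_const)
  have 2: "fps_nth (series_bimap R (fps_const x) (series_bimap C (fps_const f) (fps_const g))) n =
      (\<Sum>i\<le>n. R (n - i) x (C i f g))"
    using series_bimap_const_left[OF R_biadd star_in[OF const_series(1,1)] _ zero_in] assms
    by (simp add: C_const)
  show ?thesis by (simp add: series_defect_def assoc_defect_def 1 2)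
qed

text \<open>A formal cancellation valid for every bilinear family \<open>R\<close>: all terms occur
  in pairs, and the last pair, \<open>x\<close> times the two bracketings of \<open>F\<close>,
  \<open>G\<close>, \<open>K\<close>, cancels by associativity of the star product.\<close>

lemma series_defect_cocycle:
  assumes "x \<in> series_in X" "F \<in> series_in A" "G \<in> series_in A" "K \<in> series_in A"
  shows "series_defect R (series_bimap R x F) G K - series_defect R x (series_bimap C F G) K +
    series_defect R x F (series_bimap C G K) - series_bimap R (series_defect R x F G) K = 0"
proof -
  have "series_bimap R (series_defect R x F G) K =
    series_bimap R (series_bimap R (series_bimap R x F) G) K -
    series_bimap R (series_bimap R x (series_bimap C F G)) K"
    unfolding series_defect_def
    by (rule additive_map_diff[OF shift_linear_additive[OF R_left]])
      (intro assms R_in star_in add_closed_series_in add_closed_X)+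
  then show ?thesis using assms by (simp add: series_defect_def star_assoc)
qed

text \<open>With all lower defects zero, every product inside the identity for series may be
  replaced in order \<open>r\<close> by its undeformed part. What remains is the Hochschild cocycle
  condition.\<close>

lemma assoc_defect_cocycle:
  assumes R0: "\<And>x f. x \<in> X \<Longrightarrow> f \<in> A \<Longrightarrow> R 0 x f = act sc x f"
    and zero: "\<And>n x f g. n < r \<Longrightarrow> x \<in> X \<Longrightarrow> f \<in> A \<Longrightarrow> g \<in> A \<Longrightarrow> assoc_defect R n x f g = 0"
    and "x \<in> X" "f \<in> A" "g \<in> A" "k \<in> A"
  shows "assoc_defect R r (act sc x f) g k - assoc_defect R r x (f * g) k +
    assoc_defect R r x f (g * k) - act sc (assoc_defect R r x f g) k = 0"
proof -
  note in_s = const_series(2)[OF assms(3)] const_series(1)[OF assms(4)] const_series(1)[OF assms(5)]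
     const_series(1)[OF assms(6)]
  have nth0: "fps_nth (series_bimap R (fps_const x) (fps_const f)) 0 = act sc x f"
    "fps_nth (series_bimap C (fps_const f) (fps_const g)) 0 = f * g"
    "fps_nth (series_bimap C (fps_const g) (fps_const k)) 0 = g * k"
    using assms by (simp_all add: R_const C_const C_0 R0)
  have 1: "fps_nth (series_defect R (series_bimap R (fps_const x) (fps_const f)) (fps_const g) (fps_const k)) r
    = assoc_defect R r (act sc x f) g k"
    using shift_linear_leading[OF defect_1 add_closed_X add_closed_X R_in, OF in_s(3,4,1,2), of r] assms
    by (simp add: series_defect_const nth0 act_in)
  have 2: "fps_nth (series_defect R (fps_const x) (series_bimap C (fps_const f) (fps_const g)) (fps_const k)) r
    = assoc_defect R r x (f * g) k"
    using shift_linear_leading[OF defect_2 A.add_closed_X add_closed_X star_in, OF in_s(1,4,2,3), of r] assms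
    by (simp add: series_defect_const nth0 mult_in)
  have 3: "fps_nth (series_defect R (fps_const x) (fps_const f) (series_bimap C (fps_const g) (fps_const k))) r
    = assoc_defect R r x f (g * k)"
    using shift_linear_leading[OF defect_3 A.add_closed_X add_closed_X star_in, OF in_s(1,2,3,4), of r] assms
    by (simp add: series_defect_const nth0 mult_in)
  have d_in: "series_defect R (fps_const x) (fps_const f) (fps_const g) \<in> series_in X"
    using shift_linear_in[OF defect_1] in_s by blast
  then have "assoc_defect R r x f g \<in> X"
    using series_in_nth[OF d_in, of r] assms by (simp add: series_defect_const)
  have R00: "R n 0 k = 0" for n
    using additive_map_0[OF biadditive_left[OF R_biadd assms(6)] zero_in] .
  \<comment> \<open>The lower defects vanish, so only the defect of order \<open>r\<close> remains,
    multiplied by the undeformed action \<open>R 0\<close>.\<close>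
  have "(\<Sum>i\<le>r. R (r - i) (assoc_defect R i x f g) k) = (\<Sum>i\<le>r. if i = r then act sc (assoc_defect R r x f g) k else 0)"
    using zero assms \<open>assoc_defect R r x f g \<in> X\<close> by (intro sum.cong) (auto simp: R00)
  then have 4: "fps_nth (series_bimap R (series_defect R (fps_const x) (fps_const f) (fps_const g)) (fps_const k)) r
    = act sc (assoc_defect R r x f g) k"
    using series_bimap_const_right[OF R_biadd d_in assms(6) A.zero_in] assms
    by (simp add: series_defect_const)
  show ?thesis
    using arg_cong[OF series_defect_cocycle[OF in_s], of "\<lambda>F. fps_nth F r"] by (simp add: 1 2 3 4)
qed

text \<open>A defect that vanishes on constants vanishes on series: the arguments are freed one at a
  time, the last one first, each time by \<open>shift_linear_eq\<close>.\<close>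

lemma bundle_deformationI:
  assumes R0: "\<And>x f. x \<in> X \<Longrightarrow> f \<in> A \<Longrightarrow> R 0 x f = act sc x f"
    and zero: "\<And>n x f g. x \<in> X \<Longrightarrow> f \<in> A \<Longrightarrow> g \<in> A \<Longrightarrow> assoc_defect R n x f g = 0"
    and one: "\<And>r x. r > 0 \<Longrightarrow> x \<in> X \<Longrightarrow> R r x 1 = 0"
  shows "bundle_deformation A C sc X R"
proof -
  have z1: "series_defect R (fps_const x) (fps_const f) (fps_const g) = 0" if "x \<in> X" "f \<in> A" "g \<in> A" for x f g
    using that zero by (intro fps_ext) (simp add: series_defect_const)
  have z2: "series_defect R (fps_const x) (fps_const f) G = 0" if "x \<in> X" "f \<in> A" "G \<in> series_in A" for x f G
    by (rule shift_linear_eq[OF defect_3 shift_linear_zero[OF add_closed_X] A.add_closed_X])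
      (simp_all add: that const_series z1)
  have z3: "series_defect R (fps_const x) F G = 0" if "x \<in> X" "F \<in> series_in A" "G \<in> series_in A" for x F G
    by (rule shift_linear_eq[OF defect_2 shift_linear_zero[OF add_closed_X] A.add_closed_X])
      (simp_all add: that const_series z2)
  have z4: "series_defect R x F G = 0" if "x \<in> series_in X" "F \<in> series_in A" "G \<in> series_in A" for x F G
    by (rule shift_linear_eq[OF defect_1 shift_linear_zero[OF add_closed_X] add_closed_X])
      (simp_all add: that const_series z3)
  have id: "shift_linear X X (\<lambda>x. x)"
    by (auto simp: shift_linear_def additive_map_def)
  have "1 \<in> series_in A" using const_series(1)[OF one_in] by simp
  then have one': "series_bimap R x 1 = x" if "x \<in> series_in X" for x
  proof (rule shift_linear_eq[OF R_left id add_closed_X _ that])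
    fix y assume y: "y \<in> X"
    show "series_bimap R (fps_const y) 1 = fps_const y"
      using R_const[OF y one_in] y one R0[OF y one_in]
      by (intro fps_ext) (simp add: act_simps)
  qed
  show ?thesis
    unfolding bundle_deformation_def
    using R z4 one' R0 by (auto simp: section_bilin_iff series_defect_def act_def)
qed

end

end

section \<open>Existence of deformations of a framed module\<close>

locale framed_star_module = star_module A sc X C
  for A :: "('m \<Rightarrow> complex) set" and sc :: "complex \<Rightarrow> 'v::ab_group_add \<Rightarrow> 'v" and X :: "('m \<Rightarrow> 'v) set"
    and C :: "'m cochains" +
  fixes I :: "'i set" and e :: "'i \<Rightarrow> 'm \<Rightarrow> 'v" and co :: "'i \<Rightarrow> ('m \<Rightarrow> 'v) \<Rightarrow> 'm \<Rightarrow> complex"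
  assumes fin: "finite I"
    and e_in: "i \<in> I \<Longrightarrow> e i \<in> X"
    and co_lin: "i \<in> I \<Longrightarrow> section_lin sc (*) X A (co i)"
    and co_act: "i \<in> I \<Longrightarrow> x \<in> X \<Longrightarrow> f \<in> A \<Longrightarrow> co i (act sc x f) = co i x * f"
    and frame: "x \<in> X \<Longrightarrow> (\<Sum>i\<in>I. act sc (e i) (co i x)) = x"
begin

lemma co_in: "i \<in> I \<Longrightarrow> x \<in> X \<Longrightarrow> co i x \<in> A"
  using section_lin_in[OF co_lin] .

text \<open>The contracting homotopy given by the frame: the first slot is filled with
  \<open>e i\<close>, and the coefficient \<open>co i x\<close> moves one slot to the right.\<close>

definition defect_homotopy :: "(nat \<Rightarrow> ('m \<Rightarrow> 'v) \<Rightarrow> ('m \<Rightarrow> complex) \<Rightarrow> 'm \<Rightarrow> 'v) \<Rightarrow> nat \<Rightarrow>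
    ('m \<Rightarrow> 'v) \<Rightarrow> ('m \<Rightarrow> complex) \<Rightarrow> 'm \<Rightarrow> 'v" where
  "defect_homotopy R n x f = (\<Sum>i\<in>I. assoc_defect R n (e i) (co i x) f)"

lemma defect_trilin:
  assumes "\<And>r. section_bilin sc (*) sc X A X (R r)"
  shows "y \<in> X \<Longrightarrow> section_bilin (*) (*) sc A A X (assoc_defect R n y)"
    "f \<in> A \<Longrightarrow> g \<in> A \<Longrightarrow> section_lin sc sc X X (\<lambda>y. assoc_defect R n y f g)"
  unfolding assoc_defect_def
  by (intro section_bilin_diff_map section_bilin_sum_map section_bilin_comp_left[OF section_bilin_right[OF assms] assms]
     section_bilin_comp_out[OF C_bilin section_bilin_right[OF assms]]; assumption)
    (intro section_lin_diff_map section_lin_sum_map section_bilin_left[OF assms] section_bilin_in[OF C_bilin]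
     section_lin_comp[OF section_bilin_left[OF assms] section_bilin_left[OF assms]]; assumption)

lemma defect_homotopy_bilin:
  assumes "\<And>r. section_bilin sc (*) sc X A X (R r)"
  shows "section_bilin sc (*) sc X A X (defect_homotopy R n)"
  unfolding defect_homotopy_def
  by (intro section_bilin_sum_map section_bilin_comp_left[OF co_lin] defect_trilin[OF assms] e_in)

text \<open>In order \<open>Suc r\<close> a new term of that order meets only undeformed factors,
  hence it changes the defect by its Hochschild coboundary. The previous term of that order is zero,
  so that updating means adding.\<close>

lemma assoc_defect_upd:
  assumes R: "\<And>r. section_bilin sc (*) sc X A X (R r)" and R0: "\<And>x f. x \<in> X \<Longrightarrow> f \<in> A \<Longrightarrow> R 0 x f = act sc x f"
    and zero: "\<And>x f. R (Suc r) x f = 0" and \<rho>: "section_bilin sc (*) sc X A X \<rho>"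
    and "x \<in> X" "f \<in> A" "g \<in> A"
  shows "assoc_defect (R(Suc r := \<rho>)) (Suc r) x f g =
    assoc_defect R (Suc r) x f g + \<rho> (act sc x f) g + act sc (\<rho> x f) g - \<rho> x (f * g)"
proof -
  have *: "R n 0 g = 0" for n
    using additive_map_0[OF biadditive_left[OF section_bilin_biadditive[OF R] assms(7)] zero_in] .
  have a: "(\<Sum>i\<le>Suc r. (R(Suc r := \<rho>)) (Suc r - i) ((R(Suc r := \<rho>)) i x f) g) =
     (\<Sum>i\<le>Suc r. R (Suc r - i) (R i x f) g) + \<rho> (act sc x f) g + act sc (\<rho> x f) g"
  proof -
    have "(\<Sum>i\<le>Suc r. (R(Suc r := \<rho>)) (Suc r - i) ((R(Suc r := \<rho>)) i x f) g) =
      (\<Sum>i\<le>Suc r. R (Suc r - i) (R i x f) g + (if i = 0 then \<rho> (act sc x f) g else 0)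
        + (if i = Suc r then act sc (\<rho> x f) g else 0))"
      using assms section_bilin_in[OF \<rho>] by (intro sum.cong) (auto simp: R0 *)
    then show ?thesis by (simp add: sum.distrib)
  qed
  have b: "(\<Sum>i\<le>Suc r. (R(Suc r := \<rho>)) (Suc r - i) x (C i f g)) =
     (\<Sum>i\<le>Suc r. R (Suc r - i) x (C i f g)) + \<rho> x (f * g)"
  proof -
    have "(\<Sum>i\<le>Suc r. (R(Suc r := \<rho>)) (Suc r - i) x (C i f g)) =
      (\<Sum>i\<le>Suc r. R (Suc r - i) x (C i f g) + (if i = 0 then \<rho> x (f * g) else 0))"
      using assms by (intro sum.cong) (auto simp: C_0)
    then show ?thesis by (simp add: sum.distrib)
  qed
  show ?thesis unfolding assoc_defect_def a b by (simp add: algebra_simps)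
qed

lemma extend_deformation:
  assumes R: "\<And>r. section_bilin sc (*) sc X A X (R r)" and R0: "\<And>x f. x \<in> X \<Longrightarrow> f \<in> A \<Longrightarrow> R 0 x f = act sc x f"
    and R1: "\<And>r x. r > 0 \<Longrightarrow> x \<in> X \<Longrightarrow> R r x 1 = 0"
    and zero: "\<And>x f. R (Suc r) x f = 0"
    and defect: "\<And>n x f g. n \<le> r \<Longrightarrow> x \<in> X \<Longrightarrow> f \<in> A \<Longrightarrow> g \<in> A \<Longrightarrow> assoc_defect R n x f g = 0"
    and x: "x \<in> X"
  defines "\<rho> \<equiv> \<lambda>x f. - defect_homotopy R (Suc r) x f"
  shows "f \<in> A \<Longrightarrow> g \<in> A \<Longrightarrow> assoc_defect (R(Suc r := \<rho>)) (Suc r) x f g = 0" "\<rho> x 1 = 0"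
proof -
  have \<rho>: "section_bilin sc (*) sc X A X \<rho>"
    unfolding \<rho>_def by (intro section_bilin_neg_map defect_homotopy_bilin R)
  show "assoc_defect (R(Suc r := \<rho>)) (Suc r) x f g = 0" if fg: "f \<in> A" "g \<in> A"
  proof -
    let ?D = "assoc_defect R (Suc r)"
    \<comment> \<open>Only the module element is expanded in the frame, so that the cocycle identity
      applies with \<open>e i\<close> as module element and \<open>co i x\<close> as first
      function.\<close>
    have "?D x f g = (\<Sum>i\<in>I. ?D (act sc (e i) (co i x)) f g)"
      by (subst frame[OF x, symmetric], rule additive_map_sum[OF section_lin_additive[OF defect_trilin(2)[OF R]] add_closed_X])
        (simp_all add: fg act_in e_in co_in x)
    also have "\<dots> = (\<Sum>i\<in>I. ?D (e i) (co i x * f) g - ?D (e i) (co i x) (f * g) + act sc (?D (e i) (co i x) f) g)"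
    proof (rule sum.cong[OF refl])
      fix i assume i: "i \<in> I"
      show "?D (act sc (e i) (co i x)) f g =
        ?D (e i) (co i x * f) g - ?D (e i) (co i x) (f * g) + act sc (?D (e i) (co i x) f) g"
        using assoc_defect_cocycle[where R = R and r = "Suc r", OF R R0 _ e_in[OF i] co_in[OF i x] fg] defect
        by (simp add: algebra_simps)
    qed
    \<comment> \<open>Right linearity of \<open>co i\<close> turns the first sum into the homotopy
      at \<open>act sc x f\<close>; the three sums together are minus the coboundary of
      \<open>\<rho>\<close>.\<close>
    also have "\<dots> = - \<rho> (act sc x f) g + \<rho> x (f * g) - act sc (\<rho> x f) g"
      by (simp add: \<rho>_def defect_homotopy_def sum.distrib sum_subtractf act_sum act_simps co_act x fg)
    finally show ?thesis
      using assoc_defect_upd[OF R R0 zero \<rho> x fg] by simp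
  qed
  \<comment> \<open>This keeps the unit acting as the identity. In each of the two sums a single
    summand survives, by \<open>R1\<close> and by \<open>C_1\<close>, and both are
    \<open>R (Suc r) y f\<close>.\<close>
  have "assoc_defect R (Suc r) y f 1 = 0" if "y \<in> X" "f \<in> A" for y f
  proof -
    have "(\<Sum>i\<le>Suc r. R (Suc r - i) (R i y f) 1) = (\<Sum>i\<le>Suc r. if i = Suc r then R i y f else 0)"
      using that R1 R0 section_bilin_in[OF R]
      by (intro sum.cong) (auto simp: one_in act_simps)
    moreover have "(\<Sum>i\<le>Suc r. R (Suc r - i) y (C i f 1)) = (\<Sum>i\<le>Suc r. if i = 0 then R (Suc r) y f else 0)"
      using that C_1 C_0 additive_map_0[OF section_lin_additive[OF section_bilin_right[OF R that(1)]] A.zero_in]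
      by (intro sum.cong) (auto simp: one_in)
    ultimately show ?thesis by (simp add: assoc_defect_def)
  qed
  then show "\<rho> x 1 = 0"
    using x by (simp add: \<rho>_def defect_homotopy_def e_in co_in)
qed

text \<open>Pads a stage of the recursion by zero, since the update lemmas ask for bilinearity of
  all cochains and for a vanishing next one.\<close>

definition truncate_seq :: "nat \<Rightarrow> (nat \<Rightarrow> 'a \<Rightarrow> 'b \<Rightarrow> 'm \<Rightarrow> 'w::zero) \<Rightarrow> nat \<Rightarrow> 'a \<Rightarrow> 'b \<Rightarrow> 'm \<Rightarrow> 'w" where
  "truncate_seq n R = (\<lambda>r. if r \<le> n then R r else (\<lambda>_ _. 0))"

text \<open>The predicate \<open>Q\<close> carries a property of the cochains, such as locality or a
  bound on the order, through the recursion; what has to be supplied is its stability under the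
  homotopy.\<close>

theorem deformation_exists:
  assumes Q0: "Q 0 (act sc)"
    and QS: "\<And>R r. (\<And>s. section_bilin sc (*) sc X A X (R s)) \<Longrightarrow> (\<And>s. s \<le> r \<Longrightarrow> Q s (R s)) \<Longrightarrow>
      (\<And>x f. R (Suc r) x f = 0) \<Longrightarrow> Q (Suc r) (\<lambda>x f. - defect_homotopy R (Suc r) x f)"
  shows "\<exists>R. bundle_deformation A C sc X R \<and> (\<forall>r. Q r (R r))"
proof -
  let ?P = "\<lambda>n R. (\<forall>r\<le>n. section_bilin sc (*) sc X A X (R r)) \<and> (\<forall>x\<in>X. \<forall>f\<in>A. R 0 x f = act sc x f) \<and>
    (\<forall>r. 0 < r \<and> r \<le> n \<longrightarrow> (\<forall>x\<in>X. R r x 1 = 0)) \<and>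
    (\<forall>r\<le>n. \<forall>x\<in>X. \<forall>f\<in>A. \<forall>g\<in>A. assoc_defect R r x f g = 0) \<and> (\<forall>r\<le>n. Q r (R r))"
  have cong: "assoc_defect R r x f g = assoc_defect S r x f g"
    if "\<And>i. i \<le> n \<Longrightarrow> R i = S i" "r \<le> n" for n r R S x f g
    using that by (simp add: assoc_defect_def)
  have "\<exists>R. \<forall>n. ?P n R"
  proof (rule prefix_extend)
    fix n and R S :: "nat \<Rightarrow> ('m \<Rightarrow> 'v) \<Rightarrow> ('m \<Rightarrow> complex) \<Rightarrow> 'm \<Rightarrow> 'v"
    assume "?P n R" and eq: "\<And>i. i \<le> n \<Longrightarrow> R i = S i"
    then show "?P n S" using cong[of n R S] by simp
  next
    show "?P 0 (\<lambda>_. act sc)"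
      using Q0 by (simp add: section_bilin_act assoc_defect_def C_0 act_simps)
  next
    fix n and R :: "nat \<Rightarrow> ('m \<Rightarrow> 'v) \<Rightarrow> ('m \<Rightarrow> complex) \<Rightarrow> 'm \<Rightarrow> 'v"
    assume P: "?P n R"
    define S where "S = truncate_seq n R"
    have SR: "S i = R i" if "i \<le> n" for i using that by (simp add: S_def truncate_seq_def)
    have Sz: "S (Suc n) x f = 0" for x f by (simp add: S_def truncate_seq_def)
    have S: "section_bilin sc (*) sc X A X (S r)" for r
      using P by (simp add: S_def truncate_seq_def section_bilin_zero_map)
    have S0: "S 0 x f = act sc x f" if "x \<in> X" "f \<in> A" for x f using P SR[of 0] that by simp
    have S1: "S r x 1 = 0" if "r > 0" "x \<in> X" for r x
      using P that by (simp add: S_def truncate_seq_def)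
    have Sd: "assoc_defect S r x f g = 0" if "r \<le> n" "x \<in> X" "f \<in> A" "g \<in> A" for r x f g
      using P that cong[of n S R r] SR by simp
    define \<rho> where "\<rho> = (\<lambda>x f. - defect_homotopy S (Suc n) x f)"
    have \<rho>: "section_bilin sc (*) sc X A X \<rho>"
      unfolding \<rho>_def by (intro section_bilin_neg_map defect_homotopy_bilin S)
    have ext1: "assoc_defect (S(Suc n := \<rho>)) (Suc n) x f g = 0" if "x \<in> X" "f \<in> A" "g \<in> A" for x f g
      unfolding \<rho>_def by (rule extend_deformation(1)) (rule S S0 S1 Sz Sd that; assumption)+
    have ext2: "\<rho> x 1 = 0" if "x \<in> X" for x
      unfolding \<rho>_def by (rule extend_deformation(2)) (rule S S0 S1 Sz Sd that; assumption)+
    have d: "assoc_defect (R(Suc n := \<rho>)) r x f g = 0" if "r \<le> Suc n" "x \<in> X" "f \<in> A" "g \<in> A" for r x f g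
    proof (cases "r = Suc n")
      case True
      have "assoc_defect (R(Suc n := \<rho>)) r x f g = assoc_defect (S(Suc n := \<rho>)) r x f g"
        using that by (intro cong[of "Suc n"]) (auto simp: SR)
      then show ?thesis using ext1 that True by simp
    next
      case False
      have "assoc_defect (R(Suc n := \<rho>)) r x f g = assoc_defect R r x f g"
        using that False by (intro cong[of n]) auto
      then show ?thesis using P that False by simp
    qed
    have "Q (Suc n) \<rho>"
      unfolding \<rho>_def using P by (intro QS S Sz) (simp add: SR)
    then have "?P (Suc n) (R(Suc n := \<rho>))"
      using P d \<rho> ext2 by (auto simp: le_Suc_eq)
    then show "\<exists>a. ?P (Suc n) (R(Suc n := a))" by (rule exI[where x = \<rho>])
  qed
  then obtain R where "\<forall>n. ?P n R" by (rule exE)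
  then have P: "?P n R" for n by (rule spec)
  have R: "section_bilin sc (*) sc X A X (R r)" for r using P[of r] by simp
  have R0: "R 0 x f = act sc x f" if "x \<in> X" "f \<in> A" for x f using P[of 0] that by simp
  have Rd: "assoc_defect R n x f g = 0" if "x \<in> X" "f \<in> A" "g \<in> A" for n x f g
    using P[of n] that by simp
  have R1: "R r x 1 = 0" if "r > 0" "x \<in> X" for r x
    using P[of r] that by simp
  have "bundle_deformation A C sc X R"
    by (rule bundle_deformationI) (rule R R0 Rd R1; assumption)+
  moreover have "Q r (R r)" for r using P[of r] by simp
  ultimately show ?thesis by blast
qed

end

context star_module
begin

lemma bundle_deformationD:
  assumes "bundle_deformation A C sc X R"
  shows "section_bilin sc (*) sc X A X (R r)"
    "x \<in> X \<Longrightarrow> f \<in> A \<Longrightarrow> R 0 x f = act sc x f"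
    "x' \<in> series_in X \<Longrightarrow> F \<in> series_in A \<Longrightarrow> G \<in> series_in A \<Longrightarrow>
       series_bimap R (series_bimap R x' F) G = series_bimap R x' (series_bimap C F G)"
  using assms by (simp_all add: bundle_deformation_def section_bilin_iff act_def)

lemma self_deformation: "bundle_deformation A C (*) A C"
  using formal by (auto simp: bundle_deformation_def formal_deformation_def)

lemma star_module_self: "star_module A (*) A C"
  using module_self formal by (simp add: star_module_def star_module_axioms_def)

end

text \<open>The map is the identity modulo \<lambda>, so the system for the coefficients is
  triangular: coefficient \<open>n\<close> of the preimage is determined by the earlier
  ones.\<close>

lemma (in section_space) series_map_bij:
  assumes T: "\<And>r. additive_map X X (T r)" and T0: "\<And>x. x \<in> X \<Longrightarrow> T 0 x = x"
  shows "bij_betw (series_map T) (series_in X) (series_in X)"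
proof -
  note S = series_map_shift_linear[OF T add_closed_X add_closed_X]
  have nth: "fps_nth (series_map T F) n = fps_nth F n + (\<Sum>i<n. T (n - i) (fps_nth F i))" if "F \<in> series_in X" for F n
    using series_in_nth[OF that] by (simp add: series_map_nth lessThan_Suc_atMost[symmetric] T0 add.commute)
  have inj: "inj_on (series_map T) (series_in X)"
  proof (rule inj_onI)
    fix F G assume *: "F \<in> series_in X" "G \<in> series_in X" "series_map T F = series_map T G"
    show "F = G"
    proof (rule fps_ext)
      fix n show "fps_nth F n = fps_nth G n"
      proof (induction n rule: less_induct)
        case (less n)
        have "(\<Sum>i<n. T (n - i) (fps_nth F i)) = (\<Sum>i<n. T (n - i) (fps_nth G i))"
          by (rule sum.cong) (simp_all add: less)
        then show ?case using nth[OF *(1), of n] nth[OF *(2), of n] *(3) by simp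
      qed
    qed
  qed
  have "\<exists>F\<in>series_in X. series_map T F = G" if G: "G \<in> series_in X" for G
  proof -
    let ?P = "\<lambda>n F. \<forall>k\<le>n. F k \<in> X \<and> F k + (\<Sum>i<k. T (k - i) (F i)) = fps_nth G k"
    have "\<exists>F. \<forall>n. ?P n F"
    proof (rule prefix_extend)
      show "?P 0 (\<lambda>_. fps_nth G 0)" using series_in_nth[OF G] by simp
      fix n and F :: "nat \<Rightarrow> 'm \<Rightarrow> 'v" assume P: "?P n F"
      define a where "a = fps_nth G (Suc n) - (\<Sum>i<Suc n. T (Suc n - i) (F i))"
      have "a \<in> X" unfolding a_def
        by (intro closed(4) closed(5) series_in_nth[OF G] additive_map_in[OF T]) (use P in auto)
      moreover have "a + (\<Sum>i<Suc n. T (Suc n - i) (F i)) = fps_nth G (Suc n)" by (simp add: a_def)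
      ultimately have "?P (Suc n) (F(Suc n := a))"
        using P by (auto simp: le_Suc_eq simp del: sum.lessThan_Suc)
      then show "\<exists>a. ?P (Suc n) (F(Suc n := a))" by (rule exI[where x = a])
    next
      fix n and F F' :: "nat \<Rightarrow> 'm \<Rightarrow> 'v" assume "?P n F" "\<And>i. i \<le> n \<Longrightarrow> F i = F' i"
      then show "?P n F'" by auto
    qed
    then obtain F where "\<forall>n. ?P n F" by (rule exE)
    then have P: "?P n F" for n by (rule spec)
    have F: "F n \<in> X" "F n + (\<Sum>i<n. T (n - i) (F i)) = fps_nth G n" for n
      using P[of n] by simp_all
    then have "Abs_fps F \<in> series_in X" by (simp add: series_in_def)
    moreover have "series_map T (Abs_fps F) = G"
      by (rule fps_ext) (simp add: nth[OF \<open>Abs_fps F \<in> series_in X\<close>] F)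
    ultimately show ?thesis by blast
  qed
  then have "series_in X \<subseteq> series_map T ` series_in X" by blast
  then show ?thesis
    using inj shift_linear_in[OF S] by (auto simp: bij_betw_def)
qed

section \<open>Lifting of module maps and uniqueness\<close>

definition morphism_defect where
  "morphism_defect R R' T n x f = (\<Sum>i\<le>n. R' (n - i) (T i x) f) - (\<Sum>i\<le>n. T (n - i) (R i x f))"

text \<open>The target is a second module over the same star product: \<open>X\<close> itself when
  two deformations are compared, and the algebra with \<open>R' = C\<close> when the coframe is
  lifted.\<close>

locale star_lift = framed_star_module A sc X C I e co + Y: star_module A sc' Y C
  for A :: "('m \<Rightarrow> complex) set" and sc :: "complex \<Rightarrow> 'v::ab_group_add \<Rightarrow> 'v" and X :: "('m \<Rightarrow> 'v) set"
    and C :: "'m cochains" and I :: "'i set" and e co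
    and sc' :: "complex \<Rightarrow> 'w::ab_group_add \<Rightarrow> 'w" and Y :: "('m \<Rightarrow> 'w) set" +
  fixes R R'
  assumes def_R: "bundle_deformation A C sc X R" and def_R': "bundle_deformation A C sc' Y R'"
begin

lemmas R = bundle_deformationD[OF def_R]

lemmas R' = Y.bundle_deformationD[OF def_R']

definition series_morphism_defect where
  "series_morphism_defect T x F = series_bimap R' (series_map T x) F - series_map T (series_bimap R x F)"

context
  fixes T :: "nat \<Rightarrow> ('m \<Rightarrow> 'v) \<Rightarrow> 'm \<Rightarrow> 'w"
  assumes T: "\<And>r. section_lin sc sc' X Y (T r)"
begin

lemmas T_shift = series_map_shift_linear[OF section_lin_additive[OF T] add_closed_X Y.add_closed_X]

lemma T_in: "x \<in> series_in X \<Longrightarrow> series_map T x \<in> series_in Y"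
  using shift_linear_in[OF T_shift] .

lemma T_const: "x \<in> X \<Longrightarrow> fps_nth (series_map T (fps_const x)) n = T n x"
  by (rule series_map_const[OF section_lin_additive[OF T] zero_in])

lemma morphism_defect_1:
  assumes "F \<in> series_in A"
  shows "shift_linear X Y (\<lambda>x. series_morphism_defect T x F)"
  unfolding series_morphism_defect_def
  by (intro shift_linear_diff[OF _ _ Y.add_closed_X] assms
      shift_linear_comp[OF T_shift Y.R_left[OF R'(1)]] shift_linear_comp[OF R_left[OF R(1)] T_shift])

lemma morphism_defect_2:
  assumes "x \<in> series_in X"
  shows "shift_linear A Y (\<lambda>F. series_morphism_defect T x F)"
  unfolding series_morphism_defect_def
  by (intro shift_linear_diff[OF _ _ Y.add_closed_X] assms T_in Y.R_right[OF R'(1)]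
      shift_linear_comp[OF R_right[OF R(1)] T_shift])

lemma series_morphism_defect_const:
  assumes "x \<in> X" "f \<in> A"
  shows "fps_nth (series_morphism_defect T (fps_const x) (fps_const f)) n = morphism_defect R R' T n x f"
proof -
  have "fps_nth (series_bimap R' (series_map T (fps_const x)) (fps_const f)) n = (\<Sum>i\<le>n. R' (n - i) (T i x) f)"
    using series_bimap_const_right[OF section_bilin_biadditive[OF R'(1)] T_in[OF const_series(2)] _ A.zero_in] assms
    by (simp add: T_const)
  then show ?thesis
    by (simp add: series_morphism_defect_def morphism_defect_def series_map_nth R_const[OF R(1)] assms)
qed

text \<open>The sum telescopes once both module laws, the one of \<open>R\<close> and the one of
  \<open>R'\<close>, have been applied; nothing is asked of \<open>T\<close> beyond
  linearity.\<close>

lemma series_morphism_defect_cocycle: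
  assumes "x \<in> series_in X" "F \<in> series_in A" "G \<in> series_in A"
  shows "series_morphism_defect T (series_bimap R x F) G - series_morphism_defect T x (series_bimap C F G) +
    series_bimap R' (series_morphism_defect T x F) G = 0"
proof -
  have "series_bimap R' (series_morphism_defect T x F) G =
    series_bimap R' (series_bimap R' (series_map T x) F) G - series_bimap R' (series_map T (series_bimap R x F)) G"
    unfolding series_morphism_defect_def
    by (rule additive_map_diff[OF shift_linear_additive[OF Y.R_left[OF R'(1)]]])
      (intro assms R_in[OF R(1)] Y.R_in[OF R'(1)] T_in add_closed_series_in Y.add_closed_X)+
  then show ?thesis using assms by (simp add: series_morphism_defect_def R(3) R'(3) T_in)
qed

lemma morphism_defect_in:
  assumes "x \<in> X" "f \<in> A"
  shows "morphism_defect R R' T n x f \<in> Y"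
  using shift_linear_in[OF morphism_defect_1 const_series(2), OF const_series(1)] assms series_in_nth
    series_morphism_defect_const by metis

lemma morphism_defect_cocycle:
  assumes zero: "\<And>n x f. n < r \<Longrightarrow> x \<in> X \<Longrightarrow> f \<in> A \<Longrightarrow> morphism_defect R R' T n x f = 0"
    and "x \<in> X" "f \<in> A" "g \<in> A"
  shows "morphism_defect R R' T r (act sc x f) g - morphism_defect R R' T r x (f * g) +
    act sc' (morphism_defect R R' T r x f) g = 0"
proof -
  note in_s = const_series(2)[OF assms(2)] const_series(1)[OF assms(3)] const_series(1)[OF assms(4)]
  have nth0: "fps_nth (series_bimap R (fps_const x) (fps_const f)) 0 = act sc x f"
    "fps_nth (series_bimap C (fps_const f) (fps_const g)) 0 = f * g"
    using assms by (simp_all add: R_const[OF R(1)] C_const C_0 R(2))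
  have 1: "fps_nth (series_morphism_defect T (series_bimap R (fps_const x) (fps_const f)) (fps_const g)) r
    = morphism_defect R R' T r (act sc x f) g"
    using shift_linear_leading[OF morphism_defect_1 add_closed_X Y.add_closed_X R_in[OF R(1)], OF in_s(3,1,2), of r] assms
    by (simp add: series_morphism_defect_const nth0 act_in)
  have 2: "fps_nth (series_morphism_defect T (fps_const x) (series_bimap C (fps_const f) (fps_const g))) r
    = morphism_defect R R' T r x (f * g)"
    using shift_linear_leading[OF morphism_defect_2 A.add_closed_X Y.add_closed_X star_in, OF in_s(1,2,3), of r] assms
    by (simp add: series_morphism_defect_const nth0 mult_in)
  have d_in: "series_morphism_defect T (fps_const x) (fps_const f) \<in> series_in Y"
    using shift_linear_in[OF morphism_defect_1] in_s by blast
  have R00: "R' n 0 g = 0" for n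
    using additive_map_0[OF biadditive_left[OF section_bilin_biadditive[OF R'(1)] assms(4)] Y.zero_in] .
  have "(\<Sum>i\<le>r. R' (r - i) (morphism_defect R R' T i x f) g) =
    (\<Sum>i\<le>r. if i = r then act sc' (morphism_defect R R' T r x f) g else 0)"
    using zero assms by (intro sum.cong) (auto simp: R00 R'(2) morphism_defect_in)
  then have 3: "fps_nth (series_bimap R' (series_morphism_defect T (fps_const x) (fps_const f)) (fps_const g)) r
    = act sc' (morphism_defect R R' T r x f) g"
    using series_bimap_const_right[OF section_bilin_biadditive[OF R'(1)] d_in assms(4) A.zero_in] assms
    by (simp add: series_morphism_defect_const)
  show ?thesis
    using arg_cong[OF series_morphism_defect_cocycle[OF in_s], of "\<lambda>F. fps_nth F r"] by (simp add: 1 2 3)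
qed

text \<open>The passage from constants to series, but only up to order \<open>r\<close>: the
  isometry argument needs it while the isomorphism is still under construction.\<close>

lemma series_morphism_defect_low:
  assumes "\<And>n x f. n \<le> r \<Longrightarrow> x \<in> X \<Longrightarrow> f \<in> A \<Longrightarrow> morphism_defect R R' T n x f = 0"
    and "x \<in> series_in X" "F \<in> series_in A" "n \<le> r"
  shows "fps_nth (series_morphism_defect T x F) n = 0"
proof -
  have *: "fps_nth (series_morphism_defect T (fps_const y) F) k = 0" if "y \<in> X" "k \<le> r" for y k
    by (rule shift_linear_low[OF morphism_defect_2 A.add_closed_X Y.add_closed_X assms(3) _ that(2)])
      (use that assms in \<open>simp_all add: series_morphism_defect_const const_series\<close>)
  show ?thesis
    by (rule shift_linear_low[OF morphism_defect_1[OF assms(3)] add_closed_X Y.add_closed_X assms(2) * assms(4)])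
qed

lemma morphism_of_coefficients:
  assumes "\<And>n x f. x \<in> X \<Longrightarrow> f \<in> A \<Longrightarrow> morphism_defect R R' T n x f = 0"
    and "x \<in> series_in X" "F \<in> series_in A"
  shows "series_map T (series_bimap R x F) = series_bimap R' (series_map T x) F"
proof (rule fps_ext)
  fix n
  show "fps_nth (series_map T (series_bimap R x F)) n = fps_nth (series_bimap R' (series_map T x) F) n"
    using series_morphism_defect_low[OF _ assms(2,3) order_refl, of n] assms(1)
    by (simp add: series_morphism_defect_def)
qed

text \<open>The same filling of the first slot as in \<open>defect_homotopy\<close>. The sign is
  plus, because a new term \<tau> changes the defect by \<tau>(x) f - \<tau>(x f).\<close>

definition lift_homotopy :: "nat \<Rightarrow> ('m \<Rightarrow> 'v) \<Rightarrow> 'm \<Rightarrow> 'w" where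
  "lift_homotopy n x = (\<Sum>i\<in>I. morphism_defect R R' T n (e i) (co i x))"

lemma lift_homotopy_lin: "section_lin sc sc' X Y (lift_homotopy n)"
proof -
  have *: "section_lin (*) sc' A Y (morphism_defect R R' T n y)" if y: "y \<in> X" for y
    unfolding morphism_defect_def
    by (intro Y.section_lin_diff_map Y.section_lin_sum_map section_bilin_right[OF R'(1)]
        section_lin_in[OF T] section_lin_comp[OF section_bilin_right[OF R(1)] T] y)
  show ?thesis
    unfolding lift_homotopy_def[abs_def]
    by (intro Y.section_lin_sum_map section_lin_comp[OF co_lin *] e_in)
qed

text \<open>The summand \<open>B\<close> is linear over the undeformed algebra and therefore
  invisible to the defect. It is the freedom in the choice of a lift, spent later on making the
  isomorphism isometric, and zero for a plain lift.\<close>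

lemma lift_step:
  assumes T0: "\<And>x f. x \<in> X \<Longrightarrow> f \<in> A \<Longrightarrow> T 0 (act sc x f) = act sc' (T 0 x) f"
    and zero: "\<And>x. T (Suc r) x = 0"
    and defect: "\<And>n x f. n \<le> r \<Longrightarrow> x \<in> X \<Longrightarrow> f \<in> A \<Longrightarrow> morphism_defect R R' T n x f = 0"
    and B: "section_lin sc sc' X Y B" "\<And>x f. x \<in> X \<Longrightarrow> f \<in> A \<Longrightarrow> B (act sc x f) = act sc' (B x) f"
    and x: "x \<in> X" and f: "f \<in> A"
  defines "\<tau> \<equiv> \<lambda>x. lift_homotopy (Suc r) x + B x"
  shows "morphism_defect R R' (T(Suc r := \<tau>)) (Suc r) x f = 0"
proof -
  have \<tau>: "section_lin sc sc' X Y \<tau>"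
    unfolding \<tau>_def by (intro Y.section_lin_add_map lift_homotopy_lin B)
  let ?E = "morphism_defect R R' T (Suc r)"
  have 0: "R' n 0 f = 0" for n
    using additive_map_0[OF biadditive_left[OF section_bilin_biadditive[OF R'(1)] f] Y.zero_in] .
  have a: "(\<Sum>i\<le>Suc r. R' (Suc r - i) ((T(Suc r := \<tau>)) i x) f) =
     (\<Sum>i\<le>Suc r. R' (Suc r - i) (T i x) f) + act sc' (\<tau> x) f"
  proof -
    have "(\<Sum>i\<le>Suc r. R' (Suc r - i) ((T(Suc r := \<tau>)) i x) f) =
      (\<Sum>i\<le>Suc r. R' (Suc r - i) (T i x) f + (if i = Suc r then act sc' (\<tau> x) f else 0))"
      using x f section_lin_in[OF \<tau>] by (intro sum.cong) (auto simp: R'(2) zero 0)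
    then show ?thesis by (simp add: sum.distrib)
  qed
  have b: "(\<Sum>i\<le>Suc r. (T(Suc r := \<tau>)) (Suc r - i) (R i x f)) =
     (\<Sum>i\<le>Suc r. T (Suc r - i) (R i x f)) + \<tau> (act sc x f)"
  proof -
    have "(\<Sum>i\<le>Suc r. (T(Suc r := \<tau>)) (Suc r - i) (R i x f)) =
      (\<Sum>i\<le>Suc r. T (Suc r - i) (R i x f) + (if i = 0 then \<tau> (act sc x f) else 0))"
      using x f by (intro sum.cong) (auto simp: R(2) zero)
    then show ?thesis by (simp add: sum.distrib)
  qed
  have upd: "morphism_defect R R' (T(Suc r := \<tau>)) (Suc r) x f = ?E x f + act sc' (\<tau> x) f - \<tau> (act sc x f)"
    unfolding morphism_defect_def a b by (simp add: algebra_simps)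
  have E_lin: "additive_map X Y (\<lambda>y. ?E y f)"
    unfolding morphism_defect_def
    by (rule section_lin_additive[where sc = sc and sc' = sc'])
      (intro Y.section_lin_diff_map Y.section_lin_sum_map f section_lin_comp[OF T section_bilin_left[OF R'(1)]]
        section_lin_comp[OF section_bilin_left[OF R(1)] T])
  \<comment> \<open>By \<open>co_act\<close> the left side involves the product
    \<open>co i x * f\<close>, which the cocycle identity splits; the first summands add up to the
    defect at \<open>x\<close>.\<close>
  have "lift_homotopy (Suc r) (act sc x f) = (\<Sum>i\<in>I. ?E (act sc (e i) (co i x)) f + act sc' (?E (e i) (co i x)) f)"
    unfolding lift_homotopy_def
  proof (rule sum.cong[OF refl])
    fix i assume i: "i \<in> I"
    show "?E (e i) (co i (act sc x f)) = ?E (act sc (e i) (co i x)) f + act sc' (?E (e i) (co i x)) f"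
      using morphism_defect_cocycle[where r = "Suc r", OF _ e_in[OF i] co_in[OF i x] f] defect
      by (simp add: co_act[OF i x f] algebra_simps)
  qed
  also have "\<dots> = ?E x f + act sc' (lift_homotopy (Suc r) x) f"
  proof -
    have "?E x f = (\<Sum>i\<in>I. ?E (act sc (e i) (co i x)) f)"
      by (subst frame[OF x, symmetric], rule additive_map_sum[OF E_lin add_closed_X])
        (simp add: act_in e_in co_in x)
    then show ?thesis by (simp add: sum.distrib lift_homotopy_def Y.act_sum)
  qed
  finally show ?thesis
    unfolding upd by (simp add: \<tau>_def B(2) x f Y.act_simps)
qed

end

lemma morphism_defect_cong:
  "(\<And>i. i \<le> n \<Longrightarrow> T i = S i) \<Longrightarrow> r \<le> n \<Longrightarrow> morphism_defect R R' T r x f = morphism_defect R R' S r x f"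
  by (simp add: morphism_defect_def)

text \<open>As in \<open>deformation_exists\<close>, \<open>Q\<close> transports locality or
  differential order of the components along the recursion.\<close>

theorem lift_exists:
  assumes T0: "section_lin sc sc' X Y T0" "\<And>x f. x \<in> X \<Longrightarrow> f \<in> A \<Longrightarrow> T0 (act sc x f) = act sc' (T0 x) f"
    and Q0: "Q 0 T0"
    and QS: "\<And>T r. (\<And>s. section_lin sc sc' X Y (T s)) \<Longrightarrow> (\<And>s. s \<le> r \<Longrightarrow> Q s (T s)) \<Longrightarrow>
      (\<And>x. T (Suc r) x = 0) \<Longrightarrow> Q (Suc r) (lift_homotopy T (Suc r))"
  shows "\<exists>T. T 0 = T0 \<and> (\<forall>r. section_lin sc sc' X Y (T r)) \<and> (\<forall>r. Q r (T r)) \<and>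
    (\<forall>x\<in>series_in X. \<forall>F\<in>series_in A.
       series_map T (series_bimap R x F) = series_bimap R' (series_map T x) F)"
proof -
  let ?P = "\<lambda>n T. T 0 = T0 \<and> (\<forall>r\<le>n. section_lin sc sc' X Y (T r)) \<and> (\<forall>r\<le>n. Q r (T r)) \<and>
    (\<forall>r\<le>n. \<forall>x\<in>X. \<forall>f\<in>A. morphism_defect R R' T r x f = 0)"
  have "\<exists>T. \<forall>n. ?P n T"
  proof (rule prefix_extend)
    fix n and T S :: "nat \<Rightarrow> ('m \<Rightarrow> 'v) \<Rightarrow> 'm \<Rightarrow> 'w"
    assume "?P n T" and eq: "\<And>i. i \<le> n \<Longrightarrow> T i = S i"
    then show "?P n S" using morphism_defect_cong[of n T S] by simp
  next
    show "?P 0 (\<lambda>_. T0)"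
      using T0 Q0 section_lin_in[OF T0(1)] by (simp add: morphism_defect_def R(2) R'(2))
  next
    fix n and T :: "nat \<Rightarrow> ('m \<Rightarrow> 'v) \<Rightarrow> 'm \<Rightarrow> 'w"
    assume P: "?P n T"
    define S where "S = (\<lambda>r. if r \<le> n then T r else (\<lambda>_. 0))"
    have ST: "S i = T i" if "i \<le> n" for i using that by (simp add: S_def)
    have Sz: "S (Suc n) x = 0" for x by (simp add: S_def)
    have S: "section_lin sc sc' X Y (S r)" for r
      using P by (simp add: S_def Y.section_lin_zero_map)
    have S0: "S 0 (act sc x f) = act sc' (S 0 x) f" if "x \<in> X" "f \<in> A" for x f
      using P that T0 by (simp add: ST)
    have Sd: "morphism_defect R R' S r x f = 0" if "r \<le> n" "x \<in> X" "f \<in> A" for r x f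
      using P that morphism_defect_cong[of n S T r] ST by simp
    define \<tau> where "\<tau> = lift_homotopy S (Suc n)"
    have \<tau>: "section_lin sc sc' X Y \<tau>"
      unfolding \<tau>_def by (intro lift_homotopy_lin S)
    have d: "morphism_defect R R' (T(Suc n := \<tau>)) r x f = 0" if "r \<le> Suc n" "x \<in> X" "f \<in> A" for r x f
    proof (cases "r = Suc n")
      case True
      have "morphism_defect R R' (T(Suc n := \<tau>)) r x f = morphism_defect R R' (S(Suc n := \<tau>)) r x f"
        using that by (intro morphism_defect_cong[of "Suc n"]) (auto simp: ST)
      moreover have "morphism_defect R R' (S(Suc n := \<tau>)) (Suc n) x f = 0"
      proof -
        have "morphism_defect R R' (S(Suc n := \<lambda>x. lift_homotopy S (Suc n) x + 0)) (Suc n) x f = 0"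
          by (rule lift_step) (rule S S0 Sz Sd Y.section_lin_zero_map Y.act_simps(4)[symmetric] that; assumption)+
        then show ?thesis by (simp add: \<tau>_def)
      qed
      ultimately show ?thesis using True by simp
    next
      case False
      have "morphism_defect R R' (T(Suc n := \<tau>)) r x f = morphism_defect R R' T r x f"
        using that False by (intro morphism_defect_cong[of n]) auto
      then show ?thesis using P that False by simp
    qed
    have "Q (Suc n) \<tau>"
      unfolding \<tau>_def using P by (intro QS S Sz) (simp add: ST)
    then have "?P (Suc n) (T(Suc n := \<tau>))"
      using P d \<tau> by (auto simp: le_Suc_eq)
    then show "\<exists>a. ?P (Suc n) (T(Suc n := a))" by (rule exI[where x = \<tau>])
  qed
  then obtain T where "\<forall>n. ?P n T" by (rule exE)
  then have P: "?P n T" for n by (rule spec)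
  have T: "section_lin sc sc' X Y (T r)" for r using P[of r] by simp
  have Td: "morphism_defect R R' T n x f = 0" if "x \<in> X" "f \<in> A" for n x f
    using P[of n] that by simp
  have "series_map T (series_bimap R x F) = series_bimap R' (series_map T x) F"
    if "x \<in> series_in X" "F \<in> series_in A" for x F
    by (rule morphism_of_coefficients[OF T Td that])
  moreover have "T 0 = T0" using P[of 0] by simp
  moreover have "Q r (T r)" for r using P[of r] by simp
  ultimately show ?thesis using T by (intro exI[where x = T]) simp
qed

end

context framed_star_module
begin

theorem deformation_unique:
  assumes "bundle_deformation A C sc X R" "bundle_deformation A C sc X R'"
  shows "equivalent_deformations A sc X R R'"
proof -
  interpret star_lift A sc X C I e co sc X R R'
    using assms by unfold_locales
  have id: "section_lin sc sc X X (\<lambda>x. x)"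
    by (simp add: section_lin_def clinear_on_def)
  have "\<exists>T. T 0 = (\<lambda>x. x) \<and> (\<forall>r. section_lin sc sc X X (T r)) \<and> (\<forall>r::nat. True) \<and>
    (\<forall>x\<in>series_in X. \<forall>F\<in>series_in A.
       series_map T (series_bimap R x F) = series_bimap R' (series_map T x) F)"
    by (rule lift_exists[where Q = "\<lambda>_ _. True", OF id]) simp_all
  then obtain T where T: "T 0 = (\<lambda>x. x)" "\<forall>r. section_lin sc sc X X (T r)"
    "\<forall>x\<in>series_in X. \<forall>F\<in>series_in A.
       series_map T (series_bimap R x F) = series_bimap R' (series_map T x) F"
    by (elim exE conjE) (rule that)
  have "bij_betw (series_map T) (series_in X) (series_in X)"
    by (rule series_map_bij[OF section_lin_additive[OF T(2)[rule_format]]]) (simp add: T(1))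
  then have "deformation_iso A sc X R R' T"
    using T by (simp add: deformation_iso_def section_lin_def)
  then show ?thesis unfolding equivalent_deformations_def by (rule exI[where x = T])
qed

end

section \<open>Hermitian deformations\<close>

lemma fcnj_simps [simp]:
  "fcnj (f + g) = fcnj f + fcnj g" "fcnj (f * g) = fcnj f * fcnj g" "fcnj 0 = 0" "fcnj (fcnj f) = f"
  "fcnj (f - g) = fcnj f - fcnj g" "fcnj (fscale (*) c f) = fscale (*) (cnj c) (fcnj f)"
  by (auto simp: fcnj_def fscale_def)

lemma fcnj_sum: "fcnj (\<Sum>i\<in>I. f i) = (\<Sum>i\<in>I. fcnj (f i))"
  by (rule additive_map_sum[of UNIV UNIV fcnj]) (simp_all add: additive_map_def add_closed_def)

lemma series_cnj_nth [simp]: "fps_nth (series_cnj F) n = fcnj (fps_nth F n)"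
  by (simp add: series_cnj_def)

lemma series_cnj_simps [simp]:
  "series_cnj (F + G) = series_cnj F + series_cnj G" "series_cnj (F - G) = series_cnj F - series_cnj G"
  "series_cnj (series_cnj F) = F"
  by (auto intro!: fps_ext)

lemma series_cnj_sum: "series_cnj (\<Sum>i\<in>I. F i) = (\<Sum>i\<in>I. series_cnj (F i))"
  by (rule fps_ext) (simp add: fps_sum_nth fcnj_sum)

lemma series_nonneg_0: "series_nonneg 0"
  by (simp add: series_nonneg_def)

text \<open>Positive leading coefficients cannot cancel, so the sum starts at the smaller of the two
  subdegrees.\<close>

lemma series_nonneg_add:
  assumes "series_nonneg a" "series_nonneg b"
  shows "series_nonneg (a + b)"
proof (cases "a = 0 \<or> b = 0")
  case True
  then show ?thesis using assms by (elim disjE) simp_all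
next
  case False
  let ?m = "min (subdegree a) (subdegree b)"
  have a: "Re (fps_nth a (subdegree a)) > 0" and b: "Re (fps_nth b (subdegree b)) > 0"
    using False assms by (simp_all add: series_nonneg_def)
  have pos: "Re (fps_nth (a + b) ?m) > 0"
  proof (cases "subdegree a" "subdegree b" rule: linorder_cases)
    case less
    then show ?thesis using a nth_less_subdegree_zero[OF less] by (simp add: min_def)
  next
    case equal
    then show ?thesis using a b by simp
  next
    case greater
    then show ?thesis using b nth_less_subdegree_zero[OF greater] by (simp add: min_def)
  qed
  have "fps_nth (a + b) ?m \<noteq> 0"
  proof
    assume "fps_nth (a + b) ?m = 0"
    then show False using pos by (simp only: zero_complex.sel less_irrefl)
  qed
  then have sub: "subdegree (a + b) = ?m"
  proof (rule subdegreeI)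
    fix i assume i: "i < ?m"
    have "fps_nth a i = 0" by (rule nth_less_subdegree_zero) (use i in simp)
    moreover have "fps_nth b i = 0" by (rule nth_less_subdegree_zero) (use i in simp)
    ultimately show "fps_nth (a + b) i = 0" by simp
  qed
  have "fps_nth (a + b) r \<in> \<real>" for r
    using assms by (simp add: series_nonneg_def)
  then show ?thesis
    unfolding series_nonneg_def sub using pos by blast
qed

lemma series_nonneg_sum: "(\<And>i. i \<in> I \<Longrightarrow> series_nonneg (a i)) \<Longrightarrow> series_nonneg (\<Sum>i\<in>I. a i)"
  by (induction I rule: infinite_finite_induct) (simp_all add: series_nonneg_0 series_nonneg_add)

lemma series_bimap_low:
  assumes "\<And>r. biadditive X Y Z (B r)" "0 \<in> Y" "F \<in> series_in X" "\<And>k. k \<le> n \<Longrightarrow> fps_nth G k = 0"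
  shows "fps_nth (series_bimap B F G) n = 0"
proof -
  have "B r (fps_nth F i) 0 = 0" for r i
    using additive_map_0[OF biadditive_right[OF assms(1) series_in_nth[OF assms(3)]] assms(2)] .
  then show ?thesis by (simp add: series_bimap_nth assms(4))
qed

text \<open>These are the two corners of the triangle of indices with \<open>i + j \<le> m\<close>.
  A change of the order \<open>m\<close> term of an isomorphism is felt by the order
  \<open>m\<close> part of the metric only there.\<close>

lemma sum_triangle_delta:
  fixes a b :: "'a::comm_monoid_add"
  assumes "m > (0::nat)"
  shows "(\<Sum>i\<le>m. \<Sum>j\<le>m - i. if i = m \<and> j = 0 then a else 0) +
    (\<Sum>i\<le>m. \<Sum>j\<le>m - i. if i = 0 \<and> j = m then b else 0) = a + b"
proof -
  have *: "(\<Sum>j\<le>m - i. (if i = m \<and> j = 0 then a else 0) + (if i = 0 \<and> j = m then b else 0)) =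
    (if i = m then a else 0) + (if i = 0 then b else 0)" for i
    using assms by (cases "i = m"; cases "i = 0") (simp_all add: sum.delta)
  show ?thesis unfolding sum.distrib[symmetric] * using assms by (simp add: sum.distrib)
qed

text \<open>By \<open>co_H\<close> the coframe is the metric dual of the frame, a Parseval frame.
  This makes the undeformed metric a sum of squares, the form that is then deformed.\<close>

locale hermitian_frame = framed_star_module A sc X C I e co
  for A :: "('m \<Rightarrow> complex) set" and sc :: "complex \<Rightarrow> 'v::ab_group_add \<Rightarrow> 'v" and X :: "('m \<Rightarrow> 'v) set"
    and C :: "'m cochains" and I :: "'i set" and e co +
  fixes H :: "'m \<Rightarrow> 'v \<Rightarrow> 'v \<Rightarrow> complex" and Hs :: "('m \<Rightarrow> 'v) \<Rightarrow> ('m \<Rightarrow> 'v) \<Rightarrow> 'm \<Rightarrow> complex"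
  defines "Hs \<equiv> \<lambda>x y p. H p (x p) (y p)"
  assumes cnj_in: "f \<in> A \<Longrightarrow> fcnj f \<in> A"
    and herm: "hermitian_star A C"
    and Hs_bilin: "x \<in> X \<Longrightarrow> section_lin sc (*) X A (Hs x)"
    and Hs_act: "x \<in> X \<Longrightarrow> y \<in> X \<Longrightarrow> f \<in> A \<Longrightarrow> Hs x (act sc y f) = Hs x y * f"
    and Hs_sym: "x \<in> X \<Longrightarrow> y \<in> X \<Longrightarrow> fcnj (Hs x y) = Hs y x"
    and Hs_pos: "x \<in> X \<Longrightarrow> Hs x x = 0 \<Longrightarrow> x = 0"
    and co_H: "i \<in> I \<Longrightarrow> x \<in> X \<Longrightarrow> co i x = Hs (e i) x"
begin

lemma star_cnj: "F \<in> series_in A \<Longrightarrow> G \<in> series_in A \<Longrightarrow>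
    series_cnj (series_bimap C F G) = series_bimap C (series_cnj G) (series_cnj F)"
  using herm by (simp add: hermitian_star_def)

lemma series_cnj_in: "F \<in> series_in A \<Longrightarrow> series_cnj F \<in> series_in A"
  by (simp add: series_in_def cnj_in)

lemma series_cnj_shift: "shift_linear A A series_cnj"
proof -
  have "series_cnj (series_shift F) = series_shift (series_cnj F)" for F :: "('m \<Rightarrow> complex) fps"
    by (rule fps_ext) (simp add: series_shift_def)
  then show ?thesis by (simp add: shift_linear_def additive_map_def series_cnj_in)
qed

lemma Hs_frame:
  assumes "x \<in> X" "y \<in> X"
  shows "Hs x y = (\<Sum>i\<in>I. fcnj (co i x) * co i y)"
proof -
  have "Hs x y = (\<Sum>i\<in>I. Hs x (act sc (e i) (co i y)))"
    by (subst frame[OF assms(2), symmetric], rule additive_map_sum[OF section_lin_additive[OF Hs_bilin] add_closed_X])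
      (simp_all add: act_in e_in co_in assms)
  also have "\<dots> = (\<Sum>i\<in>I. fcnj (co i x) * co i y)"
  proof (rule sum.cong[OF refl])
    fix i assume i: "i \<in> I"
    have "Hs x (e i) = fcnj (co i x)" using i assms by (simp add: co_H Hs_sym e_in)
    then show "Hs x (act sc (e i) (co i y)) = fcnj (co i x) * co i y"
      by (simp add: Hs_act e_in co_in assms i)
  qed
  finally show ?thesis .
qed

text \<open>Coefficient \<open>r\<close> of the deformed metric on constant series, where
  \<open>\<Phi> i\<close> is the family of components of the lifted \<open>co i\<close>.\<close>

definition metric_of :: "('i \<Rightarrow> nat \<Rightarrow> ('m \<Rightarrow> 'v) \<Rightarrow> 'm \<Rightarrow> complex) \<Rightarrow> nat \<Rightarrow> ('m \<Rightarrow> 'v) \<Rightarrow> ('m \<Rightarrow> 'v) \<Rightarrow> 'm \<Rightarrow> complex" where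
  "metric_of \<Phi> r x y = (\<Sum>i\<in>I. \<Sum>a\<le>r. \<Sum>b\<le>r - a. C (r - a - b) (fcnj (\<Phi> i a x)) (\<Phi> i b y))"

theorem metric_of_hermitian_deformation:
  assumes R: "bundle_deformation A C sc X R"
    and lin: "\<And>i r. i \<in> I \<Longrightarrow> section_lin sc (*) X A (\<Phi> i r)"
    and \<Phi>0: "\<And>i. i \<in> I \<Longrightarrow> \<Phi> i 0 = co i"
    and mod: "\<And>i x F. i \<in> I \<Longrightarrow> x \<in> series_in X \<Longrightarrow> F \<in> series_in A \<Longrightarrow>
      series_map (\<Phi> i) (series_bimap R x F) = series_bimap C (series_map (\<Phi> i) x) F"
  shows "hermitian_deformation A C sc X H R (metric_of \<Phi>)"
proof -
  let ?h = "metric_of \<Phi>"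
  \<comment> \<open>In this form on series the axioms follow from associativity and conjugation of
    the star product; \<open>h_eq\<close> identifies it with the extension of the
    coefficients.\<close>
  define hs where "hs x y = (\<Sum>i\<in>I. series_bimap C (series_cnj (series_map (\<Phi> i) x)) (series_map (\<Phi> i) y))" for x y
  note mp = series_map_shift_linear[OF section_lin_additive[OF lin] add_closed_X A.add_closed_X]
  note mp_in = shift_linear_in[OF mp]
  note R_s = R_in[OF bundle_deformationD(1)[OF R]]
  have hs_right: "shift_linear X A (hs x)" if "x \<in> series_in X" for x
    unfolding hs_def
    by (intro shift_linear_sum fin A.add_closed_X shift_linear_comp[OF mp series_bimap_right[OF C_biadd A.add_closed_X A.add_closed_X]]
        series_cnj_in mp_in that)
  have hs_left: "shift_linear X A (\<lambda>x. hs x y)" if "y \<in> series_in X" for y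
    unfolding hs_def
    by (intro shift_linear_sum fin A.add_closed_X
        shift_linear_comp[OF mp shift_linear_comp[OF series_cnj_shift series_bimap_left[OF C_biadd A.add_closed_X A.add_closed_X]]]
        mp_in that)
  have hs_const: "fps_nth (hs (fps_const x) (fps_const y)) r = ?h r x y" if "x \<in> X" "y \<in> X" for x y r
    unfolding hs_def metric_of_def fps_sum_nth series_bimap_nth
    by (intro sum.cong refl) (simp add: series_map_const[OF section_lin_additive[OF lin] zero_in] that)
  have h_in: "?h r x y \<in> A" if "x \<in> X" "y \<in> X" for r x y
    using series_in_nth[OF shift_linear_in[OF hs_right], of "fps_const x" "fps_const y" r] hs_const that
    by (simp add: const_series)
  have h_biadd: "biadditive X X A (?h r)" for r
  proof -
    have "?h r (x + x') y = ?h r x y + ?h r x' y" if "x \<in> X" "x' \<in> X" "y \<in> X" for x x' y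
      using arg_cong[OF additive_map_add[OF shift_linear_additive[OF hs_left[OF const_series(2)[OF that(3)]]]
        const_series(2)[OF that(1)] const_series(2)[OF that(2)]], of "\<lambda>F. fps_nth F r"] that
      by (simp add: hs_const add_in)
    moreover have "?h r y (x + x') = ?h r y x + ?h r y x'" if "x \<in> X" "x' \<in> X" "y \<in> X" for x x' y
      using arg_cong[OF additive_map_add[OF shift_linear_additive[OF hs_right[OF const_series(2)[OF that(3)]]]
        const_series(2)[OF that(1)] const_series(2)[OF that(2)]], of "\<lambda>F. fps_nth F r"] that
      by (simp add: hs_const add_in)
    ultimately show ?thesis by (simp add: biadditive_def h_in)
  qed
  have h_eq: "series_bimap ?h x y = hs x y" if "x \<in> series_in X" "y \<in> series_in X" for x y
  proof (rule shift_linear_eq[OF series_bimap_left[OF h_biadd add_closed_X A.add_closed_X that(2)] hs_left[OF that(2)] add_closed_X _ that(1)])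
    fix u assume u: "u \<in> X"
    show "series_bimap ?h (fps_const u) y = hs (fps_const u) y"
    proof (rule shift_linear_eq[OF series_bimap_right[OF h_biadd add_closed_X A.add_closed_X] hs_right add_closed_X _ that(2)])
      fix v assume v: "v \<in> X"
      show "series_bimap ?h (fps_const u) (fps_const v) = hs (fps_const u) (fps_const v)"
        by (rule fps_ext) (simp add: series_bimap_const[OF h_biadd u v zero_in zero_in] hs_const u v)
    qed (simp_all add: const_series u)
  qed
  have h_lin: "section_lin sc (*) X A (?h r x)" if "x \<in> X" for r x
    unfolding metric_of_def
    by (intro A.section_lin_sum_map section_lin_comp[OF lin section_bilin_right[OF C_bilin]] cnj_in
       section_lin_in[OF lin] that)
  have h_0: "?h 0 x y = (\<lambda>p. H p (x p) (y p))" if "x \<in> X" "y \<in> X" for x y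
  proof -
    have "?h 0 x y = Hs x y"
      unfolding Hs_frame[OF that]
      by (simp add: metric_of_def \<Phi>0 C_0 cnj_in co_in that)
    then show ?thesis by (simp add: Hs_def)
  qed
  have h_cnj: "series_cnj (hs x y) = hs y x" if "x \<in> series_in X" "y \<in> series_in X" for x y
    unfolding hs_def series_cnj_sum
    by (rule sum.cong[OF refl]) (simp add: star_cnj series_cnj_in mp_in that)
  have h_mod: "hs x (series_bimap R y F) = series_bimap C (hs x y) F"
    if "x \<in> series_in X" "y \<in> series_in X" "F \<in> series_in A" for x y F
  proof -
    have "series_bimap C (hs x y) F = (\<Sum>i\<in>I. series_bimap C (series_bimap C (series_cnj (series_map (\<Phi> i) x)) (series_map (\<Phi> i) y)) F)"
      unfolding hs_def
      by (rule additive_map_sum[OF shift_linear_additive[OF series_bimap_left[OF C_biadd A.add_closed_X A.add_closed_X that(3)]]])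
        (simp_all add: add_closed_series_in A.add_closed_X star_in series_cnj_in mp_in that)
    also have "\<dots> = hs x (series_bimap R y F)"
      unfolding hs_def
      by (rule sum.cong[OF refl]) (simp add: star_assoc series_cnj_in mp_in that mod)
    finally show ?thesis by simp
  qed
  have h_pos: "hs x x \<in> positive_elements A C" if x: "x \<in> series_in X" for x
  proof -
    have "series_nonneg (\<omega> (hs x x))" if \<omega>: "positive_functional A C \<omega>" for \<omega>
    proof -
      have "additive_map (series_in A) UNIV \<omega>"
        using \<omega> by (simp add: positive_functional_def additive_map_def)
      then have "\<omega> (hs x x) = (\<Sum>i\<in>I. \<omega> (series_bimap C (series_cnj (series_map (\<Phi> i) x)) (series_map (\<Phi> i) x)))"
        unfolding hs_def
        by (rule additive_map_sum[OF _ add_closed_series_in[OF A.add_closed_X]])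
          (simp add: star_in series_cnj_in mp_in x)
      also have "series_nonneg \<dots>"
        by (rule series_nonneg_sum) (use \<omega> mp_in[OF _ x] in \<open>auto simp: positive_functional_def\<close>)
      finally show ?thesis .
    qed
    then show ?thesis
      using shift_linear_in[OF hs_right[OF x] x] by (simp add: positive_elements_def)
  qed
  have h_nondeg: "x = 0" if x: "x \<in> series_in X" and 0: "hs x x = 0" for x
  proof -
    \<comment> \<open>If \<open>x\<close> starts in order \<open>n\<close>, then its square starts
      in order \<open>2 * n\<close>, with the undeformed square of that coefficient, which vanishes
      only for a vanishing coefficient.\<close>
    have "fps_nth x n = 0" for n
    proof (induction n rule: less_induct)
      case (less n)
      have T0: "\<Phi> i k 0 = 0" if "i \<in> I" for i k
        using additive_map_0[OF section_lin_additive[OF lin[OF that]] zero_in] .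
      have low: "fps_nth (series_map (\<Phi> i) x) k = 0" if "i \<in> I" "k < n" for i k
        unfolding series_map_nth
      proof (rule sum.neutral, rule ballI)
        fix j assume "j \<in> {..k}"
        then have "fps_nth x j = 0" using that by (intro less) simp
        then show "\<Phi> i (k - j) (fps_nth x j) = 0" by (simp only: T0[OF that(1)])
      qed
      have mid: "fps_nth (series_map (\<Phi> i) x) n = co i (fps_nth x n)" if "i \<in> I" for i
      proof -
        have "(\<Sum>k\<le>n. \<Phi> i (n - k) (fps_nth x k)) = (\<Sum>k\<le>n. if k = n then \<Phi> i 0 (fps_nth x n) else 0)"
        proof (rule sum.cong[OF refl])
          fix k assume "k \<in> {..n}"
          then consider "k = n" | "k < n" by fastforce
          then show "\<Phi> i (n - k) (fps_nth x k) = (if k = n then \<Phi> i 0 (fps_nth x n) else 0)"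
          proof cases
            case 2
            then show ?thesis by (simp only: less[OF 2] T0[OF that] less_not_refl3 if_False)
          qed simp
        qed
        then show ?thesis using that by (simp add: series_map_nth \<Phi>0)
      qed
      have C0: "C k 0 f = 0" "C k f 0 = 0" if "f \<in> A" for k f
        using additive_map_0[OF biadditive_left[OF C_biadd that] A.zero_in]
          additive_map_0[OF biadditive_right[OF C_biadd that] A.zero_in] by simp_all
      have "fps_nth (series_bimap C (series_cnj (series_map (\<Phi> i) x)) (series_map (\<Phi> i) x)) (2 * n) =
        fcnj (co i (fps_nth x n)) * co i (fps_nth x n)" if i: "i \<in> I" for i
      proof -
        let ?u = "\<lambda>k. fps_nth (series_map (\<Phi> i) x) k"
        have u: "?u k \<in> A" for k using series_in_nth[OF mp_in[OF i x]] .
        have "(\<Sum>b\<le>2 * n - a. C (2 * n - a - b) (fcnj (?u a)) (?u b)) =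
          (if a = n then C 0 (fcnj (?u n)) (?u n) else 0)" if "a \<le> 2 * n" for a
        proof (cases "a < n")
          case True
          then show ?thesis using low[OF i] by (simp add: C0 u)
        next
          case False
          have "(\<Sum>b\<le>2 * n - a. C (2 * n - a - b) (fcnj (?u a)) (?u b)) =
            (\<Sum>b\<le>2 * n - a. if a = n \<and> b = n then C 0 (fcnj (?u n)) (?u n) else 0)"
          proof (rule sum.cong[OF refl])
            fix b assume "b \<in> {..2 * n - a}"
            \<comment> \<open>Here \<open>a\<close> is at least \<open>n\<close>, and
              \<open>b \<le> 2 * n - a\<close> then forces \<open>b < n\<close> unless both are
              \<open>n\<close>; terms with \<open>b < n\<close> vanish by
              \<open>low\<close>.\<close>
            then have "b < n \<or> a = n \<and> b = n" using False that by auto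
            then show "C (2 * n - a - b) (fcnj (?u a)) (?u b) =
              (if a = n \<and> b = n then C 0 (fcnj (?u n)) (?u n) else 0)"
              using low[OF i] by (auto simp: C0 u cnj_in)
          qed
          then show ?thesis by (cases "a = n") simp_all
        qed
        then have "fps_nth (series_bimap C (series_cnj (series_map (\<Phi> i) x)) (series_map (\<Phi> i) x)) (2 * n) =
          (\<Sum>a\<le>2 * n. if a = n then C 0 (fcnj (?u n)) (?u n) else 0)"
          unfolding series_bimap_nth by (intro sum.cong) simp_all
        then show ?thesis by (simp add: C_0 cnj_in mid[OF i] co_in[OF i series_in_nth[OF x]])
      qed
      then have "fps_nth (hs x x) (2 * n) = Hs (fps_nth x n) (fps_nth x n)"
        unfolding hs_def Hs_frame[OF series_in_nth[OF x] series_in_nth[OF x]] fps_sum_nth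
        by (rule sum.cong[OF refl])
      then have "Hs (fps_nth x n) (fps_nth x n) = 0" using 0 by simp
      then show ?case using Hs_pos series_in_nth[OF x] by blast
    qed
    then show ?thesis by (intro fps_ext) simp
  qed
  have h_clin: "clinear_on sc (*) X (?h r x)" if "x \<in> X" for r x
    using h_lin[OF that] by (simp add: section_lin_def)
  show ?thesis
    unfolding hermitian_deformation_def
  proof (intro conjI ballI allI impI)
    show "bundle_deformation A C sc X R" by (rule R)
    show "?h r x y \<in> A" if "x \<in> X" "y \<in> X" for r x y by (rule h_in[OF that])
    show "?h 0 x y = (\<lambda>p. H p (x p) (y p))" if "x \<in> X" "y \<in> X" for x y by (rule h_0[OF that])
    show "clinear_on sc (*) X (?h r x)" if "x \<in> X" for r x by (rule h_clin[OF that])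
    fix x assume x: "x \<in> series_in X"
    show "series_bimap ?h x x \<in> positive_elements A C" by (simp only: h_eq[OF x x] h_pos[OF x])
    show "x = 0" if "series_bimap ?h x x = 0" using h_nondeg[OF x] that by (simp only: h_eq[OF x x])
    fix y assume y: "y \<in> series_in X"
    show "series_cnj (series_bimap ?h x y) = series_bimap ?h y x" by (simp only: h_eq[OF x y] h_eq[OF y x] h_cnj[OF x y])
    fix F assume F: "F \<in> series_in A"
    show "series_bimap ?h x (series_bimap R y F) = series_bimap C (series_bimap ?h x y) F"
      by (simp only: h_eq[OF x y] h_eq[OF x R_s[OF y F]] h_mod[OF x y F])
  qed
qed

text \<open>Additivity of \<open>h r\<close> in the first argument has to be extracted from the
  symmetry, which speaks of series. On constant series it still mixes in the values of lower
  \<open>h s\<close> at the zero section, and these have to be shown to vanish first.\<close>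

lemma hermitian_deformationD:
  assumes "hermitian_deformation A C sc X H R h"
  shows "bundle_deformation A C sc X R"
    "biadditive X X A (h r)"
    "x \<in> X \<Longrightarrow> y \<in> X \<Longrightarrow> h 0 x y = Hs x y"
    "x' \<in> series_in X \<Longrightarrow> y' \<in> series_in X \<Longrightarrow> series_cnj (series_bimap h x' y') = series_bimap h y' x'"
    "x' \<in> series_in X \<Longrightarrow> y' \<in> series_in X \<Longrightarrow> F \<in> series_in A \<Longrightarrow>
       series_bimap h x' (series_bimap R y' F) = series_bimap C (series_bimap h x' y') F"
proof -
  have in_A: "h r x y \<in> A" if "x \<in> X" "y \<in> X" for r x y
    using assms that by (simp add: hermitian_deformation_def)
  have cl: "clinear_on sc (*) X (h r x)" if "x \<in> X" for r x
    using assms that by (simp add: hermitian_deformation_def)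
  have right: "additive_map X A (h r x)" if "x \<in> X" for r x
    using cl[OF that] in_A[OF that] by (simp add: additive_map_def clinear_on_def)
  have cnj: "series_cnj (series_bimap h x y) = series_bimap h y x" if "x \<in> series_in X" "y \<in> series_in X" for x y
    using assms that by (simp add: hermitian_deformation_def)
  have nth: "fps_nth (series_bimap h (fps_const x) (fps_const y)) r = (\<Sum>i\<le>r. h (r - i) (fps_nth (fps_const x) i) y)"
    if "x \<in> X" "y \<in> X" for x y r
  proof -
    have "(\<Sum>j\<le>r - i. h (r - i - j) (fps_nth (fps_const x) i) (fps_nth (fps_const y) j)) =
      h (r - i) (fps_nth (fps_const x) i) y" for i
    proof -
      have "fps_nth (fps_const x) i \<in> X" using that zero_in by simp
      from additive_map_0[OF right[OF this] zero_in]
      have "(\<Sum>j\<le>r - i. h (r - i - j) (fps_nth (fps_const x) i) (fps_nth (fps_const y) j)) =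
        (\<Sum>j\<le>r - i. if j = 0 then h (r - i) (fps_nth (fps_const x) i) y else 0)"
        by (intro sum.cong) simp_all
      then show ?thesis by simp
    qed
    then show ?thesis by (simp add: series_bimap_nth)
  qed
  \<comment> \<open>The symmetry for the constant series of \<open>y\<close> and of 0 says that the
    sum of \<open>h s 0 y\<close> over \<open>s \<le> r\<close> is zero; induction isolates the last
    summand.\<close>
  have h00: "h r 0 y = 0" if y: "y \<in> X" for r y
  proof (induction r rule: less_induct)
    case (less r)
    have "(\<Sum>i\<le>r. h (r - i) (fps_nth (fps_const 0) i) y) = (\<Sum>i\<le>r. fcnj (h (r - i) (fps_nth (fps_const y) i) 0))"
      using arg_cong[OF cnj[OF const_series(2)[OF y] const_series(2)[OF zero_in]], of "\<lambda>F. fps_nth F r"]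
      by (simp only: series_cnj_nth nth[OF y zero_in] nth[OF zero_in y] fcnj_sum)
    also have "\<dots> = 0"
    proof (rule sum.neutral, rule ballI)
      fix i
      have "fps_nth (fps_const y) i \<in> X" using y zero_in by simp
      from additive_map_0[OF right[OF this] zero_in]
      show "fcnj (h (r - i) (fps_nth (fps_const y) i) 0) = 0" by (simp only: fcnj_simps)
    qed
    also have "(\<Sum>i\<le>r. h (r - i) (fps_nth (fps_const 0) i) y) = (\<Sum>i\<le>r. if i = 0 then h r 0 y else 0)"
    proof (rule sum.cong[OF refl])
      fix i assume "i \<in> {..r}"
      then consider "i = 0" | "r - i < r" "i \<noteq> 0" by fastforce
      then show "h (r - i) (fps_nth (fps_const 0) i) y = (if i = 0 then h r 0 y else 0)"
      proof cases
        case 2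
        then show ?thesis using less[OF 2(1)] by (simp only: fps_const_0_eq_0 fps_zero_nth if_False)
      qed simp
    qed
    finally show ?case by (simp only: sum_delta_atMost)
  qed
  have const: "fps_nth (series_bimap h (fps_const x) (fps_const y)) r = h r x y" if "x \<in> X" "y \<in> X" for x y r
  proof -
    have "(\<Sum>i\<le>r. h (r - i) (fps_nth (fps_const x) i) y) = (\<Sum>i\<le>r. if i = 0 then h r x y else 0)"
      by (rule sum.cong) (simp_all add: h00 that)
    then show ?thesis by (simp add: nth[OF that])
  qed
  have sym: "h r x y = fcnj (h r y x)" if "x \<in> X" "y \<in> X" for r x y
    using arg_cong[OF cnj[OF const_series(2)[OF that(2)] const_series(2)[OF that(1)]], of "\<lambda>F. fps_nth F r"]
    by (simp only: series_cnj_nth const[OF that] const[OF that(2,1)])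
  have "h r (x + x') y = h r x y + h r x' y" if "x \<in> X" "x' \<in> X" "y \<in> X" for x x' y
    using additive_map_add[OF right[OF that(3)] that(1,2), of r]
    by (simp only: sym[OF add_in[OF that(1,2)] that(3)] sym[OF that(1,3)] sym[OF that(2,3)] fcnj_simps)
  then show "biadditive X X A (h r)"
    using in_A right by (simp add: biadditive_def additive_map_def)
  show "bundle_deformation A C sc X R" "x \<in> X \<Longrightarrow> y \<in> X \<Longrightarrow> h 0 x y = Hs x y"
    "x' \<in> series_in X \<Longrightarrow> y' \<in> series_in X \<Longrightarrow> F \<in> series_in A \<Longrightarrow>
       series_bimap h x' (series_bimap R y' F) = series_bimap C (series_bimap h x' y') F"
    using assms by (simp_all add: hermitian_deformation_def Hs_def)
  show "x' \<in> series_in X \<Longrightarrow> y' \<in> series_in X \<Longrightarrow> series_cnj (series_bimap h x' y') = series_bimap h y' x'"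
    by (rule cnj)
qed

text \<open>Constants belong to \<open>A\<close>, so an additive map that commutes with the action
  of \<open>A\<close> is complex linear.\<close>

lemma section_lin_of_act:
  assumes "section_space sc1 Y1" "\<And>x c. x \<in> Y1 \<Longrightarrow> act sc1 x (\<lambda>_. c) \<in> Y1"
    and "additive_map Y1 Y2 T"
    and "\<And>x f. x \<in> Y1 \<Longrightarrow> f \<in> A \<Longrightarrow> T (act sc1 x f) = act sc2 (T x) f"
  shows "section_lin sc1 sc2 Y1 Y2 T"
  using assms by (simp add: section_lin_def clinear_on_def additive_map_def fscale_act const_in)

theorem hermitian_deformation_unique:
  assumes hd: "hermitian_deformation A C sc X H R h" and hd': "hermitian_deformation A C sc X H R' h'"
  shows "equivalent_hermitian_deformations A sc X R h R' h'"
proof -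
  note h = hermitian_deformationD[OF hd] and h' = hermitian_deformationD[OF hd']
  interpret star_lift A sc X C I e co sc X R R'
    using h(1) h'(1) by unfold_locales
  \<comment> \<open>\<open>K\<close> measures in order \<open>n\<close>, on constants, how far the
    partial isomorphism is from an isometry; \<open>G\<close> is its version for series, where the
    module laws can be applied.\<close>
  define K where "K T n x y = (\<Sum>i\<le>n. \<Sum>j\<le>n - i. h' (n - i - j) (T i x) (T j y)) - h n x y"
    for T :: "nat \<Rightarrow> ('m \<Rightarrow> 'v) \<Rightarrow> 'm \<Rightarrow> 'v" and n x y
  define G where "G T x y = series_bimap h' (series_map T x) (series_map T y) - series_bimap h x y"
    for T :: "nat \<Rightarrow> ('m \<Rightarrow> 'v) \<Rightarrow> 'm \<Rightarrow> 'v" and x y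
  have K_cong: "K T r x y = K S r x y" if "\<And>i. i \<le> n \<Longrightarrow> T i = S i" "r \<le> n" for T S n r x y
    using that by (simp add: K_def)
  note h_left = series_bimap_left[OF h(2) add_closed_X A.add_closed_X]
  note h_right = series_bimap_right[OF h(2) add_closed_X A.add_closed_X]
  note h'_left = series_bimap_left[OF h'(2) add_closed_X A.add_closed_X]
  note h'_right = series_bimap_right[OF h'(2) add_closed_X A.add_closed_X]
  have G_const: "fps_nth (G T (fps_const x) (fps_const y)) n = K T n x y"
    if T: "\<And>r. section_lin sc sc X X (T r)" and "x \<in> X" "y \<in> X" for T n x y
    by (simp add: G_def K_def series_bimap_nth[of h'] T_const[OF T] series_bimap_const[OF h(2) that(2,3) zero_in zero_in] that)
  have G_left: "shift_linear X A (\<lambda>x. G T x y)"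
    if T: "\<And>r. section_lin sc sc X X (T r)" and "y \<in> series_in X" for T y
    unfolding G_def
    by (intro shift_linear_diff[OF _ _ A.add_closed_X] h_left shift_linear_comp[OF T_shift[OF T] h'_left] T_in[OF T] that)
  have G_right: "shift_linear X A (G T x)"
    if T: "\<And>r. section_lin sc sc X X (T r)" and "x \<in> series_in X" for T x
    unfolding G_def
    by (intro shift_linear_diff[OF _ _ A.add_closed_X] h_right shift_linear_comp[OF T_shift[OF T] h'_right] T_in[OF T] that)
  have G_cnj: "series_cnj (G T x y) = G T y x"
    if T: "\<And>r. section_lin sc sc X X (T r)" and "x \<in> series_in X" "y \<in> series_in X" for T x y
    by (simp add: G_def h(4) h'(4) T_in[OF T] that)
  have G_zero: "fps_nth (G T x y) n = 0"
    if T: "\<And>r. section_lin sc sc X X (T r)" and K0: "\<And>n x y. n \<le> r \<Longrightarrow> x \<in> X \<Longrightarrow> y \<in> X \<Longrightarrow> K T n x y = 0"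
      and x: "x \<in> series_in X" and y: "y \<in> series_in X" and n: "n \<le> r" for T r x y n
  proof -
    have *: "fps_nth (G T (fps_const u) y) k = 0" if "u \<in> X" "k \<le> r" for u k
      by (rule shift_linear_low[OF G_right[OF T] add_closed_X A.add_closed_X y _ that(2)])
        (simp_all only: const_series that G_const[OF T] K0)
    show ?thesis
      by (rule shift_linear_low[OF G_left[OF T y] add_closed_X A.add_closed_X x * n])
  qed
  let ?P = "\<lambda>n T. T 0 = (\<lambda>x. x) \<and> (\<forall>r\<le>n. section_lin sc sc X X (T r)) \<and>
    (\<forall>r\<le>n. \<forall>x\<in>X. \<forall>f\<in>A. morphism_defect R R' T r x f = 0) \<and>
    (\<forall>r\<le>n. \<forall>x\<in>X. \<forall>y\<in>X. K T r x y = 0)"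
  have "\<exists>T. \<forall>n. ?P n T"
  proof (rule prefix_extend)
    fix n and T S :: "nat \<Rightarrow> ('m \<Rightarrow> 'v) \<Rightarrow> 'm \<Rightarrow> 'v"
    assume "?P n T" and eq: "\<And>i. i \<le> n \<Longrightarrow> T i = S i"
    then show "?P n S" using morphism_defect_cong[of n T S] K_cong[of n T S] by simp
  next
    have "section_lin sc sc X X (\<lambda>x. x)"
      by (simp add: section_lin_def clinear_on_def)
    then show "?P 0 (\<lambda>_ x. x)"
      by (simp add: morphism_defect_def R(2) R'(2) K_def h(3) h'(3))
  next
    fix n and T :: "nat \<Rightarrow> ('m \<Rightarrow> 'v) \<Rightarrow> 'm \<Rightarrow> 'v"
    assume P: "?P n T"
    define S where "S = (\<lambda>r. if r \<le> n then T r else (\<lambda>_. 0))"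
    have ST: "S i = T i" if "i \<le> n" for i using that by (simp add: S_def)
    have Sz: "S (Suc n) x = 0" for x by (simp add: S_def)
    have S: "section_lin sc sc X X (S r)" for r
      using P by (simp add: S_def section_lin_zero_map)
    have S0: "S 0 (act sc x f) = act sc (S 0 x) f" if "x \<in> X" "f \<in> A" for x f
      using P that by (simp add: ST)
    have Sd: "morphism_defect R R' S r x f = 0" if "r \<le> n" "x \<in> X" "f \<in> A" for r x f
      using P that morphism_defect_cong[of n S T r] ST by simp
    \<comment> \<open>Any lift to the next order is taken first. In general it is not isometric in
      that order, and what can still be changed is a map linear over \<open>A\<close>.\<close>
    define \<tau>0 where "\<tau>0 = lift_homotopy S (Suc n)"
    have \<tau>0: "section_lin sc sc X X \<tau>0"
      unfolding \<tau>0_def by (intro lift_homotopy_lin S)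
    define L where "L = S(Suc n := \<tau>0)"
    have L: "section_lin sc sc X X (L r)" for r
      using S \<tau>0 by (simp add: L_def)
    have Ld: "morphism_defect R R' L r x f = 0" if "r \<le> Suc n" "x \<in> X" "f \<in> A" for r x f
    proof (cases "r = Suc n")
      case True
      have "morphism_defect R R' (S(Suc n := \<lambda>x. lift_homotopy S (Suc n) x + 0)) (Suc n) x f = 0"
        by (rule lift_step) (rule S S0 Sz Sd section_lin_zero_map act_simps(4)[symmetric] that; assumption)+
      then show ?thesis using True by (simp add: \<tau>0_def L_def)
    next
      case False
      have "morphism_defect R R' L r x f = morphism_defect R R' S r x f"
        using that False by (intro morphism_defect_cong[of n]) (auto simp: L_def)
      then show ?thesis using Sd that False by simp
    qed
    have LK: "K L r x y = 0" if "r \<le> n" "x \<in> X" "y \<in> X" for r x y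
    proof -
      have "K L r x y = K T r x y"
        using that by (intro K_cong[of n]) (auto simp: L_def ST)
      then show ?thesis using P that by simp
    qed
    define k where "k = K L (Suc n)"
    have k_G: "k x y = fps_nth (G L (fps_const x) (fps_const y)) (Suc n)" if "x \<in> X" "y \<in> X" for x y
      using G_const[OF L that] by (simp add: k_def)
    have k_in: "k x y \<in> A" if "x \<in> X" "y \<in> X" for x y
      unfolding k_G[OF that]
      by (intro series_in_nth shift_linear_in[OF G_right[OF L]] const_series that)
    have k_sym: "k x y = fcnj (k y x)" if "x \<in> X" "y \<in> X" for x y
      unfolding k_G[OF that] k_G[OF that(2,1)] series_cnj_nth[symmetric]
      by (subst G_cnj[OF L]) (simp_all add: const_series that)
    have k_add: "additive_map X A (k x)" if x: "x \<in> X" for x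
    proof -
      have "k x (y + y') = k x y + k x y'" if "y \<in> X" "y' \<in> X" for y y'
        using arg_cong[OF additive_map_add[OF shift_linear_additive[OF G_right[OF L const_series(2)[OF x]]]
          const_series(2)[OF that(1)] const_series(2)[OF that(2)]], of "\<lambda>F. fps_nth F (Suc n)"]
        by (simp only: k_G x that add_in fps_const_add fps_add_nth)
      then show ?thesis using k_in x by (simp add: additive_map_def)
    qed
    \<comment> \<open>\<open>L\<close> is a module map through order \<open>Suc n\<close> and an
      isometry through order \<open>n\<close>; hence in order \<open>Suc n\<close> only undeformed
      products with \<open>k\<close> remain.\<close>
    have k_act: "k x (act sc y f) = k x y * f" if x: "x \<in> X" and y: "y \<in> X" and f: "f \<in> A" for x y f
    proof -
      let ?x = "fps_const x" and ?y = "fps_const y" and ?f = "fps_const f"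
      note in_s = const_series(2)[OF x] const_series(2)[OF y] const_series(1)[OF f]
      have yf: "series_bimap R ?y ?f \<in> series_in X" by (intro R_in[OF R(1)] in_s)
      have Ein: "series_morphism_defect L ?y ?f \<in> series_in X"
        using shift_linear_in[OF morphism_defect_1[OF L in_s(3)] in_s(2)] .
      have "series_map L (series_bimap R ?y ?f) = series_bimap R' (series_map L ?y) ?f - series_morphism_defect L ?y ?f"
        by (simp add: series_morphism_defect_def)
      then have "series_bimap h' (series_map L ?x) (series_map L (series_bimap R ?y ?f)) =
        series_bimap h' (series_map L ?x) (series_bimap R' (series_map L ?y) ?f) -
        series_bimap h' (series_map L ?x) (series_morphism_defect L ?y ?f)"
        using additive_map_diff[OF shift_linear_additive[OF h'_right[OF T_in[OF L in_s(1)]]] add_closed_series_in[OF add_closed_X]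
          R_in[OF R'(1) T_in[OF L in_s(2)] in_s(3)] Ein] by simp
      also have "series_bimap h' (series_map L ?x) (series_bimap R' (series_map L ?y) ?f) =
        series_bimap C (series_bimap h' (series_map L ?x) (series_map L ?y)) ?f"
        by (intro h'(5) T_in[OF L] in_s)
      finally have "G L ?x (series_bimap R ?y ?f) = series_bimap C (series_bimap h' (series_map L ?x) (series_map L ?y)) ?f
        - series_bimap C (series_bimap h ?x ?y) ?f - series_bimap h' (series_map L ?x) (series_morphism_defect L ?y ?f)"
        by (simp add: G_def h(5) in_s)
      also have "series_bimap C (series_bimap h' (series_map L ?x) (series_map L ?y)) ?f
        - series_bimap C (series_bimap h ?x ?y) ?f = series_bimap C (G L ?x ?y) ?f"
        unfolding G_def
        by (rule additive_map_diff[OF shift_linear_additive[OF series_bimap_left[OF C_biadd A.add_closed_X A.add_closed_X in_s(3)]], symmetric])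
          (intro add_closed_series_in A.add_closed_X shift_linear_in[OF h'_right] shift_linear_in[OF h_right] T_in[OF L] in_s)+
      finally have eq: "fps_nth (G L ?x (series_bimap R ?y ?f)) (Suc n) = fps_nth (series_bimap C (G L ?x ?y) ?f) (Suc n) -
        fps_nth (series_bimap h' (series_map L ?x) (series_morphism_defect L ?y ?f)) (Suc n)"
        by simp
      have 1: "fps_nth (series_bimap h' (series_map L ?x) (series_morphism_defect L ?y ?f)) (Suc n) = 0"
        by (rule series_bimap_low[OF h'(2) zero_in T_in[OF L in_s(1)]])
          (rule series_morphism_defect_low[OF L Ld in_s(2,3)])
      have G_in: "G L ?x ?y \<in> series_in A" by (rule shift_linear_in[OF G_right[OF L in_s(1)] in_s(2)])
      have C0: "C m 0 f = 0" for m
        using additive_map_0[OF biadditive_left[OF C_biadd f] A.zero_in] .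
      have 2: "fps_nth (series_bimap C (G L ?x ?y) ?f) (Suc n) = k x y * f"
      proof -
        have "(\<Sum>i\<le>Suc n. C (Suc n - i) (fps_nth (G L ?x ?y) i) f) = (\<Sum>i\<le>Suc n. if i = Suc n then k x y * f else 0)"
        proof (rule sum.cong[OF refl])
          fix i assume "i \<in> {..Suc n}"
          then consider "i = Suc n" | "i \<le> n" by fastforce
          then show "C (Suc n - i) (fps_nth (G L ?x ?y) i) f = (if i = Suc n then k x y * f else 0)"
          proof cases
            case 1
            then show ?thesis using C_0[OF k_in[OF x y] f] by (simp add: k_G[OF x y])
          next
            case 2
            have "fps_nth (G L ?x ?y) i = 0" by (rule G_zero[OF L LK in_s(1,2) 2])
            then show ?thesis using 2 by (simp add: C0)
          qed
        qed
        then show ?thesis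
          by (simp add: series_bimap_const_right[OF C_biadd G_in f A.zero_in])
      qed
      have 3: "fps_nth (G L ?x (series_bimap R ?y ?f)) (Suc n) = k x (act sc y f)"
      proof -
        have "fps_nth (G L ?x (series_bimap R ?y ?f)) (Suc n) = fps_nth (G L ?x (fps_const (fps_nth (series_bimap R ?y ?f) 0))) (Suc n)"
        proof (rule shift_linear_leading[OF G_right[OF L in_s(1)] add_closed_X A.add_closed_X yf])
          fix u m assume u: "u \<in> X" and "m < Suc n"
          then have m: "m \<le> n" by simp
          show "fps_nth (G L ?x (fps_const u)) m = 0"
            by (rule G_zero[OF L LK in_s(1) const_series(2)[OF u] m])
        qed
        also have "fps_nth (series_bimap R ?y ?f) 0 = act sc y f"
          by (simp add: R_const[OF R(1)] R(2) y f)
        finally show ?thesis by (simp add: k_G x y f act_in)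
      qed
      show ?thesis using eq by (simp add: 1 2 3)
    qed
    \<comment> \<open>This represents minus one half of \<open>k\<close> in terms of the undeformed
      metric. It occurs in both arguments of the metric, and the two halves remove
      \<open>k\<close>.\<close>
    define B where "B y = (\<Sum>i\<in>I. act sc (e i) (fscale (*) (- 1 / 2) (k (e i) y)))" for y
    have B_in: "B y \<in> X" if "y \<in> X" for y
      unfolding B_def by (intro closed(5) act_in e_in A.scale_in k_in that)
    have B_act: "B (act sc y f) = act sc (B y) f" if "y \<in> X" "f \<in> A" for y f
    proof -
      have *: "fscale (*) c g * f = fscale (*) c (g * f)" for c :: complex and g :: "'m \<Rightarrow> complex"
        by (auto simp: fscale_def)
      show ?thesis
        by (simp add: * B_def act_sum act_simps k_act e_in that)
    qed
    have "additive_map X X B"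
    proof -
      have "B (y + y') = B y + B y'" if "y \<in> X" "y' \<in> X" for y y'
        unfolding B_def sum.distrib[symmetric]
        by (rule sum.cong[OF refl])
          (simp only: additive_map_add[OF k_add[OF e_in] that] A.fscale_simps act_simps)
      then show ?thesis using B_in by (simp add: additive_map_def)
    qed
    then have B: "section_lin sc sc X X B"
      by (intro section_lin_of_act B_act section_space_axioms act_in const_in)
    have HB: "Hs x (B y) = fscale (*) (- 1 / 2) (k x y)" if x: "x \<in> X" and y: "y \<in> X" for x y
    proof -
      have sc_mult: "f * fscale (*) c g = fscale (*) c (f * g)" for c :: complex and f g :: "'m \<Rightarrow> complex"
        by (auto simp: fscale_def)
      \<comment> \<open>Only linearity in the second argument is at hand, so the frame expansion of
        \<open>x\<close> is inserted after exchanging the arguments by symmetry.\<close>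
      have "k x y = fcnj (k y (\<Sum>i\<in>I. act sc (e i) (co i x)))"
        using k_sym[OF x y] by (simp add: frame[OF x])
      also have "k y (\<Sum>i\<in>I. act sc (e i) (co i x)) = (\<Sum>i\<in>I. k y (e i) * co i x)"
        by (subst additive_map_sum[OF k_add[OF y] add_closed_X])
          (simp_all add: k_act act_in e_in co_in x y)
      also have "fcnj \<dots> = (\<Sum>i\<in>I. Hs x (e i) * k (e i) y)"
        unfolding fcnj_sum
      proof (rule sum.cong[OF refl])
        fix i assume i: "i \<in> I"
        have "fcnj (co i x) = Hs x (e i)" using i x by (simp add: co_H Hs_sym e_in)
        moreover have "fcnj (k y (e i)) = k (e i) y" using k_sym[OF e_in[OF i] y] by simp
        ultimately show "fcnj (k y (e i) * co i x) = Hs x (e i) * k (e i) y" by (simp add: mult.commute)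
      qed
      finally have kxy: "k x y = (\<Sum>i\<in>I. Hs x (e i) * k (e i) y)" .
      have "Hs x (B y) = (\<Sum>i\<in>I. Hs x (act sc (e i) (fscale (*) (- 1 / 2) (k (e i) y))))"
        unfolding B_def
        by (rule additive_map_sum[OF section_lin_additive[OF Hs_bilin[OF x]] add_closed_X])
          (intro act_in e_in A.scale_in k_in y)
      also have "\<dots> = (\<Sum>i\<in>I. fscale (*) (- 1 / 2) (Hs x (e i) * k (e i) y))"
        by (rule sum.cong[OF refl]) (simp only: Hs_act x y e_in A.scale_in k_in sc_mult)
      finally show ?thesis by (simp only: kxy A.fscale_sum)
    qed
    have BH: "Hs (B x) y = fscale (*) (- 1 / 2) (k x y)" if x: "x \<in> X" and y: "y \<in> X" for x y
    proof -
      have "Hs (B x) y = fcnj (Hs y (B x))" by (simp add: Hs_sym y B_in[OF x])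
      also have "\<dots> = fscale (*) (- 1 / 2) (fcnj (k y x))" by (simp add: HB[OF y x])
      finally show ?thesis by (simp only: k_sym[OF x y])
    qed
    define \<tau> where "\<tau> x = \<tau>0 x + B x" for x
    have \<tau>: "section_lin sc sc X X \<tau>"
      unfolding \<tau>_def by (intro section_lin_add_map \<tau>0 B)
    have d: "morphism_defect R R' (T(Suc n := \<tau>)) r x f = 0" if "r \<le> Suc n" "x \<in> X" "f \<in> A" for r x f
    proof (cases "r = Suc n")
      case True
      have "morphism_defect R R' (T(Suc n := \<tau>)) r x f = morphism_defect R R' (S(Suc n := \<lambda>x. lift_homotopy S (Suc n) x + B x)) r x f"
        using that by (intro morphism_defect_cong[of "Suc n"]) (auto simp: ST \<tau>_def \<tau>0_def)
      moreover have "morphism_defect R R' (S(Suc n := \<lambda>x. lift_homotopy S (Suc n) x + B x)) (Suc n) x f = 0"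
        by (rule lift_step) (rule S S0 Sz Sd B B_act that; assumption)+
      ultimately show ?thesis using True by simp
    next
      case False
      have "morphism_defect R R' (T(Suc n := \<tau>)) r x f = morphism_defect R R' T r x f"
        using that False by (intro morphism_defect_cong[of n]) auto
      then show ?thesis using P that False by simp
    qed
    have K0: "K (T(Suc n := \<tau>)) r x y = 0" if "r \<le> Suc n" "x \<in> X" "y \<in> X" for r x y
    proof (cases "r = Suc n")
      case False
      have "K (T(Suc n := \<tau>)) r x y = K T r x y"
        using that False by (intro K_cong[of n]) auto
      then show ?thesis using P that False by simp
    next
      case True
      let ?m = "Suc n" and ?T = "T(Suc n := \<tau>)"
      have L0: "L 0 = (\<lambda>x. x)" using P by (simp add: L_def ST)
      have lt: "?T i = L i" if "i < ?m" for i using that by (simp add: L_def ST)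
      have Lm: "?T ?m u = L ?m u + B u" for u by (simp add: L_def \<tau>_def)
      have "h' (?m - i - j) (?T i x) (?T j y) = h' (?m - i - j) (L i x) (L j y) +
        ((if i = ?m \<and> j = 0 then Hs (B x) y else 0) + (if i = 0 \<and> j = ?m then Hs x (B y) else 0))"
        if "i \<le> ?m" "j \<le> ?m - i" for i j
      proof -
        \<comment> \<open>Away from the two corners neither index is \<open>Suc n\<close>, and there
          the corrected map coincides with \<open>L\<close>.\<close>
        have "(i = ?m \<and> j = 0) \<or> (i = 0 \<and> j = ?m) \<or> (i < ?m \<and> j < ?m)" using that by arith
        then consider "i = ?m" "j = 0" | "i = 0" "j = ?m" | "i < ?m" "j < ?m" by blast
        then show ?thesis
        proof cases
          case 1
          have "h' 0 (L ?m x + B x) (L 0 y) = h' 0 (L ?m x) (L 0 y) + h' 0 (B x) (L 0 y)"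
            by (intro biadditive_add_left[OF h'(2)] section_lin_in[OF L] B_in \<open>x \<in> X\<close> \<open>y \<in> X\<close>)
          moreover have "h' 0 (B x) (L 0 y) = Hs (B x) y" by (simp add: L0 h'(3) B_in \<open>x \<in> X\<close> \<open>y \<in> X\<close>)
          ultimately show ?thesis using 1 lt[of 0] by (simp add: Lm del: fun_upd_apply)
        next
          case 2
          have "h' 0 (L 0 x) (L ?m y + B y) = h' 0 (L 0 x) (L ?m y) + h' 0 (L 0 x) (B y)"
            by (intro biadditive_add_right[OF h'(2)] section_lin_in[OF L] B_in \<open>x \<in> X\<close> \<open>y \<in> X\<close>)
          moreover have "h' 0 (L 0 x) (B y) = Hs x (B y)" by (simp add: L0 h'(3) B_in \<open>x \<in> X\<close> \<open>y \<in> X\<close>)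
          ultimately show ?thesis using 2 lt[of 0] by (simp add: Lm del: fun_upd_apply)
        next
          case 3
          then show ?thesis by (simp add: lt del: fun_upd_apply)
        qed
      qed
      then have "(\<Sum>i\<le>?m. \<Sum>j\<le>?m - i. h' (?m - i - j) (?T i x) (?T j y)) =
        (\<Sum>i\<le>?m. \<Sum>j\<le>?m - i. h' (?m - i - j) (L i x) (L j y) +
        ((if i = ?m \<and> j = 0 then Hs (B x) y else 0) + (if i = 0 \<and> j = ?m then Hs x (B y) else 0)))"
        by (intro sum.cong refl) (simp only: atMost_iff)
      also have "\<dots> = (\<Sum>i\<le>?m. \<Sum>j\<le>?m - i. h' (?m - i - j) (L i x) (L j y)) + (Hs (B x) y + Hs x (B y))"
        by (simp only: sum.distrib sum_triangle_delta[OF zero_less_Suc])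
      finally have "K ?T ?m x y = k x y + (Hs (B x) y + Hs x (B y))"
        by (simp only: K_def k_def) (simp add: algebra_simps)
      also have "\<dots> = 0"
        unfolding HB[OF \<open>x \<in> X\<close> \<open>y \<in> X\<close>] BH[OF \<open>x \<in> X\<close> \<open>y \<in> X\<close>]
        by (auto simp: fscale_def)
      finally show ?thesis using True by simp
    qed
    have "?P (Suc n) (T(Suc n := \<tau>))"
      using P d K0 \<tau> by (auto simp: le_Suc_eq)
    then show "\<exists>a. ?P (Suc n) (T(Suc n := a))" by (rule exI[where x = \<tau>])
  qed
  then obtain T where "\<forall>n. ?P n T" by (rule exE)
  then have P: "?P n T" for n by (rule spec)
  have T: "section_lin sc sc X X (T r)" for r using P[of r] by simp
  have Td: "morphism_defect R R' T n x f = 0" if "x \<in> X" "f \<in> A" for n x f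
    using P[of n] that by simp
  have TK: "K T n x y = 0" if "x \<in> X" "y \<in> X" for n x y
    using P[of n] that by simp
  have T0: "T 0 = (\<lambda>x. x)" using P[of 0] by simp
  have "deformation_iso A sc X R R' T"
    unfolding deformation_iso_def
  proof (intro conjI ballI allI)
    show "bij_betw (series_map T) (series_in X) (series_in X)"
      by (rule series_map_bij[OF section_lin_additive[OF T]]) (simp add: T0)
    show "series_map T (series_bimap R x F) = series_bimap R' (series_map T x) F"
      if "x \<in> series_in X" "F \<in> series_in A" for x F
      by (rule morphism_of_coefficients[OF T Td that])
  qed (use T T0 in \<open>simp_all add: section_lin_def\<close>)
  moreover have "series_bimap h' (series_map T x) (series_map T y) = series_bimap h x y"
    if "x \<in> series_in X" "y \<in> series_in X" for x y
  proof (rule fps_ext)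
    fix n
    have "fps_nth (G T x y) n = 0" by (rule G_zero[OF T TK that order_refl])
    then show "fps_nth (series_bimap h' (series_map T x) (series_map T y)) n = fps_nth (series_bimap h x y) n"
      by (simp add: G_def)
  qed
  ultimately show ?thesis
    unfolding equivalent_hermitian_deformations_def by blast
qed

end

section \<open>Smooth functions\<close>

lemma Ck_on_SucD: "Ck_on (Suc k) S f \<Longrightarrow> Ck_on k S f"
proof (induction k arbitrary: f)
  case 0
  then show ?case
    by (auto intro!: continuous_at_imp_continuous_on differentiable_imp_continuous_within)
next
  case (Suc k)
  have "Ck_on k S (\<lambda>x. frechet_derivative f (at x) v)" for v
    using Suc.prems by (intro Suc.IH) simp
  then show ?case using Suc.prems by simp
qed

lemma Ck_on_subset: "Ck_on k S f \<Longrightarrow> T \<subseteq> S \<Longrightarrow> Ck_on k T f"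
  by (induction k arbitrary: f) (auto intro: continuous_on_subset)

text \<open>A derivative at a point depends on a neighbourhood only; openness of \<open>S\<close>
  therefore passes equality on \<open>S\<close> to the derivatives.\<close>

lemma Ck_on_cong:
  assumes "open S" "\<And>x. x \<in> S \<Longrightarrow> f x = g x" "Ck_on k S f"
  shows "Ck_on k S g"
  using assms(2,3)
proof (induction k arbitrary: f g)
  case 0
  then show ?case by (simp cong: continuous_on_cong)
next
  case (Suc k)
  have diff: "f differentiable (at x)" if "x \<in> S" for x using Suc.prems that by simp
  have fd: "(f has_derivative frechet_derivative f (at x)) (at x)" if "x \<in> S" for x
    using diff[OF that] by (simp only: frechet_derivative_works)
  have gd: "(g has_derivative frechet_derivative f (at x)) (at x)" if "x \<in> S" for x
    by (rule has_derivative_transform_within_open[OF fd[OF that] assms(1) that Suc.prems(1)])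
  have eq: "frechet_derivative f (at x) = frechet_derivative g (at x)" if "x \<in> S" for x
    by (rule frechet_derivative_at[OF gd[OF that]])
  have "Ck_on k S (\<lambda>x. frechet_derivative g (at x) v)" for v
  proof (rule Suc.IH)
    show "frechet_derivative f (at x) v = frechet_derivative g (at x) v" if "x \<in> S" for x
      by (simp only: eq[OF that])
    show "Ck_on k S (\<lambda>x. frechet_derivative f (at x) v)" using Suc.prems(2) by simp
  qed
  then show ?case using gd unfolding Ck_on.simps differentiable_def by blast
qed

lemma Ck_on_locally:
  assumes "\<And>x. x \<in> S \<Longrightarrow> \<exists>T. open T \<and> x \<in> T \<and> Ck_on k T f"
  shows "Ck_on k S f"
  using assms
proof (induction k arbitrary: f)
  case 0
  show ?case
  proof (rule continuous_at_imp_continuous_on[THEN iffD2[OF Ck_on.simps(1)]], rule ballI)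
    fix x assume "x \<in> S"
    then obtain T where "open T" "x \<in> T" "continuous_on T f" using 0 by auto
    then show "isCont f x" using continuous_on_eq_continuous_at by blast
  qed
next
  case (Suc k)
  have "f differentiable (at x)" if "x \<in> S" for x using Suc.prems[OF that] by auto
  moreover have "Ck_on k S (\<lambda>x. frechet_derivative f (at x) v)" for v
    by (rule Suc.IH) (use Suc.prems in force)
  ultimately show ?case by simp
qed

lemma Ck_on_SucI:
  assumes "open S" "\<And>x. x \<in> S \<Longrightarrow> (f has_derivative f' x) (at x)" "\<And>v. Ck_on k S (\<lambda>x. f' x v)"
  shows "Ck_on (Suc k) S f"
proof -
  have "Ck_on k S (\<lambda>x. frechet_derivative f (at x) v)" for v
    by (rule Ck_on_cong[OF assms(1) _ assms(3)[of v]])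
      (use frechet_derivative_at[OF assms(2)] in simp)
  then show ?thesis using assms(2) by (auto simp: differentiable_def)
qed

lemma Ck_on_SucD':
  assumes "Ck_on (Suc k) S f"
  shows "x \<in> S \<Longrightarrow> (f has_derivative frechet_derivative f (at x)) (at x)"
    "Ck_on k S (\<lambda>x. frechet_derivative f (at x) v)"
  using assms by (auto simp: frechet_derivative_works)

lemma Ck_on_const: "Ck_on k S (\<lambda>x. c)"
proof (induction k arbitrary: c)
  case (Suc k)
  then show ?case by simp
qed simp

lemma Ck_on_linear:
  assumes "open S" "bounded_linear L" "Ck_on k S f"
  shows "Ck_on k S (\<lambda>x. L (f x))"
  using assms(3)
proof (induction k arbitrary: f)
  case 0
  then show ?case using assms(2) by (simp add: bounded_linear.continuous_on)
next
  case (Suc k)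
  show ?case
    by (rule Ck_on_SucI[OF assms(1) bounded_linear.has_derivative[OF assms(2) Ck_on_SucD'(1)[OF Suc.prems]]])
      (intro Suc.IH Ck_on_SucD'(2)[OF Suc.prems] | assumption)+
qed

lemma Ck_on_add:
  assumes "open S" "Ck_on k S f" "Ck_on k S g"
  shows "Ck_on k S (\<lambda>x. f x + g x)"
  using assms(2,3)
proof (induction k arbitrary: f g)
  case 0
  then show ?case by (simp add: continuous_on_add)
next
  case (Suc k)
  show ?case
    by (rule Ck_on_SucI[OF assms(1) has_derivative_add[OF Ck_on_SucD'(1)[OF Suc.prems(1)] Ck_on_SucD'(1)[OF Suc.prems(2)]]])
      (intro Suc.IH Ck_on_SucD'(2)[OF Suc.prems(1)] Ck_on_SucD'(2)[OF Suc.prems(2)] | assumption)+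
qed

lemma Ck_on_bilinear:
  assumes "open S" "bounded_bilinear B" "Ck_on k S f" "Ck_on k S g"
  shows "Ck_on k S (\<lambda>x. B (f x) (g x))"
  using assms(3,4)
proof (induction k arbitrary: f g)
  case 0
  then show ?case using assms(2) by (simp add: bounded_bilinear.continuous_on)
next
  case (Suc k)
  have "Ck_on k S (\<lambda>x. B (f x) (frechet_derivative g (at x) v) + B (frechet_derivative f (at x) v) (g x))" for v
    by (intro Ck_on_add assms(1) Suc.IH Ck_on_SucD'(2)[OF Suc.prems(1)] Ck_on_SucD'(2)[OF Suc.prems(2)]
      Ck_on_SucD[OF Suc.prems(1)] Ck_on_SucD[OF Suc.prems(2)])
  then show ?case
    by (intro Ck_on_SucI[OF assms(1) bounded_bilinear.FDERIV[OF assms(2) Ck_on_SucD'(1)[OF Suc.prems(1)] Ck_on_SucD'(1)[OF Suc.prems(2)]]])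
qed

lemma Ck_on_sum:
  assumes "open S" "\<And>i. i \<in> I \<Longrightarrow> Ck_on k S (f i)"
  shows "Ck_on k S (\<lambda>x. \<Sum>i\<in>I. f i x)"
  using assms(2)
  by (induction I rule: infinite_finite_induct) (simp_all add: Ck_on_const Ck_on_add[OF assms(1)])

lemma Ck_on_ident: "Ck_on k S (\<lambda>x. x)"
  by (cases k) (simp_all add: Ck_on_const)

text \<open>\<open>Ck_on\<close> speaks of derivatives in fixed directions, while the chain rule
  produces a direction that varies with the point. Expanding that direction in the basis
  \<open>B\<close> leaves fixed directions with varying scalar factors, to which the induction
  hypothesis applies.\<close>

lemma Ck_on_compose:
  fixes F :: "'a::real_inner \<Rightarrow> 'b::real_normed_vector" and B :: "'a set"
  assumes B: "finite B" "\<And>z. z = (\<Sum>b\<in>B. (z \<bullet> b) *\<^sub>R b)"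
    and "open S" "open S'" "\<tau> ` S \<subseteq> S'" "Ck_on k S' F" "Ck_on k S \<tau>"
  shows "Ck_on k S (\<lambda>x. F (\<tau> x))"
  using assms(6,7)
proof (induction k arbitrary: F)
  case 0
  then show ?case using assms(5) continuous_on_compose2[of S' F S \<tau>] by auto
next
  case (Suc k)
  have der: "((\<lambda>x. F (\<tau> x)) has_derivative (\<lambda>v. \<Sum>b\<in>B. (frechet_derivative \<tau> (at x) v \<bullet> b) *\<^sub>R frechet_derivative F (at (\<tau> x)) b)) (at x)"
    if x: "x \<in> S" for x
  proof -
    have F: "(F has_derivative frechet_derivative F (at (\<tau> x))) (at (\<tau> x))"
      using Ck_on_SucD'(1)[OF Suc.prems(1)] x assms(5) by blast
    interpret F: bounded_linear "frechet_derivative F (at (\<tau> x))"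
      using F by (rule has_derivative_bounded_linear)
    have eq: "frechet_derivative F (at (\<tau> x)) w = (\<Sum>b\<in>B. (w \<bullet> b) *\<^sub>R frechet_derivative F (at (\<tau> x)) b)" for w
      by (subst B(2)[of w]) (simp add: F.sum F.scaleR)
    show ?thesis
      by (rule has_derivative_eq_rhs[OF has_derivative_compose[OF Ck_on_SucD'(1)[OF Suc.prems(2) x] F]])
        (rule ext, rule eq)
  qed
  have "Ck_on k S (\<lambda>x. \<Sum>b\<in>B. (frechet_derivative \<tau> (at x) v \<bullet> b) *\<^sub>R frechet_derivative F (at (\<tau> x)) b)" for v
    by (intro Ck_on_sum assms(3) Ck_on_bilinear[OF assms(3) bounded_bilinear_scaleR]
        Ck_on_linear[OF assms(3) bounded_linear_inner_left] Ck_on_SucD'(2)[OF Suc.prems(2)] Suc.IH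
        Ck_on_SucD'(2)[OF Suc.prems(1)] Ck_on_SucD[OF Suc.prems(2)])
  then show ?case by (intro Ck_on_SucI[OF assms(3) der])
qed

text \<open>A family closed under differentiation is smooth, by an induction over all its members at
  once.\<close>

lemma Ck_on_real_family:
  fixes \<theta> :: "nat \<Rightarrow> real \<Rightarrow> real"
  assumes "open J" "\<And>n t. t \<in> J \<Longrightarrow> (\<theta> n has_real_derivative \<theta> (Suc n) t) (at t)"
  shows "Ck_on k J (\<theta> n)"
proof (induction k arbitrary: n)
  case 0
  have "isCont (\<theta> n) t" if "t \<in> J" for t using assms(2)[OF that] by (rule DERIV_isCont)
  then show ?case by (simp add: continuous_at_imp_continuous_on)
next
  case (Suc k)
  have der: "(\<theta> n has_derivative (\<lambda>v. \<theta> (Suc n) t * v)) (at t)" if "t \<in> J" for t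
    using assms(2)[OF that] by (simp add: has_field_derivative_def)
  show ?case
    by (rule Ck_on_SucI[OF assms(1) der]) (intro Ck_on_linear[OF assms(1) bounded_linear_mult_left] Suc | assumption)+
qed

lemma Cinf_on_subset: "Cinf_on S f \<Longrightarrow> T \<subseteq> S \<Longrightarrow> Cinf_on T f"
  by (auto simp: Cinf_on_def intro: Ck_on_subset)

lemma Cinf_on_cong: "open S \<Longrightarrow> (\<And>x. x \<in> S \<Longrightarrow> f x = g x) \<Longrightarrow> Cinf_on S f \<Longrightarrow> Cinf_on S g"
  by (auto simp: Cinf_on_def intro: Ck_on_cong)

lemma Cinf_on_locally: 
  assumes "\<And>x. x \<in> S \<Longrightarrow> \<exists>T. open T \<and> x \<in> T \<and> Cinf_on T f"
  shows "Cinf_on S f"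
  unfolding Cinf_on_def
proof
  show "Ck_on k S f" for k
    by (rule Ck_on_locally) (use assms in \<open>force simp: Cinf_on_def\<close>)
qed

lemma Cinf_on_const: "Cinf_on S (\<lambda>x. c)"
  and Cinf_on_ident: "Cinf_on S (\<lambda>x. x)"
  by (simp_all add: Cinf_on_def Ck_on_const Ck_on_ident)

lemma Cinf_on_linear: "open S \<Longrightarrow> bounded_linear L \<Longrightarrow> Cinf_on S f \<Longrightarrow> Cinf_on S (\<lambda>x. L (f x))"
  by (simp add: Cinf_on_def Ck_on_linear)

lemma Cinf_on_add: "open S \<Longrightarrow> Cinf_on S f \<Longrightarrow> Cinf_on S g \<Longrightarrow> Cinf_on S (\<lambda>x. f x + g x)"
  by (simp add: Cinf_on_def Ck_on_add)

lemma Cinf_on_bilinear: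
  "open S \<Longrightarrow> bounded_bilinear B \<Longrightarrow> Cinf_on S f \<Longrightarrow> Cinf_on S g \<Longrightarrow> Cinf_on S (\<lambda>x. B (f x) (g x))"
  by (simp add: Cinf_on_def Ck_on_bilinear)

lemma Cinf_on_compose:
  fixes F :: "'a::real_inner \<Rightarrow> 'b::real_normed_vector" and B :: "'a set"
  assumes "finite B" "\<And>z. z = (\<Sum>b\<in>B. (z \<bullet> b) *\<^sub>R b)"
    and "open S" "open S'" "\<tau> ` S \<subseteq> S'" "Cinf_on S' F" "Cinf_on S \<tau>"
  shows "Cinf_on S (\<lambda>x. F (\<tau> x))"
  unfolding Cinf_on_def
  by (rule allI, rule Ck_on_compose[where S' = S' and F = F, OF assms(1,2,3,4,5)])
    (rule assms(6,7)[unfolded Cinf_on_def, THEN spec])+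

lemma Cinf_on_compose_real:
  fixes F :: "real \<Rightarrow> real"
  assumes "open S" "open J" "\<tau> ` S \<subseteq> J" "Cinf_on J F" "Cinf_on S \<tau>"
  shows "Cinf_on S (\<lambda>x. F (\<tau> x))"
  by (rule Cinf_on_compose[where B = "{1}" and S' = J]) (simp_all add: assms)

lemma Cinf_on_derivative: "Cinf_on S f \<Longrightarrow> Cinf_on S (\<lambda>x. frechet_derivative f (at x) v)"
  unfolding Cinf_on_def using Ck_on_SucD'(2) by blast

lemma Cinf_on_has_derivative:
  "Cinf_on S f \<Longrightarrow> x \<in> S \<Longrightarrow> (f has_derivative frechet_derivative f (at x)) (at x)"
  unfolding Cinf_on_def using Ck_on_SucD'(1)[of 0] by blast

lemma Cinf_on_imp_continuous: "Cinf_on S f \<Longrightarrow> continuous_on S f"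
  unfolding Cinf_on_def using Ck_on.simps(1) by blast

lemma Cinf_on_powr: "Cinf_on {0<..} (\<lambda>x::real. x powr a)"
proof -
  define \<theta> where "\<theta> n x = (\<Prod>i<n. a - real i) * x powr (a - real n)" for n and x :: real
  have "(\<theta> n has_real_derivative \<theta> (Suc n) t) (at t)" if "t \<in> {0<..}" for n t
    unfolding \<theta>_def using that
    by (auto intro!: derivative_eq_intros simp: algebra_simps)
  then have "Ck_on k {0<..} (\<theta> 0)" for k
    by (intro Ck_on_real_family) simp_all
  then show ?thesis by (simp add: Cinf_on_def \<theta>_def[abs_def])
qed

text \<open>The classical flat function exp(-1/t), multiplied by polynomials in 1/t so that the
  class is closed under differentiation.\<close>

definition flat_poly :: "real poly \<Rightarrow> real \<Rightarrow> real" where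
  "flat_poly p t = (if t > 0 then poly p (1 / t) * exp (- (1 / t)) else 0)"

lemma poly_times_exp_tendsto_0: "((\<lambda>u. poly p u * exp (- u)) \<longlongrightarrow> 0) at_top" for p :: "real poly"
proof -
  have "((\<lambda>u. \<Sum>i\<le>degree p. coeff p i * (u ^ i / exp u)) \<longlongrightarrow> (\<Sum>i\<le>degree p. coeff p i * 0)) at_top"
    by (intro tendsto_intros tendsto_power_div_exp_0)
  then show ?thesis
    by (simp add: poly_altdef sum_divide_distrib exp_minus field_simps)
qed

lemma flat_poly_tendsto_0: "(flat_poly p \<longlongrightarrow> 0) (at 0)"
proof -
  have "((\<lambda>t. poly p (1 / t) * exp (- (1 / t))) \<longlongrightarrow> 0) (at_right 0)"
    using filterlim_compose[OF poly_times_exp_tendsto_0 filterlim_inverse_at_top_right]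
    by (simp add: inverse_eq_divide)
  then have "(flat_poly p \<longlongrightarrow> 0) (at_right 0)"
    by (rule Lim_transform_eventually)
      (auto simp: flat_poly_def eventually_at_filter)
  moreover have "(flat_poly p \<longlongrightarrow> 0) (at_left 0)"
    by (rule Lim_transform_eventually[OF tendsto_const])
      (auto simp: flat_poly_def eventually_at_filter)
  ultimately show ?thesis by (simp add: filterlim_split_at)
qed

text \<open>With u = 1/t the derivative of p(u) exp(-u) with respect to t is
  \<open>u\<^sup>2 (p - p')(u) exp(-u)\<close>, and \<open>[:0, 0, 1:]\<close> is the square of
  u.\<close>

lemma flat_poly_derivative:
  "(flat_poly p has_real_derivative flat_poly ([:0, 0, 1:] * (p - pderiv p)) t) (at t)"
proof (cases t "0 :: real" rule: linorder_cases)
  case less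
  have "((\<lambda>_. 0) has_real_derivative 0) (at t)" by simp
  then have "(flat_poly p has_real_derivative 0) (at t)"
    by (rule has_field_derivative_transform_within_open[where S = "{..<0}"]) (use less in \<open>auto simp: flat_poly_def\<close>)
  then show ?thesis using less by (simp add: flat_poly_def)
next
  case greater
  have "((\<lambda>t. poly p (1 / t) * exp (- (1 / t))) has_real_derivative
      poly ([:0, 0, 1:] * (p - pderiv p)) (1 / t) * exp (- (1 / t))) (at t)"
    using greater
    by (auto intro!: derivative_eq_intros DERIV_chain2[OF poly_DERIV] simp: field_simps power2_eq_square)
  then have "(flat_poly p has_real_derivative poly ([:0, 0, 1:] * (p - pderiv p)) (1 / t) * exp (- (1 / t))) (at t)"
    by (rule has_field_derivative_transform_within_open[where S = "{0<..}"]) (use greater in \<open>auto simp: flat_poly_def\<close>)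
  then show ?thesis using greater by (simp add: flat_poly_def)
next
  case equal
  \<comment> \<open>The difference quotient at 0 is again of this form, one degree higher, so the
    limit at 0 gives derivative 0.\<close>
  have "flat_poly p h / h = flat_poly (pCons 0 p) h" for h
    by (simp add: flat_poly_def)
  then have "(\<lambda>h. (flat_poly p (0 + h) - flat_poly p 0) / h) \<midarrow>0\<rightarrow> 0"
    using flat_poly_tendsto_0[of "pCons 0 p"] by (simp add: flat_poly_def[of p 0])
  then show ?thesis using equal by (simp add: DERIV_def flat_poly_def)
qed

lemma Cinf_on_flat_poly: "Cinf_on S (flat_poly p)"
proof -
  define ps where "ps = rec_nat p (\<lambda>_ p. [:0, 0, 1:] * (p - pderiv p))"
  have "Ck_on k UNIV (flat_poly (ps 0))" for k
    by (rule Ck_on_real_family) (use flat_poly_derivative in \<open>simp_all add: ps_def del: mult_pCons_left\<close>)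
  then have "Cinf_on UNIV (flat_poly p)" by (simp add: Cinf_on_def ps_def)
  then show ?thesis by (rule Cinf_on_subset) simp
qed

lemma flat_poly_1: "flat_poly 1 t \<ge> 0" "flat_poly 1 t > 0 \<longleftrightarrow> t > 0"
  by (auto simp: flat_poly_def)

text \<open>The model space is a finite-dimensional inner product space without a distinguished
  basis, so coordinates come from an explicit set, empty in dimension zero.\<close>

definition orthonormal_basis :: "'e::real_inner set \<Rightarrow> bool" where
  "orthonormal_basis B \<longleftrightarrow> finite B \<and> (\<forall>b\<in>B. \<forall>c\<in>B. b \<bullet> c = (if b = c then 1 else 0)) \<and> span B = UNIV"

lemma orthonormal_basis_exists:
  assumes "finite (B::'e::real_inner set)" "span B = UNIV"
  obtains C where "orthonormal_basis (C :: 'e set)"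
proof -
  obtain D where D: "finite D" "span D = span B" "pairwise orthogonal D"
    using basis_orthogonal[OF assms(1)] by blast
  let ?C = "(\<lambda>d. d /\<^sub>R norm d) ` (D - {0})"
  have "d \<in> span ?C" if "d \<in> D" for d
  proof (cases "d = 0")
    case False
    then have "norm d *\<^sub>R (d /\<^sub>R norm d) \<in> span ?C"
      using that by (intro span_scale span_base) blast
    then show ?thesis using False by simp
  qed (simp add: span_zero)
  then have "span D \<subseteq> span ?C" by (intro span_minimal) auto
  then have "span ?C = UNIV" using D assms by auto
  moreover have "b \<bullet> c = (if b = c then 1 else 0)" if bc: "b \<in> ?C" "c \<in> ?C" for b c
  proof -
    obtain d d' where d: "d \<in> D" "d \<noteq> 0" "b = d /\<^sub>R norm d" "d' \<in> D" "d' \<noteq> 0" "c = d' /\<^sub>R norm d'"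
      using bc by auto
    show ?thesis
    proof (cases "d = d'")
      case True
      then show ?thesis using d by (simp add: dot_square_norm power2_eq_square)
    next
      case False
      then have "d \<bullet> d' = 0" using D(3) d by (auto simp: pairwise_def orthogonal_def)
      then have "b \<bullet> c = 0" using d by simp
      moreover have "b \<noteq> c"
      proof
        assume "b = c"
        then have "b \<bullet> b = 0" using \<open>b \<bullet> c = 0\<close> by simp
        then show False using d by simp
      qed
      ultimately show ?thesis by simp
    qed
  qed
  ultimately show ?thesis using that[of ?C] D(1) by (simp add: orthonormal_basis_def)
qed

lemma orthonormal_expansion:
  assumes "orthonormal_basis B"
  shows "z = (\<Sum>b\<in>B. (z \<bullet> b) *\<^sub>R b)"
proof -
  have "z \<in> span B" using assms by (simp add: orthonormal_basis_def)
  then show ?thesis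
  proof (induction rule: span_induct_alt)
    case base
    then show ?case by simp
  next
    case (step c x y)
    have "(\<Sum>b\<in>B. (x \<bullet> b) *\<^sub>R b) = (\<Sum>b\<in>B. if x = b then b else 0)"
      using assms step(1) by (intro sum.cong) (auto simp: orthonormal_basis_def)
    also have "\<dots> = x" using assms step(1) by (simp add: orthonormal_basis_def)
    finally have "(\<Sum>b\<in>B. ((c *\<^sub>R x + y) \<bullet> b) *\<^sub>R b) = c *\<^sub>R x + (\<Sum>b\<in>B. (y \<bullet> b) *\<^sub>R b)"
      by (simp add: inner_add_left scaleR_add_left sum.distrib scaleR_scaleR[symmetric] scaleR_right.sum[symmetric] del: scaleR_scaleR)
    then show ?case using step by simp
  qed
qed

text \<open>Coordinates of points of the ball are bounded, so the ball is a closed subset of the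
  continuous image of a product of compact intervals.\<close>

lemma compact_cball_of_orthonormal_basis:
  assumes B: "orthonormal_basis (B :: 'e::real_inner set)"
  shows "compact (cball (z::'e) r)"
proof -
  define R where "R = norm z + r"
  \<comment> \<open>The product runs over all vectors as indices, and is compact by the Tychonoff
    theorem; only the coordinates at elements of \<open>B\<close> enter \<open>?f\<close>.\<close>
  let ?P = "PiE UNIV (\<lambda>_::'e. {-R..R})" and ?f = "\<lambda>g. \<Sum>b\<in>B. g b *\<^sub>R b"
  have "compactin (product_topology (\<lambda>_::'e. euclidean::real topology) UNIV) ?P"
    by (simp add: compactin_PiE)
  then have "compact ?P" by (simp add: euclidean_product_topology)
  moreover have "continuous_on ?P ?f"
    by (intro continuous_intros continuous_on_subset[OF continuous_on_product_coordinates subset_UNIV])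
  ultimately have "compact (?f ` ?P)" by (rule compact_continuous_image[rotated])
  moreover have "cball z r \<subseteq> ?f ` ?P"
  proof
    fix w assume "w \<in> cball z r"
    then have "norm w \<le> R"
      using norm_triangle_sub[of w z] by (simp add: R_def dist_norm norm_minus_commute)
    moreover have "\<bar>w \<bullet> b\<bar> \<le> norm w" if "b \<in> B" for b
      using Cauchy_Schwarz_ineq2[of w b] B that by (simp add: orthonormal_basis_def norm_eq_sqrt_inner)
    ultimately have wb: "\<bar>w \<bullet> b\<bar> \<le> R" if "b \<in> B" for b
      using that by (meson order_trans)
    define g where "g = (\<lambda>b. if b \<in> B then w \<bullet> b else 0)"
    have "0 \<le> R" using norm_ge_zero[of w] \<open>norm w \<le> R\<close> by linarith
    then have "g b \<in> {-R..R}" for b using wb[of b] by (cases "b \<in> B") (auto simp: g_def abs_le_iff minus_le_iff)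
    then have gP: "g \<in> ?P" by (simp add: PiE_iff)
    have "(\<Sum>b\<in>B. g b *\<^sub>R b) = (\<Sum>b\<in>B. (w \<bullet> b) *\<^sub>R b)"
      by (rule sum.cong) (simp_all add: g_def)
    also have "\<dots> = w" by (rule orthonormal_expansion[OF B, symmetric])
    finally show "w \<in> ?f ` ?P" by (intro image_eqI[OF _ gP]) (rule sym)
  qed
  ultimately show ?thesis
    using compact_Int_closed[of "?f ` ?P" "cball z r"] by (simp add: inf.absorb2)
qed

section \<open>Smooth functions, bump functions and exhaustions on a manifold\<close>

locale smooth_mfd =
  fixes atlas :: "('m::{t2_space,second_countable_topology}, 'e::real_inner) atlas"
  assumes mfd: "smooth_manifold atlas"
begin

lemma chart:
  assumes "(U, \<phi>) \<in> atlas"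
  shows "open U" "open (\<phi> ` U)" "homeomorphism U (\<phi> ` U) \<phi> (inv_into U \<phi>)"
  using mfd assms unfolding smooth_manifold_def by blast+

lemma transition:
  assumes "(U, \<phi>) \<in> atlas" "(V, \<eta>) \<in> atlas"
  shows "Cinf_on (\<phi> ` (U \<inter> V)) (\<lambda>z. \<eta> (inv_into U \<phi> z))"
  using mfd assms unfolding smooth_manifold_def by blast

lemma chart_at: obtains U \<phi> where "(U, \<phi>) \<in> atlas" "p \<in> U"
proof -
  have "p \<in> (\<Union>(U, \<phi>)\<in>atlas. U)" using mfd by (simp add: smooth_manifold_def)
  then show ?thesis using that by auto
qed

lemma chart_inv:
  assumes "(U, \<phi>) \<in> atlas"
  shows "p \<in> U \<Longrightarrow> inv_into U \<phi> (\<phi> p) = p" "z \<in> \<phi> ` U \<Longrightarrow> \<phi> (inv_into U \<phi> z) = z"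
    "z \<in> \<phi> ` U \<Longrightarrow> inv_into U \<phi> z \<in> U" "inj_on \<phi> U"
    "continuous_on U \<phi>" "continuous_on (\<phi> ` U) (inv_into U \<phi>)"
proof -
  note h = chart(3)[OF assms]
  show 1: "p \<in> U \<Longrightarrow> inv_into U \<phi> (\<phi> p) = p" for p using homeomorphism_apply1[OF h] .
  show "z \<in> \<phi> ` U \<Longrightarrow> \<phi> (inv_into U \<phi> z) = z" using homeomorphism_apply2[OF h] .
  show "z \<in> \<phi> ` U \<Longrightarrow> inv_into U \<phi> z \<in> U" by (rule inv_into_into)
  show "inj_on \<phi> U" using 1 by (rule inj_on_inverseI)
  show "continuous_on U \<phi>" "continuous_on (\<phi> ` U) (inv_into U \<phi>)"
    using h by (simp_all add: homeomorphism_def)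
qed

lemma chart_open_image:
  assumes "(U, \<phi>) \<in> atlas" "open W"
  shows "open (\<phi> ` (U \<inter> W))"
proof -
  have "openin (top_of_set (\<phi> ` U)) (\<phi> ` (U \<inter> W))"
    by (rule homeomorphism_imp_open_map[OF chart(3)[OF assms(1)]]) (use assms(2) in \<open>auto simp: openin_open\<close>)
  then show ?thesis using chart(2)[OF assms(1)] openin_open_trans by blast
qed

lemma orthonormal_basis_ex: "\<exists>B::'e set. orthonormal_basis B"
proof -
  obtain B :: "'e set" where "finite B" "span B = UNIV" using mfd by (auto simp: smooth_manifold_def)
  then show ?thesis using orthonormal_basis_exists by blast
qed

abbreviation smooth :: "'m set \<Rightarrow> ('m \<Rightarrow> 'w::real_normed_vector) \<Rightarrow> bool" where
  "smooth \<equiv> smooth_map_on atlas"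

lemma smoothI: "(\<And>U \<phi>. (U, \<phi>) \<in> atlas \<Longrightarrow> Cinf_on (\<phi> ` (U \<inter> W)) (\<lambda>z. f (inv_into U \<phi> z))) \<Longrightarrow> smooth W f"
  by (auto simp: smooth_map_on_def)

lemma smoothD: "smooth W f \<Longrightarrow> (U, \<phi>) \<in> atlas \<Longrightarrow> Cinf_on (\<phi> ` (U \<inter> W)) (\<lambda>z. f (inv_into U \<phi> z))"
  by (auto simp: smooth_map_on_def)

lemma smooth_cong:
  assumes "open W" "\<And>p. p \<in> W \<Longrightarrow> f p = g p" "smooth W f"
  shows "smooth W g"
proof (rule smoothI)
  fix U \<phi> assume c: "(U, \<phi>) \<in> atlas"
  show "Cinf_on (\<phi> ` (U \<inter> W)) (\<lambda>z. g (inv_into U \<phi> z))"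
    by (rule Cinf_on_cong[OF chart_open_image[OF c assms(1)] _ smoothD[OF assms(3) c]])
      (auto simp: chart_inv(1)[OF c] assms(2))
qed

lemma smooth_subset: "smooth W f \<Longrightarrow> W' \<subseteq> W \<Longrightarrow> smooth W' f"
  by (rule smoothI, rule Cinf_on_subset[OF smoothD]) auto

lemma smooth_locally:
  assumes "\<And>p. p \<in> W \<Longrightarrow> \<exists>W'. open W' \<and> p \<in> W' \<and> smooth W' f"
  shows "smooth W f"
proof (rule smoothI, rule Cinf_on_locally)
  fix U \<phi> z assume c: "(U, \<phi>) \<in> atlas" and "z \<in> \<phi> ` (U \<inter> W)"
  then obtain p where p: "p \<in> U" "p \<in> W" "z = \<phi> p" by auto
  then obtain W' where "open W'" "p \<in> W'" "smooth W' f" using assms by blast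
  then show "\<exists>T. open T \<and> z \<in> T \<and> Cinf_on T (\<lambda>z. f (inv_into U \<phi> z))"
    using p chart_open_image[OF c] smoothD[OF _ c] by (intro exI[of _ "\<phi> ` (U \<inter> W')"]) auto
qed

lemma smooth_const: "smooth W (\<lambda>p. c)"
  by (rule smoothI) (rule Cinf_on_const)

lemma smooth_linear: "open W \<Longrightarrow> bounded_linear L \<Longrightarrow> smooth W f \<Longrightarrow> smooth W (\<lambda>p. L (f p))"
  by (rule smoothI, rule Cinf_on_linear) (auto intro: chart_open_image smoothD)

lemma smooth_add: "open W \<Longrightarrow> smooth W f \<Longrightarrow> smooth W g \<Longrightarrow> smooth W (\<lambda>p. f p + g p)"
  by (rule smoothI, rule Cinf_on_add) (auto intro: chart_open_image smoothD)

lemma smooth_bilinear: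
  "open W \<Longrightarrow> bounded_bilinear B \<Longrightarrow> smooth W f \<Longrightarrow> smooth W g \<Longrightarrow> smooth W (\<lambda>p. B (f p) (g p))"
  by (rule smoothI, rule Cinf_on_bilinear) (auto intro: chart_open_image smoothD)

lemma smooth_sum:
  assumes "open W" "\<And>i. i \<in> I \<Longrightarrow> smooth W (f i)"
  shows "smooth W (\<lambda>p. \<Sum>i\<in>I. f i p)"
  using assms(2) by (induction I rule: infinite_finite_induct) (simp_all add: smooth_const smooth_add[OF assms(1)])

lemma smooth_real_compose:
  fixes F :: "real \<Rightarrow> real"
  assumes "open W" "open J" "\<And>p. p \<in> W \<Longrightarrow> g p \<in> J" "Cinf_on J F" "smooth W g"
  shows "smooth W (\<lambda>p. F (g p))"
proof (rule smoothI, rule Cinf_on_compose_real[OF _ assms(2) _ assms(4)])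
  fix U \<phi> assume c: "(U, \<phi>) \<in> atlas"
  show "open (\<phi> ` (U \<inter> W))" by (rule chart_open_image[OF c assms(1)])
  show "(\<lambda>z. g (inv_into U \<phi> z)) ` \<phi> ` (U \<inter> W) \<subseteq> J"
    using assms(3) by (auto simp: chart_inv(1)[OF c])
  show "Cinf_on (\<phi> ` (U \<inter> W)) (\<lambda>z. g (inv_into U \<phi> z))" by (rule smoothD[OF assms(5) c])
qed

text \<open>On the domain of one chart this chart suffices, since any other one differs from it by a
  smooth transition map and the chain rule applies.\<close>

lemma smooth_chart:
  assumes c: "(U, \<phi>) \<in> atlas" and "open W" "W \<subseteq> U" "Cinf_on (\<phi> ` W) (\<lambda>z. f (inv_into U \<phi> z))"
  shows "smooth W f"
proof (rule smoothI)
  fix V \<eta> assume d: "(V, \<eta>) \<in> atlas"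
  obtain B :: "'e set" where B: "orthonormal_basis B" using orthonormal_basis_ex by blast
  have oW: "open (\<phi> ` W)" using chart_open_image[OF c assms(2)] assms(3) by (simp add: inf.absorb2)
  have sub: "\<eta> ` (V \<inter> W) \<subseteq> \<eta> ` (V \<inter> U)" using assms(3) by blast
  have im: "(\<lambda>z. \<phi> (inv_into V \<eta> z)) ` \<eta> ` (V \<inter> W) \<subseteq> \<phi> ` W"
    by (auto simp: chart_inv(1)[OF d])
  have fin: "finite B" using B by (simp add: orthonormal_basis_def)
  have "Cinf_on (\<eta> ` (V \<inter> W)) (\<lambda>z. f (inv_into U \<phi> (\<phi> (inv_into V \<eta> z))))"
    by (rule Cinf_on_compose[where F = "\<lambda>z. f (inv_into U \<phi> z)",
        OF fin orthonormal_expansion[OF B] chart_open_image[OF d assms(2)] oW im assms(4)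
        Cinf_on_subset[OF transition[OF d c] sub]])
  then show "Cinf_on (\<eta> ` (V \<inter> W)) (\<lambda>z. f (inv_into V \<eta> z))"
    by (rule Cinf_on_cong[OF chart_open_image[OF d assms(2)], rotated])
      (use assms(3) in \<open>auto simp: chart_inv(1)[OF d] chart_inv(1)[OF c]\<close>)
qed

lemma smooth_continuous:
  assumes "open W" "smooth W f"
  shows "continuous_on W f"
proof (rule continuous_at_imp_continuous_on, rule ballI)
  fix p assume p: "p \<in> W"
  obtain U \<phi> where c: "(U, \<phi>) \<in> atlas" "p \<in> U" by (rule chart_at)
  have "continuous_on (U \<inter> W) (\<lambda>q. f (inv_into U \<phi> (\<phi> q)))"
    by (rule continuous_on_compose2[OF Cinf_on_imp_continuous[OF smoothD[OF assms(2) c(1)]]])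
      (auto intro: continuous_on_subset[OF chart_inv(5)[OF c(1)]])
  then have "continuous_on (U \<inter> W) f"
    by (rule continuous_on_eq) (simp add: chart_inv(1)[OF c(1)])
  then show "isCont f p"
    using p c chart(1)[OF c(1)] assms(1) by (simp add: continuous_on_eq_continuous_at open_Int)
qed

text \<open>A flat function of \<open>r\<^sup>2\<close> minus the squared distance in a chart,
  extended by zero. The preimage \<open>K\<close> of the ball is compact, hence closed in a
  Hausdorff space, so the chart domain and the complement of \<open>K\<close> form an open cover on
  which smoothness is checked.\<close>

lemma bump_at:
  assumes "open N" "p \<in> N"
  obtains \<beta> :: "'m \<Rightarrow> real" and K where "compact K" "K \<subseteq> N" "smooth UNIV \<beta>" "\<And>q. \<beta> q \<ge> 0" "\<beta> p > 0"
    "\<And>q. q \<notin> K \<Longrightarrow> \<beta> q = 0"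
proof -
  obtain U \<phi> where c: "(U, \<phi>) \<in> atlas" "p \<in> U" by (rule chart_at)
  obtain B :: "'e set" where B: "orthonormal_basis B" using orthonormal_basis_ex by blast
  have "\<phi> p \<in> \<phi> ` (U \<inter> N)" using c assms by blast
  then obtain r where r: "r > 0" "cball (\<phi> p) r \<subseteq> \<phi> ` (U \<inter> N)"
    using chart_open_image[OF c(1) assms(1)] open_contains_cball by blast
  define K where "K = inv_into U \<phi> ` cball (\<phi> p) r"
  define \<beta> where "\<beta> q = (if q \<in> U then flat_poly 1 (r\<^sup>2 - (\<phi> q - \<phi> p) \<bullet> (\<phi> q - \<phi> p)) else 0)" for q
  have K: "compact K"
    unfolding K_def
    by (rule compact_continuous_image[OF continuous_on_subset[OF chart_inv(6)[OF c(1)]] compact_cball_of_orthonormal_basis[OF B]])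
      (use r in auto)
  have KN: "K \<subseteq> N" "K \<subseteq> U"
    using r(2) by (auto simp: K_def chart_inv(1)[OF c(1)] dest!: subsetD)
  have zero: "\<beta> q = 0" if "q \<notin> K" for q
  proof (rule ccontr)
    assume "\<beta> q \<noteq> 0"
    then have q: "q \<in> U" "flat_poly 1 (r\<^sup>2 - (\<phi> q - \<phi> p) \<bullet> (\<phi> q - \<phi> p)) > 0"
      using flat_poly_1(1) by (auto simp: \<beta>_def less_le split: if_splits)
    then have "(norm (\<phi> q - \<phi> p))\<^sup>2 < r\<^sup>2" by (simp add: flat_poly_1 power2_norm_eq_inner)
    then have "norm (\<phi> q - \<phi> p) < r" using r(1) by (simp add: power_less_imp_less_base)
    then have "\<phi> q \<in> cball (\<phi> p) r" by (simp add: dist_norm norm_minus_commute)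
    then show False using that q(1) unfolding K_def by (metis chart_inv(1)[OF c(1)] imageI)
  qed
  have "smooth U \<beta>"
  proof (rule smooth_chart[OF c(1) chart(1)[OF c(1)] order_refl])
    have 1: "Cinf_on (\<phi> ` U) (\<lambda>z. r\<^sup>2 + - ((z - \<phi> p) \<bullet> (z - \<phi> p)))"
      by (intro Cinf_on_add Cinf_on_const Cinf_on_linear[OF _ bounded_linear_minus[OF bounded_linear_ident]]
          Cinf_on_bilinear[OF _ bounded_bilinear_inner] chart(2)[OF c(1)])
       (simp_all add: diff_conv_add_uminus Cinf_on_add Cinf_on_const Cinf_on_ident chart(2)[OF c(1)] del: add_uminus_conv_diff)
    have "Cinf_on (\<phi> ` U) (\<lambda>z. flat_poly 1 (r\<^sup>2 + - ((z - \<phi> p) \<bullet> (z - \<phi> p))))"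
      by (rule Cinf_on_compose_real[OF chart(2)[OF c(1)] open_UNIV _ Cinf_on_flat_poly 1]) simp
    then show "Cinf_on (\<phi> ` U) (\<lambda>z. \<beta> (inv_into U \<phi> z))"
      by (rule Cinf_on_cong[OF chart(2)[OF c(1)], rotated]) (auto simp: \<beta>_def chart_inv(1)[OF c(1)])
  qed
  moreover have "smooth (- K) \<beta>"
    by (rule smooth_cong[OF _ _ smooth_const[of _ 0]]) (use zero compact_imp_closed[OF K] in auto)
  ultimately have "smooth UNIV \<beta>"
    using KN chart(1)[OF c(1)] compact_imp_closed[OF K]
    by (intro smooth_locally) (metis Compl_iff open_Compl subsetD)
  moreover have "\<beta> q \<ge> 0" for q by (simp add: \<beta>_def flat_poly_1)
  moreover have "\<beta> p > 0" using r(1) c(2) by (simp add: \<beta>_def flat_poly_1)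
  ultimately show ?thesis using that[OF K KN(1)] zero by blast
qed

lemma bump_compact:
  assumes "open N" "compact Q" "Q \<subseteq> N"
  obtains \<beta> :: "'m \<Rightarrow> real" and K where "compact K" "K \<subseteq> N" "smooth UNIV \<beta>" "\<And>q. \<beta> q \<ge> 0"
    "\<And>q. q \<in> Q \<Longrightarrow> \<beta> q > 0" "\<And>q. q \<notin> K \<Longrightarrow> \<beta> q = 0"
proof -
  have "\<forall>p\<in>Q. \<exists>\<beta> K. compact K \<and> K \<subseteq> N \<and> smooth UNIV (\<beta> :: 'm \<Rightarrow> real) \<and> (\<forall>q. \<beta> q \<ge> 0) \<and> \<beta> p > 0 \<and> (\<forall>q. q \<notin> K \<longrightarrow> \<beta> q = 0)"
    using bump_at[OF assms(1)] assms(3) by (metis subsetD)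
  then obtain \<beta> :: "'m \<Rightarrow> 'm \<Rightarrow> real" and K where
    *: "\<forall>p\<in>Q. compact (K p) \<and> K p \<subseteq> N \<and> smooth UNIV (\<beta> p) \<and> (\<forall>q. \<beta> p q \<ge> 0) \<and> \<beta> p p > 0 \<and> (\<forall>q. q \<notin> K p \<longrightarrow> \<beta> p q = 0)"
    by metis
  have op: "open {q. \<beta> p q > 0}" if "p \<in> Q" for p
    using smooth_continuous[OF open_UNIV] * that by (intro open_Collect_less continuous_on_const) blast
  have "Q \<subseteq> (\<Union>p\<in>Q. {q. \<beta> p q > 0})" using * by blast
  from compactE_image[OF assms(2) op this] obtain D where D: "D \<subseteq> Q" "finite D" "Q \<subseteq> (\<Union>p\<in>D. {q. \<beta> p q > 0})" .
  show ?thesis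
  proof (rule that[of "\<Union>p\<in>D. K p" "\<lambda>q. \<Sum>p\<in>D. \<beta> p q"])
    show "compact (\<Union>p\<in>D. K p)" using D * by (intro compact_UN) blast+
    show "(\<Union>p\<in>D. K p) \<subseteq> N" using D * by blast
    show "smooth UNIV (\<lambda>q. \<Sum>p\<in>D. \<beta> p q)" using D * by (intro smooth_sum) blast+
    show "(\<Sum>p\<in>D. \<beta> p q) \<ge> 0" for q using D * by (intro sum_nonneg) blast
    show "(\<Sum>p\<in>D. \<beta> p q) = 0" if "q \<notin> (\<Union>p\<in>D. K p)" for q using that D * by (intro sum.neutral) blast
    show "(\<Sum>p\<in>D. \<beta> p q) > 0" if qQ: "q \<in> Q" for q
    proof -
      obtain p where "p \<in> D" "\<beta> p q > 0" using D(3) qQ by blast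
      then show ?thesis using D * by (intro sum_pos2[of D p]) blast+
    qed
  qed
qed

text \<open>The set on which a bump function is positive is open and lies in the compact set off
  which the function vanishes.\<close>

lemma compact_neighbourhood:
  assumes "compact (Q :: 'm set)"
  obtains L :: "'m set" where "compact L" "Q \<subseteq> interior L"
proof -
  obtain \<beta> :: "'m \<Rightarrow> real" and K where K: "compact K" "smooth UNIV \<beta>" "\<And>q. q \<in> Q \<Longrightarrow> \<beta> q > 0" "\<And>q. q \<notin> K \<Longrightarrow> \<beta> q = 0"
    by (rule bump_compact[OF open_UNIV assms subset_UNIV]) blast
  have "open {q. \<beta> q > 0}"
    using smooth_continuous[OF open_UNIV K(2)] by (intro open_Collect_less continuous_on_const)
  moreover have "{q. \<beta> q > 0} \<subseteq> K" using K(4) by force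
  ultimately have "{q. \<beta> q > 0} \<subseteq> interior K" by (rule interior_maximal[rotated])
  then show ?thesis using that[OF K(1)] K(3) by blast
qed

text \<open>Second countability enters through the Lindelof property: countably many relatively
  compact open sets cover, and they are absorbed one after the other. The empty \<open>L 0\<close>
  lets the annuli between consecutive sets start at index 0.\<close>

lemma exhaustion:
  obtains L :: "nat \<Rightarrow> 'm set" where "\<And>n. compact (L n)" "\<And>n. L n \<subseteq> interior (L (Suc n))" "(\<Union>n. L n) = UNIV" "L 0 = {}"
proof -
  let ?G = "{W. open W \<and> (\<exists>K. compact K \<and> W \<subseteq> K)} :: 'm set set"
  obtain G where G: "G \<subseteq> ?G" "countable G" "\<Union>G = \<Union>?G"
    using Lindelof[of ?G] by blast
  have "p \<in> \<Union>?G" for p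
  proof -
    obtain L where "compact L" "{p} \<subseteq> interior L" using compact_neighbourhood[of "{p}"] by auto
    then have "interior L \<in> ?G" "p \<in> interior L"
      using interior_subset[of L] by (auto intro: exI[of _ L])
    then show ?thesis by (rule UnionI)
  qed
  then have UG: "\<Union>G = UNIV" using G(3) by blast
  have "\<forall>W\<in>?G. \<exists>K. compact K \<and> W \<subseteq> K" by simp
  from bchoice[OF this] obtain \<kappa> where \<kappa>: "\<forall>W\<in>?G. compact (\<kappa> W) \<and> W \<subseteq> \<kappa> W" by (elim exE)
  define w where "w n = (if G = {} then {} else from_nat_into G n)" for n
  have w: "compact (\<kappa> (w n)) \<and> w n \<subseteq> \<kappa> (w n)" for n
  proof -
    have "w n \<in> ?G"
    proof (cases "G = {}")
      case True
      then show ?thesis by (simp add: w_def) (rule exI[of _ "{}"], simp)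
    next
      case False
      then show ?thesis using G(1) from_nat_into[OF False, of n] by (auto simp: w_def)
    qed
    then show ?thesis by (rule bspec[OF \<kappa>])
  qed
  have "\<exists>L. \<forall>n. (compact (L n) \<and> (n = 0 \<longrightarrow> L n = {})) \<and> L n \<union> \<kappa> (w n) \<subseteq> interior (L (Suc n))"
  proof (rule dependent_nat_choice)
    show "\<exists>x. compact x \<and> (0 = (0::nat) \<longrightarrow> x = ({} :: 'm set))" by auto
    fix L :: "'m set" and n :: nat assume "compact L \<and> (n = 0 \<longrightarrow> L = {})"
    then have "compact (L \<union> \<kappa> (w n))" using w by auto
    from compact_neighbourhood[OF this] obtain y where "compact y" "L \<union> \<kappa> (w n) \<subseteq> interior y" .
    then show "\<exists>y. (compact y \<and> (Suc n = 0 \<longrightarrow> y = {})) \<and> L \<union> \<kappa> (w n) \<subseteq> interior y"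
      by (intro exI[of _ y]) simp
  qed
  then obtain L where L': "\<forall>n. (compact (L n) \<and> (n = 0 \<longrightarrow> L n = {})) \<and> L n \<union> \<kappa> (w n) \<subseteq> interior (L (Suc n))"
    by (elim exE)
  then have L: "\<And>n. compact (L n)" "L 0 = {}" "\<And>n. L n \<union> \<kappa> (w n) \<subseteq> interior (L (Suc n))" by simp_all
  have "p \<in> (\<Union>n. L n)" for p
  proof -
    have "p \<in> \<Union>G" unfolding UG by (rule UNIV_I)
    then obtain W where W: "p \<in> W" "W \<in> G" by (elim UnionE)
    obtain n where "from_nat_into G n = W" using from_nat_into_surj[OF G(2) W(2)] by (elim exE)
    then have wn: "w n = W" using W(2) unfolding w_def by (metis emptyE)
    then have "p \<in> interior (L (Suc n))" using W(1) w[of n] L(3)[of n] by (metis UnI2 subsetD)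
    then show ?thesis using interior_subset[of "L (Suc n)"] by auto
  qed
  then have "(\<Union>n. L n) = UNIV" by auto
  with L show ?thesis by (intro that[of L]) simp_all
qed

end

section \<open>Covers with a bounded number of colours\<close>

lemma cube_colouring:
  fixes B Z :: "'e::real_inner set"
  assumes B: "orthonormal_basis B" and Z: "compact Z" and "\<epsilon> > 0"
  shows "\<exists>(M :: ('e \<Rightarrow> int) set) P col. finite M \<and> Z \<subseteq> (\<Union>m\<in>M. P m) \<and> (\<forall>m. closed (P m)) \<and>
    (\<forall>m. \<forall>x\<in>P m. \<forall>y\<in>P m. dist x y < \<epsilon>) \<and> (\<forall>m. col m \<subseteq> B) \<and>
    (\<forall>m\<in>M. \<forall>m'\<in>M. m \<noteq> m' \<longrightarrow> col m = col m' \<longrightarrow> P m \<inter> P m' = {})"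
proof -
  \<comment> \<open>Two points of a cube of side \<open>\<delta>\<close> have distance at most
    \<open>card B * \<delta>\<close>; the added one makes this strictly less than
    \<open>\<epsilon>\<close>, also in dimension zero.\<close>
  define \<delta> where "\<delta> = \<epsilon> / (card B + 1)"
  have \<delta>: "\<delta> > 0" "card B * \<delta> < \<epsilon>" using assms(3) by (simp_all add: \<delta>_def field_simps)
  obtain R where R: "\<And>z. z \<in> Z \<Longrightarrow> norm z \<le> R" using compact_imp_bounded[OF Z] bounded_iff by blast
  define N where "N = \<lceil>\<bar>R\<bar> / \<delta>\<rceil> + 1"
  define M where "M = PiE B (\<lambda>_. {-N..N})"
  define P :: "('e \<Rightarrow> int) \<Rightarrow> 'e set" where
    "P m = (\<Inter>b\<in>B. {z. z \<bullet> b \<in> {\<delta> * m b .. \<delta> * (m b + 1)}})" for m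
  \<comment> \<open>The colour records the parities of the indices. Distinct cubes of one colour
    differ by at least 2 in some index, so even the closed cubes are disjoint.\<close>
  define col where "col m = {b\<in>B. odd (m b)}" for m :: "'e \<Rightarrow> int"
  have fin: "finite B" and norm1: "\<And>b. b \<in> B \<Longrightarrow> norm b = 1"
    using B by (auto simp: orthonormal_basis_def norm_eq_sqrt_inner)
  show ?thesis
  proof (rule exI[of _ M], rule exI[of _ P], rule exI[of _ col], intro conjI allI ballI impI)
    show "finite M" unfolding M_def by (intro finite_PiE fin) simp
    show "closed (P m)" for m
      unfolding P_def
      by (intro closed_INT ballI) (auto intro!: closed_Collect_conj closed_Collect_le continuous_intros)
    show "col m \<subseteq> B" for m by (auto simp: col_def)
    show "dist x y < \<epsilon>" if "x \<in> P m" "y \<in> P m" for m x y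
    proof -
      have "\<bar>(x - y) \<bullet> b\<bar> \<le> \<delta>" if "b \<in> B" for b
      proof -
        have "x \<bullet> b \<in> {\<delta> * m b .. \<delta> * (m b + 1)}" "y \<bullet> b \<in> {\<delta> * m b .. \<delta> * (m b + 1)}"
          using \<open>x \<in> P m\<close> \<open>y \<in> P m\<close> that by (auto simp: P_def)
        then show ?thesis by (simp add: inner_diff_left algebra_simps abs_le_iff)
      qed
      then have "(\<Sum>b\<in>B. norm (((x - y) \<bullet> b) *\<^sub>R b)) \<le> card B * \<delta>"
        using norm1 by (intro sum_bounded_above) simp
      moreover have "norm (x - y) \<le> (\<Sum>b\<in>B. norm (((x - y) \<bullet> b) *\<^sub>R b))"
        by (rule ord_eq_le_trans[OF arg_cong[OF orthonormal_expansion[OF B, of "x - y"], of norm] norm_sum])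
      ultimately show ?thesis using \<delta>(2) by (simp add: dist_norm)
    qed
    show "P m \<inter> P m' = {}" if mm: "m \<in> M" "m' \<in> M" "m \<noteq> m'" "col m = col m'" for m m'
    proof -
      obtain b where b: "b \<in> B" "m b \<noteq> m' b" using mm(1-3) unfolding M_def by (metis PiE_ext)
      then have par: "even (m b) \<longleftrightarrow> even (m' b)" using mm(4) by (auto simp: col_def)
      have False if z: "z \<in> P m" "z \<in> P m'" for z
      proof -
        have 1: "\<delta> * m b \<le> \<delta> * (m' b + 1)" "\<delta> * m' b \<le> \<delta> * (m b + 1)"
          using z b(1) unfolding P_def by force+
        then have "real_of_int (m b) \<le> m' b + 1" "real_of_int (m' b) \<le> m b + 1"
          using \<delta>(1) by simp_all
        then have "m b \<le> m' b + 1" "m' b \<le> m b + 1" by linarith+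
        then have "m b = m' b + 1 \<or> m' b = m b + 1" using b(2) by linarith
        then show False using par by auto
      qed
      then show ?thesis by blast
    qed
    show "Z \<subseteq> (\<Union>m\<in>M. P m)"
    proof
      fix z assume z: "z \<in> Z"
      define m where "m = restrict (\<lambda>b. \<lfloor>(z \<bullet> b) / \<delta>\<rfloor>) B"
      have "m b \<in> {-N..N}" if "b \<in> B" for b
      proof -
        have "\<bar>z \<bullet> b\<bar> \<le> \<bar>R\<bar>"
          using Cauchy_Schwarz_ineq2[of z b] norm1[OF that] R[OF z] by simp
        then have "\<bar>(z \<bullet> b) / \<delta>\<bar> \<le> \<bar>R\<bar> / \<delta>" using \<delta>(1) by (simp add: abs_divide divide_right_mono)
        then have "(z \<bullet> b) / \<delta> \<le> \<bar>R\<bar> / \<delta>" "- (\<bar>R\<bar> / \<delta>) \<le> (z \<bullet> b) / \<delta>" by linarith+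
        then show ?thesis using that unfolding N_def m_def by simp linarith
      qed
      then have "m \<in> M" by (auto simp: M_def m_def)
      moreover have "z \<in> P m"
      proof -
        have "\<delta> * m b \<le> z \<bullet> b \<and> z \<bullet> b \<le> \<delta> * (m b + 1)" if "b \<in> B" for b
        proof -
          have 1: "real_of_int \<lfloor>(z \<bullet> b) / \<delta>\<rfloor> \<le> (z \<bullet> b) / \<delta>" by linarith
          have 2: "(z \<bullet> b) / \<delta> \<le> real_of_int (\<lfloor>(z \<bullet> b) / \<delta>\<rfloor> + 1)" by linarith
          have "\<delta> * ((z \<bullet> b) / \<delta>) = z \<bullet> b" "m b = \<lfloor>(z \<bullet> b) / \<delta>\<rfloor>" using \<delta>(1) that by (simp_all add: m_def)
          then show ?thesis
            using mult_left_mono[OF 1, of \<delta>] mult_left_mono[OF 2, of \<delta>] \<delta>(1) by (simp only: less_imp_le simp_thms)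
        qed
        then show ?thesis by (auto simp: P_def)
      qed
      ultimately show "z \<in> (\<Union>m\<in>M. P m)" by blast
    qed
  qed
qed

context smooth_mfd
begin

text \<open>The colours are the subsets of \<open>B\<close>, so their number depends on the
  dimension and not on the compact set \<open>Y\<close>. This uniform bound is what makes a finite
  frame possible on a noncompact manifold.\<close>

definition coloured_cover :: "'e set \<Rightarrow> 'm set set \<Rightarrow> 'm set \<Rightarrow> ('e set \<Rightarrow> 'm set set) \<Rightarrow> bool" where
  "coloured_cover B \<N> Y F \<longleftrightarrow>
     (\<forall>c. finite (F c) \<and> (\<forall>Q\<in>F c. compact Q \<and> (\<exists>N\<in>\<N>. Q \<subseteq> N)) \<and> pairwise disjnt (F c)) \<and>
     Y \<subseteq> (\<Union>c\<in>Pow B. \<Union>(F c))"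

text \<open>The number of colours does not grow: a new small cube that meets a member of its colour is
  absorbed by that member, and being small it meets at most one.\<close>

lemma coloured_cover_extend:
  assumes B: "orthonormal_basis B" and \<N>: "\<And>N. N \<in> \<N> \<Longrightarrow> open N"
    and F: "coloured_cover B \<N> Y F"
    and Y': "compact Y'" "Y' \<subseteq> \<Union>\<N>" and c: "(U, \<phi>) \<in> atlas" "Y' \<subseteq> U"
  shows "\<exists>F'. coloured_cover B \<N> (Y \<union> Y') F'"
proof -
  have finF: "finite (F k)" and cptF: "\<And>Q. Q \<in> F k \<Longrightarrow> compact Q" and disF: "pairwise disjnt (F k)"
    and smallF: "\<And>Q. Q \<in> F k \<Longrightarrow> \<exists>N\<in>\<N>. Q \<subseteq> N" for k
    using F by (auto simp: coloured_cover_def)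
  have finB: "finite B" using B by (simp add: orthonormal_basis_def)
  define \<F> where "\<F> = (\<Union>k\<in>Pow B. F k)"
  have fin\<F>: "finite \<F>" unfolding \<F>_def using finB finF by simp
  have "\<forall>Q\<in>(\<Union>k. F k). \<exists>N\<in>\<N>. Q \<subseteq> N" using smallF by blast
  then obtain \<nu> where \<nu>: "\<And>Q k. Q \<in> F k \<Longrightarrow> \<nu> Q \<in> \<N> \<and> Q \<subseteq> \<nu> Q" by (metis UN_I UNIV_I)
  have "\<forall>p\<in>Y'. \<exists>N\<in>\<N>. p \<in> N" using Y' by blast
  then obtain o' where o': "\<And>p. p \<in> Y' \<Longrightarrow> o' p \<in> \<N> \<and> p \<in> o' p" by metis
  \<comment> \<open>A neighbourhood of \<open>p\<close> that misses all old members not containing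
    \<open>p\<close> and lies in \<open>\<nu> Q\<close> for those containing it. A new cube inside
    \<open>S p\<close> thus meets only old members through \<open>p\<close>, at most one of each
    colour.\<close>
  define S where "S p = U \<inter> o' p \<inter> (\<Inter>Q\<in>\<F>. if p \<in> Q then \<nu> Q else - Q)" for p
  have S_open: "open (S p)" if "p \<in> Y'" for p
  proof -
    have "open (if p \<in> Q then \<nu> Q else - Q)" if QF: "Q \<in> \<F>" for Q
    proof -
      obtain k where k: "Q \<in> F k" using QF by (auto simp: \<F>_def)
      have "open (\<nu> Q)" "open (- Q)"
        using \<N> \<nu>[OF k] compact_imp_closed[OF cptF[OF k]] by (simp_all add: open_Compl)
      then show ?thesis by simp
    qed
    then show ?thesis unfolding S_def
      using o'[OF that] \<N> chart(1)[OF c(1)] fin\<F> by (intro open_Int open_INT) auto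
  qed
  have S_in: "p \<in> S p" if "p \<in> Y'" for p
    using that o'[OF that] c(2) \<nu> by (auto simp: S_def \<F>_def)
  define Z where "Z = \<phi> ` Y'"
  have Z: "compact Z"
    unfolding Z_def by (rule compact_continuous_image[OF continuous_on_subset[OF chart_inv(5)[OF c(1)] c(2)] Y'(1)])
  have cov: "Z \<subseteq> \<Union>((\<lambda>p. \<phi> ` S p) ` Y')" using S_in by (auto simp: Z_def)
  have im_open: "open (\<phi> ` S p)" if "p \<in> Y'" for p
  proof -
    have "U \<inter> S p = S p" by (auto simp: S_def)
    then show ?thesis using chart_open_image[OF c(1) S_open[OF that]] by simp
  qed
  have "open G" if "G \<in> (\<lambda>p. \<phi> ` S p) ` Y'" for G using that im_open by (elim imageE) simp
  \<comment> \<open>A Lebesgue number: a cube of diameter less than \<open>\<epsilon>\<close> that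
    contains a point of \<open>Z\<close> lies in the image of a single \<open>S p\<close>.\<close>
  from Heine_Borel_lemma[OF Z cov this]
  have "\<exists>\<epsilon>>0. \<forall>z\<in>Z. \<exists>G\<in>(\<lambda>p. \<phi> ` S p) ` Y'. ball z \<epsilon> \<subseteq> G" by metis
  then obtain \<epsilon> where \<epsilon>: "\<epsilon> > 0" "\<And>z. z \<in> Z \<Longrightarrow> \<exists>G\<in>(\<lambda>p. \<phi> ` S p) ` Y'. ball z \<epsilon> \<subseteq> G"
    by metis
  obtain M P col where MP': "finite (M :: ('e \<Rightarrow> int) set)" "Z \<subseteq> (\<Union>m\<in>M. P m)" "\<forall>m. closed (P m)"
    "\<forall>m. \<forall>x\<in>P m. \<forall>y\<in>P m. dist x y < \<epsilon>" "\<forall>m. col m \<subseteq> B"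
    "\<forall>m\<in>M. \<forall>m'\<in>M. m \<noteq> m' \<longrightarrow> col m = col m' \<longrightarrow> P m \<inter> P m' = {}"
    using cube_colouring[OF B Z \<epsilon>(1)] by (elim exE conjE) (rule that)
  have MP: "finite M" "Z \<subseteq> (\<Union>m\<in>M. P m)" "\<And>m. closed (P m)"
    "\<And>m x y. x \<in> P m \<Longrightarrow> y \<in> P m \<Longrightarrow> dist x y < \<epsilon>" "\<And>m. col m \<subseteq> B"
    "\<And>m m'. m \<in> M \<Longrightarrow> m' \<in> M \<Longrightarrow> m \<noteq> m' \<Longrightarrow> col m = col m' \<Longrightarrow> P m \<inter> P m' = {}"
    using MP' by simp_all
  define D where "D m = inv_into U \<phi> ` (P m \<inter> Z)" for m
  have ZU: "Z \<subseteq> \<phi> ` U" using c(2) by (auto simp: Z_def)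
  have D_iff: "q \<in> D m \<longleftrightarrow> q \<in> Y' \<and> \<phi> q \<in> P m" for q m
    using c(2) chart_inv(1)[OF c(1)] by (force simp: D_def Z_def)
  have D_cpt: "compact (D m)" for m
    unfolding D_def
    by (intro compact_continuous_image continuous_on_subset[OF chart_inv(6)[OF c(1)]])
      (use ZU closed_Int_compact[OF MP(3) Z] in auto)
  have D_small: "\<exists>p\<in>Y'. D m \<subseteq> S p" if Dm: "D m \<noteq> {}" for m
  proof -
    obtain q where q: "q \<in> Y'" "\<phi> q \<in> P m" using Dm D_iff by blast
    then have "\<phi> q \<in> Z" by (simp add: Z_def)
    from \<epsilon>(2)[OF this] obtain p where p: "p \<in> Y'" "ball (\<phi> q) \<epsilon> \<subseteq> \<phi> ` S p" by blast
    have "D m \<subseteq> S p"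
    proof
      fix q' assume "q' \<in> D m"
      then have q': "q' \<in> U" "\<phi> q' \<in> P m" using D_iff c(2) by auto
      then have "\<phi> q' \<in> \<phi> ` S p" using p(2) MP(4)[OF q(2) q'(2)] by auto
      then obtain x where x: "x \<in> S p" "\<phi> q' = \<phi> x" by (elim imageE)
      then have "x \<in> U" by (simp add: S_def)
      then have "q' = x" by (rule inj_onD[OF chart_inv(4)[OF c(1)] x(2) q'(1)])
      then show "q' \<in> S p" using x(1) by simp
    qed
    then show ?thesis using p(1) by blast
  qed
  have D_meets: "D m \<subseteq> \<nu> Q" "p \<in> Q" if "p \<in> Y'" "D m \<subseteq> S p" "Q \<in> F k" "k \<subseteq> B" "D m \<inter> Q \<noteq> {}" for m p Q k
  proof -
    have "Q \<in> \<F>" using that by (auto simp: \<F>_def)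
    then have "S p \<subseteq> (if p \<in> Q then \<nu> Q else - Q)" unfolding S_def by blast
    then have *: "D m \<subseteq> (if p \<in> Q then \<nu> Q else - Q)" by (rule subset_trans[OF that(2)])
    then show "p \<in> Q" using that(5) by (auto split: if_splits)
    then show "D m \<subseteq> \<nu> Q" using * by simp
  qed
  have D_unique: "Q = Q'" if QQ: "Q \<in> F k" "Q' \<in> F k" "k \<subseteq> B" "D m \<inter> Q \<noteq> {}" "D m \<inter> Q' \<noteq> {}" for m Q Q' k
  proof -
    obtain p where p: "p \<in> Y'" "D m \<subseteq> S p" using D_small[of m] QQ(4) by blast
    have "p \<in> Q" "p \<in> Q'" using D_meets(2)[OF p] QQ by blast+
    then show ?thesis using disF[of k] QQ(1,2) unfolding pairwise_def disjnt_def by blast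
  qed
  have D_disj: "D m \<inter> D m' = {}" if "m \<in> M" "m' \<in> M" "m \<noteq> m'" "col m = col m'" for m m'
    using MP(6)[OF that] D_iff by blast
  define M' where "M' k = {m\<in>M. col m = k \<and> D m \<noteq> {}}" for k
  have M': "finite (M' k)" for k using MP(1) by (simp add: M'_def)
  \<comment> \<open>An old member swallows the new cubes of its colour that it meets; by
    \<open>D_meets\<close> the union still lies in \<open>\<nu> Q\<close>.\<close>
  define ab where "ab k Q = Q \<union> (\<Union>m\<in>{m\<in>M' k. D m \<inter> Q \<noteq> {}}. D m)" for k Q
  define F' where "F' k = (if k \<subseteq> B then ab k ` F k \<union> D ` {m\<in>M' k. \<forall>Q\<in>F k. D m \<inter> Q = {}} else {})" for k
  have "coloured_cover B \<N> (Y \<union> Y') F'"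
    unfolding coloured_cover_def
  proof (intro conjI allI ballI)
    fix k
    show "finite (F' k)" using finF M' by (simp add: F'_def)
    show "compact Q" if "Q \<in> F' k" for Q
      using that cptF D_cpt M' unfolding F'_def ab_def
      by (auto intro!: compact_Un compact_UN split: if_splits)
    show "\<exists>N\<in>\<N>. Q \<subseteq> N" if QF: "Q \<in> F' k" for Q
    proof -
      have kB: "k \<subseteq> B" using QF by (auto simp: F'_def split: if_splits)
      consider Q1 where "Q1 \<in> F k" "Q = ab k Q1" | m where "m \<in> M' k" "Q = D m"
        using QF by (auto simp: F'_def split: if_splits)
      then show ?thesis
      proof cases
        case 1
        have "D m \<subseteq> \<nu> Q1" if "m \<in> M' k" "D m \<inter> Q1 \<noteq> {}" for m
          using D_small[of m] D_meets(1)[OF _ _ 1(1) kB that(2)] that(2) by blast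
        then have "Q \<subseteq> \<nu> Q1" using 1 \<nu> by (auto simp: ab_def)
        then show ?thesis using \<nu> 1(1) by blast
      next
        case 2
        then obtain p where "p \<in> Y'" "D m \<subseteq> S p" using D_small[of m] by (auto simp: M'_def)
        then show ?thesis using 2 o' by (intro bexI[of _ "o' p"]) (auto simp: S_def)
      qed
    qed
    show "pairwise disjnt (F' k)"
    proof (cases "k \<subseteq> B")
      case kB: True
      have mm: "D m \<inter> D m' = {}" if "m \<in> M' k" "m' \<in> M' k" "m \<noteq> m'" for m m'
        using that D_disj by (auto simp: M'_def)
      have 1: "ab k Q \<inter> ab k Q' = {}" if Q: "Q \<in> F k" "Q' \<in> F k" "Q \<noteq> Q'" for Q Q'
      proof -
        have "Q \<inter> Q' = {}" using disF[of k] Q by (auto simp: pairwise_def disjnt_def)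
        moreover have "D m \<inter> Q' = {}" if "D m \<inter> Q \<noteq> {}" for m
          using D_unique[OF Q(1,2) kB that] Q(3) by blast
        moreover have "D m \<inter> Q = {}" if "D m \<inter> Q' \<noteq> {}" for m
          using D_unique[OF Q(1,2) kB _ that] Q(3) by blast
        moreover have "D m \<inter> D m' = {}" if "m \<in> M' k" "m' \<in> M' k" "D m \<inter> Q \<noteq> {}" "D m' \<inter> Q' \<noteq> {}" for m m'
          using mm that D_unique[OF Q(1,2) kB] Q(3) by metis
        ultimately show ?thesis unfolding ab_def by blast
      qed
      have 2: "ab k Q \<inter> D m = {}" if "Q \<in> F k" "m \<in> M' k" "\<forall>Q\<in>F k. D m \<inter> Q = {}" for Q m
        using that mm unfolding ab_def by blast
      show ?thesis
        unfolding pairwise_def disjnt_def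
      proof (intro ballI impI)
        fix Q Q' assume QQ: "Q \<in> F' k" "Q' \<in> F' k" "Q \<noteq> Q'"
        let ?N = "{m\<in>M' k. \<forall>Q\<in>F k. D m \<inter> Q = {}}"
        have Q: "Q \<in> ab k ` F k \<or> Q \<in> D ` ?N" and Q': "Q' \<in> ab k ` F k \<or> Q' \<in> D ` ?N"
          using QQ kB by (auto simp: F'_def)
        from Q show "Q \<inter> Q' = {}"
        proof (elim disjE imageE)
          fix Q1 assume Q1: "Q = ab k Q1" "Q1 \<in> F k"
          from Q' show ?thesis
          proof (elim disjE imageE)
            fix Q2 assume "Q' = ab k Q2" "Q2 \<in> F k"
            then show ?thesis using 1[of Q1 Q2] Q1 QQ(3) by metis
          next
            fix m assume "Q' = D m" "m \<in> ?N"
            then show ?thesis using 2[of Q1 m] Q1 by simp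
          qed
        next
          fix m assume m: "Q = D m" "m \<in> ?N"
          from Q' show ?thesis
          proof (elim disjE imageE)
            fix Q2 assume "Q' = ab k Q2" "Q2 \<in> F k"
            then show ?thesis using 2[of Q2 m] m by (simp add: Int_commute)
          next
            fix m' assume m': "Q' = D m'" "m' \<in> ?N"
            then have "m \<noteq> m'" using m QQ(3) by metis
            then show ?thesis using mm[of m m'] m m' by simp
          qed
        qed
      qed
    qed (simp add: F'_def)
  next
    show "Y \<union> Y' \<subseteq> (\<Union>k\<in>Pow B. \<Union>(F' k))"
    proof (rule Un_least)
      have "Y \<subseteq> (\<Union>k\<in>Pow B. \<Union>(F k))" using F by (simp add: coloured_cover_def)
      also have "\<dots> \<subseteq> (\<Union>k\<in>Pow B. \<Union>(F' k))"
      proof (rule UN_mono[OF order_refl])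
        fix k assume "k \<in> Pow B"
        then have kB: "k \<subseteq> B" by simp
        show "\<Union>(F k) \<subseteq> \<Union>(F' k)"
        proof
          fix q assume "q \<in> \<Union>(F k)"
          then obtain Q where Q: "q \<in> Q" "Q \<in> F k" by (elim UnionE)
          then have "q \<in> ab k Q" "ab k Q \<in> F' k" using kB by (simp_all add: ab_def F'_def)
          then show "q \<in> \<Union>(F' k)" by (rule UnionI[rotated])
        qed
      qed
      finally show "Y \<subseteq> (\<Union>k\<in>Pow B. \<Union>(F' k))" .
      show "Y' \<subseteq> (\<Union>k\<in>Pow B. \<Union>(F' k))"
      proof
        fix q assume q: "q \<in> Y'"
        then have "\<phi> q \<in> Z" by (simp add: Z_def)
        with MP(2) have "\<phi> q \<in> (\<Union>m\<in>M. P m)" by (rule subsetD)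
        then obtain m where m: "m \<in> M" "\<phi> q \<in> P m" by (elim UN_E)
        have qD: "q \<in> D m" using q m(2) by (simp only: D_iff)
        then have "D m \<noteq> {}" by blast
        then have mM: "m \<in> M' (col m)" using m(1) by (simp add: M'_def)
        have "q \<in> \<Union>(F' (col m))"
        proof (cases "\<forall>Q\<in>F (col m). D m \<inter> Q = {}")
          case True
          then have "D m \<in> F' (col m)" using mM MP(5)[of m] by (simp add: F'_def)
          then show ?thesis using qD by (rule UnionI)
        next
          case False
          then obtain Q where "Q \<in> F (col m)" "D m \<inter> Q \<noteq> {}" by blast
          then have "q \<in> ab (col m) Q" using qD mM by (auto simp: ab_def)
          moreover have "ab (col m) Q \<in> F' (col m)" using \<open>Q \<in> F (col m)\<close> MP(5)[of m] by (simp add: F'_def)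
          ultimately show ?thesis by (rule UnionI[rotated])
        qed
        then show "q \<in> (\<Union>k\<in>Pow B. \<Union>(F' k))" by (rule UN_I[rotated]) (simp add: MP(5))
      qed
    qed
  qed
  then show ?thesis by blast
qed

text \<open>Finitely many compact pieces, each inside one chart, cover \<open>Y\<close>; they are
  added one at a time, the set of colours remaining the same.\<close>

theorem coloured_cover_exists:
  assumes B: "orthonormal_basis B" and \<N>: "\<And>N. N \<in> \<N> \<Longrightarrow> open N" and Y: "compact Y" "Y \<subseteq> \<Union>\<N>"
  shows "\<exists>F. coloured_cover B \<N> Y F"
proof -
  let ?\<C> = "{K. compact K \<and> (\<exists>(U, \<phi>)\<in>atlas. K \<subseteq> U)}"
  have nbhd: "\<exists>K\<in>?\<C>. p \<in> interior K" for p
  proof -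
    obtain U \<phi> where c: "(U, \<phi>) \<in> atlas" "p \<in> U" by (rule chart_at)
    obtain \<beta> :: "'m \<Rightarrow> real" and K where K: "compact K" "K \<subseteq> U" "smooth UNIV \<beta>" "\<beta> p > 0" "\<And>q. q \<notin> K \<Longrightarrow> \<beta> q = 0"
      by (rule bump_at[OF chart(1)[OF c(1)] c(2)]) blast
    have "open {q. \<beta> q > 0}"
      using smooth_continuous[OF open_UNIV K(3)] by (intro open_Collect_less continuous_on_const)
    then have "{q. \<beta> q > 0} \<subseteq> interior K" using K(5) by (intro interior_maximal) force+
    then show ?thesis using K c by (intro bexI[of _ K]) auto
  qed
  then have "\<forall>p. \<exists>K. K \<in> ?\<C> \<and> p \<in> interior K" by (simp only: Bex_def simp_thms)
  from choice[OF this] obtain \<kappa> where \<kappa>': "\<forall>p. \<kappa> p \<in> ?\<C> \<and> p \<in> interior (\<kappa> p)" by (elim exE)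
  then have \<kappa>: "\<kappa> p \<in> ?\<C>" "p \<in> interior (\<kappa> p)" for p by simp_all
  have "Y \<subseteq> (\<Union>p\<in>Y. interior (\<kappa> p))" by (rule subsetI, rule UN_I, assumption, rule \<kappa>(2))
  from compactE_image[OF Y(1) open_interior this] obtain D where D: "D \<subseteq> Y" "finite D" "Y \<subseteq> (\<Union>p\<in>D. interior (\<kappa> p))" .
  have "\<exists>F. coloured_cover B \<N> (\<Union>p\<in>D. \<kappa> p \<inter> Y) F"
    using D(2)
  proof (induction D rule: finite_induct)
    case empty
    then show ?case by (intro exI[of _ "\<lambda>_. {}"]) (simp add: coloured_cover_def)
  next
    case (insert p D)
    then obtain F where F: "coloured_cover B \<N> (\<Union>p\<in>D. \<kappa> p \<inter> Y) F" by blast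
    obtain U \<phi> where c: "(U, \<phi>) \<in> atlas" "\<kappa> p \<subseteq> U" using \<kappa>(1)[of p] by auto
    have "compact (\<kappa> p \<inter> Y)" using \<kappa>(1)[of p] compact_imp_closed[OF Y(1)] by (simp add: compact_Int_closed)
    then show ?case
      using coloured_cover_extend[OF B \<N> F _ _ c(1), of "\<kappa> p \<inter> Y"] Y(2) c(2) by (auto simp: Un_commute)
  qed
  then obtain F where "coloured_cover B \<N> (\<Union>p\<in>D. \<kappa> p \<inter> Y) F" by blast
  moreover have "Y \<subseteq> (\<Union>p\<in>D. \<kappa> p \<inter> Y)"
  proof
    fix q assume q: "q \<in> Y"
    with D(3) obtain p where p: "p \<in> D" "q \<in> interior (\<kappa> p)" by (meson UN_E subsetD)
    then have "q \<in> \<kappa> p \<inter> Y" using q interior_subset[of "\<kappa> p"] by (metis IntI subsetD)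
    then show "q \<in> (\<Union>p\<in>D. \<kappa> p \<inter> Y)" by (rule UN_I[OF p(1)])
  qed
  ultimately have "coloured_cover B \<N> Y F" unfolding coloured_cover_def by (elim conjE) (intro conjI, assumption, rule subset_trans)
  then show ?thesis by (rule exI[of _ F])
qed

text \<open>A bump function that is positive on \<open>Q\<close> and vanishes off a compact set
  avoiding \<open>Q'\<close> supplies both neighbourhoods.\<close>

lemma separate_compact:
  assumes "compact (Q :: 'm set)" "compact Q'" "Q \<inter> Q' = {}"
  shows "\<exists>N N'. open N \<and> open N' \<and> Q \<subseteq> N \<and> Q' \<subseteq> N' \<and> N \<inter> N' = {}"
proof -
  have o: "open (- Q')" using compact_imp_closed[OF assms(2)] by (rule open_Compl)
  have s: "Q \<subseteq> - Q'" using assms(3) by auto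
  obtain \<beta> :: "'m \<Rightarrow> real" and K where K: "compact K" "K \<subseteq> - Q'" "smooth UNIV \<beta>" "\<forall>q\<in>Q. \<beta> q > 0" "\<forall>q. q \<notin> K \<longrightarrow> \<beta> q = 0"
    by (rule bump_compact[OF o assms(1) s]) simp
  have "open {q. \<beta> q > 0}"
    using smooth_continuous[OF open_UNIV K(3)] by (intro open_Collect_less continuous_on_const)
  moreover have "{q. \<beta> q > 0} \<subseteq> K" using K(5) by (auto intro: ccontr)
  moreover have "open (- K)" using compact_imp_closed[OF K(1)] by (rule open_Compl)
  ultimately show ?thesis
    using K(2,4) by (intro exI[of _ "{q. \<beta> q > 0}"] exI[of _ "- K"] conjI) auto
qed

lemma separate_family:
  assumes "finite \<Q>" "\<And>Q. Q \<in> \<Q> \<Longrightarrow> compact (Q :: 'm set)" "pairwise disjnt \<Q>"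
  shows "\<exists>N. \<forall>Q\<in>\<Q>. open (N Q) \<and> Q \<subseteq> N Q \<and> (\<forall>Q'\<in>\<Q>. Q \<noteq> Q' \<longrightarrow> N Q \<inter> N Q' = {})"
  using assms
proof (induction \<Q> rule: finite_induct)
  case (insert Q \<Q>)
  have "pairwise disjnt \<Q>" using insert.prems(2) by (simp add: pairwise_insert)
  then obtain N where N: "\<forall>Q\<in>\<Q>. open (N Q) \<and> Q \<subseteq> N Q \<and> (\<forall>Q'\<in>\<Q>. Q \<noteq> Q' \<longrightarrow> N Q \<inter> N Q' = {})"
    using insert.IH insert.prems(1) by auto
  have "compact (\<Union>\<Q>)" using insert.hyps insert.prems(1) by (intro compact_Union) auto
  moreover have "Q \<inter> \<Union>\<Q> = {}"
    using insert.prems(2) insert.hyps(2) by (auto simp: pairwise_insert disjnt_def)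
  ultimately obtain N1 N2 where N12: "open N1" "open N2" "Q \<subseteq> N1" "\<Union>\<Q> \<subseteq> N2" "N1 \<inter> N2 = {}"
    using separate_compact[of Q "\<Union>\<Q>"] insert.prems(1) by auto
  define M where "M R = (if R = Q then N1 else N R \<inter> N2)" for R
  have "\<forall>R\<in>insert Q \<Q>. open (M R) \<and> R \<subseteq> M R \<and> (\<forall>R'\<in>insert Q \<Q>. R \<noteq> R' \<longrightarrow> M R \<inter> M R' = {})"
  proof (intro ballI conjI impI)
    fix R assume R: "R \<in> insert Q \<Q>"
    show "open (M R)" using R N N12 by (auto simp: M_def)
    show "R \<subseteq> M R"
    proof (cases "R = Q")
      case False
      then have "R \<in> \<Q>" using R by simp
      then have "R \<subseteq> N R" "R \<subseteq> \<Union>\<Q>" using N by auto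
      then show ?thesis using N12(4) False by (auto simp: M_def)
    qed (simp add: M_def N12)
    fix R' assume R': "R' \<in> insert Q \<Q>" "R \<noteq> R'"
    show "M R \<inter> M R' = {}"
    proof (cases "R = Q \<or> R' = Q")
      case True
      then show ?thesis using R' N12(5) by (auto simp: M_def)
    next
      case False
      then have "N R \<inter> N R' = {}" using N R R' by simp
      then show ?thesis using False by (auto simp: M_def)
    qed
  qed
  then show ?case by (rule exI[of _ M])
qed simp

text \<open>Raw material of a partition of unity: locally finite bump functions in finitely many
  colours, those of one colour with disjoint supports, each subordinate to a member of
  \<open>\<W>\<close>. The normalization is left to \<open>global_frame\<close>.\<close>

definition pieces :: "'m set set \<Rightarrow> 'c set \<Rightarrow> ('c \<Rightarrow> 'q set) \<Rightarrow> ('q \<Rightarrow> 'm set) \<Rightarrow> ('q \<Rightarrow> 'm \<Rightarrow> real) \<Rightarrow> ('q \<Rightarrow> 'm set) \<Rightarrow> bool" where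
  "pieces \<W> \<Gamma> \<Q> K \<beta> W \<longleftrightarrow> finite \<Gamma> \<and>
     (\<forall>\<gamma>\<in>\<Gamma>. \<forall>\<tau>\<in>\<Q> \<gamma>. compact (K \<tau>) \<and> K \<tau> \<subseteq> W \<tau> \<and> W \<tau> \<in> \<W> \<and> smooth UNIV (\<beta> \<tau>) \<and>
        (\<forall>p. \<beta> \<tau> p \<ge> 0) \<and> (\<forall>p. p \<notin> K \<tau> \<longrightarrow> \<beta> \<tau> p = 0)) \<and>
     (\<forall>\<gamma>\<in>\<Gamma>. \<forall>\<tau>\<in>\<Q> \<gamma>. \<forall>\<tau>'\<in>\<Q> \<gamma>. \<tau> \<noteq> \<tau>' \<longrightarrow> K \<tau> \<inter> K \<tau>' = {}) \<and>
     (\<forall>p. \<exists>G. open G \<and> p \<in> G \<and> (\<forall>\<gamma>\<in>\<Gamma>. finite {\<tau>\<in>\<Q> \<gamma>. K \<tau> \<inter> G \<noteq> {}})) \<and>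
     (\<forall>p. \<exists>\<gamma>\<in>\<Gamma>. \<exists>\<tau>\<in>\<Q> \<gamma>. \<beta> \<tau> p > 0)"

text \<open>The disjoint compact sets of one colour are enlarged to disjoint open sets, and bump
  functions are placed inside these. Disjointness thereby passes to the supports, which also stay
  within the prescribed neighbourhood \<open>V\<close> of the annulus.\<close>

lemma annulus_pieces:
  fixes B :: "'e set"
  assumes B: "orthonormal_basis B" and \<W>: "\<And>W. W \<in> \<W> \<Longrightarrow> open W" "\<Union>\<W> = UNIV"
    and Y: "compact Y" "Y \<subseteq> V" "open V"
  shows "\<exists>(F :: 'e set \<Rightarrow> 'm set set) K \<beta> W. (\<forall>c\<in>Pow B. finite (F c) \<and>
      (\<forall>Q\<in>F c. compact (K c Q) \<and> K c Q \<subseteq> W c Q \<inter> V \<and> W c Q \<in> \<W> \<and> smooth UNIV (\<beta> c Q :: 'm \<Rightarrow> real) \<and>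
        (\<forall>p. \<beta> c Q p \<ge> 0) \<and> (\<forall>p. p \<notin> K c Q \<longrightarrow> \<beta> c Q p = 0) \<and>
        (\<forall>Q'\<in>F c. Q \<noteq> Q' \<longrightarrow> K c Q \<inter> K c Q' = {}))) \<and>
      (\<forall>p\<in>Y. \<exists>c\<in>Pow B. \<exists>Q\<in>F c. \<beta> c Q p > 0)"
proof -
  let ?\<N> = "(\<lambda>W. W \<inter> V) ` \<W>"
  have "\<And>N. N \<in> ?\<N> \<Longrightarrow> open N" using \<W>(1) Y(3) by auto
  moreover have "Y \<subseteq> \<Union>?\<N>"
  proof
    fix p assume p: "p \<in> Y"
    have "p \<in> \<Union>\<W>" by (simp add: \<W>(2))
    then obtain W where "W \<in> \<W>" "p \<in> W" by (elim UnionE)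
    then show "p \<in> \<Union>?\<N>" using p Y(2) by auto
  qed
  ultimately have "\<exists>F. coloured_cover B ?\<N> Y F" by (rule coloured_cover_exists[OF B _ Y(1)])
  then obtain F where F: "coloured_cover B ?\<N> Y F" by (elim exE)
  then have fin: "finite (F c)" and cpt: "\<And>Q. Q \<in> F c \<Longrightarrow> compact Q" and dis: "pairwise disjnt (F c)"
    and sub: "\<forall>Q\<in>F c. \<exists>W\<in>\<W>. Q \<subseteq> W \<inter> V" and cov: "Y \<subseteq> (\<Union>c\<in>Pow B. \<Union>(F c))" for c
    by (simp_all add: coloured_cover_def)
  have "\<forall>c. \<exists>N. \<forall>Q\<in>F c. open (N Q) \<and> Q \<subseteq> N Q \<and> (\<forall>Q'\<in>F c. Q \<noteq> Q' \<longrightarrow> N Q \<inter> N Q' = {})"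
    using separate_family[OF fin cpt dis] by (rule allI)
  from choice[OF this] obtain N where
    N: "\<forall>c. \<forall>Q\<in>F c. open (N c Q) \<and> Q \<subseteq> N c Q \<and> (\<forall>Q'\<in>F c. Q \<noteq> Q' \<longrightarrow> N c Q \<inter> N c Q' = {})" by (elim exE)
  have ex: "\<exists>t. case t of (K, \<beta>, W) \<Rightarrow> compact K \<and> K \<subseteq> N c Q \<and> K \<subseteq> W \<inter> V \<and> W \<in> \<W> \<and> smooth UNIV (\<beta> :: 'm \<Rightarrow> real) \<and> (\<forall>p. \<beta> p \<ge> 0) \<and>
      (\<forall>p. p \<notin> K \<longrightarrow> \<beta> p = 0) \<and> (\<forall>p\<in>Q. \<beta> p > 0)" if Q: "Q \<in> F c" for c Q
  proof -
    obtain W where W: "W \<in> \<W>" "Q \<subseteq> W \<inter> V" using sub[of c] Q by (elim ballE bexE) auto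
    have NQ: "open (N c Q)" "Q \<subseteq> N c Q" using N Q by simp_all
    have o: "open (N c Q \<inter> (W \<inter> V))" using NQ \<W>(1)[OF W(1)] Y(3) by (intro open_Int)
    have s: "Q \<subseteq> N c Q \<inter> (W \<inter> V)" using NQ W by auto
    obtain \<beta> :: "'m \<Rightarrow> real" and K where K: "compact K" "K \<subseteq> N c Q \<inter> (W \<inter> V)" "smooth UNIV \<beta>" "\<forall>q. \<beta> q \<ge> 0" "\<forall>q\<in>Q. \<beta> q > 0" "\<forall>q. q \<notin> K \<longrightarrow> \<beta> q = 0"
      by (rule bump_compact[OF o cpt[OF Q] s]) simp
    then show ?thesis using W(1) by (intro exI[of _ "(K, \<beta>, W)"]) simp
  qed
  define t where "t c Q = (SOME t. case t of (K, \<beta>, W) \<Rightarrow> compact K \<and> K \<subseteq> N c Q \<and> K \<subseteq> W \<inter> V \<and> W \<in> \<W> \<and> smooth UNIV (\<beta> :: 'm \<Rightarrow> real) \<and> (\<forall>p. \<beta> p \<ge> 0) \<and>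
      (\<forall>p. p \<notin> K \<longrightarrow> \<beta> p = 0) \<and> (\<forall>p\<in>Q. \<beta> p > 0))" for c Q
  define K where "K c Q = fst (t c Q)" for c Q
  define \<beta> where "\<beta> c Q = fst (snd (t c Q))" for c Q
  define W where "W c Q = snd (snd (t c Q))" for c Q
  have t: "compact (K c Q) \<and> K c Q \<subseteq> N c Q \<and> K c Q \<subseteq> W c Q \<inter> V \<and> W c Q \<in> \<W> \<and> smooth UNIV (\<beta> c Q) \<and> (\<forall>p. \<beta> c Q p \<ge> 0) \<and>
      (\<forall>p. p \<notin> K c Q \<longrightarrow> \<beta> c Q p = 0) \<and> (\<forall>p\<in>Q. \<beta> c Q p > 0)" if Q: "Q \<in> F c" for c Q
    using someI_ex[OF ex[OF Q], folded t_def] by (simp add: K_def \<beta>_def W_def case_prod_beta)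
  show ?thesis
  proof (rule exI[of _ F], rule exI[of _ K], rule exI[of _ \<beta>], rule exI[of _ W], intro conjI ballI impI)
    fix c assume "c \<in> Pow B"
    show "finite (F c)" by (rule fin)
    fix Q assume Q: "Q \<in> F c"
    show "compact (K c Q)" "K c Q \<subseteq> W c Q \<inter> V" "W c Q \<in> \<W>" "smooth UNIV (\<beta> c Q)" "\<forall>p. \<beta> c Q p \<ge> 0"
      "\<forall>p. p \<notin> K c Q \<longrightarrow> \<beta> c Q p = 0"
      using t[OF Q] by simp_all
    fix Q' assume Q': "Q' \<in> F c" "Q \<noteq> Q'"
    have "K c Q \<subseteq> N c Q" "K c Q' \<subseteq> N c Q'" "N c Q \<inter> N c Q' = {}" using t[OF Q] t[OF Q'(1)] N Q Q' by simp_all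
    then show "K c Q \<inter> K c Q' = {}" by auto
  next
    fix p assume "p \<in> Y"
    with cov have "p \<in> (\<Union>c\<in>Pow B. \<Union>(F c))" by (rule subsetD)
    then obtain c Q where c: "c \<in> Pow B" and Q: "Q \<in> F c" "p \<in> Q" by (elim UN_E UnionE)
    then have "\<beta> c Q p > 0" using t[OF Q(1)] by simp
    then show "\<exists>c\<in>Pow B. \<exists>Q\<in>F c. \<beta> c Q p > 0" using c Q(1) by (intro bexI)
  qed
qed

text \<open>The annuli of an exhaustion are treated separately, and three groups of annuli suffice
  for disjointness; hence the number of colours is three times that for a compact set.\<close>

theorem pieces_exist:
  assumes \<W>: "\<And>W. W \<in> \<W> \<Longrightarrow> open W" "\<Union>\<W> = UNIV"
  shows "\<exists>(\<Gamma> :: (nat \<times> 'e set) set) (\<Q> :: nat \<times> 'e set \<Rightarrow> (nat \<times> 'e set \<times> 'm set) set) K \<beta> W. pieces \<W> \<Gamma> \<Q> K \<beta> W"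
proof -
  obtain B :: "'e set" where B: "orthonormal_basis B" using orthonormal_basis_ex by (elim exE)
  then have finB: "finite B" by (simp add: orthonormal_basis_def)
  obtain L :: "nat \<Rightarrow> 'm set" where L: "\<forall>n. compact (L n)" "\<forall>n. L n \<subseteq> interior (L (Suc n))" "(\<Union>n. L n) = UNIV" "L 0 = {}"
  proof (rule exhaustion)
    fix L :: "nat \<Rightarrow> 'm set"
    assume L: "\<And>n. compact (L n)" "\<And>n. L n \<subseteq> interior (L (Suc n))" "(\<Union>n. L n) = UNIV" "L 0 = {}"
    show thesis by (rule that[of L]) (simp_all add: L)
  qed
  have L_mono: "L m \<subseteq> L n" if "m \<le> n" for m n
    using that
  proof (induction rule: dec_induct)
    case (step n)
    have "L n \<subseteq> L (Suc n)" using L(2) interior_subset[of "L (Suc n)"] by (meson subset_trans)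
    then show ?case using step.IH by (rule subset_trans[rotated])
  qed simp
  define Y where "Y n = L (Suc n) - interior (L n)" for n
  \<comment> \<open>For \<open>n = 0\<close> the truncated difference gives \<open>L 0\<close>,
    which is empty, so nothing is removed.\<close>
  define V where "V n = interior (L (Suc (Suc n))) - L (n - 1)" for n
  have Y_cpt: "compact (Y n)" for n
    unfolding Y_def using L(1) by (intro compact_diff) simp_all
  have V_open: "open (V n)" for n
    unfolding V_def using compact_imp_closed[OF spec[OF L(1)]] by (intro open_Diff) simp_all
  have YV: "Y n \<subseteq> V n" for n
  proof -
    have "L (n - 1) \<subseteq> interior (L n)"
      using L(2) L(4) by (cases n) simp_all
    moreover have "L (Suc n) \<subseteq> interior (L (Suc (Suc n)))" using L(2) by simp
    ultimately show ?thesis by (auto simp: Y_def V_def)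
  qed
  have V_disj: "V m \<inter> V n = {}" if "m + 3 \<le> n" for m n
  proof -
    have "Suc (Suc m) \<le> n - 1" using that by linarith
    then have "interior (L (Suc (Suc m))) \<subseteq> L (n - 1)"
      by (intro subset_trans[OF interior_subset] L_mono)
    then show ?thesis by (auto simp: V_def)
  qed
  have Y_cov: "\<exists>n. p \<in> Y n" for p
  proof -
    have "p \<in> (\<Union>n. L n)" by (simp add: L(3))
    then have ex: "\<exists>n. p \<in> L n" by simp
    define n where "n = (LEAST n. p \<in> L n)"
    have n: "p \<in> L n" unfolding n_def by (rule LeastI_ex[OF ex])
    then obtain m where m: "n = Suc m" using L(4) by (cases n) auto
    have "p \<notin> L m" using not_less_Least[of m "\<lambda>n. p \<in> L n"] m n_def by simp
    then have "p \<notin> interior (L m)" using interior_subset[of "L m"] by (rule contra_subsetD[rotated])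
    then show ?thesis using n m by (intro exI[of _ m]) (simp add: Y_def)
  qed
  let ?P = "\<lambda>n (F :: 'e set \<Rightarrow> 'm set set, K, \<beta>, W). (\<forall>c\<in>Pow B. finite (F c) \<and>
      (\<forall>Q\<in>F c. compact (K c Q) \<and> K c Q \<subseteq> W c Q \<inter> V n \<and> W c Q \<in> \<W> \<and> smooth UNIV (\<beta> c Q :: 'm \<Rightarrow> real) \<and>
        (\<forall>p. \<beta> c Q p \<ge> 0) \<and> (\<forall>p. p \<notin> K c Q \<longrightarrow> \<beta> c Q p = 0) \<and>
        (\<forall>Q'\<in>F c. Q \<noteq> Q' \<longrightarrow> K c Q \<inter> K c Q' = {}))) \<and>
      (\<forall>p\<in>Y n. \<exists>c\<in>Pow B. \<exists>Q\<in>F c. \<beta> c Q p > 0)"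
  have "\<exists>t. ?P n t" for n
    using annulus_pieces[where \<W> = \<W>, OF B \<W> Y_cpt YV V_open, of n] by (simp add: split_paired_Ex)
  then have "\<forall>n. \<exists>t. ?P n t" by (rule allI)
  from choice[OF this] obtain t where t': "\<forall>n. ?P n (t n)" by (elim exE)
  define F where "F n = fst (t n)" for n
  define K where "K = (\<lambda>(n, c, Q). fst (snd (t n)) c Q)"
  define \<beta> where "\<beta> = (\<lambda>(n, c, Q). fst (snd (snd (t n))) c Q)"
  define W where "W = (\<lambda>(n, c, Q). snd (snd (snd (t n))) c Q)"
  have t: "(\<forall>c\<in>Pow B. finite (F n c) \<and>
      (\<forall>Q\<in>F n c. compact (K (n, c, Q)) \<and> K (n, c, Q) \<subseteq> W (n, c, Q) \<inter> V n \<and> W (n, c, Q) \<in> \<W> \<and> smooth UNIV (\<beta> (n, c, Q)) \<and>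
        (\<forall>p. \<beta> (n, c, Q) p \<ge> 0) \<and> (\<forall>p. p \<notin> K (n, c, Q) \<longrightarrow> \<beta> (n, c, Q) p = 0) \<and>
        (\<forall>Q'\<in>F n c. Q \<noteq> Q' \<longrightarrow> K (n, c, Q) \<inter> K (n, c, Q') = {}))) \<and>
      (\<forall>p\<in>Y n. \<exists>c\<in>Pow B. \<exists>Q\<in>F n c. \<beta> (n, c, Q) p > 0)" for n
    using spec[OF t', of n] by (simp only: F_def K_def \<beta>_def W_def case_prod_beta fst_conv snd_conv)
  \<comment> \<open>Neighbourhoods \<open>V n\<close> whose indices differ by at least 3 are
    disjoint, so the residue of \<open>n\<close> modulo 3 together with the colour inside the
    annulus is a valid colour.\<close>
  define \<Gamma> where "\<Gamma> = {0, 1, 2 :: nat} \<times> Pow B"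
  define \<Q> where "\<Q> = (\<lambda>(j, c). {(n, c', Q). n mod 3 = j \<and> c' = c \<and> Q \<in> F n c})"
  have Qcase: "\<exists>n Q. \<tau> = (n, c, Q) \<and> n mod 3 = j \<and> Q \<in> F n c" if "\<tau> \<in> \<Q> (j, c)" for \<tau> j c
    using that by (auto simp: \<Q>_def)
  have P: "pieces \<W> \<Gamma> \<Q> K \<beta> W"
    unfolding pieces_def
  proof (intro conjI ballI allI impI)
    show "finite \<Gamma>" using finB by (simp add: \<Gamma>_def)
  next
    fix \<gamma> \<tau> assume \<gamma>: "\<gamma> \<in> \<Gamma>" "\<tau> \<in> \<Q> \<gamma>"
    obtain j c where jc: "\<gamma> = (j, c)" by (cases \<gamma>)
    then have c: "c \<in> Pow B" using \<gamma> by (simp add: \<Gamma>_def)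
    obtain n Q where \<tau>: "\<tau> = (n, c, Q)" "n mod 3 = j" "Q \<in> F n c" using Qcase[of \<tau> j c] \<gamma>(2) jc by auto
    note tt = bspec[OF conjunct2[OF bspec[OF conjunct1[OF t[of n]] c]] \<tau>(3)]
    show "compact (K \<tau>)" "K \<tau> \<subseteq> W \<tau>" "W \<tau> \<in> \<W>" "smooth UNIV (\<beta> \<tau>)" "0 \<le> \<beta> \<tau> p" "p \<notin> K \<tau> \<Longrightarrow> \<beta> \<tau> p = 0" for p
      using tt unfolding \<tau>(1) by simp_all
    fix \<tau>' assume \<tau>': "\<tau>' \<in> \<Q> \<gamma>" "\<tau> \<noteq> \<tau>'"
    obtain n' Q' where \<tau>'': "\<tau>' = (n', c, Q')" "n' mod 3 = j" "Q' \<in> F n' c" using Qcase[of \<tau>' j c] \<tau>'(1) jc by auto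
    note tt' = bspec[OF conjunct2[OF bspec[OF conjunct1[OF t[of n']] c]] \<tau>''(3)]
    show "K \<tau> \<inter> K \<tau>' = {}"
    proof (cases "n = n'")
      case True
      then have "Q \<noteq> Q'" using \<tau>'(2) \<tau> \<tau>'' by simp
      then show ?thesis using tt True \<tau>''(3) unfolding \<tau>(1) \<tau>''(1) by simp
    next
      case False
      have a: "n = 3 * (n div 3) + j" "n' = 3 * (n' div 3) + j"
        using mult_div_mod_eq[of 3 n] mult_div_mod_eq[of 3 n'] \<tau>(2) \<tau>''(2) by simp_all
      have "n div 3 \<noteq> n' div 3"
      proof
        assume "n div 3 = n' div 3"
        then have "3 * (n div 3) + j = 3 * (n' div 3) + j" by (rule arg_cong)
        then show False using a False by (simp only:)
      qed
      then have "n div 3 < n' div 3 \<or> n' div 3 < n div 3" by (rule linorder_neq_iff[THEN iffD1])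
      \<comment> \<open>Different indices with the same residue modulo 3 are at least 3
        apart.\<close>
      then have "n + 3 \<le> n' \<or> n' + 3 \<le> n" using a by linarith
      then have "V n \<inter> V n' = {}" using V_disj[of n n'] V_disj[of n' n] by auto
      moreover have "K \<tau> \<subseteq> V n" "K \<tau>' \<subseteq> V n'" using tt tt' unfolding \<tau>(1) \<tau>''(1) by simp_all
      ultimately show ?thesis by auto
    qed
  next
    fix p
    have "p \<in> (\<Union>n. L n)" by (simp add: L(3))
    then obtain m where "p \<in> L m" by (elim UN_E)
    then have p: "p \<in> interior (L (Suc m))" using L(2) by (meson subsetD)
    have "finite {\<tau>\<in>\<Q> \<gamma>. K \<tau> \<inter> interior (L (Suc m)) \<noteq> {}}" if \<gamma>: "\<gamma> \<in> \<Gamma>" for \<gamma>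
    proof -
      obtain j c where jc: "\<gamma> = (j, c)" by (cases \<gamma>)
      then have c: "c \<in> Pow B" using \<gamma> by (simp add: \<Gamma>_def)
      have sub: "{\<tau>\<in>\<Q> \<gamma>. K \<tau> \<inter> interior (L (Suc m)) \<noteq> {}} \<subseteq> (\<Union>n\<in>{..Suc m}. (\<lambda>Q. (n, c, Q)) ` F n c)"
      proof
        fix \<tau> assume "\<tau> \<in> {\<tau>\<in>\<Q> \<gamma>. K \<tau> \<inter> interior (L (Suc m)) \<noteq> {}}"
        then have a: "\<tau> \<in> \<Q> (j, c)" "K \<tau> \<inter> interior (L (Suc m)) \<noteq> {}" using jc by simp_all
        obtain n Q where \<tau>: "\<tau> = (n, c, Q)" "Q \<in> F n c" using Qcase[OF a(1)] by auto
        have "K \<tau> \<subseteq> V n"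
          using bspec[OF conjunct2[OF bspec[OF conjunct1[OF t[of n]] c]] \<tau>(2)] unfolding \<tau>(1) by simp
        then obtain q where q: "q \<in> interior (L (Suc m))" "q \<notin> L (n - 1)" using a(2) by (auto simp: V_def)
        \<comment> \<open>Later annuli have neighbourhoods outside \<open>L (Suc m)\<close>. Hence
          the interior of that set meets only finitely many supports, which is local
          finiteness.\<close>
        have "n \<le> Suc m"
        proof (rule ccontr)
          assume "\<not> n \<le> Suc m"
          then have "L (Suc m) \<subseteq> L (n - 1)" by (intro L_mono) simp
          then show False using q interior_subset[of "L (Suc m)"] by (meson subsetD)
        qed
        then show "\<tau> \<in> (\<Union>n\<in>{..Suc m}. (\<lambda>Q. (n, c, Q)) ` F n c)"
          using \<tau> by (intro UN_I[of n] image_eqI[of _ _ Q]) simp_all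
      qed
      have "finite (F n c)" for n using bspec[OF conjunct1[OF t[of n]] c] by (rule conjunct1)
      then have "finite (\<Union>n\<in>{..Suc m}. (\<lambda>Q. (n, c, Q)) ` F n c)" by (intro finite_UN_I finite_imageI finite_atMost)
      then show ?thesis by (rule finite_subset[OF sub])
    qed
    then have "\<forall>\<gamma>\<in>\<Gamma>. finite {\<tau>\<in>\<Q> \<gamma>. K \<tau> \<inter> interior (L (Suc m)) \<noteq> {}}" by (rule ballI)
    then show "\<exists>G. open G \<and> p \<in> G \<and> (\<forall>\<gamma>\<in>\<Gamma>. finite {\<tau>\<in>\<Q> \<gamma>. K \<tau> \<inter> G \<noteq> {}})"
      by (intro exI[of _ "interior (L (Suc m))"] conjI open_interior p)
  next
    fix p
    obtain n where n: "p \<in> Y n" using Y_cov[of p] by (elim exE)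
    obtain c Q where c: "c \<in> Pow B" "Q \<in> F n c" "\<beta> (n, c, Q) p > 0"
      using bspec[OF conjunct2[OF t[of n]] n] by (elim bexE)
    have "(n mod 3, c) \<in> \<Gamma>" using c(1) by (auto simp: \<Gamma>_def)
    moreover have "(n, c, Q) \<in> \<Q> (n mod 3, c)" using c(2) by (simp add: \<Q>_def)
    ultimately show "\<exists>\<gamma>\<in>\<Gamma>. \<exists>\<tau>\<in>\<Q> \<gamma>. \<beta> \<tau> p > 0"
      using c(3) by (intro bexI)
  qed
  show ?thesis
    by (rule exI[of _ \<Gamma>], rule exI[of _ \<Q>], rule exI[of _ K], rule exI[of _ \<beta>], rule exI[of _ W], rule P)
qed

end

section \<open>Finite global frames of vector bundles\<close>

lemma bounded_bilinear_vector_scalar: "bounded_bilinear ((*s) :: complex \<Rightarrow> complex ^ 'n \<Rightarrow> complex ^ 'n)"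
proof -
  have "bilinear ((*s) :: complex \<Rightarrow> complex ^ 'n \<Rightarrow> complex ^ 'n)"
    unfolding bilinear_def by (intro conjI allI linearI) (simp_all add: vec_eq_iff algebra_simps)
  then show ?thesis by (simp only: bilinear_conv_bounded_bilinear)
qed

locale complex_bundle = smooth_mfd atlas
  for atlas :: "('m::{t2_space,second_countable_topology}, 'e::real_inner) atlas" +
  fixes sc :: "complex \<Rightarrow> 'v::ab_group_add \<Rightarrow> 'v" and E :: "'m \<Rightarrow> 'v set"
    and triv :: "('m, 'v, complex ^ 'n) trivializations"
  assumes cvb: "complex_vector_bundle atlas sc E triv"
begin

lemma vector_space_sc: "vector_space sc"
  using cvb by (simp add: complex_vector_bundle_def)

sublocale vs: vector_space sc by (rule vector_space_sc)

lemma E_subspace: "vs.subspace (E p)"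
  using cvb by (simp add: complex_vector_bundle_def)

lemmas E_closed = vs.subspace_0[OF E_subspace] vs.subspace_add[OF E_subspace] vs.subspace_scale[OF E_subspace]
  vs.subspace_neg[OF E_subspace] vs.subspace_diff[OF E_subspace] vs.subspace_sum[OF E_subspace]

abbreviation "iv \<psi> p w \<equiv> inv_into (E p) (\<psi> p) w"

lemma triv_props:
  assumes "(U, \<psi>) \<in> triv"
  shows "open U" "p \<in> U \<Longrightarrow> bij_betw (\<psi> p) (E p) UNIV"
    "p \<in> U \<Longrightarrow> u \<in> E p \<Longrightarrow> v \<in> E p \<Longrightarrow> \<psi> p (u + v) = \<psi> p u + \<psi> p v"
    "p \<in> U \<Longrightarrow> u \<in> E p \<Longrightarrow> \<psi> p (sc c u) = c *s \<psi> p u"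
proof -
  have *: "\<forall>(U, \<psi>)\<in>triv. open U \<and>
        (\<forall>p\<in>U. bij_betw (\<psi> p) (E p) UNIV \<and>
           (\<forall>u\<in>E p. \<forall>v\<in>E p. \<psi> p (u + v) = \<psi> p u + \<psi> p v) \<and>
           (\<forall>c. \<forall>u\<in>E p. \<psi> p (sc c u) = c *s \<psi> p u))"
    using cvb unfolding complex_vector_bundle_def by (elim conjE)
  note t = bspec[OF * assms, unfolded prod.case]
  from t show "open U" "p \<in> U \<Longrightarrow> bij_betw (\<psi> p) (E p) UNIV"
    "p \<in> U \<Longrightarrow> u \<in> E p \<Longrightarrow> v \<in> E p \<Longrightarrow> \<psi> p (u + v) = \<psi> p u + \<psi> p v"
    "p \<in> U \<Longrightarrow> u \<in> E p \<Longrightarrow> \<psi> p (sc c u) = c *s \<psi> p u"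
    by simp_all
qed

lemma triv_transition:
  assumes "(U, \<psi>) \<in> triv" "(V, \<eta>) \<in> triv"
  shows "smooth (U \<inter> V) (\<lambda>p. \<eta> p (iv \<psi> p w))"
proof -
  have *: "\<forall>(U, \<psi>)\<in>triv. \<forall>(V, \<eta>)\<in>triv. \<forall>w.
        smooth (U \<inter> V) (\<lambda>p. \<eta> p (inv_into (E p) (\<psi> p) w))"
    using cvb unfolding complex_vector_bundle_def by (elim conjE)
  show ?thesis
    using bspec[OF bspec[OF * assms(1), unfolded prod.case] assms(2), unfolded prod.case] by (rule spec)
qed

lemma triv_at: "\<exists>U \<psi>. (U, \<psi>) \<in> triv \<and> p \<in> U"
proof -
  have "(\<Union>(U, \<psi>)\<in>triv. U) = UNIV" using cvb unfolding complex_vector_bundle_def by (elim conjE)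
  then have "p \<in> (\<Union>(U, \<psi>)\<in>triv. U)" by simp
  then show ?thesis by auto
qed

context
  fixes U \<psi> p
  assumes tr: "(U, \<psi>) \<in> triv" "p \<in> U"
begin

lemma iv_in: "iv \<psi> p w \<in> E p"
  using triv_props(2)[OF tr] by (intro inv_into_into) (simp add: bij_betw_def)

lemma psi_iv: "\<psi> p (iv \<psi> p w) = w"
  using triv_props(2)[OF tr] by (intro f_inv_into_f) (simp add: bij_betw_def)

lemma iv_psi: "v \<in> E p \<Longrightarrow> iv \<psi> p (\<psi> p v) = v"
  using triv_props(2)[OF tr] by (intro inv_into_f_f) (simp add: bij_betw_def)

lemma psi_inj: "u \<in> E p \<Longrightarrow> v \<in> E p \<Longrightarrow> \<psi> p u = \<psi> p v \<Longrightarrow> u = v"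
  using triv_props(2)[OF tr] by (meson bij_betw_imp_inj_on inj_onD)

lemma psi_0: "\<psi> p 0 = 0"
  using triv_props(4)[OF tr E_closed(1), of 0] by simp

lemma psi_sum:
  "(\<And>i. i \<in> I \<Longrightarrow> x i \<in> E p) \<Longrightarrow> \<psi> p (\<Sum>i\<in>I. x i) = (\<Sum>i\<in>I. \<psi> p (x i))"
  by (induction I rule: infinite_finite_induct) (simp_all add: psi_0 triv_props(3)[OF tr] E_closed)

lemma psi_expand:
  assumes "v \<in> E p"
  shows "v = (\<Sum>j\<in>UNIV. sc (\<psi> p v $ j) (iv \<psi> p (axis j 1)))"
proof (rule psi_inj)
  show "\<psi> p v = \<psi> p (\<Sum>j\<in>UNIV. sc (\<psi> p v $ j) (iv \<psi> p (axis j 1)))"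
    by (subst psi_sum) (simp_all add: E_closed iv_in triv_props(4)[OF tr] psi_iv basis_expansion)
qed (simp_all add: assms E_closed iv_in)

end

definition lin_fun :: "'m \<Rightarrow> ('v \<Rightarrow> complex) \<Rightarrow> bool" where
  "lin_fun p l \<longleftrightarrow> (\<forall>u\<in>E p. \<forall>v\<in>E p. l (u + v) = l u + l v) \<and> (\<forall>c. \<forall>u\<in>E p. l (sc c u) = c * l u)"

lemma lin_fun_add: "lin_fun p l \<Longrightarrow> u \<in> E p \<Longrightarrow> v \<in> E p \<Longrightarrow> l (u + v) = l u + l v"
  and lin_fun_scale: "lin_fun p l \<Longrightarrow> u \<in> E p \<Longrightarrow> l (sc c u) = c * l u"
  by (simp_all add: lin_fun_def)

lemma lin_fun_0: "lin_fun p l \<Longrightarrow> l 0 = 0"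
  using lin_fun_scale[of p l 0 0] E_closed(1) by simp

lemma lin_fun_sum:
  assumes l: "lin_fun p l" and "\<And>i. i \<in> I \<Longrightarrow> x i \<in> E p"
  shows "l (\<Sum>i\<in>I. x i) = (\<Sum>i\<in>I. l (x i))"
  using assms(2)
  by (induction I rule: infinite_finite_induct) (simp_all add: lin_fun_0[OF l] lin_fun_add[OF l] E_closed)

definition sections_on :: "'m set \<Rightarrow> ('m \<Rightarrow> 'v) \<Rightarrow> bool" where
  "sections_on W x \<longleftrightarrow> (\<forall>p\<in>W. x p \<in> E p) \<and> (\<forall>(V, \<eta>)\<in>triv. smooth (V \<inter> W) (\<lambda>p. \<eta> p (x p)))"

text \<open>Smoothness of a section of the dual bundle, tested on the constant sections of each
  trivialization.\<close>

definition cosections_on :: "'m set \<Rightarrow> ('m \<Rightarrow> 'v \<Rightarrow> complex) \<Rightarrow> bool" where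
  "cosections_on W l \<longleftrightarrow> (\<forall>p\<in>W. lin_fun p (l p)) \<and>
     (\<forall>(V, \<eta>)\<in>triv. \<forall>w. smooth (V \<inter> W) (\<lambda>p. l p (iv \<eta> p w)))"

lemma sections_onI:
  "(\<And>p. p \<in> W \<Longrightarrow> x p \<in> E p) \<Longrightarrow> (\<And>V \<eta>. (V, \<eta>) \<in> triv \<Longrightarrow> smooth (V \<inter> W) (\<lambda>p. \<eta> p (x p))) \<Longrightarrow> sections_on W x"
  by (auto simp: sections_on_def)

lemma sections_onD:
  assumes "sections_on W x"
  shows "p \<in> W \<Longrightarrow> x p \<in> E p" "(V, \<eta>) \<in> triv \<Longrightarrow> smooth (V \<inter> W) (\<lambda>p. \<eta> p (x p))"
  using assms by (auto simp: sections_on_def)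

lemma cosections_onI:
  "(\<And>p. p \<in> W \<Longrightarrow> lin_fun p (l p)) \<Longrightarrow> (\<And>V \<eta> w. (V, \<eta>) \<in> triv \<Longrightarrow> smooth (V \<inter> W) (\<lambda>p. l p (iv \<eta> p w)))
    \<Longrightarrow> cosections_on W l"
  by (auto simp: cosections_on_def)

lemma cosections_onD:
  assumes "cosections_on W l"
  shows "p \<in> W \<Longrightarrow> lin_fun p (l p)" "(V, \<eta>) \<in> triv \<Longrightarrow> smooth (V \<inter> W) (\<lambda>p. l p (iv \<eta> p w))"
  using assms by (auto simp: cosections_on_def)

lemma sections_UNIV: "smooth_sections atlas E triv = {x. sections_on UNIV x}"
  by (auto simp: smooth_sections_def sections_on_def)

lemma sections_on_subset: "sections_on W x \<Longrightarrow> W' \<subseteq> W \<Longrightarrow> sections_on W' x"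
  by (rule sections_onI) (auto intro: sections_onD(1) smooth_subset[OF sections_onD(2)])

lemma sections_on_locally:
  assumes "\<And>p. p \<in> W \<Longrightarrow> \<exists>W'. open W' \<and> p \<in> W' \<and> sections_on W' x"
  shows "sections_on W x"
proof (rule sections_onI)
  fix p assume "p \<in> W"
  then obtain W' where "p \<in> W'" "sections_on W' x" using assms by meson
  then show "x p \<in> E p" by (intro sections_onD(1))
next
  fix V \<eta> assume V: "(V, \<eta>) \<in> triv"
  show "smooth (V \<inter> W) (\<lambda>p. \<eta> p (x p))"
  proof (rule smooth_locally)
    fix p assume p: "p \<in> V \<inter> W"
    then obtain W' where W': "open W'" "p \<in> W'" "sections_on W' x" using assms[of p] by auto
    show "\<exists>W'. open W' \<and> p \<in> W' \<and> smooth W' (\<lambda>p. \<eta> p (x p))"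
      using W' p sections_onD(2)[OF W'(3) V] triv_props(1)[OF V] by (intro exI[of _ "V \<inter> W'"]) (simp add: open_Int)
  qed
qed

lemma cosections_on_locally:
  assumes "\<And>p. p \<in> W \<Longrightarrow> \<exists>W'. open W' \<and> p \<in> W' \<and> cosections_on W' l"
  shows "cosections_on W l"
proof (rule cosections_onI)
  fix p assume "p \<in> W"
  then obtain W' where "p \<in> W'" "cosections_on W' l" using assms by meson
  then show "lin_fun p (l p)" by (intro cosections_onD(1))
next
  fix V \<eta> w assume V: "(V, \<eta>) \<in> triv"
  show "smooth (V \<inter> W) (\<lambda>p. l p (iv \<eta> p w))"
  proof (rule smooth_locally)
    fix p assume p: "p \<in> V \<inter> W"
    then obtain W' where W': "open W'" "p \<in> W'" "cosections_on W' l" using assms[of p] by auto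
    show "\<exists>W'. open W' \<and> p \<in> W' \<and> smooth W' (\<lambda>p. l p (iv \<eta> p w))"
      using W' p cosections_onD(2)[OF W'(3) V] triv_props(1)[OF V] by (intro exI[of _ "V \<inter> W'"]) (simp add: open_Int)
  qed
qed

lemma sections_on_cong:
  assumes "open W" "\<And>p. p \<in> W \<Longrightarrow> x p = y p" "sections_on W x"
  shows "sections_on W y"
proof (rule sections_onI)
  show "y p \<in> E p" if "p \<in> W" for p using sections_onD(1)[OF assms(3) that] assms(2)[OF that] by simp
  fix V \<eta> assume V: "(V, \<eta>) \<in> triv"
  show "smooth (V \<inter> W) (\<lambda>p. \<eta> p (y p))"
    by (rule smooth_cong[OF _ _ sections_onD(2)[OF assms(3) V]]) (use triv_props(1)[OF V] assms(1,2) in auto)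
qed

lemma cosections_on_cong:
  assumes "open W" "\<And>p v. p \<in> W \<Longrightarrow> v \<in> E p \<Longrightarrow> l p v = m p v" "cosections_on W l"
  shows "cosections_on W m"
proof (rule cosections_onI)
  show "lin_fun p (m p)" if "p \<in> W" for p
    using cosections_onD(1)[OF assms(3) that] assms(2)[OF that] by (simp add: lin_fun_def E_closed)
  fix V \<eta> w assume V: "(V, \<eta>) \<in> triv"
  show "smooth (V \<inter> W) (\<lambda>p. m p (iv \<eta> p w))"
    by (rule smooth_cong[OF _ _ cosections_onD(2)[OF assms(3) V]])
      (use triv_props(1)[OF V] assms(1,2) iv_in[OF V] in auto)
qed

lemma sections_on_zero: "open W \<Longrightarrow> sections_on W (\<lambda>_. 0)"
proof (rule sections_onI)
  fix V \<eta> assume "open W" and V: "(V, \<eta>) \<in> triv"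
  then show "smooth (V \<inter> W) (\<lambda>p. \<eta> p 0)"
    by (intro smooth_cong[OF _ _ smooth_const[of _ 0]]) (auto simp: psi_0[OF V] triv_props(1)[OF V])
qed (rule E_closed)

lemma sections_on_add:
  assumes "open W" "sections_on W x" "sections_on W y"
  shows "sections_on W (\<lambda>p. x p + y p)"
proof (rule sections_onI)
  fix V \<eta> assume V: "(V, \<eta>) \<in> triv"
  have o: "open (V \<inter> W)" using triv_props(1)[OF V] assms(1) by auto
  show "smooth (V \<inter> W) (\<lambda>p. \<eta> p (x p + y p))"
    by (rule smooth_cong[OF o _ smooth_add[OF o sections_onD(2)[OF assms(2) V] sections_onD(2)[OF assms(3) V]]])
      (auto simp: triv_props(3)[OF V] sections_onD(1)[OF assms(2)] sections_onD(1)[OF assms(3)])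
qed (intro E_closed sections_onD(1)[OF assms(2)] sections_onD(1)[OF assms(3)])

lemma sections_on_scale:
  assumes "open W" "smooth W f" "sections_on W x"
  shows "sections_on W (\<lambda>p. sc (f p) (x p))"
proof (rule sections_onI)
  fix V \<eta> assume V: "(V, \<eta>) \<in> triv"
  have o: "open (V \<inter> W)" using triv_props(1)[OF V] assms(1) by auto
  have f: "smooth (V \<inter> W) f" by (rule smooth_subset[OF assms(2)]) simp
  show "smooth (V \<inter> W) (\<lambda>p. \<eta> p (sc (f p) (x p)))"
    by (rule smooth_cong[OF o _ smooth_bilinear[OF o bounded_bilinear_vector_scalar f sections_onD(2)[OF assms(3) V]]])
      (auto simp: triv_props(4)[OF V] sections_onD(1)[OF assms(3)])
qed (intro E_closed sections_onD(1)[OF assms(3)])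

lemma sections_on_sum:
  assumes "open W" "\<And>i. i \<in> I \<Longrightarrow> sections_on W (x i)"
  shows "sections_on W (\<lambda>p. \<Sum>i\<in>I. x i p)"
  using assms(2)
  by (induction I rule: infinite_finite_induct) (simp_all add: sections_on_zero sections_on_add assms(1))

lemma cosections_on_zero: "cosections_on W (\<lambda>_ _. 0)"
  by (rule cosections_onI) (simp_all add: lin_fun_def smooth_const)

lemma cosections_on_add:
  assumes "open W" "cosections_on W x" "cosections_on W y"
  shows "cosections_on W (\<lambda>p v. x p v + y p v)"
proof (rule cosections_onI)
  show "lin_fun p (\<lambda>v. x p v + y p v)" if "p \<in> W" for p
    using cosections_onD(1)[OF assms(2) that] cosections_onD(1)[OF assms(3) that]
    by (simp add: lin_fun_def algebra_simps)
  fix V \<eta> w assume V: "(V, \<eta>) \<in> triv"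
  have o: "open (V \<inter> W)" using triv_props(1)[OF V] assms(1) by auto
  show "smooth (V \<inter> W) (\<lambda>p. x p (iv \<eta> p w) + y p (iv \<eta> p w))"
    by (intro smooth_add[OF o] cosections_onD(2)[OF assms(2) V] cosections_onD(2)[OF assms(3) V])
qed

lemma cosections_on_scale:
  assumes "open W" "smooth W f" "cosections_on W x"
  shows "cosections_on W (\<lambda>p v. f p * x p v)"
proof (rule cosections_onI)
  show "lin_fun p (\<lambda>v. f p * x p v)" if "p \<in> W" for p
    using cosections_onD(1)[OF assms(3) that] by (simp add: lin_fun_def algebra_simps)
  fix V \<eta> w assume V: "(V, \<eta>) \<in> triv"
  have o: "open (V \<inter> W)" using triv_props(1)[OF V] assms(1) by auto
  have f: "smooth (V \<inter> W) f" by (rule smooth_subset[OF assms(2)]) simp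
  show "smooth (V \<inter> W) (\<lambda>p. f p * x p (iv \<eta> p w))"
    by (intro smooth_bilinear[OF o bounded_bilinear_mult f] cosections_onD(2)[OF assms(3) V])
qed

lemma cosections_on_sum:
  assumes "open W" "\<And>i. i \<in> I \<Longrightarrow> cosections_on W (x i)"
  shows "cosections_on W (\<lambda>p v. \<Sum>i\<in>I. x i p v)"
  using assms(2)
  by (induction I rule: infinite_finite_induct) (simp_all add: cosections_on_zero cosections_on_add assms(1))

text \<open>One trivialization suffices: in any other one the section is the combination of the
  finitely many transported basis sections, with smooth coefficients.\<close>

lemma sections_on_triv:
  assumes U: "(U, \<psi>) \<in> triv" and W: "open W" "W \<subseteq> U" and x: "\<And>p. p \<in> W \<Longrightarrow> x p \<in> E p"
    and s: "smooth W (\<lambda>p. \<psi> p (x p))"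
  shows "sections_on W x"
proof (rule sections_onI[OF x])
  fix V \<eta> assume V: "(V, \<eta>) \<in> triv"
  have o: "open (V \<inter> W)" using triv_props(1)[OF V] W(1) by auto
  have *: "smooth (V \<inter> W) (\<lambda>p. (\<psi> p (x p) $ j) *s \<eta> p (iv \<psi> p (axis j 1)))" for j
    by (intro smooth_bilinear[OF o bounded_bilinear_vector_scalar] smooth_linear[OF o bounded_linear_vec_nth]
        smooth_subset[OF s] smooth_subset[OF triv_transition[OF U V]]) (use W in auto)
  show "smooth (V \<inter> W) (\<lambda>p. \<eta> p (x p))"
  proof (rule smooth_cong[OF o _ smooth_sum[OF o *]])
    fix p assume p: "p \<in> V \<inter> W"
    then have pU: "p \<in> U" and pV: "p \<in> V" using W by auto
    have "\<eta> p (x p) = \<eta> p (\<Sum>j\<in>UNIV. sc (\<psi> p (x p) $ j) (iv \<psi> p (axis j 1)))"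
      using psi_expand[OF U pU x] p by simp
    also have "\<dots> = (\<Sum>j\<in>UNIV. (\<psi> p (x p) $ j) *s \<eta> p (iv \<psi> p (axis j 1)))"
      by (subst psi_sum[OF V pV]) (simp_all add: E_closed iv_in[OF U pU] triv_props(4)[OF V pV])
    finally show "(\<Sum>j\<in>UNIV. (\<psi> p (x p) $ j) *s \<eta> p (iv \<psi> p (axis j 1))) = \<eta> p (x p)" by (rule sym)
  qed
qed

lemma cosection_apply:
  assumes W: "open W" and l: "cosections_on W l" and x: "sections_on W x"
  shows "smooth W (\<lambda>p. l p (x p))"
proof (rule smooth_locally)
  fix p assume p: "p \<in> W"
  obtain U \<psi> where U: "(U, \<psi>) \<in> triv" "p \<in> U" using triv_at[of p] by (elim exE conjE) (rule that)
  have o: "open (U \<inter> W)" using triv_props(1)[OF U(1)] W by auto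
  have *: "smooth (U \<inter> W) (\<lambda>p. (\<psi> p (x p) $ j) * l p (iv \<psi> p (axis j 1)))" for j
    by (intro smooth_bilinear[OF o bounded_bilinear_mult] smooth_linear[OF o bounded_linear_vec_nth]
        sections_onD(2)[OF x U(1)] cosections_onD(2)[OF l U(1)])
  have "smooth (U \<inter> W) (\<lambda>p. l p (x p))"
  proof (rule smooth_cong[OF o _ smooth_sum[OF o *]])
    fix p assume "p \<in> U \<inter> W"
    then have p: "p \<in> U" "p \<in> W" by auto
    note xp = sections_onD(1)[OF x p(2)] and lp = cosections_onD(1)[OF l p(2)]
    have "l p (x p) = l p (\<Sum>j\<in>UNIV. sc (\<psi> p (x p) $ j) (iv \<psi> p (axis j 1)))"
      using psi_expand[OF U(1) p(1) xp] by simp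
    also have "\<dots> = (\<Sum>j\<in>UNIV. (\<psi> p (x p) $ j) * l p (iv \<psi> p (axis j 1)))"
      by (subst lin_fun_sum[OF lp]) (simp_all add: E_closed iv_in[OF U(1) p(1)] lin_fun_scale[OF lp])
    finally show "(\<Sum>j\<in>UNIV. (\<psi> p (x p) $ j) * l p (iv \<psi> p (axis j 1))) = l p (x p)" by (rule sym)
  qed
  then show "\<exists>W'. open W' \<and> p \<in> W' \<and> smooth W' (\<lambda>p. l p (x p))"
    using o p U(2) by (intro exI[of _ "U \<inter> W"]) simp
qed

section \<open>Gluing local frames to a finite global frame\<close>

definition local_frame :: "'m set \<Rightarrow> ('n \<Rightarrow> 'm \<Rightarrow> 'v) \<Rightarrow> ('n \<Rightarrow> 'm \<Rightarrow> 'v \<Rightarrow> complex) \<Rightarrow> bool" where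
  "local_frame W s l \<longleftrightarrow> open W \<and> (\<forall>k. sections_on W (s k)) \<and> (\<forall>k. cosections_on W (l k)) \<and>
     (\<forall>p\<in>W. \<forall>v\<in>E p. (\<Sum>k\<in>UNIV. sc (l k p v) (s k p)) = v)"

lemma triv_frame:
  assumes U: "(U, \<psi>) \<in> triv"
  shows "local_frame U (\<lambda>k p. iv \<psi> p (axis k 1)) (\<lambda>k p v. \<psi> p v $ k)"
  unfolding local_frame_def
proof (intro conjI allI ballI)
  show o: "open U" by (rule triv_props(1)[OF U])
  fix k
  show "sections_on U (\<lambda>p. iv \<psi> p (axis k 1))"
  proof (rule sections_on_triv[OF U o order_refl iv_in[OF U]])
    show "smooth U (\<lambda>p. \<psi> p (iv \<psi> p (axis k 1)))"
      by (rule smooth_cong[OF o _ smooth_const[of _ "axis k 1"]]) (simp add: psi_iv[OF U])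
  qed
  show "cosections_on U (\<lambda>p v. \<psi> p v $ k)"
  proof (rule cosections_onI)
    show "lin_fun p (\<lambda>v. \<psi> p v $ k)" if "p \<in> U" for p
      by (simp add: lin_fun_def triv_props(3,4)[OF U that])
    fix V \<eta> w assume V: "(V, \<eta>) \<in> triv"
    have "open (V \<inter> U)" using o triv_props(1)[OF V] by auto
    then show "smooth (V \<inter> U) (\<lambda>p. \<psi> p (iv \<eta> p w) $ k)"
      by (intro smooth_linear[OF _ bounded_linear_vec_nth] triv_transition[OF V U])
  qed
next
  fix p v assume "p \<in> U" "v \<in> E p"
  then show "(\<Sum>k\<in>UNIV. sc (\<psi> p v $ k) (iv \<psi> p (axis k 1))) = v"
    by (rule psi_expand[OF U, symmetric])
qed

lemma cosections_on_subset: "cosections_on W l \<Longrightarrow> W' \<subseteq> W \<Longrightarrow> cosections_on W' l"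
  by (rule cosections_onI) (auto intro: cosections_onD(1) smooth_subset[OF cosections_onD(2)])

text \<open>On \<open>W\<close> the result is a smooth multiple of \<open>s\<close>, on the
  complement of the closed set \<open>K\<close> it is zero, and these two open sets cover the
  manifold.\<close>

lemma cut_off_section:
  assumes K: "compact K" "K \<subseteq> W" and W: "open W" and f: "smooth W f" "\<And>p. p \<in> W \<Longrightarrow> p \<notin> K \<Longrightarrow> f p = 0"
    and s: "sections_on W s"
  shows "sections_on UNIV (\<lambda>p. if p \<in> K then sc (f p) (s p) else 0)"
proof (rule sections_on_locally)
  fix p
  have oK: "open (- K)" using compact_imp_closed[OF K(1)] by (rule open_Compl)
  have 1: "sections_on W (\<lambda>p. if p \<in> K then sc (f p) (s p) else 0)"
    by (rule sections_on_cong[OF W _ sections_on_scale[OF W f(1) s]]) (simp add: f(2))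
  have 2: "sections_on (- K) (\<lambda>p. if p \<in> K then sc (f p) (s p) else 0)"
    by (rule sections_on_cong[OF oK _ sections_on_zero[OF oK]]) simp
  show "\<exists>W'. open W' \<and> p \<in> W' \<and> sections_on W' (\<lambda>p. if p \<in> K then sc (f p) (s p) else 0)"
  proof (cases "p \<in> K")
    case True
    then show ?thesis using 1 W K by (intro exI[of _ W]) auto
  next
    case False
    then show ?thesis using 2 oK by (intro exI[of _ "- K"]) simp
  qed
qed

lemma cut_off_cosection:
  assumes K: "compact K" "K \<subseteq> W" and W: "open W" and f: "smooth W f" "\<And>p. p \<in> W \<Longrightarrow> p \<notin> K \<Longrightarrow> f p = 0"
    and l: "cosections_on W l"
  shows "cosections_on UNIV (\<lambda>p v. if p \<in> K then f p * l p v else 0)"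
proof (rule cosections_on_locally)
  fix p
  have oK: "open (- K)" using compact_imp_closed[OF K(1)] by (rule open_Compl)
  have 1: "cosections_on W (\<lambda>p v. if p \<in> K then f p * l p v else 0)"
    by (rule cosections_on_cong[OF W _ cosections_on_scale[OF W f(1) l]]) (simp add: f(2))
  have 2: "cosections_on (- K) (\<lambda>p v. if p \<in> K then f p * l p v else 0)"
    by (rule cosections_on_cong[OF oK _ cosections_on_zero]) simp
  show "\<exists>W'. open W' \<and> p \<in> W' \<and> cosections_on W' (\<lambda>p v. if p \<in> K then f p * l p v else 0)"
  proof (cases "p \<in> K")
    case True
    then show ?thesis using 1 W K by (intro exI[of _ W]) auto
  next
    case False
    then show ?thesis using 2 oK by (intro exI[of _ "- K"]) simp
  qed
qed

text \<open>Pieces of the same colour are disjoint, so their cut-off frames add up to global sections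
  without interfering; one section per colour and frame index suffices.\<close>

theorem global_frame:
  fixes \<S> :: "('m set \<times> ('n \<Rightarrow> 'm \<Rightarrow> 'v) \<times> ('n \<Rightarrow> 'm \<Rightarrow> 'v \<Rightarrow> complex)) set"
  assumes LF: "\<And>W s m. (W, s, m) \<in> \<S> \<Longrightarrow> local_frame W s m"
    and cov: "\<And>p. \<exists>W s m. (W, s, m) \<in> \<S> \<and> p \<in> W"
  shows "\<exists>(I :: ((nat \<times> 'e set) \<times> 'n) set) e l. finite I \<and> (\<forall>i\<in>I. sections_on UNIV (e i)) \<and>
    (\<forall>i\<in>I. cosections_on UNIV (l i)) \<and> (\<forall>p. \<forall>v\<in>E p. (\<Sum>i\<in>I. sc (l i p v) (e i p)) = v) \<and>
    (\<forall>i\<in>I. \<forall>p. \<exists>W s m k t. (W, s, m) \<in> \<S> \<and> p \<in> W \<and> e i p = sc (of_real t) (s k p) \<and>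
       (\<forall>v\<in>E p. l i p v = of_real t * m k p v))"
proof -
  have op: "\<And>W. W \<in> fst ` \<S> \<Longrightarrow> open W"
  proof -
    fix W assume "W \<in> fst ` \<S>"
    then obtain s m where "(W, s, m) \<in> \<S>" by auto
    then show "open W" using LF by (simp add: local_frame_def)
  qed
  have cov': "\<Union>(fst ` \<S>) = UNIV"
  proof (rule UNIV_eq_I[symmetric])
    fix p
    obtain W s m where "(W, s, m) \<in> \<S>" "p \<in> W" using cov[of p] by (elim exE conjE) (rule that)
    then show "p \<in> \<Union>(fst ` \<S>)" by force
  qed
  have "\<exists>(\<Gamma> :: (nat \<times> 'e set) set) (\<Q> :: nat \<times> 'e set \<Rightarrow> (nat \<times> 'e set \<times> 'm set) set) K \<beta> W.
      pieces (fst ` \<S>) \<Gamma> \<Q> K \<beta> W"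
  proof (rule pieces_exist)
    show "open W" if "W \<in> fst ` \<S>" for W by (rule op[OF that])
  qed (rule cov')
  then obtain \<Gamma> :: "(nat \<times> 'e set) set" and \<Q> :: "nat \<times> 'e set \<Rightarrow> (nat \<times> 'e set \<times> 'm set) set" and K \<beta> W
    where P: "pieces (fst ` \<S>) \<Gamma> \<Q> K \<beta> W" by (elim exE)
  have fin\<Gamma>: "finite \<Gamma>" using P unfolding pieces_def by (elim conjE)
  have piece: "compact (K \<tau>)" "K \<tau> \<subseteq> W \<tau>" "W \<tau> \<in> fst ` \<S>" "smooth UNIV (\<beta> \<tau>)" "\<beta> \<tau> p \<ge> 0"
    "p \<notin> K \<tau> \<Longrightarrow> \<beta> \<tau> p = 0" if "\<gamma> \<in> \<Gamma>" "\<tau> \<in> \<Q> \<gamma>" for \<gamma> \<tau> p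
    using P that unfolding pieces_def by simp_all
  have disj: "K \<tau> \<inter> K \<tau>' = {}" if "\<gamma> \<in> \<Gamma>" "\<tau> \<in> \<Q> \<gamma>" "\<tau>' \<in> \<Q> \<gamma>" "\<tau> \<noteq> \<tau>'" for \<gamma> \<tau> \<tau>'
    using P that unfolding pieces_def by simp
  have locfin: "\<exists>G. open G \<and> p \<in> G \<and> (\<forall>\<gamma>\<in>\<Gamma>. finite {\<tau>\<in>\<Q> \<gamma>. K \<tau> \<inter> G \<noteq> {}})" for p
    using P unfolding pieces_def by simp
  have pos: "\<exists>\<gamma>\<in>\<Gamma>. \<exists>\<tau>\<in>\<Q> \<gamma>. \<beta> \<tau> p > 0" for p
    using P unfolding pieces_def by simp
  have "\<forall>W\<in>fst ` \<S>. \<exists>sm. (W, sm) \<in> \<S>"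
  proof
    fix W assume "W \<in> fst ` \<S>"
    then obtain x where "x \<in> \<S>" "W = fst x" by (elim imageE) (rule that)
    then have "(W, snd x) \<in> \<S>" by simp
    then show "\<exists>sm. (W, sm) \<in> \<S>" by (rule exI)
  qed
  from bchoice[OF this] obtain sm where sm: "\<forall>W\<in>fst ` \<S>. (W, sm W) \<in> \<S>" by (elim exE)
  define s where "s \<tau> = fst (sm (W \<tau>))" for \<tau>
  define m where "m \<tau> = snd (sm (W \<tau>))" for \<tau>
  have in\<S>: "(W \<tau>, s \<tau>, m \<tau>) \<in> \<S>" if "\<gamma> \<in> \<Gamma>" "\<tau> \<in> \<Q> \<gamma>" for \<gamma> \<tau>
    using bspec[OF sm piece(3)[OF that]] by (simp add: s_def m_def)
  have lf: "open (W \<tau>)" "sections_on (W \<tau>) (s \<tau> k)" "cosections_on (W \<tau>) (m \<tau> k)"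
    "p \<in> W \<tau> \<Longrightarrow> v \<in> E p \<Longrightarrow> (\<Sum>k\<in>UNIV. sc (m \<tau> k p v) (s \<tau> k p)) = v"
    if "\<gamma> \<in> \<Gamma>" "\<tau> \<in> \<Q> \<gamma>" for \<gamma> \<tau> k p v
    using LF[OF in\<S>[OF that]] by (simp_all add: local_frame_def)
  \<comment> \<open>The pieces of one colour at a point: at most one, by disjointness, so that
    products of sums over \<open>T\<close> have no mixed terms.\<close>
  define T where "T \<gamma> p = {\<tau>\<in>\<Q> \<gamma>. p \<in> K \<tau>}" for \<gamma> p
  have T: "T \<gamma> p = {} \<or> (\<exists>\<tau>\<in>\<Q> \<gamma>. T \<gamma> p = {\<tau>} \<and> p \<in> K \<tau>)" if "\<gamma> \<in> \<Gamma>" for \<gamma> p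
  proof (cases "T \<gamma> p = {}")
    case False
    then obtain \<tau> where \<tau>: "\<tau> \<in> \<Q> \<gamma>" "p \<in> K \<tau>" by (auto simp: T_def)
    have \<tau>T: "\<tau> \<in> T \<gamma> p" using \<tau> by (simp add: T_def)
    have eq: "\<tau>' = \<tau>" if "\<tau>' \<in> T \<gamma> p" for \<tau>'
    proof (rule ccontr)
      assume "\<tau>' \<noteq> \<tau>"
      then have "K \<tau>' \<inter> K \<tau> = {}" using disj[OF \<open>\<gamma> \<in> \<Gamma>\<close>, of \<tau>' \<tau>] that \<tau>(1) by (simp add: T_def)
      moreover have "p \<in> K \<tau>' \<inter> K \<tau>" using that \<tau>(2) by (simp add: T_def)
      ultimately show False by simp
    qed
    have "T \<gamma> p = {\<tau>}"
      by (rule equalityI) (rule subsetI, drule eq, simp, simp add: \<tau>T)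
    then show ?thesis using \<tau> by (intro disjI2 bexI[of _ \<tau>] conjI)
  qed simp
  have T_ex: "\<exists>\<tau>\<in>\<Q> \<gamma>. T \<gamma> p = {\<tau>} \<and> p \<in> K \<tau>" if \<gamma>: "\<gamma> \<in> \<Gamma>" and ne: "T \<gamma> p \<noteq> {}" for \<gamma> p
  proof (rule disjE[OF T[OF \<gamma>, of p]])
    assume "T \<gamma> p = {}"
    with ne show ?thesis by (rule notE)
  qed
  have T_eq: "T \<gamma> p = {\<tau>}" if \<gamma>: "\<gamma> \<in> \<Gamma>" and \<tau>: "\<tau> \<in> T \<gamma> p" for \<gamma> \<tau> p
  proof -
    have "T \<gamma> p \<noteq> {}" using \<tau> by (metis emptyE)
    from T_ex[OF \<gamma> this] obtain \<tau>' where "T \<gamma> p = {\<tau>'}" by (elim bexE conjE) (rule that)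
    then show ?thesis using \<tau> by simp
  qed
  have T_sum: "(\<Sum>\<tau>\<in>T \<gamma> p. g \<tau>) = (\<Sum>\<tau>\<in>{\<tau>\<in>\<Q> \<gamma>. K \<tau> \<inter> G \<noteq> {}}. if p \<in> K \<tau> then g \<tau> else 0)"
    if "finite {\<tau>\<in>\<Q> \<gamma>. K \<tau> \<inter> G \<noteq> {}}" "p \<in> G" for \<gamma> G p and g :: "_ \<Rightarrow> 'x::comm_monoid_add"
  proof -
    have "(\<Sum>\<tau>\<in>T \<gamma> p. g \<tau>) = (\<Sum>\<tau>\<in>T \<gamma> p. if p \<in> K \<tau> then g \<tau> else 0)"
      by (rule sum.cong) (simp_all add: T_def)
    also have "\<dots> = (\<Sum>\<tau>\<in>{\<tau>\<in>\<Q> \<gamma>. K \<tau> \<inter> G \<noteq> {}}. if p \<in> K \<tau> then g \<tau> else 0)"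
      by (rule sum.mono_neutral_left[OF that(1)]) (use that(2) in \<open>auto simp: T_def\<close>)
    finally show ?thesis .
  qed
  \<comment> \<open>Squares, because the factor of a piece will be shared equally between section
    and cosection.\<close>
  define S where "S p = (\<Sum>\<gamma>\<in>\<Gamma>. \<Sum>\<tau>\<in>T \<gamma> p. \<beta> \<tau> p * \<beta> \<tau> p)" for p
  have S_smooth: "smooth UNIV S"
  proof (rule smooth_locally)
    fix p
    obtain G where G: "open G" "p \<in> G" "\<forall>\<gamma>\<in>\<Gamma>. finite {\<tau>\<in>\<Q> \<gamma>. K \<tau> \<inter> G \<noteq> {}}"
      using locfin[of p] by (elim exE conjE) (rule that)
    let ?g = "\<lambda>p. \<Sum>\<gamma>\<in>\<Gamma>. \<Sum>\<tau>\<in>{\<tau>\<in>\<Q> \<gamma>. K \<tau> \<inter> G \<noteq> {}}. \<beta> \<tau> p * \<beta> \<tau> p"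
    have "smooth G ?g"
    proof (intro smooth_sum G(1))
      fix \<gamma> \<tau> assume "\<gamma> \<in> \<Gamma>" "\<tau> \<in> {\<tau>\<in>\<Q> \<gamma>. K \<tau> \<inter> G \<noteq> {}}"
      then have sm: "smooth G (\<beta> \<tau>)" by (intro smooth_subset[OF piece(4)[of \<gamma> \<tau>] subset_UNIV]) simp_all
      show "smooth G (\<lambda>p. \<beta> \<tau> p * \<beta> \<tau> p)"
        by (rule smooth_bilinear[OF G(1) bounded_bilinear_mult sm sm])
    qed
    moreover have "?g q = S q" if "q \<in> G" for q
      unfolding S_def
    proof (rule sum.cong[OF refl])
      fix \<gamma> assume \<gamma>: "\<gamma> \<in> \<Gamma>"
      show "(\<Sum>\<tau>\<in>{\<tau>\<in>\<Q> \<gamma>. K \<tau> \<inter> G \<noteq> {}}. \<beta> \<tau> q * \<beta> \<tau> q) = (\<Sum>\<tau>\<in>T \<gamma> q. \<beta> \<tau> q * \<beta> \<tau> q)"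
        by (subst T_sum[OF bspec[OF G(3) \<gamma>] that]) (rule sum.cong, simp_all add: piece(6)[OF \<gamma>])
    qed
    ultimately have "smooth G S" by (intro smooth_cong[OF G(1), of ?g S])
    then show "\<exists>W'. open W' \<and> p \<in> W' \<and> smooth W' S" using G(1,2) by (intro exI[of _ G]) simp
  qed
  have S_pos: "S p > 0" for p
  proof -
    obtain \<gamma> \<tau> where \<gamma>: "\<gamma> \<in> \<Gamma>" "\<tau> \<in> \<Q> \<gamma>" "\<beta> \<tau> p > 0" using pos[of p] by (elim bexE) (rule that)
    have "p \<in> K \<tau>"
    proof (rule ccontr)
      assume "p \<notin> K \<tau>"
      then have "\<beta> \<tau> p = 0" by (rule piece(6)[OF \<gamma>(1,2)])
      with \<gamma>(3) show False by simp
    qed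
    then have "\<tau> \<in> T \<gamma> p" using \<gamma> by (simp add: T_def)
    then have "T \<gamma> p = {\<tau>}" by (rule T_eq[OF \<gamma>(1)])
    then have "(\<Sum>\<tau>\<in>T \<gamma> p. \<beta> \<tau> p * \<beta> \<tau> p) > 0" using \<gamma>(3) by simp
    then show ?thesis
      unfolding S_def by (intro sum_pos2[OF fin\<Gamma> \<gamma>(1)] sum_nonneg) (simp_all only: zero_le_square)
  qed
  \<comment> \<open>The inverse square root of \<open>S\<close>, smooth since \<open>S\<close> is
    positive everywhere. The rescaled bump functions then have squares summing to 1, and they are
    real.\<close>
  define \<rho> where "\<rho> p = S p powr (- 1 / 2)" for p
  have \<rho>_smooth: "smooth UNIV \<rho>"
    unfolding \<rho>_def
    by (rule smooth_real_compose[OF open_UNIV _ _ Cinf_on_powr S_smooth]) (simp_all add: S_pos)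
  have \<rho>_sq: "\<rho> p * \<rho> p * S p = 1" for p
  proof -
    have "\<rho> p * \<rho> p = S p powr (- 1)" unfolding \<rho>_def by (simp add: powr_add[symmetric])
    then show ?thesis using S_pos[of p] by (simp add: powr_minus)
  qed
  define f where "f \<tau> p = complex_of_real (\<rho> p * \<beta> \<tau> p)" for \<tau> p
  have f_smooth: "smooth UNIV (f \<tau>)" if "\<gamma> \<in> \<Gamma>" "\<tau> \<in> \<Q> \<gamma>" for \<gamma> \<tau>
    unfolding f_def
    by (intro smooth_linear[OF open_UNIV bounded_linear_of_real] smooth_bilinear[OF open_UNIV bounded_bilinear_mult]
        \<rho>_smooth piece(4)[OF that])
  define e where "e i p = (\<Sum>\<tau>\<in>T (fst i) p. sc (f \<tau> p) (s \<tau> (snd i) p))" for i p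
  define l where "l i p v = (\<Sum>\<tau>\<in>T (fst i) p. f \<tau> p * m \<tau> (snd i) p v)" for i p v
  let ?I = "\<Gamma> \<times> (UNIV :: 'n set)"
  have piece_sec: "sections_on UNIV (\<lambda>p. if p \<in> K \<tau> then sc (f \<tau> p) (s \<tau> k p) else 0)"
    and piece_cosec: "cosections_on UNIV (\<lambda>p v. if p \<in> K \<tau> then f \<tau> p * m \<tau> k p v else 0)"
    if \<gamma>: "\<gamma> \<in> \<Gamma>" "\<tau> \<in> \<Q> \<gamma>" for \<gamma> \<tau> k
  proof -
    have fs: "smooth (W \<tau>) (f \<tau>)" by (rule smooth_subset[OF f_smooth[OF \<gamma>] subset_UNIV])
    have fz: "f \<tau> p = 0" if "p \<in> W \<tau>" "p \<notin> K \<tau>" for p by (simp add: f_def piece(6)[OF \<gamma> that(2)])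
    show "sections_on UNIV (\<lambda>p. if p \<in> K \<tau> then sc (f \<tau> p) (s \<tau> k p) else 0)"
      by (rule cut_off_section[OF piece(1)[OF \<gamma>] piece(2)[OF \<gamma>] lf(1)[OF \<gamma>] fs fz lf(2)[OF \<gamma>]])
    show "cosections_on UNIV (\<lambda>p v. if p \<in> K \<tau> then f \<tau> p * m \<tau> k p v else 0)"
      by (rule cut_off_cosection[OF piece(1)[OF \<gamma>] piece(2)[OF \<gamma>] lf(1)[OF \<gamma>] fs fz lf(3)[OF \<gamma>]])
  qed
  have e_sec: "sections_on UNIV (e i)" if i: "i \<in> ?I" for i
  proof (rule sections_on_locally)
    fix p
    have \<gamma>: "fst i \<in> \<Gamma>" using i by auto
    obtain G where G: "open G" "p \<in> G" "\<forall>\<gamma>\<in>\<Gamma>. finite {\<tau>\<in>\<Q> \<gamma>. K \<tau> \<inter> G \<noteq> {}}"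
      using locfin[of p] by (elim exE conjE) (rule that)
    have "sections_on G (\<lambda>p. \<Sum>\<tau>\<in>{\<tau>\<in>\<Q> (fst i). K \<tau> \<inter> G \<noteq> {}}. if p \<in> K \<tau> then sc (f \<tau> p) (s \<tau> (snd i) p) else 0)"
      by (intro sections_on_sum G(1) sections_on_subset[OF piece_sec[OF \<gamma>] subset_UNIV]) simp
    then have "sections_on G (e i)"
      by (rule sections_on_cong[OF G(1), rotated])
        (simp only: e_def T_sum[OF bspec[OF G(3) \<gamma>]])
    then show "\<exists>W'. open W' \<and> p \<in> W' \<and> sections_on W' (e i)" using G(1,2) by (intro exI[of _ G]) simp
  qed
  have l_sec: "cosections_on UNIV (l i)" if i: "i \<in> ?I" for i
  proof (rule cosections_on_locally)
    fix p
    have \<gamma>: "fst i \<in> \<Gamma>" using i by auto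
    obtain G where G: "open G" "p \<in> G" "\<forall>\<gamma>\<in>\<Gamma>. finite {\<tau>\<in>\<Q> \<gamma>. K \<tau> \<inter> G \<noteq> {}}"
      using locfin[of p] by (elim exE conjE) (rule that)
    have "cosections_on G (\<lambda>p v. \<Sum>\<tau>\<in>{\<tau>\<in>\<Q> (fst i). K \<tau> \<inter> G \<noteq> {}}. if p \<in> K \<tau> then f \<tau> p * m \<tau> (snd i) p v else 0)"
    proof (intro cosections_on_sum G(1))
      fix \<tau> assume "\<tau> \<in> {\<tau>\<in>\<Q> (fst i). K \<tau> \<inter> G \<noteq> {}}"
      then have "\<tau> \<in> \<Q> (fst i)" by simp
      from piece_cosec[OF \<gamma> this, of "snd i"]
      show "cosections_on G (\<lambda>p v. if p \<in> K \<tau> then f \<tau> p * m \<tau> (snd i) p v else 0)"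
        by (rule cosections_on_subset) simp
    qed
    then have "cosections_on G (l i)"
    proof (rule cosections_on_cong[OF G(1), rotated])
      fix q v assume "q \<in> G"
      then show "(\<Sum>\<tau>\<in>{\<tau>\<in>\<Q> (fst i). K \<tau> \<inter> G \<noteq> {}}. if q \<in> K \<tau> then f \<tau> q * m \<tau> (snd i) q v else 0) = l i q v"
        by (simp only: l_def T_sum[OF bspec[OF G(3) \<gamma>]])
    qed
    then show "\<exists>W'. open W' \<and> p \<in> W' \<and> cosections_on W' (l i)" using G(1,2) by (intro exI[of _ G]) simp
  qed
  have recon: "(\<Sum>i\<in>?I. sc (l i p v) (e i p)) = v" if v: "v \<in> E p" for p v
  proof -
    \<comment> \<open>A single colour already reproduces \<open>v\<close>, up to the square of the
      bump function of the one piece at \<open>p\<close>.\<close>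
    have "(\<Sum>k\<in>UNIV. sc (l (\<gamma>, k) p v) (e (\<gamma>, k) p)) = sc (\<Sum>\<tau>\<in>T \<gamma> p. f \<tau> p * f \<tau> p) v" if \<gamma>: "\<gamma> \<in> \<Gamma>" for \<gamma>
    proof (cases "T \<gamma> p = {}")
      case True
      then show ?thesis by (simp add: e_def l_def)
    next
      case False
      from T_ex[OF \<gamma> this] obtain \<tau> where \<tau>: "\<tau> \<in> \<Q> \<gamma>" "T \<gamma> p = {\<tau>}" "p \<in> K \<tau>"
        by (elim bexE conjE) (rule that)
      have "(\<Sum>k\<in>UNIV. sc (l (\<gamma>, k) p v) (e (\<gamma>, k) p)) = (\<Sum>k\<in>UNIV. sc (f \<tau> p * f \<tau> p) (sc (m \<tau> k p v) (s \<tau> k p)))"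
        by (rule sum.cong) (simp_all add: e_def l_def \<tau>(2) mult_ac)
      also have "\<dots> = sc (f \<tau> p * f \<tau> p) v"
        using lf(4)[OF \<gamma> \<tau>(1) subsetD[OF piece(2)[OF \<gamma> \<tau>(1)] \<tau>(3)] v] by (simp only: vs.scale_sum_right[symmetric])
      finally show ?thesis by (simp add: \<tau>(2))
    qed
    note slice = this
    have "(\<Sum>i\<in>?I. sc (l i p v) (e i p)) = (\<Sum>\<gamma>\<in>\<Gamma>. \<Sum>k\<in>UNIV. sc (l (\<gamma>, k) p v) (e (\<gamma>, k) p))"
      by (simp add: sum.cartesian_product case_prod_unfold)
    also have "\<dots> = (\<Sum>\<gamma>\<in>\<Gamma>. sc (\<Sum>\<tau>\<in>T \<gamma> p. f \<tau> p * f \<tau> p) v)"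
      by (rule sum.cong[OF refl slice])
    also have "\<dots> = sc (\<Sum>\<gamma>\<in>\<Gamma>. \<Sum>\<tau>\<in>T \<gamma> p. f \<tau> p * f \<tau> p) v"
      by (rule vs.scale_sum_left[symmetric])
    also have "(\<Sum>\<gamma>\<in>\<Gamma>. \<Sum>\<tau>\<in>T \<gamma> p. f \<tau> p * f \<tau> p) = of_real (\<rho> p * \<rho> p * S p)"
      unfolding S_def f_def of_real_mult of_real_sum sum_distrib_left
      by (intro sum.cong refl) (simp add: mult_ac)
    finally show ?thesis by (simp add: \<rho>_sq)
  qed
  \<comment> \<open>At each point \<open>e i\<close> and \<open>l i\<close> are the same real
    multiple of a local frame vector and of its dual; for a point on no piece of the colour the
    multiple is 0. Relations between local frame and coframe such as metric duality survive the
    gluing in this way.\<close>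
  have last: "\<exists>W s' m' k t. (W, s', m') \<in> \<S> \<and> p \<in> W \<and> e i p = sc (of_real t) (s' k p) \<and>
       (\<forall>v\<in>E p. l i p v = of_real t * m' k p v)" if i: "i \<in> ?I" for i p
  proof (cases "T (fst i) p = {}")
    case True
    obtain W s' m' where "(W, s', m') \<in> \<S>" "p \<in> W" using cov[of p] by (elim exE conjE) (rule that)
    then show ?thesis using True
      by (intro exI[of _ W] exI[of _ s'] exI[of _ m'] exI[of _ "snd i"] exI[of _ 0]) (simp add: e_def l_def)
  next
    case False
    have \<gamma>: "fst i \<in> \<Gamma>" using i by auto
    from T_ex[OF \<gamma> False] obtain \<tau> where \<tau>: "\<tau> \<in> \<Q> (fst i)" "T (fst i) p = {\<tau>}" "p \<in> K \<tau>"
      by (elim bexE conjE) (rule that)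
    have "p \<in> W \<tau>" using piece(2)[OF \<gamma> \<tau>(1)] \<tau>(3) by auto
    then show ?thesis using in\<S>[OF \<gamma> \<tau>(1)] \<tau>(2)
      by (intro exI[of _ "W \<tau>"] exI[of _ "s \<tau>"] exI[of _ "m \<tau>"] exI[of _ "snd i"] exI[of _ "\<rho> p * \<beta> \<tau> p"])
        (simp add: e_def l_def f_def)
  qed
  show ?thesis
    by (rule exI[of _ ?I], rule exI[of _ e], rule exI[of _ l], intro conjI ballI allI)
      (simp_all only: e_sec l_sec recon last finite_cartesian_product[OF fin\<Gamma> finite])
qed

end

section \<open>Hermitian bundles and local orthonormal frames\<close>

locale hermitian_bundle = complex_bundle atlas sc E triv
  for atlas :: "('m::{t2_space,second_countable_topology}, 'e::real_inner) atlas"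
    and sc :: "complex \<Rightarrow> 'v::ab_group_add \<Rightarrow> 'v" and E :: "'m \<Rightarrow> 'v set"
    and triv :: "('m, 'v, complex ^ 'n) trivializations" +
  fixes H :: "'m \<Rightarrow> 'v \<Rightarrow> 'v \<Rightarrow> complex"
  assumes hfm: "hermitian_fibre_metric atlas sc E triv H"
begin

lemma H_props:
  "u \<in> E p \<Longrightarrow> v \<in> E p \<Longrightarrow> w \<in> E p \<Longrightarrow> H p u (v + w) = H p u v + H p u w"
  "u \<in> E p \<Longrightarrow> v \<in> E p \<Longrightarrow> H p u (sc c v) = c * H p u v"
  "u \<in> E p \<Longrightarrow> v \<in> E p \<Longrightarrow> cnj (H p u v) = H p v u"
  "u \<in> E p \<Longrightarrow> u \<noteq> 0 \<Longrightarrow> Re (H p u u) > 0"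
  using hfm unfolding hermitian_fibre_metric_def by simp_all

lemma H_smooth:
  assumes "(U, \<psi>) \<in> triv"
  shows "smooth U (\<lambda>p. H p (iv \<psi> p w) (iv \<psi> p w'))"
proof -
  have *: "\<forall>(U, \<psi>)\<in>triv. \<forall>w w'. smooth U (\<lambda>p. H p (iv \<psi> p w) (iv \<psi> p w'))"
    using hfm unfolding hermitian_fibre_metric_def by (elim conjE)
  show ?thesis using bspec[OF * assms, unfolded prod.case] by (elim allE)
qed

lemma H_lin: "u \<in> E p \<Longrightarrow> lin_fun p (H p u)"
  by (simp add: lin_fun_def H_props)

lemma H_left: "u \<in> E p \<Longrightarrow> v \<in> E p \<Longrightarrow> w \<in> E p \<Longrightarrow> H p (u + v) w = H p u w + H p v w"
  "u \<in> E p \<Longrightarrow> v \<in> E p \<Longrightarrow> H p (sc c u) v = cnj c * H p u v"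
  by (subst (1 2 3) H_props(3)[symmetric]; simp add: E_closed H_props(1,2))
    (subst (1 2) H_props(3)[symmetric]; simp add: E_closed H_props(1,2))

lemma H_left_0: "v \<in> E p \<Longrightarrow> H p 0 v = 0"
  using H_left(2)[of 0 p v 0] by (simp add: E_closed)

lemma H_left_sum: "(\<And>i. i \<in> I \<Longrightarrow> x i \<in> E p) \<Longrightarrow> v \<in> E p \<Longrightarrow> H p (\<Sum>i\<in>I. x i) v = (\<Sum>i\<in>I. H p (x i) v)"
  by (induction I rule: infinite_finite_induct) (simp_all add: H_left_0 H_left(1) E_closed)

lemma H_cosection:
  assumes W: "open W" and x: "sections_on W x"
  shows "cosections_on W (\<lambda>p. H p (x p))"
proof (rule cosections_onI)
  show "lin_fun p (H p (x p))" if "p \<in> W" for p by (rule H_lin[OF sections_onD(1)[OF x that]])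
  fix V \<eta> w assume V: "(V, \<eta>) \<in> triv"
  have o: "open (V \<inter> W)" using triv_props(1)[OF V] W by auto
  have *: "smooth (V \<inter> W) (\<lambda>p. cnj (\<eta> p (x p) $ j) * H p (iv \<eta> p (axis j 1)) (iv \<eta> p w))" for j
    by (intro smooth_bilinear[OF o bounded_bilinear_mult] smooth_linear[OF o bounded_linear_cnj]
        smooth_linear[OF o bounded_linear_vec_nth] sections_onD(2)[OF x V] smooth_subset[OF H_smooth[OF V]]) simp
  show "smooth (V \<inter> W) (\<lambda>p. H p (x p) (iv \<eta> p w))"
  proof (rule smooth_cong[OF o _ smooth_sum[OF o *]])
    fix p assume "p \<in> V \<inter> W"
    then have p: "p \<in> V" "p \<in> W" by auto
    have "H p (x p) (iv \<eta> p w) = H p (\<Sum>j\<in>UNIV. sc (\<eta> p (x p) $ j) (iv \<eta> p (axis j 1))) (iv \<eta> p w)"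
      using psi_expand[OF V p(1) sections_onD(1)[OF x p(2)]] by simp
    also have "\<dots> = (\<Sum>j\<in>UNIV. cnj (\<eta> p (x p) $ j) * H p (iv \<eta> p (axis j 1)) (iv \<eta> p w))"
      by (subst H_left_sum) (simp_all add: E_closed iv_in[OF V p(1)] H_left(2))
    finally show "(\<Sum>j\<in>UNIV. cnj (\<eta> p (x p) $ j) * H p (iv \<eta> p (axis j 1)) (iv \<eta> p w)) = H p (x p) (iv \<eta> p w)"
      by (rule sym)
  qed
qed

lemma H_apply: "open W \<Longrightarrow> sections_on W x \<Longrightarrow> sections_on W y \<Longrightarrow> smooth W (\<lambda>p. H p (x p) (y p))"
  by (intro cosection_apply H_cosection)

text \<open>Induction over the set \<open>J\<close> of directions already treated. The invariant is
  that the \<open>u i\<close> with \<open>i \<in> J\<close> form an orthonormal basis of the vectors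
  whose coordinates outside \<open>J\<close> vanish, at every point of \<open>U\<close>
  simultaneously.\<close>

lemma gram_schmidt:
  assumes U: "(U, \<psi>) \<in> triv" and "finite J"
  shows "\<exists>u :: 'n \<Rightarrow> 'm \<Rightarrow> 'v. (\<forall>i\<in>J. sections_on U (u i)) \<and> (\<forall>p\<in>U.
     (\<forall>i\<in>J. \<forall>k. k \<notin> J \<longrightarrow> \<psi> p (u i p) $ k = 0) \<and>
     (\<forall>i\<in>J. \<forall>j\<in>J. H p (u i p) (u j p) = (if i = j then 1 else 0)) \<and>
     (\<forall>v\<in>E p. (\<forall>k. k \<notin> J \<longrightarrow> \<psi> p v $ k = 0) \<longrightarrow> v = (\<Sum>i\<in>J. sc (H p (u i p) v) (u i p))))"
  using assms(2)
proof (induction J rule: finite_induct)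
  case empty
  have "v = 0" if "p \<in> U" "v \<in> E p" "\<forall>k. \<psi> p v $ k = 0" for p v
    using psi_inj[OF U that(1,2) E_closed(1)] that(3) psi_0[OF U that(1)] by (simp add: vec_eq_iff)
  then show ?case by simp
next
  case (insert k J)
  then obtain u where u: "\<forall>i\<in>J. sections_on U (u i)"
    and u': "\<forall>p\<in>U. (\<forall>i\<in>J. \<forall>k. k \<notin> J \<longrightarrow> \<psi> p (u i p) $ k = 0) \<and>
     (\<forall>i\<in>J. \<forall>j\<in>J. H p (u i p) (u j p) = (if i = j then 1 else 0)) \<and>
     (\<forall>v\<in>E p. (\<forall>k. k \<notin> J \<longrightarrow> \<psi> p v $ k = 0) \<longrightarrow> v = (\<Sum>i\<in>J. sc (H p (u i p) v) (u i p)))"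
    by (elim exE conjE) (rule that)
  have o: "open U" by (rule triv_props(1)[OF U])
  define t where "t p = iv \<psi> p (axis k 1)" for p
  have t: "sections_on U t" using triv_frame[OF U] by (simp add: local_frame_def t_def[abs_def])
  \<comment> \<open>The basis section in direction \<open>k\<close> minus its orthogonal projection
    to the span of the sections found so far.\<close>
  define y where "y p = t p + (\<Sum>i\<in>J. sc (- H p (u i p) (t p)) (u i p))" for p
  have y: "sections_on U y"
    unfolding y_def
    by (intro sections_on_add sections_on_sum sections_on_scale o t smooth_linear[OF o bounded_linear_minus[OF bounded_linear_ident]]
        H_apply) (use u in simp_all)
  have uE: "u i p \<in> E p" if "i \<in> J" "p \<in> U" for i p using sections_onD(1)[OF bspec[OF u that(1)] that(2)] .
  have tE: "t p \<in> E p" and yE: "y p \<in> E p" if "p \<in> U" for p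
    using sections_onD(1)[OF t that] sections_onD(1)[OF y that] .
  \<comment> \<open>The subtracted terms have no coordinate outside \<open>J\<close>, so the
    coordinate of \<open>y\<close> at \<open>k\<close> stays 1. Hence \<open>y\<close> vanishes
    nowhere and can be normalized smoothly.\<close>
  have psi_y: "\<psi> p (y p) $ j = (if j = k then 1 else 0)" if p: "p \<in> U" and j: "j \<notin> J" for p j
  proof -
    have "\<psi> p (\<Sum>i\<in>J. sc (- H p (u i p) (t p)) (u i p)) = (\<Sum>i\<in>J. - H p (u i p) (t p) *s \<psi> p (u i p))"
      by (subst psi_sum[OF U p]) (simp_all add: E_closed uE p triv_props(4)[OF U p] del: vs.scale_minus_left)
    moreover have "\<psi> p (y p) = \<psi> p (t p) + \<psi> p (\<Sum>i\<in>J. sc (- H p (u i p) (t p)) (u i p))"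
      unfolding y_def by (rule triv_props(3)[OF U p tE[OF p]]) (intro E_closed uE p)
    moreover have "\<psi> p (t p) = axis k 1" by (simp add: t_def psi_iv[OF U p])
    ultimately have "\<psi> p (y p) = axis k 1 + (\<Sum>i\<in>J. - H p (u i p) (t p) *s \<psi> p (u i p))"
      by (simp only:)
    moreover have "(\<Sum>i\<in>J. - H p (u i p) (t p) *s \<psi> p (u i p)) $ j = 0"
      using bspec[OF u' p] j by (simp add: sum_component)
    ultimately show ?thesis by (simp add: axis_def)
  qed
  have y0: "y p \<noteq> 0" if p: "p \<in> U" for p
    using psi_y[OF p insert.hyps(2)] psi_0[OF U p] by auto
  define N where "N p = Re (H p (y p) (y p))" for p
  have Npos: "N p > 0" if "p \<in> U" for p using H_props(4)[OF yE[OF that] y0[OF that]] by (simp add: N_def)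
  have Hyy: "H p (y p) (y p) = of_real (N p)" if "p \<in> U" for p
    using arg_cong[OF H_props(3)[OF yE[OF that] yE[OF that]], of Im] by (simp add: N_def complex_eq_iff)
  define c where "c p = N p powr (- 1 / 2)" for p
  have c: "c p * c p * N p = 1" "c p \<noteq> 0" if "p \<in> U" for p
  proof -
    have "c p * c p = N p powr (- 1)" unfolding c_def by (simp add: powr_add[symmetric])
    then show "c p * c p * N p = 1" using Npos[OF that] by (simp add: powr_minus)
    then show "c p \<noteq> 0" by auto
  qed
  have N_smooth: "smooth U N"
    unfolding N_def by (intro smooth_linear[OF o bounded_linear_Re] H_apply o y)
  have c_smooth: "smooth U (\<lambda>p. complex_of_real (c p))"
    unfolding c_def
    by (intro smooth_linear[OF o bounded_linear_of_real] smooth_real_compose[OF o _ _ Cinf_on_powr N_smooth]) (simp_all add: Npos)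
  have Huy: "H p (u i p) (y p) = 0" if i: "i \<in> J" and p: "p \<in> U" for i p
  proof -
    have lin: "lin_fun p (H p (u i p))" by (rule H_lin[OF uE[OF i p]])
    have "H p (u i p) (y p) = H p (u i p) (t p) + H p (u i p) (\<Sum>j\<in>J. sc (- H p (u j p) (t p)) (u j p))"
      unfolding y_def by (rule lin_fun_add[OF lin tE[OF p]]) (intro E_closed uE p)
    also have "H p (u i p) (\<Sum>j\<in>J. sc (- H p (u j p) (t p)) (u j p)) = (\<Sum>j\<in>J. - H p (u j p) (t p) * H p (u i p) (u j p))"
      by (subst lin_fun_sum[OF lin]) (simp_all add: E_closed uE p lin_fun_scale[OF lin] del: vs.scale_minus_left)
    also have "\<dots> = (\<Sum>j\<in>J. if i = j then - H p (u j p) (t p) else 0)"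
      using bspec[OF u' p] i by (intro sum.cong) simp_all
    also have "\<dots> = - H p (u i p) (t p)" using i insert.hyps(1) by simp
    finally show ?thesis by simp
  qed
  have Hyu: "H p (y p) (u i p) = 0" if i: "i \<in> J" and p: "p \<in> U" for i p
    using H_props(3)[OF uE[OF i p] yE[OF p]] Huy[OF i p] by simp
  define z where "z p = sc (of_real (c p)) (y p)" for p
  have z: "sections_on U z" unfolding z_def by (intro sections_on_scale o c_smooth y)
  have zE: "z p \<in> E p" if "p \<in> U" for p using sections_onD(1)[OF z that] .
  have Hz: "H p (z p) v = of_real (c p) * H p (y p) v" if "p \<in> U" "v \<in> E p" for p v
    using H_left(2)[OF yE[OF that(1)] that(2)] by (simp add: z_def)
  have Hz2: "H p v (z p) = of_real (c p) * H p v (y p)" if "p \<in> U" "v \<in> E p" for p v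
    using H_props(2)[OF that(2) yE[OF that(1)]] by (simp add: z_def)
  have Hzz: "H p (z p) (z p) = 1" if "p \<in> U" for p
  proof -
    have "H p (z p) (z p) = of_real (c p * c p * N p)"
      by (simp add: Hz[OF that zE[OF that]] Hz2[OF that yE[OF that]] Hyy[OF that])
    then show ?thesis by (simp only: c(1)[OF that] of_real_1)
  qed
  let ?u = "u(k := z)"
  have uk: "?u i = u i" if "i \<in> J" for i using that insert.hyps(2) by auto
  show ?case
  proof (rule exI[of _ ?u], intro conjI ballI allI impI)
    fix i assume "i \<in> insert k J"
    then show "sections_on U (?u i)" using u z by auto
  next
    fix p i j assume p: "p \<in> U" and i: "i \<in> insert k J" and j: "j \<notin> insert k J"
    show "\<psi> p (?u i p) $ j = 0"
    proof (cases "i = k")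
      case True
      then show ?thesis using psi_y[OF p, of j] j by (simp add: z_def triv_props(4)[OF U p yE[OF p]])
    next
      case False
      then have "i \<in> J" using i by simp
      then show ?thesis using bspec[OF u' p] j False by simp
    qed
  next
    fix p i j assume p: "p \<in> U" and i: "i \<in> insert k J" and j: "j \<in> insert k J"
    show "H p (?u i p) (?u j p) = (if i = j then 1 else 0)"
    proof (cases "i = k"; cases "j = k")
      assume "i \<noteq> k" "j \<noteq> k"
      then show ?thesis using bspec[OF u' p] i j by simp
    next
      assume "i \<noteq> k" "j = k"
      then show ?thesis using i Huy[of i p] p by (simp add: Hz2[OF p] uE)
    next
      assume "i = k" "j \<noteq> k"
      then show ?thesis using j Hyu[of j p] p by (simp add: Hz[OF p] uE)
    qed (simp add: Hzz[OF p])
  next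
    fix p v assume p: "p \<in> U" and v: "v \<in> E p" and supp: "\<forall>j. j \<notin> insert k J \<longrightarrow> \<psi> p v $ j = 0"
    define a where "a = \<psi> p v $ k"
    \<comment> \<open>Removing the \<open>k\<close> coordinate by a multiple of \<open>y\<close>
      leaves a vector to which the induction hypothesis applies; the removed multiple is exactly the
      component along \<open>z\<close>.\<close>
    define v' where "v' = v + sc (- a) (y p)"
    have v'E: "v' \<in> E p" unfolding v'_def by (intro E_closed v yE p)
    have "\<psi> p v' $ j = 0" if "j \<notin> J" for j
    proof -
      have "\<psi> p v' = \<psi> p v + (- a) *s \<psi> p (y p)"
        unfolding v'_def by (simp only: triv_props(3,4)[OF U p] v yE[OF p] E_closed)
      then show ?thesis using supp that psi_y[OF p that] by (cases "j = k") (simp_all add: a_def)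
    qed
    then have v'_eq: "v' = (\<Sum>i\<in>J. sc (H p (u i p) v') (u i p))"
      using bspec[OF u' p] v'E by blast
    have Huv: "H p (u i p) v' = H p (u i p) v" if i: "i \<in> J" for i
    proof -
      have "H p (u i p) v' = H p (u i p) v + H p (u i p) (sc (- a) (y p))"
        unfolding v'_def by (rule H_props(1)[OF uE[OF i p] v]) (intro E_closed yE p)
      also have "H p (u i p) (sc (- a) (y p)) = - a * H p (u i p) (y p)"
        by (rule H_props(2)[OF uE[OF i p] yE[OF p]])
      finally show ?thesis by (simp add: Huy[OF i p])
    qed
    have "H p (y p) v' = (\<Sum>i\<in>J. H p (u i p) v' * H p (y p) (u i p))"
      by (subst v'_eq, subst lin_fun_sum[OF H_lin[OF yE[OF p]]])
        (simp_all add: E_closed uE p H_props(2) yE[OF p])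
    also have "\<dots> = 0" by (rule sum.neutral) (simp add: Hyu p)
    finally have "H p (y p) v' = 0" .
    moreover have "H p (y p) v' = H p (y p) v + H p (y p) (sc (- a) (y p))"
      unfolding v'_def by (rule H_props(1)[OF yE[OF p] v]) (intro E_closed yE p)
    moreover have "H p (y p) (sc (- a) (y p)) = - a * H p (y p) (y p)"
      by (rule H_props(2)[OF yE[OF p] yE[OF p]])
    ultimately have "H p (y p) v = a * of_real (N p)" by (simp add: Hyy[OF p])
    then have "H p (z p) v = a * of_real (c p * N p)" by (simp add: Hz[OF p v])
    then have "sc (H p (z p) v) (z p) = sc (a * of_real (c p * c p * N p)) (y p)"
      by (simp add: z_def mult_ac)
    also have "\<dots> = sc a (y p)" by (simp only: c(1)[OF p] of_real_1 mult_1_right)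
    finally have zk: "sc (H p (z p) v) (z p) = sc a (y p)" .
    have "(\<Sum>i\<in>insert k J. sc (H p (?u i p) v) (?u i p)) = sc a (y p) + (\<Sum>i\<in>J. sc (H p (?u i p) v) (?u i p))"
      using insert.hyps by (simp add: zk)
    also have "(\<Sum>i\<in>J. sc (H p (?u i p) v) (?u i p)) = (\<Sum>i\<in>J. sc (H p (u i p) v') (u i p))"
      by (rule sum.cong) (simp_all only: uk Huv)
    also have "\<dots> = v'" by (rule v'_eq[symmetric])
    also have "sc a (y p) + v' = v" by (simp add: v'_def)
    finally show "v = (\<Sum>i\<in>insert k J. sc (H p (?u i p) v) (?u i p))" by (rule sym)
  qed
qed

lemma orthonormal_frame:
  assumes U: "(U, \<psi>) \<in> triv"
  shows "\<exists>u. local_frame U u (\<lambda>k p. H p (u k p))"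
proof -
  obtain u :: "'n \<Rightarrow> 'm \<Rightarrow> 'v" where uu: "(\<forall>i\<in>UNIV. sections_on U (u i)) \<and> (\<forall>p\<in>U.
     (\<forall>i\<in>UNIV. \<forall>k. k \<notin> UNIV \<longrightarrow> \<psi> p (u i p) $ k = 0) \<and>
     (\<forall>i\<in>UNIV. \<forall>j\<in>UNIV. H p (u i p) (u j p) = (if i = j then 1 else 0)) \<and>
     (\<forall>v\<in>E p. (\<forall>k. k \<notin> UNIV \<longrightarrow> \<psi> p v $ k = 0) \<longrightarrow> v = (\<Sum>i\<in>UNIV. sc (H p (u i p) v) (u i p))))"
    using gram_schmidt[OF U finite, of UNIV] by (elim exE)
  note u = conjunct1[OF uu] and u' = conjunct2[OF uu]
  have o: "open U" by (rule triv_props(1)[OF U])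
  have "local_frame U u (\<lambda>k p. H p (u k p))"
    unfolding local_frame_def
  proof (intro conjI allI ballI o)
    show "sections_on U (u k)" for k using u by simp
    then show "cosections_on U (\<lambda>p. H p (u k p))" for k by (rule H_cosection[OF o])
    fix p v assume "p \<in> U" "v \<in> E p"
    then have "v = (\<Sum>i\<in>UNIV. sc (H p (u i p) v) (u i p))" using u' by simp
    then show "(\<Sum>k\<in>UNIV. sc (H p (u k p) v) (u k p)) = v" by (rule sym)
  qed
  then show ?thesis by (rule exI[of _ u])
qed

end

section \<open>Differential operators in charts\<close>

lemma Cinf_on_iter_deriv: "Cinf_on S f \<Longrightarrow> Cinf_on S (iter_deriv a f)"
  by (induction a) (simp_all add: Cinf_on_derivative)

lemma frechet_derivative_cong_open:
  assumes "open S" "z \<in> S" "\<And>z. z \<in> S \<Longrightarrow> f z = g z" "Cinf_on S f"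
  shows "frechet_derivative g (at z) = frechet_derivative f (at z)"
  using has_derivative_transform_within_open[OF Cinf_on_has_derivative[OF assms(4,2)] assms(1,2,3)]
  by (rule frechet_derivative_at[symmetric])

text \<open>\<open>W\<close> may be smaller than the domain of the chart, so that several
  trivializations are available over it at the same time.\<close>

locale chart_domain = smooth_mfd atlas
  for atlas :: "('m::{t2_space,second_countable_topology}, 'e::real_inner) atlas" +
  fixes U :: "'m set" and \<phi> :: "'m \<Rightarrow> 'e" and W :: "'m set"
  assumes chart_U: "(U, \<phi>) \<in> atlas" and W_open: "open W" and W_sub: "W \<subseteq> U"
begin

text \<open>The directions are arbitrary vectors of the model space; the return to multi-indices
  over a basis is made in \<open>pder_expand\<close>.\<close>

definition pder :: "'e list \<Rightarrow> ('m \<Rightarrow> 'w::real_normed_vector) \<Rightarrow> 'm \<Rightarrow> 'w" where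
  "pder a g p = iter_deriv a (\<lambda>z. g (inv_into U \<phi> z)) (\<phi> p)"

lemma image_open: "open (\<phi> ` W)"
  using chart_open_image[OF chart_U W_open] W_sub by (simp add: inf.absorb2)

lemma Cinf_rep: "smooth W g \<Longrightarrow> Cinf_on (\<phi> ` W) (\<lambda>z. g (inv_into U \<phi> z))"
  using smoothD[OF _ chart_U, of W g] W_sub by (simp add: inf.absorb2)

lemma inv_W: "p \<in> W \<Longrightarrow> inv_into U \<phi> (\<phi> p) = p"
  using chart_inv(1)[OF chart_U] W_sub by auto

lemma pder_rep: "z \<in> \<phi> ` W \<Longrightarrow> pder a g (inv_into U \<phi> z) = iter_deriv a (\<lambda>z. g (inv_into U \<phi> z)) z"
  using chart_inv(2)[OF chart_U, of z] W_sub by (auto simp: pder_def)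

lemma pder_smooth: "smooth W g \<Longrightarrow> smooth W (pder a g)"
  by (rule smooth_chart[OF chart_U W_open W_sub],
      rule Cinf_on_cong[OF image_open pder_rep[symmetric] Cinf_on_iter_deriv[OF Cinf_rep]])

lemma pder_Nil: "p \<in> W \<Longrightarrow> pder [] g p = g p"
  by (simp add: pder_def inv_W)

lemma pder_Cons:
  assumes "smooth W g" "p \<in> W"
  shows "pder (v # a) g p = pder [v] (pder a g) p"
proof -
  have "frechet_derivative (\<lambda>z. pder a g (inv_into U \<phi> z)) (at (\<phi> p)) =
    frechet_derivative (iter_deriv a (\<lambda>z. g (inv_into U \<phi> z))) (at (\<phi> p))"
    by (rule frechet_derivative_cong_open[OF image_open imageI[OF assms(2)] pder_rep[symmetric]
          Cinf_on_iter_deriv[OF Cinf_rep[OF assms(1)]]])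
  then show ?thesis by (simp add: pder_def)
qed

lemma pder1_derivative:
  assumes "smooth W g" "p \<in> W"
  shows "((\<lambda>z. g (inv_into U \<phi> z)) has_derivative (\<lambda>v. pder [v] g p)) (at (\<phi> p))"
proof -
  have "(\<lambda>v. pder [v] g p) = frechet_derivative (\<lambda>z. g (inv_into U \<phi> z)) (at (\<phi> p))"
    by (rule ext) (simp add: pder_def)
  then show ?thesis using Cinf_on_has_derivative[OF Cinf_rep[OF assms(1)] imageI[OF assms(2)]] by (simp only:)
qed

lemma pder1_eqI:
  assumes "((\<lambda>z. g (inv_into U \<phi> z)) has_derivative g') (at (\<phi> p))"
  shows "pder [v] g p = g' v"
  by (simp add: pder_def frechet_derivative_at[OF assms, symmetric])

lemma pder1_cong:
  assumes "\<And>p. p \<in> W \<Longrightarrow> f p = g p" "smooth W f" "p \<in> W"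
  shows "pder [v] g p = pder [v] f p"
proof -
  have "frechet_derivative (\<lambda>z. g (inv_into U \<phi> z)) (at (\<phi> p)) = frechet_derivative (\<lambda>z. f (inv_into U \<phi> z)) (at (\<phi> p))"
    by (rule frechet_derivative_cong_open[OF image_open imageI[OF assms(3)] _ Cinf_rep[OF assms(2)]])
      (auto simp: inv_W assms(1))
  then show ?thesis by (simp add: pder_def)
qed

lemma pder1_add:
  assumes "smooth W f" "smooth W g" "p \<in> W"
  shows "pder [v] (\<lambda>p. f p + g p) p = pder [v] f p + pder [v] g p"
  by (rule pder1_eqI[OF has_derivative_add[OF pder1_derivative[OF assms(1,3)] pder1_derivative[OF assms(2,3)]]])

lemma pder1_bilinear:
  assumes "bounded_bilinear B" "smooth W f" "smooth W g" "p \<in> W"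
  shows "pder [v] (\<lambda>p. B (f p) (g p)) p = B (f p) (pder [v] g p) + B (pder [v] f p) (g p)"
  using pder1_eqI[OF bounded_bilinear.FDERIV[OF assms(1) pder1_derivative[OF assms(2,4)] pder1_derivative[OF assms(3,4)]]]
  by (simp add: inv_W[OF assms(4)])

lemma pder1_linear:
  assumes "bounded_linear B" "smooth W f" "p \<in> W"
  shows "pder [v] (\<lambda>p. B (f p)) p = B (pder [v] f p)"
  by (rule pder1_eqI[OF bounded_linear.has_derivative[OF assms(1) pder1_derivative[OF assms(2,3)]]])

lemma pder1_expand:
  assumes D: "orthonormal_basis D" and "smooth W g" "p \<in> W"
  shows "pder [v] g p = (\<Sum>b\<in>D. (v \<bullet> b) *\<^sub>R pder [b] g p)"
proof -
  interpret d: bounded_linear "\<lambda>v. pder [v] g p"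
    by (rule has_derivative_bounded_linear[OF pder1_derivative[OF assms(2,3)]])
  have "pder [v] g p = pder [\<Sum>b\<in>D. (v \<bullet> b) *\<^sub>R b] g p"
    by (subst orthonormal_expansion[OF D, of v]) (rule refl)
  also have "\<dots> = (\<Sum>b\<in>D. (v \<bullet> b) *\<^sub>R pder [b] g p)"
    by (simp add: d.sum d.scaleR)
  finally show ?thesis .
qed

lemma smooth_family_apply:
  fixes c :: "'m \<Rightarrow> 'z::euclidean_space \<Rightarrow> 'w::real_normed_vector"
  assumes "\<And>p. p \<in> W \<Longrightarrow> linear (c p)" "\<And>u. smooth W (\<lambda>p. c p u)" "smooth W m"
  shows "smooth W (\<lambda>p. c p (m p))"
proof -
  have "smooth W (\<lambda>p. \<Sum>i\<in>Basis. (m p \<bullet> i) *\<^sub>R c p i)"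
    by (intro smooth_sum W_open smooth_bilinear[OF W_open bounded_bilinear_scaleR]
        smooth_linear[OF W_open bounded_linear_inner_left] assms)
  then show ?thesis
  proof (rule smooth_cong[OF W_open, rotated])
    fix p assume "p \<in> W"
    then interpret linear "c p" by (rule assms(1))
    have "c p (m p) = c p (\<Sum>i\<in>Basis. (m p \<bullet> i) *\<^sub>R i)" by (simp only: euclidean_representation)
    then show "(\<Sum>i\<in>Basis. (m p \<bullet> i) *\<^sub>R c p i) = c p (m p)" by (simp add: sum scale)
  qed
qed

text \<open>Differential operators of order at most \<open>k\<close> over \<open>W\<close>,
  presented as finite sums of components of derivatives with smooth coefficients. Rule induction
  then gives sums, derivatives and compositions without tables of coefficients. Components refer to
  the real inner product, so that complex conjugation is an admissible coefficient.\<close>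

inductive sdop :: "'x set \<Rightarrow> ('x \<Rightarrow> 'm \<Rightarrow> 'u::euclidean_space) \<Rightarrow> nat \<Rightarrow> ('x \<Rightarrow> 'm \<Rightarrow> 'z::real_normed_vector) \<Rightarrow> bool"
  for X L k where
  zero: "(\<And>x p. x \<in> X \<Longrightarrow> p \<in> W \<Longrightarrow> F x p = 0) \<Longrightarrow> sdop X L k F"
| step: "sdop X L k F \<Longrightarrow> length a \<le> k \<Longrightarrow> smooth W m \<Longrightarrow>
    (\<And>x p. x \<in> X \<Longrightarrow> p \<in> W \<Longrightarrow> G x p = F x p + (pder a (L x) p \<bullet> i) *\<^sub>R m p) \<Longrightarrow> sdop X L k G"

lemma sdop_cong:
  assumes "sdop X L k F" "\<And>x p. x \<in> X \<Longrightarrow> p \<in> W \<Longrightarrow> G x p = F x p"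
  shows "sdop X L k G"
  using assms
proof (induction arbitrary: G rule: sdop.induct)
  case (zero F)
  show ?case by (rule sdop.zero) (simp add: zero)
next
  case (step F a m F' i)
  show ?case by (rule sdop.step[where i = i, OF step.hyps(1) step.hyps(2,3)]) (simp add: step.hyps(4) step.prems)
qed

lemma sdop_mono: "sdop X L k F \<Longrightarrow> k \<le> l \<Longrightarrow> sdop X L l F"
proof (induction rule: sdop.induct)
  case (zero F)
  show ?case by (rule sdop.zero) (simp add: zero)
next
  case (step F a m G i)
  show ?case
    by (rule sdop.step[OF step.IH[OF step.prems] _ step.hyps(3,4)]) (use step.hyps(2) step.prems in auto)
qed

lemma sdop_add:
  assumes "sdop X L k F" "sdop X L k F'"
  shows "sdop X L k (\<lambda>x p. F x p + F' x p)"
  using assms(2)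
proof (induction rule: sdop.induct)
  case (zero F')
  show ?case by (rule sdop_cong[OF assms(1)]) (simp add: zero)
next
  case (step F' a m G i)
  show ?case by (rule sdop.step[where i = i, OF step.IH step.hyps(2,3)]) (simp add: step.hyps(4))
qed

lemma sdop_sum:
  assumes "\<And>i. i \<in> I \<Longrightarrow> sdop X L k (F i)"
  shows "sdop X L k (\<lambda>x p. \<Sum>i\<in>I. F i x p)"
  using assms
  by (induction I rule: infinite_finite_induct) (simp_all add: sdop.zero sdop_add)

lemma sdop_scale:
  fixes F :: "'x \<Rightarrow> 'm \<Rightarrow> 'z::euclidean_space"
  assumes "sdop X L k F" "\<And>p. p \<in> W \<Longrightarrow> linear (c p)" "\<And>u. smooth W (\<lambda>p. c p u)"
  shows "sdop X L k (\<lambda>x p. c p (F x p))"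
  using assms(1)
proof (induction rule: sdop.induct)
  case (zero F)
  show ?case by (rule sdop.zero) (simp add: zero linear_0[OF assms(2)])
next
  case (step F a m G i)
  show ?case
    by (rule sdop.step[where i = i, OF step.IH step.hyps(2) smooth_family_apply[OF assms(2,3) step.hyps(3)]])
      (simp_all add: step.hyps(4) linear_add[OF assms(2)] linear_cmul[OF assms(2)])
qed

lemma sdop_single: 
  assumes "smooth W m" "length a \<le> k"
  shows "sdop X L k (\<lambda>x p. (pder a (L x) p \<bullet> i) *\<^sub>R m p)"
  by (rule sdop.step[OF sdop.zero[of X "\<lambda>_ _. 0"] assms(2,1), where i = i]) simp_all

lemma sdop_smooth:
  assumes "sdop X L k F" "x \<in> X" "smooth W (L x)"
  shows "smooth W (F x)"
  using assms(1)
proof (induction rule: sdop.induct)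
  case (zero F)
  show ?case by (rule smooth_cong[OF W_open _ smooth_const[of _ 0]]) (simp add: zero assms)
next
  case (step F a m G i)
  have "smooth W (\<lambda>p. F x p + (pder a (L x) p \<bullet> i) *\<^sub>R m p)"
    by (intro smooth_add W_open step smooth_bilinear[OF W_open bounded_bilinear_scaleR]
        smooth_linear[OF W_open bounded_linear_inner_left] pder_smooth assms)
  then show ?case by (rule smooth_cong[OF W_open, rotated]) (simp add: step.hyps(4) assms)
qed

text \<open>The Leibniz rule: the derivative falls on the coefficient, which stays smooth, or on the
  derivative of the argument, which raises the order by one.\<close>

lemma sdop_pder1:
  assumes "sdop X L k F" "\<And>x. x \<in> X \<Longrightarrow> smooth W (L x)"
  shows "sdop X L (Suc k) (\<lambda>x. pder [v] (F x))"
  using assms(1)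
proof (induction rule: sdop.induct)
  case (zero F)
  show ?case
  proof (rule sdop.zero)
    fix x p assume "x \<in> X" and p: "p \<in> W"
    then have "pder [v] (F x) p = pder [v] (\<lambda>_. 0) p"
      by (intro pder1_cong) (simp_all add: zero smooth_const)
    then show "pder [v] (F x) p = 0" by (simp add: pder_def)
  qed
next
  case (step F a m G i)
  have "sdop X L (Suc k) (\<lambda>x p. pder [v] (F x) p + ((pder (v # a) (L x) p \<bullet> i) *\<^sub>R m p + (pder a (L x) p \<bullet> i) *\<^sub>R pder [v] m p))"
    using step.hyps(2) by (intro sdop_add sdop_single step.IH pder_smooth step.hyps(3)) simp_all
  then show ?case
  proof (rule sdop_cong)
    fix x p assume x: "x \<in> X" and p: "p \<in> W"
    note Lx = assms(2)[OF x]
    have i: "smooth W (\<lambda>p. pder a (L x) p \<bullet> i)"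
      by (intro smooth_linear[OF W_open bounded_linear_inner_left] pder_smooth Lx)
    have t: "smooth W (\<lambda>p. (pder a (L x) p \<bullet> i) *\<^sub>R m p)"
      by (intro smooth_bilinear[OF W_open bounded_bilinear_scaleR] i step.hyps(3))
    note Fx = sdop_smooth[OF step.hyps(1) x Lx]
    have "pder [v] (G x) p = pder [v] (\<lambda>p. F x p + (pder a (L x) p \<bullet> i) *\<^sub>R m p) p"
      by (rule pder1_cong[OF _ smooth_add[OF W_open Fx t] p]) (simp add: step.hyps(4)[OF x])
    also have "\<dots> = pder [v] (F x) p + pder [v] (\<lambda>p. (pder a (L x) p \<bullet> i) *\<^sub>R m p) p"
      by (rule pder1_add[OF Fx t p])
    also have "pder [v] (\<lambda>p. (pder a (L x) p \<bullet> i) *\<^sub>R m p) p =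
      (pder a (L x) p \<bullet> i) *\<^sub>R pder [v] m p + (pder (v # a) (L x) p \<bullet> i) *\<^sub>R m p"
      by (simp add: pder1_bilinear[OF bounded_bilinear_scaleR i step.hyps(3) p]
          pder1_linear[OF bounded_linear_inner_left pder_smooth[OF Lx] p] pder_Cons[OF Lx p])
    finally show "pder [v] (G x) p = pder [v] (F x) p + ((pder (v # a) (L x) p \<bullet> i) *\<^sub>R m p + (pder a (L x) p \<bullet> i) *\<^sub>R pder [v] m p)"
      by simp
  qed
qed

lemma sdop_pder:
  assumes "sdop X L k F" "\<And>x. x \<in> X \<Longrightarrow> smooth W (L x)"
  shows "sdop X L (k + length a) (\<lambda>x. pder a (F x))"
proof (induction a)
  case Nil
  show ?case by (rule sdop_cong[OF sdop_mono[OF assms(1)]]) (simp_all add: pder_Nil)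
next
  case (Cons v a)
  show ?case
    by (rule sdop_cong[OF sdop_mono[OF sdop_pder1[OF Cons.IH assms(2), of v]]])
      (simp_all add: pder_Cons sdop_smooth[OF assms(1)] assms(2))
qed

lemma sdop_base: "sdop X L k (\<lambda>x. L x)"
proof -
  have "sdop X L k (\<lambda>x p. \<Sum>i\<in>Basis. (pder [] (L x) p \<bullet> i) *\<^sub>R i)"
    by (intro sdop_sum sdop_single smooth_const) simp
  then show ?thesis by (rule sdop_cong) (simp add: pder_Nil euclidean_representation)
qed

text \<open>Orders add under composition, since by \<open>sdop_pder\<close> a derivative of length
  at most \<open>k\<close> raises the order \<open>l\<close> of the inner operator by at most
  \<open>k\<close>.\<close>

lemma sdop_subst:
  fixes L' :: "'y \<Rightarrow> 'm \<Rightarrow> 'w::euclidean_space"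
  assumes N: "sdop Y L' k N" and G: "sdop X L l (\<lambda>x. L' (G x))" "\<And>x. x \<in> X \<Longrightarrow> G x \<in> Y"
    and L: "\<And>x. x \<in> X \<Longrightarrow> smooth W (L x)"
  shows "sdop X L (k + l) (\<lambda>x. N (G x))"
  using N
proof (induction rule: sdop.induct)
  case (zero F)
  show ?case by (rule sdop.zero) (simp add: zero G(2))
next
  case (step F a m F' i)
  have "sdop X L (k + l) (\<lambda>x p. (pder a (L' (G x)) p \<bullet> i) *\<^sub>R m p)"
    by (rule sdop_scale[OF sdop_mono[OF sdop_pder[OF G(1) L]], where c = "\<lambda>p w. (w \<bullet> i) *\<^sub>R m p"])
      (use step.hyps(2) in \<open>auto intro!: linearI smooth_linear[OF W_open bounded_linear_scaleR_right] step.hyps(3)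
         simp: inner_add_left scaleR_add_left\<close>)
  from sdop_add[OF step.IH this] show ?case
    by (rule sdop_cong) (simp add: step.hyps(4) G(2))
qed

text \<open>Sums of products of real-valued operators in the two arguments. The arguments stay
  separated with an order for each, so substitution in one of them reduces to
  \<open>sdop_subst\<close>.\<close>

inductive bdop :: "'x set \<Rightarrow> ('x \<Rightarrow> 'm \<Rightarrow> 'u::euclidean_space) \<Rightarrow> 'y set \<Rightarrow> ('y \<Rightarrow> 'm \<Rightarrow> 'v::euclidean_space) \<Rightarrow>
    nat \<Rightarrow> nat \<Rightarrow> ('x \<Rightarrow> 'y \<Rightarrow> 'm \<Rightarrow> 'z::real_normed_vector) \<Rightarrow> bool"
  for X L Y L' k l where
  zero: "(\<And>x y p. x \<in> X \<Longrightarrow> y \<in> Y \<Longrightarrow> p \<in> W \<Longrightarrow> F x y p = 0) \<Longrightarrow> bdop X L Y L' k l F"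
| step: "bdop X L Y L' k l F \<Longrightarrow> sdop X L k G \<Longrightarrow> sdop Y L' l G' \<Longrightarrow> smooth W m \<Longrightarrow>
    (\<And>x y p. x \<in> X \<Longrightarrow> y \<in> Y \<Longrightarrow> p \<in> W \<Longrightarrow> F' x y p = F x y p + (G x p * G' y p :: real) *\<^sub>R m p) \<Longrightarrow>
    bdop X L Y L' k l F'"

lemma bdop_cong:
  assumes "bdop X L Y L' k l F" "\<And>x y p. x \<in> X \<Longrightarrow> y \<in> Y \<Longrightarrow> p \<in> W \<Longrightarrow> F' x y p = F x y p"
  shows "bdop X L Y L' k l F'"
  using assms
proof (induction arbitrary: F' rule: bdop.induct)
  case (zero F)
  show ?case by (rule bdop.zero) (simp add: zero)
next
  case (step F G G' m F'')
  show ?case by (rule bdop.step[OF step.hyps(1-4)]) (simp add: step.hyps(5) step.prems)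
qed

lemma bdop_mono: "bdop X L Y L' k l F \<Longrightarrow> k \<le> k' \<Longrightarrow> l \<le> l' \<Longrightarrow> bdop X L Y L' k' l' F"
proof (induction rule: bdop.induct)
  case (zero F)
  show ?case by (rule bdop.zero) (simp add: zero)
next
  case (step F G G' m F')
  show ?case
    by (rule bdop.step[OF step.IH[OF step.prems] sdop_mono[OF step.hyps(2) step.prems(1)]
        sdop_mono[OF step.hyps(3) step.prems(2)] step.hyps(4,5)])
qed

lemma bdop_add:
  assumes "bdop X L Y L' k l F" "bdop X L Y L' k l F'"
  shows "bdop X L Y L' k l (\<lambda>x y p. F x y p + F' x y p)"
  using assms(2)
proof (induction rule: bdop.induct)
  case (zero F')
  show ?case by (rule bdop_cong[OF assms(1)]) (simp add: zero)
next
  case (step F' G G' m F'')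
  show ?case by (rule bdop.step[OF step.IH step.hyps(2-4)]) (simp add: step.hyps(5))
qed

lemma bdop_sum:
  assumes "\<And>i. i \<in> I \<Longrightarrow> bdop X L Y L' k l (F i)"
  shows "bdop X L Y L' k l (\<lambda>x y p. \<Sum>i\<in>I. F i x y p)"
  using assms
  by (induction I rule: infinite_finite_induct) (simp_all add: bdop.zero bdop_add)

lemma bdop_scale:
  fixes F :: "'x \<Rightarrow> 'y \<Rightarrow> 'm \<Rightarrow> 'z::euclidean_space"
  assumes "bdop X L Y L' k l F" "\<And>p. p \<in> W \<Longrightarrow> linear (c p)" "\<And>u. smooth W (\<lambda>p. c p u)"
  shows "bdop X L Y L' k l (\<lambda>x y p. c p (F x y p))"
  using assms(1)
proof (induction rule: bdop.induct)
  case (zero F)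
  show ?case by (rule bdop.zero) (simp add: zero linear_0[OF assms(2)])
next
  case (step F G G' m F')
  show ?case
    by (rule bdop.step[OF step.IH step.hyps(2,3) smooth_family_apply[OF assms(2,3) step.hyps(4)]])
      (simp_all add: step.hyps(5) linear_add[OF assms(2)] linear_cmul[OF assms(2)])
qed

lemma bdop_single: "sdop X L k G \<Longrightarrow> sdop Y L' l G' \<Longrightarrow> smooth W m \<Longrightarrow>
    bdop X L Y L' k l (\<lambda>x y p. (G x p * G' y p :: real) *\<^sub>R m p)"
  by (rule bdop.step[OF bdop.zero[of X Y "\<lambda>_ _ _. 0"]]) simp_all

lemma bdop_bilinear:
  fixes G :: "'x \<Rightarrow> 'm \<Rightarrow> 'u'::euclidean_space" and G' :: "'y \<Rightarrow> 'm \<Rightarrow> 'v'::euclidean_space"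
  assumes "sdop X L k G" "sdop Y L' l G'" "\<And>p. p \<in> W \<Longrightarrow> bilinear (c p)" "\<And>u v. smooth W (\<lambda>p. c p u v)"
  shows "bdop X L Y L' k l (\<lambda>x y p. c p (G x p) (G' y p))"
proof -
  have "sdop X L k (\<lambda>x p. G x p \<bullet> i)" for i
    by (rule sdop_scale[OF assms(1), where c = "\<lambda>p w. w \<bullet> i"])
      (auto intro: smooth_const bounded_linear.linear[OF bounded_linear_inner_left])
  moreover have "sdop Y L' l (\<lambda>x p. G' x p \<bullet> i)" for i
    by (rule sdop_scale[OF assms(2), where c = "\<lambda>p w. w \<bullet> i"])
      (auto intro: smooth_const bounded_linear.linear[OF bounded_linear_inner_left])
  ultimately have "bdop X L Y L' k l (\<lambda>x y p. \<Sum>i\<in>Basis. \<Sum>j\<in>Basis. ((G x p \<bullet> i) * (G' y p \<bullet> j)) *\<^sub>R c p i j)"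
    by (intro bdop_sum bdop_single assms(4))
  then show ?thesis
  proof (rule bdop_cong)
    fix x y p assume "p \<in> W"
    then have b: "bilinear (c p)" by (rule assms(3))
    have "c p (G x p) (G' y p) = c p (\<Sum>i\<in>Basis. (G x p \<bullet> i) *\<^sub>R i) (\<Sum>j\<in>Basis. (G' y p \<bullet> j) *\<^sub>R j)"
      by (simp only: euclidean_representation)
    also have "\<dots> = (\<Sum>i\<in>Basis. \<Sum>j\<in>Basis. ((G x p \<bullet> i) * (G' y p \<bullet> j)) *\<^sub>R c p i j)"
      by (simp add: bilinear_sum[OF b] sum.cartesian_product[symmetric] bilinear_lmul[OF b] bilinear_rmul[OF b] mult.commute)
    finally show "c p (G x p) (G' y p) = (\<Sum>i\<in>Basis. \<Sum>j\<in>Basis. ((G x p \<bullet> i) * (G' y p \<bullet> j)) *\<^sub>R c p i j)" .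
  qed
qed

lemma bdop_smooth:
  assumes "bdop X L Y L' k l F" "x \<in> X" "smooth W (L x)" "y \<in> Y" "smooth W (L' y)"
  shows "smooth W (F x y)"
  using assms(1)
proof (induction rule: bdop.induct)
  case (zero F)
  show ?case by (rule smooth_cong[OF W_open _ smooth_const[of _ 0]]) (simp add: zero assms)
next
  case (step F G G' m F')
  have "smooth W (\<lambda>p. F x y p + (G x p * G' y p) *\<^sub>R m p)"
    by (intro smooth_add W_open step.IH step.hyps(4) smooth_bilinear[OF W_open bounded_bilinear_scaleR]
        smooth_bilinear[OF W_open bounded_bilinear_mult] sdop_smooth[OF step.hyps(2)] sdop_smooth[OF step.hyps(3)] assms)
  then show ?case by (rule smooth_cong[OF W_open, rotated]) (simp add: step.hyps(5) assms)
qed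

lemma bdop_pder1:
  assumes "bdop X L Y L' k l F" and L: "\<And>x. x \<in> X \<Longrightarrow> smooth W (L x)" "\<And>y. y \<in> Y \<Longrightarrow> smooth W (L' y)"
  shows "bdop X L Y L' (Suc k) (Suc l) (\<lambda>x y. pder [v] (F x y))"
  using assms(1)
proof (induction rule: bdop.induct)
  case (zero F)
  show ?case
  proof (rule bdop.zero)
    fix x y p assume "x \<in> X" "y \<in> Y" and p: "p \<in> W"
    then have "pder [v] (F x y) p = pder [v] (\<lambda>_. 0) p"
      by (intro pder1_cong) (simp_all add: zero smooth_const)
    then show "pder [v] (F x y) p = 0" by (simp add: pder_def)
  qed
next
  case (step F G G' m F')
  have s: "sdop X L (Suc k) G" "sdop Y L' (Suc l) G'"
    using sdop_mono[OF step.hyps(2)] sdop_mono[OF step.hyps(3)] by simp_all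
  have "bdop X L Y L' (Suc k) (Suc l) (\<lambda>x y p. pder [v] (F x y) p + ((G x p * G' y p) *\<^sub>R pder [v] m p +
      ((G x p * pder [v] (G' y) p) *\<^sub>R m p + (pder [v] (G x) p * G' y p) *\<^sub>R m p)))"
    by (intro bdop_add bdop_single step.IH s pder_smooth step.hyps(4) sdop_pder1[OF step.hyps(2) L(1)] sdop_pder1[OF step.hyps(3) L(2)])
  then show ?case
  proof (rule bdop_cong)
    fix x y p assume x: "x \<in> X" and y: "y \<in> Y" and p: "p \<in> W"
    note Gx = sdop_smooth[OF step.hyps(2) x L(1)[OF x]] and Gy = sdop_smooth[OF step.hyps(3) y L(2)[OF y]]
    note GG = smooth_bilinear[OF W_open bounded_bilinear_mult Gx Gy]
    note t = smooth_bilinear[OF W_open bounded_bilinear_scaleR GG step.hyps(4)]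
    note Fx = bdop_smooth[OF step.hyps(1) x L(1)[OF x] y L(2)[OF y]]
    have "pder [v] (F' x y) p = pder [v] (\<lambda>p. F x y p + (G x p * G' y p) *\<^sub>R m p) p"
      by (rule pder1_cong[OF _ smooth_add[OF W_open Fx t] p]) (simp add: step.hyps(5)[OF x y])
    also have "\<dots> = pder [v] (F x y) p + pder [v] (\<lambda>p. (G x p * G' y p) *\<^sub>R m p) p"
      by (rule pder1_add[OF Fx t p])
    also have "pder [v] (\<lambda>p. (G x p * G' y p) *\<^sub>R m p) p = (G x p * G' y p) *\<^sub>R pder [v] m p +
      (G x p * pder [v] (G' y) p + pder [v] (G x) p * G' y p) *\<^sub>R m p"
      by (simp only: pder1_bilinear[OF bounded_bilinear_scaleR GG step.hyps(4) p]
          pder1_bilinear[OF bounded_bilinear_mult Gx Gy p])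
    finally show "pder [v] (F' x y) p = pder [v] (F x y) p + ((G x p * G' y p) *\<^sub>R pder [v] m p +
      ((G x p * pder [v] (G' y) p) *\<^sub>R m p + (pder [v] (G x) p * G' y p) *\<^sub>R m p))"
      by (simp add: scaleR_add_left)
  qed
qed

lemma bdop_pder:
  assumes "bdop X L Y L' k l F" and L: "\<And>x. x \<in> X \<Longrightarrow> smooth W (L x)" "\<And>y. y \<in> Y \<Longrightarrow> smooth W (L' y)"
  shows "bdop X L Y L' (k + length a) (l + length a) (\<lambda>x y. pder a (F x y))"
proof (induction a)
  case Nil
  show ?case by (rule bdop_cong[OF bdop_mono[OF assms(1)]]) (simp_all add: pder_Nil)
next
  case (Cons v a)
  show ?case
    by (rule bdop_cong[OF bdop_mono[OF bdop_pder1[OF Cons.IH L, of v]]])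
      (simp_all add: pder_Cons bdop_smooth[OF assms(1)] L)
qed

lemma bdop_subst_left:
  assumes "bdop Y L' Z L'' k l B" and "sdop X L s (\<lambda>x. L' (G x))" "\<And>x. x \<in> X \<Longrightarrow> G x \<in> Y"
    and "\<And>x. x \<in> X \<Longrightarrow> smooth W (L x)"
  shows "bdop X L Z L'' (k + s) l (\<lambda>x. B (G x))"
  using assms(1)
proof (induction rule: bdop.induct)
  case (zero F)
  show ?case by (rule bdop.zero) (simp add: zero assms(3))
next
  case (step F H H' m F')
  show ?case
    by (rule bdop.step[OF step.IH sdop_subst[OF step.hyps(2) assms(2,3,4)] step.hyps(3,4)]) (simp_all add: step.hyps(5) assms(3))
qed

text \<open>By the Leibniz rule all \<open>k\<close> outer derivatives may fall on either argument,
  so both orders rise by \<open>k\<close>.\<close>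

lemma bdop_subst_out:
  fixes L'' :: "'z \<Rightarrow> 'm \<Rightarrow> 'w::euclidean_space"
  assumes "sdop Z L'' k N" and B: "bdop X L Y L' s t (\<lambda>x y. L'' (B x y))"
    "\<And>x y. x \<in> X \<Longrightarrow> y \<in> Y \<Longrightarrow> B x y \<in> Z"
    and L: "\<And>x. x \<in> X \<Longrightarrow> smooth W (L x)" "\<And>y. y \<in> Y \<Longrightarrow> smooth W (L' y)"
  shows "bdop X L Y L' (k + s) (k + t) (\<lambda>x y. N (B x y))"
  using assms(1)
proof (induction rule: sdop.induct)
  case (zero F)
  show ?case by (rule bdop.zero) (simp add: zero B(2))
next
  case (step F a m F' i)
  have "bdop X L Y L' (k + s) (k + t) (\<lambda>x y p. (pder a (L'' (B x y)) p \<bullet> i) *\<^sub>R m p)"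
    by (rule bdop_scale[OF bdop_mono[OF bdop_pder[OF B(1) L]], where c = "\<lambda>p w. (w \<bullet> i) *\<^sub>R m p"])
      (use step.hyps(2) in \<open>auto intro!: linearI smooth_linear[OF W_open bounded_linear_scaleR_right] step.hyps(3)
         simp: inner_add_left scaleR_add_left\<close>)
  from bdop_add[OF step.IH this] show ?case
    by (rule bdop_cong) (simp add: step.hyps(4) B(2))
qed

text \<open>With the first argument frozen, its factor becomes part of the smooth
  coefficient.\<close>

lemma bdop_partial:
  assumes "bdop X L Y L' k l (B :: 'x \<Rightarrow> 'y \<Rightarrow> 'm \<Rightarrow> 'z::euclidean_space)" "x \<in> X" "smooth W (L x)"
  shows "sdop Y L' l (B x)"
  using assms(1)
proof (induction rule: bdop.induct)
  case (zero F)
  show ?case by (rule sdop.zero) (simp add: zero assms)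
next
  case (step F G G' m F')
  have m: "smooth W (\<lambda>p. G x p *\<^sub>R m p)"
    by (intro smooth_bilinear[OF W_open bounded_bilinear_scaleR] sdop_smooth[OF step.hyps(2)] step.hyps(4) assms)
  have "sdop Y L' l (\<lambda>y p. G' y p *\<^sub>R (G x p *\<^sub>R m p))"
    by (rule sdop_scale[OF step.hyps(3), where c = "\<lambda>p r. r *\<^sub>R (G x p *\<^sub>R m p)"])
      (auto intro!: linearI smooth_linear[OF W_open bounded_linear_scaleR_right m] simp: scaleR_add_left scaleR_scaleR[symmetric] simp del: scaleR_scaleR)
  from sdop_add[OF step.IH this] show ?case
    by (rule sdop_cong) (simp add: step.hyps(5) assms mult_ac)
qed

text \<open>The coefficient of the derivative along \<open>bs\<close> when each direction of the
  first list is expanded in an orthonormal basis. It is used for lists of equal length.\<close>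

primrec list_coef :: "'e list \<Rightarrow> 'e list \<Rightarrow> real" where
  "list_coef [] bs = 1"
| "list_coef (a # as) bs = (a \<bullet> hd bs) * list_coef as (tl bs)"

text \<open>\<open>bidiff_op\<close> asks for multi-indices over a basis, whereas
  \<open>sdop\<close> admits all directions; multilinearity of iterated derivatives in the
  directions bridges the two.\<close>

lemma pder_expand:
  assumes D: "orthonormal_basis D" and g: "smooth W g"
  shows "p \<in> W \<Longrightarrow> pder a g p = (\<Sum>b\<in>{b. set b \<subseteq> D \<and> length b = length a}. list_coef a b *\<^sub>R pder b g p)"
proof (induction a arbitrary: p)
  case Nil
  have "{b. set b \<subseteq> D \<and> length b = length ([] :: 'e list)} = {[]}" by auto
  then show ?case by simp
next
  case (Cons v a)
  let ?S = "{b. set b \<subseteq> D \<and> length b = length a}"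
  have finD: "finite D" using D by (simp add: orthonormal_basis_def)
  have fin: "finite ?S" by (rule finite_lists_length_eq[OF finD])
  have sm: "smooth W (\<lambda>p. list_coef a b *\<^sub>R pder b g p)" for b
    by (intro smooth_linear[OF W_open bounded_linear_scaleR_right] pder_smooth g)
  have dsum: "pder [d] (\<lambda>p. \<Sum>b\<in>B. list_coef a b *\<^sub>R pder b g p) p = (\<Sum>b\<in>B. list_coef a b *\<^sub>R pder (d # b) g p)"
    if "finite B" for d B
    using that
  proof (induction B rule: finite_induct)
    case empty
    then show ?case by (simp add: pder_def)
  next
    case (insert b B)
    have "pder [d] (\<lambda>p. list_coef a b *\<^sub>R pder b g p + (\<Sum>b\<in>B. list_coef a b *\<^sub>R pder b g p)) p =
      pder [d] (\<lambda>p. list_coef a b *\<^sub>R pder b g p) p + pder [d] (\<lambda>p. \<Sum>b\<in>B. list_coef a b *\<^sub>R pder b g p) p"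
      by (rule pder1_add[OF sm smooth_sum[OF W_open sm] Cons.prems])
    also have "pder [d] (\<lambda>p. list_coef a b *\<^sub>R pder b g p) p = list_coef a b *\<^sub>R pder (d # b) g p"
      by (simp only: pder1_linear[OF bounded_linear_scaleR_right pder_smooth[OF g] Cons.prems] pder_Cons[OF g Cons.prems, of d b])
    finally show ?case using insert by simp
  qed
  have "pder (v # a) g p = pder [v] (pder a g) p" by (rule pder_Cons[OF g Cons.prems])
  also have "\<dots> = (\<Sum>d\<in>D. (v \<bullet> d) *\<^sub>R pder [d] (pder a g) p)"
    by (rule pder1_expand[OF D pder_smooth[OF g] Cons.prems])
  also have "\<dots> = (\<Sum>d\<in>D. (v \<bullet> d) *\<^sub>R (\<Sum>b\<in>?S. list_coef a b *\<^sub>R pder (d # b) g p))"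
  proof (rule sum.cong[OF refl])
    fix d
    have "pder [d] (pder a g) p = pder [d] (\<lambda>p. \<Sum>b\<in>?S. list_coef a b *\<^sub>R pder b g p) p"
      by (rule pder1_cong[OF _ smooth_sum[OF W_open sm] Cons.prems]) (rule Cons.IH[symmetric])
    then show "(v \<bullet> d) *\<^sub>R pder [d] (pder a g) p = (v \<bullet> d) *\<^sub>R (\<Sum>b\<in>?S. list_coef a b *\<^sub>R pder (d # b) g p)"
      by (simp only: dsum[OF fin])
  qed
  also have "\<dots> = (\<Sum>(d, b)\<in>D \<times> ?S. list_coef (v # a) (d # b) *\<^sub>R pder (d # b) g p)"
    by (simp add: scaleR_sum_right sum.cartesian_product)
  also have "\<dots> = (\<Sum>b\<in>(\<lambda>(d, b). d # b) ` (D \<times> ?S). list_coef (v # a) b *\<^sub>R pder b g p)"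
    by (subst sum.reindex) (auto simp: inj_on_def case_prod_beta)
  also have "(\<lambda>(d, b). d # b) ` (D \<times> ?S) = {b. set b \<subseteq> D \<and> length b = length (v # a)}"
  proof (intro equalityI subsetI)
    fix b assume "b \<in> {b. set b \<subseteq> D \<and> length b = length (v # a)}"
    then obtain d b' where "b = d # b'" "d \<in> D" "b' \<in> ?S" by (cases b) auto
    then show "b \<in> (\<lambda>(d, b). d # b) ` (D \<times> ?S)" by (intro image_eqI[of _ _ "(d, b')"]) simp_all
  qed auto
  finally show ?case .
qed

abbreviation "lists_upto D k \<equiv> {a :: 'e list. set a \<subseteq> D \<and> length a \<le> k}"

lemma sdop_coefficients:
  assumes D: "orthonormal_basis D" and L: "\<And>x. x \<in> X \<Longrightarrow> smooth W (L x)"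
    and "sdop X L k (F :: 'x \<Rightarrow> 'm \<Rightarrow> real)"
  shows "\<exists>d. (\<forall>a. \<forall>p\<in>W. linear (d a p)) \<and> (\<forall>a u. smooth W (\<lambda>p. d a p u)) \<and>
    (\<forall>x\<in>X. \<forall>p\<in>W. F x p = (\<Sum>a\<in>lists_upto D k. d a p (pder a (L x) p)))"
  using assms(3)
proof (induction rule: sdop.induct)
  case (zero F)
  then show ?case by (intro exI[of _ "\<lambda>_ _ _. 0"]) (simp add: smooth_const linear_zero)
next
  case (step F a m G i)
  from step.IH obtain d where d: "\<forall>a. \<forall>p\<in>W. linear (d a p)" "\<forall>a u. smooth W (\<lambda>p. d a p u)"
    "\<forall>x\<in>X. \<forall>p\<in>W. F x p = (\<Sum>a\<in>lists_upto D k. d a p (pder a (L x) p))" by (elim exE conjE) (rule that)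
  have finD: "finite D" using D by (simp add: orthonormal_basis_def)
  have fin: "finite (lists_upto D k)" by (rule finite_lists_length_le[OF finD])
  let ?c = "\<lambda>b. if length b = length a then list_coef a b else 0"
  define d' where "d' b p u = d b p u + ?c b * (u \<bullet> i) * m p" for b p u
  have lin: "linear (d' b p)" if "p \<in> W" for b p
  proof -
    have dl: "linear (d b p)" using d(1) that by simp
    show ?thesis
      unfolding d'_def by (rule linearI) (simp_all add: linear_add[OF dl] linear_cmul[OF dl] inner_add_left algebra_simps)
  qed
  have sm: "smooth W (\<lambda>p. d' b p u)" for b u
    unfolding d'_def using d(2)
    by (intro smooth_add W_open smooth_linear[OF W_open bounded_linear_mult_right step.hyps(3)]) simp
  have "G x p = (\<Sum>b\<in>lists_upto D k. d' b p (pder b (L x) p))" if x: "x \<in> X" and p: "p \<in> W" for x p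
  proof -
    have sub: "{b. set b \<subseteq> D \<and> length b = length a} \<subseteq> lists_upto D k" using step.hyps(2) by auto
    have "pder a (L x) p = (\<Sum>b\<in>{b. set b \<subseteq> D \<and> length b = length a}. list_coef a b *\<^sub>R pder b (L x) p)"
      by (rule pder_expand[OF D L[OF x] p])
    also have "\<dots> = (\<Sum>b\<in>lists_upto D k. ?c b *\<^sub>R pder b (L x) p)"
      using fin sub by (intro sum.mono_neutral_cong_left) auto
    finally have "(pder a (L x) p \<bullet> i) * m p = (\<Sum>b\<in>lists_upto D k. ?c b * (pder b (L x) p \<bullet> i) * m p)"
      by (simp only: inner_sum_left inner_scaleR_left sum_distrib_right)
    moreover have "F x p = (\<Sum>b\<in>lists_upto D k. d b p (pder b (L x) p))" using d(3) x p by simp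
    ultimately show ?thesis
      by (simp only: step.hyps(4)[OF x p] d'_def sum.distrib real_scaleR_def)
  qed
  then show ?case using lin sm by (intro exI[of _ d']) simp
qed

text \<open>Each inductive step adds one product of operators; expanding both factors over the basis
  adds one real bilinear coefficient for every pair of multi-indices.\<close>

lemma bdop_coefficients:
  assumes D: "orthonormal_basis D" and L: "\<And>x. x \<in> X \<Longrightarrow> smooth W (L x)" "\<And>y. y \<in> Y \<Longrightarrow> smooth W (L' y)"
    and "bdop X L Y L' k l F"
  shows "\<exists>c. (\<forall>a b. \<forall>p\<in>W. bilinear (c a b p)) \<and> (\<forall>a b u v. smooth W (\<lambda>p. c a b p u v)) \<and>
    (\<forall>x\<in>X. \<forall>y\<in>Y. \<forall>p\<in>W. F x y p = (\<Sum>a\<in>lists_upto D k. \<Sum>b\<in>lists_upto D l. c a b p (pder a (L x) p) (pder b (L' y) p)))"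
  using assms(4)
proof (induction rule: bdop.induct)
  case (zero F)
  then show ?case
    by (intro exI[of _ "\<lambda>_ _ _ _ _. 0"]) (simp add: smooth_const bilinear_def linear_zero)
next
  case (step F G G' m F')
  from step.IH obtain c where c: "\<forall>a b. \<forall>p\<in>W. bilinear (c a b p)" "\<forall>a b u v. smooth W (\<lambda>p. c a b p u v)"
    "\<forall>x\<in>X. \<forall>y\<in>Y. \<forall>p\<in>W. F x y p = (\<Sum>a\<in>lists_upto D k. \<Sum>b\<in>lists_upto D l. c a b p (pder a (L x) p) (pder b (L' y) p))"
    by (elim exE conjE) (rule that)
  from sdop_coefficients[where L = L, OF D L(1) step.hyps(2)]
  obtain d where d: "\<forall>a. \<forall>p\<in>W. linear (d a p)" "\<forall>a u. smooth W (\<lambda>p. d a p u)"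
    "\<forall>x\<in>X. \<forall>p\<in>W. G x p = (\<Sum>a\<in>lists_upto D k. d a p (pder a (L x) p))" by blast
  from sdop_coefficients[where L = L', OF D L(2) step.hyps(3)]
  obtain d' where d': "\<forall>a. \<forall>p\<in>W. linear (d' a p)" "\<forall>a u. smooth W (\<lambda>p. d' a p u)"
    "\<forall>y\<in>Y. \<forall>p\<in>W. G' y p = (\<Sum>b\<in>lists_upto D l. d' b p (pder b (L' y) p))" by blast
  define c' where "c' a b p u v = c a b p u v + (d a p u * d' b p v :: real) *\<^sub>R m p" for a b p u v
  have bil: "bilinear (c' a b p)" if p: "p \<in> W" for a b p
  proof -
    have cb: "bilinear (c a b p)" and dl: "linear (d a p)" and dl': "linear (d' b p)"
      using c(1) d(1) d'(1) p by simp_all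
    show ?thesis
      unfolding bilinear_def c'_def
      by (intro conjI allI linearI)
        (simp_all add: bilinear_ladd[OF cb] bilinear_radd[OF cb] bilinear_lmul[OF cb] bilinear_rmul[OF cb]
          linear_add[OF dl] linear_add[OF dl'] linear_cmul[OF dl] linear_cmul[OF dl'] algebra_simps)
  qed
  have sm: "smooth W (\<lambda>p. c' a b p u v)" for a b u v
    unfolding c'_def using c(2) d(2) d'(2)
    by (intro smooth_add W_open smooth_bilinear[OF W_open bounded_bilinear_scaleR _ step.hyps(4)]
        smooth_bilinear[OF W_open bounded_bilinear_mult]) simp_all
  have "F' x y p = (\<Sum>a\<in>lists_upto D k. \<Sum>b\<in>lists_upto D l. c' a b p (pder a (L x) p) (pder b (L' y) p))"
    if x: "x \<in> X" and y: "y \<in> Y" and p: "p \<in> W" for x y p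
  proof -
    have "G x p * G' y p = (\<Sum>a\<in>lists_upto D k. \<Sum>b\<in>lists_upto D l. d a p (pder a (L x) p) * d' b p (pder b (L' y) p))"
      using d(3) d'(3) x y p by (simp add: sum_product)
    moreover have "F x y p = (\<Sum>a\<in>lists_upto D k. \<Sum>b\<in>lists_upto D l. c a b p (pder a (L x) p) (pder b (L' y) p))"
      using c(3) x y p by simp
    ultimately show ?thesis
      by (simp only: step.hyps(5)[OF x y p] c'_def sum.distrib scaleR_sum_left)
  qed
  then show ?case using bil sm by (intro exI[of _ c']) simp
qed

end

section \<open>Deformations of vector bundles\<close>

lemma sum_fun_apply: "(\<Sum>i\<in>I. f i) p = (\<Sum>i\<in>I. f i p)"
  for f :: "'i \<Rightarrow> 'm \<Rightarrow> 'w::comm_monoid_add"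
  by (induction I rule: infinite_finite_induct) simp_all

context complex_bundle
begin

lemma psi_uminus: "(U, \<psi>) \<in> triv \<Longrightarrow> p \<in> U \<Longrightarrow> v \<in> E p \<Longrightarrow> \<psi> p (- v) = - \<psi> p v"
  using triv_props(4)[of U \<psi> p v "-1"] by (simp add: vs.scale_minus_left)

lemma psi_diff:
  "(U, \<psi>) \<in> triv \<Longrightarrow> p \<in> U \<Longrightarrow> u \<in> E p \<Longrightarrow> v \<in> E p \<Longrightarrow> \<psi> p (u - v) = \<psi> p u - \<psi> p v"
  using triv_props(3)[of U \<psi> p u "- v"] by (simp add: psi_uminus E_closed)

lemma iv_add:
  assumes t: "(U, \<psi>) \<in> triv" "p \<in> U"
  shows "iv \<psi> p (v + w) = iv \<psi> p v + iv \<psi> p w"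
  by (rule psi_inj[OF t]) (simp_all add: iv_in[OF t] psi_iv[OF t] E_closed triv_props(3)[OF t])

lemma iv_scaleR:
  assumes t: "(U, \<psi>) \<in> triv" "p \<in> U"
  shows "iv \<psi> p (c *\<^sub>R w) = sc (of_real c) (iv \<psi> p w)"
  by (rule psi_inj[OF t])
    (simp_all add: iv_in[OF t] psi_iv[OF t] E_closed triv_props(4)[OF t] vec_eq_iff scaleR_conv_of_real[where 'a = complex])

lemma scale_transition_smooth:
  assumes t: "(U1, \<psi>1) \<in> triv" "(U3, \<psi>3) \<in> triv" and W: "open W" "W \<subseteq> U1" "W \<subseteq> U3"
  shows "smooth W (\<lambda>p. z *s \<psi>3 p (iv \<psi>1 p w))"
proof (rule smooth_bilinear[OF W(1) bounded_bilinear_vector_scalar smooth_const])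
  show "smooth W (\<lambda>p. \<psi>3 p (iv \<psi>1 p w))"
    by (rule smooth_subset[OF triv_transition[OF t]]) (use W in simp)
qed

text \<open>The local form of the module action between two trivializations. Linearity is meant over
  the reals, as \<open>bidiff_op\<close> requires of its coefficients.\<close>

lemma scale_transition_bilinear:
  assumes t1: "(U1, \<psi>1) \<in> triv" "p \<in> U1" and t3: "(U3, \<psi>3) \<in> triv" "p \<in> U3"
  shows "bilinear (\<lambda>w z. z *s \<psi>3 p (iv \<psi>1 p w))"
proof -
  let ?L = "\<lambda>w. \<psi>3 p (iv \<psi>1 p w)"
  have add: "?L (v + w) = ?L v + ?L w" for v w
    by (simp only: iv_add[OF t1] triv_props(3)[OF t3 iv_in[OF t1] iv_in[OF t1]])
  have scale: "?L (c *\<^sub>R w) = c *\<^sub>R ?L w" for c w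
    by (simp only: iv_scaleR[OF t1] triv_props(4)[OF t3 iv_in[OF t1]])
      (simp add: vec_eq_iff scaleR_conv_of_real[where 'a = complex])
  interpret m: bounded_bilinear "(*s) :: complex \<Rightarrow> complex ^ 'n \<Rightarrow> complex ^ 'n"
    by (rule bounded_bilinear_vector_scalar)
  show ?thesis
    unfolding bilinear_def
  proof (intro conjI allI)
    show "linear (\<lambda>z. z *s ?L w)" for w
      by (rule linearI) (simp_all only: m.add_left m.scaleR_left)
    show "linear (\<lambda>w. z *s ?L w)" for z
      by (rule linearI) (simp_all only: add scale m.add_right m.scaleR_right)
  qed
qed

lemma smooth_functions_iff: "f \<in> smooth_functions atlas \<longleftrightarrow> smooth UNIV f"
  by (simp add: smooth_functions_def)

lemma smooth_sections_iff: "x \<in> smooth_sections atlas E triv \<longleftrightarrow> sections_on UNIV x"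
  by (simp add: sections_UNIV)

lemma smooth_complex_mult:
  fixes f g :: "'m \<Rightarrow> complex"
  shows "open W \<Longrightarrow> smooth W f \<Longrightarrow> smooth W g \<Longrightarrow> smooth W (\<lambda>p. f p * g p)"
  by (rule smooth_bilinear[OF _ bounded_bilinear_mult])

lemma section_space_smooth_functions: "section_space (*) (smooth_functions atlas)"
proof
  show "0 \<in> smooth_functions atlas"
    unfolding smooth_functions_iff zero_fun_def by (rule smooth_const)
  show "x + y \<in> smooth_functions atlas"
    if "x \<in> smooth_functions atlas" "y \<in> smooth_functions atlas" for x y
    using that unfolding smooth_functions_iff plus_fun_def by (rule smooth_add[OF open_UNIV])
  show "fscale (*) c x \<in> smooth_functions atlas" if "x \<in> smooth_functions atlas" for x c
    using that unfolding smooth_functions_iff fscale_def by (rule smooth_complex_mult[OF open_UNIV smooth_const])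
qed

lemma section_space_smooth_sections: "section_space sc (smooth_sections atlas E triv)"
  unfolding section_space_def
proof (intro conjI allI impI)
  show "vector_space sc" by (rule vector_space_sc)
  show "0 \<in> smooth_sections atlas E triv"
    unfolding smooth_sections_iff zero_fun_def by (rule sections_on_zero[OF open_UNIV])
  show "x + y \<in> smooth_sections atlas E triv"
    if "x \<in> smooth_sections atlas E triv" "y \<in> smooth_sections atlas E triv" for x y
    using that unfolding smooth_sections_iff plus_fun_def by (rule sections_on_add[OF open_UNIV])
  show "fscale sc c x \<in> smooth_sections atlas E triv" if "x \<in> smooth_sections atlas E triv" for x c
    using that unfolding smooth_sections_iff fscale_def by (rule sections_on_scale[OF open_UNIV smooth_const])
qed

lemma section_module_bundle: "section_module (smooth_functions atlas) sc (smooth_sections atlas E triv)"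
  unfolding section_module_def section_module_axioms_def
proof (intro conjI allI impI)
  show "section_space sc (smooth_sections atlas E triv)" by (rule section_space_smooth_sections)
  show "section_space (*) (smooth_functions atlas)" by (rule section_space_smooth_functions)
  show "1 \<in> smooth_functions atlas"
    unfolding smooth_functions_iff one_fun_def by (rule smooth_const)
  show "f * g \<in> smooth_functions atlas"
    if "f \<in> smooth_functions atlas" "g \<in> smooth_functions atlas" for f g
    using that unfolding smooth_functions_iff times_fun_def by (rule smooth_complex_mult[OF open_UNIV])
  show "act sc x f \<in> smooth_sections atlas E triv"
    if "x \<in> smooth_sections atlas E triv" "f \<in> smooth_functions atlas" for x f
    using that(2,1) unfolding smooth_functions_iff smooth_sections_iff act_def by (rule sections_on_scale[OF open_UNIV])
qed

end

section \<open>Framed bundles and operators on their sections\<close>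

locale framed_bundle = complex_bundle atlas sc E triv
  for atlas :: "('m::{t2_space,second_countable_topology}, 'e::real_inner) atlas"
    and sc :: "complex \<Rightarrow> 'v::ab_group_add \<Rightarrow> 'v" and E :: "'m \<Rightarrow> 'v set"
    and triv :: "('m, 'v, complex ^ 'n) trivializations" +
  fixes C :: "'m cochains" and I :: "'i set" and e :: "'i \<Rightarrow> 'm \<Rightarrow> 'v" and l :: "'i \<Rightarrow> 'm \<Rightarrow> 'v \<Rightarrow> complex"
  assumes star: "formal_deformation (smooth_functions atlas) C"
    and finite_frame: "finite I"
    and frame_section: "i \<in> I \<Longrightarrow> sections_on UNIV (e i)"
    and frame_cosection: "i \<in> I \<Longrightarrow> cosections_on UNIV (l i)"
    and frame_expand: "v \<in> E p \<Longrightarrow> (\<Sum>i\<in>I. sc (l i p v) (e i p)) = v"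
begin

abbreviation "A \<equiv> smooth_functions atlas"
abbreviation "X \<equiv> smooth_sections atlas E triv"
abbreviation "co i x \<equiv> \<lambda>p. l i p (x p)"

lemma X_fibre: "x \<in> X \<Longrightarrow> x p \<in> E p"
  unfolding smooth_sections_iff using sections_onD(1)[of UNIV x p] by simp

lemma frame_lin: "i \<in> I \<Longrightarrow> lin_fun p (l i p)"
  using cosections_onD(1)[OF frame_cosection, of i p] by simp

sublocale framed_star_module A sc X C I e co
  unfolding framed_star_module_def framed_star_module_axioms_def star_module_def star_module_axioms_def
proof (intro conjI allI impI)
  show "section_module A sc X" by (rule section_module_bundle)
  show "formal_deformation A C" by (rule star)
  show "finite I" by (rule finite_frame)
  show "e i \<in> X" if "i \<in> I" for i using frame_section[OF that] unfolding smooth_sections_iff .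
  show "section_lin sc (*) X A (co i)" if i: "i \<in> I" for i
    unfolding section_lin_def clinear_on_def
  proof (intro conjI ballI allI)
    show "co i x \<in> A" if "x \<in> X" for x
      using that unfolding smooth_functions_iff smooth_sections_iff
      by (rule cosection_apply[OF open_UNIV frame_cosection[OF i]])
    show "co i (x + y) = co i x + co i y" if "x \<in> X" "y \<in> X" for x y
      by (simp add: fun_eq_iff lin_fun_add[OF frame_lin[OF i]] X_fibre that)
    show "co i (fscale sc c x) = fscale (*) c (co i x)" if "x \<in> X" for x c
      by (simp add: fun_eq_iff fscale_def lin_fun_scale[OF frame_lin[OF i]] X_fibre that)
  qed
  show "co i (act sc x f) = co i x * f" if "i \<in> I" "x \<in> X" "f \<in> A" for i x f
    by (simp add: fun_eq_iff act_def lin_fun_scale[OF frame_lin] X_fibre that mult.commute)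
  show "(\<Sum>i\<in>I. act sc (e i) (co i x)) = x" if "x \<in> X" for x
  proof
    fix p
    have "(\<Sum>i\<in>I. act sc (e i) (co i x)) p = (\<Sum>i\<in>I. sc (l i p (x p)) (e i p))"
      by (simp add: act_def sum_fun_apply)
    then show "(\<Sum>i\<in>I. act sc (e i) (co i x)) p = x p"
      by (simp only: frame_expand[OF X_fibre[OF that]])
  qed
qed

end

lemma ball_pairI: "(\<And>a b. (a, b) \<in> S \<Longrightarrow> P a b) \<Longrightarrow> \<forall>(a, b)\<in>S. P a b"
  by auto

context chart_domain
begin

lemma bdop_subst_right:
  assumes "bdop X L Y L' k l B" and "sdop Z L'' s (\<lambda>z. L' (G z))" "\<And>z. z \<in> Z \<Longrightarrow> G z \<in> Y"
    and "\<And>z. z \<in> Z \<Longrightarrow> smooth W (L'' z)"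
  shows "bdop X L Z L'' k (l + s) (\<lambda>x z. B x (G z))"
  using assms(1)
proof (induction rule: bdop.induct)
  case (zero F)
  show ?case by (rule bdop.zero) (simp add: zero assms(3))
next
  case (step F H H' m F')
  show ?case
    by (rule bdop.step[OF step.IH step.hyps(2) sdop_subst[OF step.hyps(3) assms(2,3,4)] step.hyps(4)])
      (simp_all add: step.hyps(5) assms(3))
qed

lemma bdop_of_coefficients:
  assumes L: "\<And>x. x \<in> X \<Longrightarrow> smooth W (L x)" "\<And>y. y \<in> Y \<Longrightarrow> smooth W (L' y)"
    and c: "\<And>a b p. p \<in> W \<Longrightarrow> bilinear (c a b p)" "\<And>a b u v. smooth W (\<lambda>p. c a b p u v)"
    and J: "\<And>a. a \<in> J \<Longrightarrow> length a \<le> k" "\<And>b. b \<in> J' \<Longrightarrow> length b \<le> l"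
  shows "bdop X L Y L' k l (\<lambda>x y p. \<Sum>a\<in>J. \<Sum>b\<in>J'. c a b p (pder a (L x) p) (pder b (L' y) p))"
proof (intro bdop_sum)
  fix a b assume ab: "a \<in> J" "b \<in> J'"
  have "sdop X L (0 + length a) (\<lambda>x. pder a (L x))"
    by (rule sdop_pder[OF sdop_base L(1)])
  then have a: "sdop X L k (\<lambda>x. pder a (L x))" by (rule sdop_mono) (simp add: J ab)
  have "sdop Y L' (0 + length b) (\<lambda>y. pder b (L' y))"
    by (rule sdop_pder[OF sdop_base L(2)])
  then have b: "sdop Y L' l (\<lambda>y. pder b (L' y))" by (rule sdop_mono) (simp add: J ab)
  show "bdop X L Y L' k l (\<lambda>x y p. c a b p (pder a (L x) p) (pder b (L' y) p))"
    by (rule bdop_bilinear[OF a b c])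
qed

lemma pder_loc_rep: "iter_deriv a (loc_rep U \<phi> \<psi> x) (\<phi> p) = pder a (\<lambda>p. \<psi> p (x p)) p"
  by (simp add: pder_def loc_rep_def)

end

context smooth_mfd
begin

definition smooth_reps :: "('m, 'u, 'u1::real_normed_vector) trivializations \<Rightarrow> ('m \<Rightarrow> 'u) set \<Rightarrow> bool" where
  "smooth_reps tX X \<longleftrightarrow> (\<forall>(U, \<psi>)\<in>tX. open U \<and> (\<forall>x\<in>X. smooth U (\<lambda>p. \<psi> p (x p))))"

lemma smooth_repsD:
  assumes "smooth_reps tX X" "(U, \<psi>) \<in> tX"
  shows "open U" "x \<in> X \<Longrightarrow> W \<subseteq> U \<Longrightarrow> smooth W (\<lambda>p. \<psi> p (x p))"
proof -
  have *: "open U \<and> (\<forall>x\<in>X. smooth U (\<lambda>p. \<psi> p (x p)))"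
    using bspec[OF assms(1)[unfolded smooth_reps_def] assms(2)] by simp
  show "open U" using * by (rule conjunct1)
  show "smooth W (\<lambda>p. \<psi> p (x p))" if "x \<in> X" "W \<subseteq> U"
    by (rule smooth_subset[OF bspec[OF conjunct2[OF *] that(1)] that(2)])
qed

definition chart_diff_op ::
  "('m, 'u, 'u1::euclidean_space) trivializations \<Rightarrow> ('m, 'w, 'w1::real_normed_vector) trivializations \<Rightarrow>
   ('m \<Rightarrow> 'u) set \<Rightarrow> nat \<Rightarrow> (('m \<Rightarrow> 'u) \<Rightarrow> 'm \<Rightarrow> 'w) \<Rightarrow> bool" where
  "chart_diff_op tX tZ X k F \<longleftrightarrow> (\<forall>U \<phi> W U1 \<psi>1 U3 \<psi>3. chart_domain atlas U \<phi> W \<longrightarrow>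
     (U1, \<psi>1) \<in> tX \<longrightarrow> (U3, \<psi>3) \<in> tZ \<longrightarrow> W \<subseteq> U1 \<longrightarrow> W \<subseteq> U3 \<longrightarrow>
     chart_domain.sdop atlas U \<phi> W X (\<lambda>x p. \<psi>1 p (x p)) k (\<lambda>x p. \<psi>3 p (F x p)))"

definition chart_bidiff_op ::
  "('m, 'u, 'u1::euclidean_space) trivializations \<Rightarrow> ('m, 'v, 'v1::euclidean_space) trivializations \<Rightarrow>
   ('m, 'w, 'w1::real_normed_vector) trivializations \<Rightarrow>
   ('m \<Rightarrow> 'u) set \<Rightarrow> ('m \<Rightarrow> 'v) set \<Rightarrow> nat \<Rightarrow> (('m \<Rightarrow> 'u) \<Rightarrow> ('m \<Rightarrow> 'v) \<Rightarrow> 'm \<Rightarrow> 'w) \<Rightarrow> bool" where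
  "chart_bidiff_op tX tY tZ X Y k B \<longleftrightarrow> (\<forall>U \<phi> W U1 \<psi>1 U2 \<psi>2 U3 \<psi>3. chart_domain atlas U \<phi> W \<longrightarrow>
     (U1, \<psi>1) \<in> tX \<longrightarrow> (U2, \<psi>2) \<in> tY \<longrightarrow> (U3, \<psi>3) \<in> tZ \<longrightarrow> W \<subseteq> U1 \<longrightarrow> W \<subseteq> U2 \<longrightarrow> W \<subseteq> U3 \<longrightarrow>
     chart_domain.bdop atlas U \<phi> W X (\<lambda>x p. \<psi>1 p (x p)) Y (\<lambda>y p. \<psi>2 p (y p)) k k (\<lambda>x y p. \<psi>3 p (B x y p)))"

lemma chart_diff_opD:
  assumes "chart_diff_op tX tZ X k F" "chart_domain atlas U \<phi> W"
    "(U1, \<psi>1) \<in> tX" "(U3, \<psi>3) \<in> tZ" "W \<subseteq> U1" "W \<subseteq> U3"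
  shows "chart_domain.sdop atlas U \<phi> W X (\<lambda>x p. \<psi>1 p (x p)) k (\<lambda>x p. \<psi>3 p (F x p))"
  using assms(1)[unfolded chart_diff_op_def, rule_format, OF assms(2-6)] .

lemma chart_bidiff_opD:
  assumes "chart_bidiff_op tX tY tZ X Y k B" "chart_domain atlas U \<phi> W"
    "(U1, \<psi>1) \<in> tX" "(U2, \<psi>2) \<in> tY" "(U3, \<psi>3) \<in> tZ" "W \<subseteq> U1" "W \<subseteq> U2" "W \<subseteq> U3"
  shows "chart_domain.bdop atlas U \<phi> W X (\<lambda>x p. \<psi>1 p (x p)) Y (\<lambda>y p. \<psi>2 p (y p)) k k (\<lambda>x y p. \<psi>3 p (B x y p))"
  using assms(1)[unfolded chart_bidiff_op_def, rule_format, OF assms(2-8)] .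

lemma chart_bidiff_op_mono:
  assumes "chart_bidiff_op tX tY tZ X Y k B" "k \<le> k'"
  shows "chart_bidiff_op tX tY tZ X Y k' B"
  unfolding chart_bidiff_op_def
proof (intro allI impI)
  fix U \<phi> W U1 \<psi>1 U2 \<psi>2 U3 \<psi>3
  assume *: "chart_domain atlas U \<phi> W" "(U1, \<psi>1) \<in> tX" "(U2, \<psi>2) \<in> tY" "(U3, \<psi>3) \<in> tZ" "W \<subseteq> U1" "W \<subseteq> U2" "W \<subseteq> U3"
  show "chart_domain.bdop atlas U \<phi> W X (\<lambda>x p. \<psi>1 p (x p)) Y (\<lambda>y p. \<psi>2 p (y p)) k' k' (\<lambda>x y p. \<psi>3 p (B x y p))"
    by (rule chart_domain.bdop_mono[OF *(1) chart_bidiff_opD[OF assms(1) *] assms(2) assms(2)])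
qed

lemma bidiff_op_imp_chart:
  assumes tX: "smooth_reps tX X" and tY: "smooth_reps tY Y" and B: "bidiff_op atlas tX tY tZ X Y k B"
  shows "chart_bidiff_op tX tY tZ X Y k B"
  unfolding chart_bidiff_op_def
proof (intro allI impI)
  fix U \<phi> W U1 \<psi>1 U2 \<psi>2 U3 \<psi>3
  assume cd: "chart_domain atlas U \<phi> W"
    and t: "(U1, \<psi>1) \<in> tX" "(U2, \<psi>2) \<in> tY" "(U3, \<psi>3) \<in> tZ" and W: "W \<subseteq> U1" "W \<subseteq> U2" "W \<subseteq> U3"
  interpret chart_domain atlas U \<phi> W by (rule cd)
  let ?W = "U \<inter> U1 \<inter> U2 \<inter> U3"
  have sub: "W \<subseteq> ?W" using W W_sub by (intro Int_greatest)
  obtain D c where c: "\<forall>a b. \<forall>p\<in>?W. bilinear (c a b p)" "\<forall>a b u v. smooth ?W (\<lambda>p. c a b p u v)"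
    "\<forall>x\<in>X. \<forall>y\<in>Y. \<forall>p\<in>?W. \<psi>3 p (B x y p) =
       (\<Sum>a\<in>{a. set a \<subseteq> D \<and> length a \<le> k}. \<Sum>b\<in>{b. set b \<subseteq> D \<and> length b \<le> k}.
          c a b p (iter_deriv a (loc_rep U \<phi> \<psi>1 x) (\<phi> p)) (iter_deriv b (loc_rep U \<phi> \<psi>2 y) (\<phi> p)))"
    using bspec[OF bspec[OF bspec[OF bspec[OF B[unfolded bidiff_op_def] chart_U, simplified] t(1), simplified] t(2), simplified] t(3), simplified]
    unfolding Let_def by (elim exE conjE) (rule that)
  have "bdop X (\<lambda>x p. \<psi>1 p (x p)) Y (\<lambda>y p. \<psi>2 p (y p)) k k
    (\<lambda>x y p. \<Sum>a\<in>{a. set a \<subseteq> D \<and> length a \<le> k}. \<Sum>b\<in>{b. set b \<subseteq> D \<and> length b \<le> k}.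
       c a b p (pder a (\<lambda>p. \<psi>1 p (x p)) p) (pder b (\<lambda>p. \<psi>2 p (y p)) p))"
  proof (rule bdop_of_coefficients)
    show "bilinear (c a b p)" if "p \<in> W" for a b p
      by (rule bspec[OF spec[OF spec[OF c(1)]]], rule subsetD[OF sub that])
    show "smooth W (\<lambda>p. c a b p u v)" for a b u v
      by (rule smooth_subset[OF spec[OF spec[OF spec[OF spec[OF c(2)]]]] sub])
  qed (simp_all add: smooth_repsD(2)[OF tX t(1)] smooth_repsD(2)[OF tY t(2)] W)
  then show "bdop X (\<lambda>x p. \<psi>1 p (x p)) Y (\<lambda>y p. \<psi>2 p (y p)) k k (\<lambda>x y p. \<psi>3 p (B x y p))"
  proof (rule bdop_cong)
    fix x y p assume xy: "x \<in> X" "y \<in> Y" and p: "p \<in> W"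
    show "\<psi>3 p (B x y p) = (\<Sum>a\<in>{a. set a \<subseteq> D \<and> length a \<le> k}. \<Sum>b\<in>{b. set b \<subseteq> D \<and> length b \<le> k}.
       c a b p (pder a (\<lambda>p. \<psi>1 p (x p)) p) (pder b (\<lambda>p. \<psi>2 p (y p)) p))"
      using bspec[OF bspec[OF bspec[OF c(3) xy(1)] xy(2)] subsetD[OF sub p]] by (simp only: pder_loc_rep)
  qed
qed

text \<open>The inductive description is applied on the full intersection of the domains and
  expanded over one orthonormal basis, which is also independent, as the definition demands.\<close>

lemma chart_imp_bidiff_op:
  fixes tX :: "('m, 'u, 'u1::euclidean_space) trivializations" and tY :: "('m, 'v, 'v1::euclidean_space) trivializations"
    and tZ :: "('m, 'w, 'w1::real_normed_vector) trivializations"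
  assumes tX: "smooth_reps tX X" and tY: "smooth_reps tY Y" and tZ: "smooth_reps tZ Z"
    and B: "chart_bidiff_op tX tY tZ X Y k B"
  shows "bidiff_op atlas tX tY tZ X Y k B"
proof -
  obtain D :: "'e set" where D: "orthonormal_basis D" using orthonormal_basis_ex by (elim exE)
  have D0: "0 \<notin> D"
  proof
    assume "0 \<in> D"
    then have "(0::'e) \<bullet> 0 = 1" using D unfolding orthonormal_basis_def by (metis (full_types))
    then show False by simp
  qed
  have D_basis: "finite D \<and> independent D \<and> span D = UNIV"
  proof (intro conjI)
    show "independent D"
      by (rule pairwise_orthogonal_independent[OF _ D0])
        (use D in \<open>auto simp: orthonormal_basis_def pairwise_def orthogonal_def\<close>)
  qed (use D in \<open>auto simp: orthonormal_basis_def\<close>)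
  have main: "\<exists>D (c :: 'e list \<Rightarrow> 'e list \<Rightarrow> 'm \<Rightarrow> 'u1 \<Rightarrow> 'v1 \<Rightarrow> 'w1). finite D \<and> independent D \<and> span D = UNIV \<and>
      (\<forall>a b. \<forall>p\<in>W. bilinear (c a b p)) \<and>
      (\<forall>a b u v. smooth W (\<lambda>p. c a b p u v)) \<and>
      (\<forall>x\<in>X. \<forall>y\<in>Y. \<forall>p\<in>W.
         \<psi>3 p (B x y p) =
           (\<Sum>a\<in>{a. set a \<subseteq> D \<and> length a \<le> k}. \<Sum>b\<in>{b. set b \<subseteq> D \<and> length b \<le> k}.
              c a b p (iter_deriv a (loc_rep U \<phi> \<psi>1 x) (\<phi> p)) (iter_deriv b (loc_rep U \<phi> \<psi>2 y) (\<phi> p))))"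
    if U: "(U, \<phi>) \<in> atlas" and t: "(U1, \<psi>1) \<in> tX" "(U2, \<psi>2) \<in> tY" "(U3, \<psi>3) \<in> tZ"
      and W: "W = U \<inter> U1 \<inter> U2 \<inter> U3" for U \<phi> U1 \<psi>1 U2 \<psi>2 U3 \<psi>3 W
  proof -
    have sub: "W \<subseteq> U1" "W \<subseteq> U2" "W \<subseteq> U3" by (auto simp: W)
    have "open W" unfolding W
      by (intro open_Int chart(1)[OF U] smooth_repsD(1)[OF tX t(1)] smooth_repsD(1)[OF tY t(2)] smooth_repsD(1)[OF tZ t(3)])
    then interpret chart_domain atlas U \<phi> W
      by unfold_locales (simp_all add: U, simp add: W inf.coboundedI1)
    have rX: "smooth W (\<lambda>p. \<psi>1 p (x p))" if "x \<in> X" for x by (rule smooth_repsD(2)[OF tX t(1) that sub(1)])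
    have rY: "smooth W (\<lambda>p. \<psi>2 p (y p))" if "y \<in> Y" for y by (rule smooth_repsD(2)[OF tY t(2) that sub(2)])
    show ?thesis
    proof (rule exE[OF bdop_coefficients[OF D rX rY chart_bidiff_opD[OF B chart_domain_axioms t sub]]])
      fix c assume c: "(\<forall>a b. \<forall>p\<in>W. bilinear (c a b p)) \<and> (\<forall>a b u v. smooth W (\<lambda>p. c a b p u v)) \<and>
        (\<forall>x\<in>X. \<forall>y\<in>Y. \<forall>p\<in>W. \<psi>3 p (B x y p) =
          (\<Sum>a\<in>lists_upto D k. \<Sum>b\<in>lists_upto D k. c a b p (pder a (\<lambda>p. \<psi>1 p (x p)) p) (pder b (\<lambda>p. \<psi>2 p (y p)) p)))"
      show ?thesis
        unfolding pder_loc_rep by (rule exI[of _ D], rule exI[of _ c]) (intro conjI D_basis[THEN conjunct1]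
          D_basis[THEN conjunct2, THEN conjunct1] D_basis[THEN conjunct2, THEN conjunct2]
          c[THEN conjunct1] c[THEN conjunct2, THEN conjunct1] c[THEN conjunct2, THEN conjunct2])
    qed (assumption)+
  qed
  show ?thesis
    unfolding bidiff_op_def Let_def
    by (intro ball_pairI main[OF _ _ _ _ refl])
qed

end

section \<open>Supports and local deformations\<close>

lemma fsupp_mono: "(\<And>p. x p \<noteq> 0 \<Longrightarrow> y p \<noteq> 0) \<Longrightarrow> fsupp x \<subseteq> fsupp y"
  unfolding fsupp_def by (intro closure_mono) auto

lemma fsupp_sum:
  fixes f :: "'i \<Rightarrow> 'm::topological_space \<Rightarrow> 'w::comm_monoid_add"
  assumes "\<And>i. i \<in> I \<Longrightarrow> fsupp (f i) \<subseteq> S"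
  shows "fsupp (\<Sum>i\<in>I. f i) \<subseteq> S"
  using assms
proof (induction I rule: infinite_finite_induct)
  case (insert i I)
  have "{p. (f i + sum f I) p \<noteq> 0} \<subseteq> {p. f i p \<noteq> 0} \<union> {p. sum f I p \<noteq> 0}" by auto
  then have "fsupp (f i + sum f I) \<subseteq> fsupp (f i) \<union> fsupp (sum f I)"
    unfolding fsupp_def closure_Un[symmetric] by (rule closure_mono)
  moreover have "fsupp (f i) \<union> fsupp (sum f I) \<subseteq> S"
    by (intro Un_least insert.IH insert.prems) simp_all
  ultimately show ?case unfolding sum.insert[OF insert.hyps(1,2)] by (rule order_trans)
qed (simp_all add: fsupp_def)

lemma fsupp_diff:
  fixes x y :: "'m::topological_space \<Rightarrow> 'w::ab_group_add"
  assumes "fsupp x \<subseteq> S" "fsupp y \<subseteq> S"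
  shows "fsupp (x - y) \<subseteq> S"
proof -
  have "{p. (x - y) p \<noteq> 0} \<subseteq> {p. x p \<noteq> 0} \<union> {p. y p \<noteq> 0}" by auto
  then have "fsupp (x - y) \<subseteq> fsupp x \<union> fsupp y"
    unfolding fsupp_def closure_Un[symmetric] by (rule closure_mono)
  then show ?thesis by (rule order_trans) (intro Un_least assms)
qed

lemma fsupp_uminus: "fsupp (- x) = fsupp x"
  for x :: "'m::topological_space \<Rightarrow> 'w::ab_group_add"
  by (simp add: fsupp_def)

lemma local_opD: "local_op X Y B \<Longrightarrow> x \<in> X \<Longrightarrow> y \<in> Y \<Longrightarrow> fsupp (B x y) \<subseteq> fsupp x \<inter> fsupp y"
  by (simp add: local_op_def)

context framed_bundle
begin

lemma fsupp_co: "i \<in> I \<Longrightarrow> fsupp (co i x) \<subseteq> fsupp x"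
  by (rule fsupp_mono) (auto simp: lin_fun_0[OF frame_lin])

text \<open>The frame elements contribute no support condition: the support of \<open>x\<close> is
  inherited through \<open>co i x\<close>, that of \<open>f\<close> directly, and each cochain keeps
  both.\<close>

lemma local_defect_homotopy:
  assumes C: "\<And>r. local_op A A (C r)" and R: "\<And>s. section_bilin sc (*) sc X A X (R s)"
    and loc: "\<And>s. s \<le> n \<Longrightarrow> local_op X A (R s)"
  shows "local_op X A (\<lambda>x f. - defect_homotopy R n x f)"
  unfolding local_op_def fsupp_uminus defect_homotopy_def assoc_defect_def
proof (intro ballI fsupp_sum fsupp_diff)
  fix x f i s assume x: "x \<in> X" and f: "f \<in> A" and i: "i \<in> I" and s: "s \<in> {..n}"
  note co = co_in[OF i x] and RA = section_bilin_in[OF R] and CA = section_bilin_in[OF C_bilin]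
  have "fsupp (R s (e i) (co i x)) \<subseteq> fsupp x"
    using local_opD[OF loc e_in[OF i] co, of s] s fsupp_co[OF i, of x] by auto
  then show "fsupp (R (n - s) (R s (e i) (co i x)) f) \<subseteq> fsupp x \<inter> fsupp f"
    using local_opD[OF loc RA[OF e_in[OF i] co] f, of "n - s" s] by auto
  show "fsupp (R (n - s) (e i) (C s (co i x) f)) \<subseteq> fsupp x \<inter> fsupp f"
    using local_opD[OF loc e_in[OF i] CA[OF co f], of "n - s" s] local_opD[OF C co f, of s]
      fsupp_co[OF i, of x] by auto
qed

lemma local_morphism_homotopy:
  assumes C: "\<And>r. local_op A A (C r)" and R: "\<And>s. section_bilin sc (*) sc X A X (R s)"
    and loc: "\<And>s. local_op X A (R s)" and T: "\<And>s. section_lin sc (*) X A (T s)"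
    and T_loc: "\<And>s y. s \<le> n \<Longrightarrow> y \<in> X \<Longrightarrow> fsupp (T s y) \<subseteq> fsupp y" and x: "x \<in> X"
  shows "fsupp (\<Sum>i\<in>I. morphism_defect R C T n (e i) (co i x)) \<subseteq> fsupp x"
  unfolding morphism_defect_def
proof (intro fsupp_sum fsupp_diff)
  fix i s assume i: "i \<in> I" and s: "s \<in> {..n}"
  note co = co_in[OF i x] and RA = section_bilin_in[OF R]
  show "fsupp (C (n - s) (T s (e i)) (co i x)) \<subseteq> fsupp x"
    using local_opD[OF C section_lin_in[OF T e_in[OF i]] co, of "n - s" s] fsupp_co[OF i, of x] by auto
  show "fsupp (T (n - s) (R s (e i) (co i x))) \<subseteq> fsupp x"
    using T_loc[OF _ RA[OF e_in[OF i] co], of "n - s" s] local_opD[OF loc e_in[OF i] co, of s]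
      fsupp_co[OF i, of x] by auto
qed

theorem local_deformation_exists:
  assumes C: "\<And>r. local_op A A (C r)"
  shows "\<exists>R. bundle_deformation A C sc X R \<and> (\<forall>r. local_op X A (R r))"
proof (rule deformation_exists[where Q = "\<lambda>_. local_op X A"])
  show "local_op X A (act sc)"
    unfolding local_op_def act_def
    by (intro ballI Int_greatest fsupp_mono) (auto simp: vs.scale_zero_left)
next
  fix R :: "nat \<Rightarrow> ('m \<Rightarrow> 'v) \<Rightarrow> ('m \<Rightarrow> complex) \<Rightarrow> 'm \<Rightarrow> 'v" and r
  assume R: "\<And>s. section_bilin sc (*) sc X A X (R s)" and Q: "\<And>s. s \<le> r \<Longrightarrow> local_op X A (R s)"
    and zero: "\<And>x f. R (Suc r) x f = 0"
  \<comment> \<open>The homotopy of order \<open>Suc r\<close> formally contains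
    \<open>R (Suc r)\<close>, which is still zero at this stage and hence local.\<close>
  have "local_op X A (R s)" if "s \<le> Suc r" for s
  proof (cases "s = Suc r")
    case True
    then show ?thesis by (simp only: local_op_def zero) (simp add: fsupp_def)
  qed (use that Q in simp)
  then show "local_op X A (\<lambda>x f. - defect_homotopy R (Suc r) x f)"
    by (rule local_defect_homotopy[OF C R])
qed

lemma smooth_reps_X: "smooth_reps triv X"
  unfolding smooth_reps_def
proof (intro ballI, simp only: split_paired_all prod.case, intro conjI ballI)
  fix U \<psi> x assume U: "(U, \<psi>) \<in> triv"
  show "open U" by (rule triv_props(1)[OF U])
  show "smooth U (\<lambda>p. \<psi> p (x p))" if "x \<in> X"
    using sections_onD(2)[OF that[unfolded smooth_sections_iff] U] by simp
qed

lemma smooth_reps_A: "smooth_reps fun_triv A"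
  unfolding smooth_reps_def by (simp add: fun_triv_def smooth_functions_iff)

lemma fun_triv_UNIV: "(UNIV, \<lambda>p z. z) \<in> fun_triv" by (simp add: fun_triv_def)

lemma fun_trivD: "(U, \<psi>) \<in> fun_triv \<Longrightarrow> U = UNIV \<and> \<psi> = (\<lambda>p z. z)" by (simp add: fun_triv_def)

text \<open>A cosection acts fibrewise and linearly, so in a trivialization it is a smooth linear
  coefficient applied to the section itself.\<close>

lemma chart_diff_op_co:
  assumes i: "i \<in> I"
  shows "chart_diff_op triv fun_triv X 0 (co i)"
  unfolding chart_diff_op_def
proof (intro allI impI)
  fix U \<phi> W U1 \<psi>1 U3 and \<psi>3 :: "'m \<Rightarrow> complex \<Rightarrow> complex"
  assume cd: "chart_domain atlas U \<phi> W" and t: "(U1, \<psi>1) \<in> triv" "(U3, \<psi>3) \<in> fun_triv" and W: "W \<subseteq> U1"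
  interpret chart_domain atlas U \<phi> W by (rule cd)
  have inU: "p \<in> U1" if "p \<in> W" for p using that W by auto
  have "sdop X (\<lambda>x p. \<psi>1 p (x p)) 0 (\<lambda>x p. l i p (iv \<psi>1 p (\<psi>1 p (x p))))"
  proof (rule sdop_scale[OF sdop_base, where c = "\<lambda>p w. l i p (iv \<psi>1 p w)"])
    fix p assume p: "p \<in> W"
    note t1 = t(1) inU[OF p]
    show "linear (\<lambda>w. l i p (iv \<psi>1 p w))"
      by (rule linearI)
        (simp_all add: iv_add[OF t1] iv_scaleR[OF t1] iv_in[OF t1] lin_fun_add[OF frame_lin[OF i]]
          lin_fun_scale[OF frame_lin[OF i]] scaleR_conv_of_real[where 'a = complex])
  next
    fix w
    show "smooth W (\<lambda>p. l i p (iv \<psi>1 p w))"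
      by (rule smooth_subset[OF cosections_onD(2)[OF frame_cosection[OF i] t(1)]]) (use W in simp)
  qed
  then have "sdop X (\<lambda>x p. \<psi>1 p (x p)) 0 (\<lambda>x. co i x)"
    by (rule sdop_cong) (simp add: iv_psi[OF t(1) inU] X_fibre)
  then show "sdop X (\<lambda>x p. \<psi>1 p (x p)) 0 (\<lambda>x p. \<psi>3 p (l i p (x p)))"
    using fun_trivD[OF t(2)] by simp
qed

text \<open>No derivative is taken: the action is multiplication followed by a change of
  trivialization. It therefore qualifies for every bound \<open>k\<close>.\<close>

lemma chart_bidiff_op_act: "chart_bidiff_op triv fun_triv triv X A k (act sc)"
  unfolding chart_bidiff_op_def
proof (intro allI impI)
    fix U \<phi> W U1 \<psi>1 U2 and \<psi>2 :: "'m \<Rightarrow> complex \<Rightarrow> complex" and U3 \<psi>3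
    assume cd: "chart_domain atlas U \<phi> W" and t: "(U1, \<psi>1) \<in> triv" "(U2, \<psi>2) \<in> fun_triv" "(U3, \<psi>3) \<in> triv"
      and W: "W \<subseteq> U1" "W \<subseteq> U2" "W \<subseteq> U3"
    interpret chart_domain atlas U \<phi> W by (rule cd)
    have inU: "p \<in> U1" "p \<in> U3" if "p \<in> W" for p using that W by auto
    have b1: "sdop X (\<lambda>x p. \<psi>1 p (x p)) k (\<lambda>x p. \<psi>1 p (x p))" by (rule sdop_base)
    have b2: "sdop A (\<lambda>f. f) k (\<lambda>f. f)" by (rule sdop_base)
    note b3 = bdop_bilinear[OF b1 b2 scale_transition_bilinear[OF t(1) inU(1) t(3) inU(2)] scale_transition_smooth[OF t(1,3) W_open W(1,3)]]
    have "bdop X (\<lambda>x p. \<psi>1 p (x p)) A (\<lambda>f. f) k k (\<lambda>x f p. \<psi>3 p (act sc x f p))"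
      by (rule bdop_cong[OF b3], assumption, assumption)
        (simp add: act_def iv_psi[OF t(1) inU(1)] X_fibre triv_props(4)[OF t(3) inU(2)])
    then show "bdop X (\<lambda>x p. \<psi>1 p (x p)) A (\<lambda>f p. \<psi>2 p (f p)) k k (\<lambda>x f p. \<psi>3 p (act sc x f p))"
      using fun_trivD[OF t(2)] by simp
qed

end

section \<open>Differential order of the deformation\<close>

locale graded_framed_bundle = framed_bundle atlas sc E triv C I e l
  for atlas :: "('m::{t2_space,second_countable_topology}, 'e::real_inner) atlas"
    and sc :: "complex \<Rightarrow> 'v::ab_group_add \<Rightarrow> 'v" and E :: "'m \<Rightarrow> 'v set"
    and triv :: "('m, 'v, complex ^ 'n) trivializations"
    and C :: "'m cochains" and I :: "'i set" and e l +
  fixes \<kappa> :: "nat \<Rightarrow> nat"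
  assumes \<kappa>_add: "\<kappa> r + \<kappa> s \<le> \<kappa> (r + s)"
    and C_order: "chart_bidiff_op fun_triv fun_triv fun_triv A A (\<kappa> r) (C r)"
begin

lemma \<kappa>_diff: "s \<le> r \<Longrightarrow> \<kappa> (r - s) + \<kappa> s \<le> \<kappa> r"
  using \<kappa>_add[of "r - s" s] by simp

lemma \<kappa>_mono: "s \<le> r \<Longrightarrow> \<kappa> s \<le> \<kappa> r"
  using \<kappa>_diff[of s r] by simp

context
  fixes U \<phi> W U1 \<psi>1
  assumes cd: "chart_domain atlas U \<phi> W" and t1: "(U1, \<psi>1) \<in> triv" and W1: "W \<subseteq> U1"
begin

interpretation chart_domain atlas U \<phi> W by (rule cd)

lemma rep_X: "x \<in> X \<Longrightarrow> smooth W (\<lambda>p. \<psi>1 p (x p))"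
  by (rule smooth_repsD(2)[OF smooth_reps_X t1 _ W1])

lemma rep_A: "f \<in> A \<Longrightarrow> smooth W f"
  by (simp add: smooth_functions_iff smooth_subset[OF _ subset_UNIV])

lemma co_order: "i \<in> I \<Longrightarrow> sdop X (\<lambda>x p. \<psi>1 p (x p)) 0 (co i)"
  by (rule chart_diff_opD[OF chart_diff_op_co cd t1 fun_triv_UNIV W1 subset_UNIV])

lemma C_chart_order: "bdop A (\<lambda>f. f) A (\<lambda>f. f) (\<kappa> r) (\<kappa> r) (C r)"
  by (rule chart_bidiff_opD[OF C_order cd fun_triv_UNIV fun_triv_UNIV fun_triv_UNIV subset_UNIV subset_UNIV subset_UNIV])

lemma C_partial_order: "f \<in> A \<Longrightarrow> sdop A (\<lambda>f. f) (\<kappa> r) (C r f)"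
  by (rule bdop_partial[OF C_chart_order]) (simp_all only: rep_A)

context
  fixes R :: "nat \<Rightarrow> ('m \<Rightarrow> 'v) \<Rightarrow> ('m \<Rightarrow> complex) \<Rightarrow> 'm \<Rightarrow> 'v" and n
  assumes R: "\<And>s. section_bilin sc (*) sc X A X (R s)"
    and R_order: "\<And>s. s \<le> n \<Longrightarrow> chart_bidiff_op triv fun_triv triv X A (\<kappa> s) (R s)"
begin

lemma R_chart_order:
  assumes "s \<le> n" "(U3, \<psi>3) \<in> triv" "W \<subseteq> U3"
  shows "bdop X (\<lambda>x p. \<psi>1 p (x p)) A (\<lambda>f. f) (\<kappa> s) (\<kappa> s) (\<lambda>x f p. \<psi>3 p (R s x f p))"
  by (rule chart_bidiff_opD[OF R_order[OF assms(1)] cd t1 fun_triv_UNIV assms(2) W1 subset_UNIV assms(3)])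

lemma R_frame_order:
  assumes "s \<le> n" "(U3, \<psi>3) \<in> triv" "W \<subseteq> U3" "i \<in> I"
  shows "sdop A (\<lambda>f. f) (\<kappa> s) (\<lambda>f p. \<psi>3 p (R s (e i) f p))"
  by (rule bdop_partial[OF R_chart_order[OF assms(1-3)] e_in[OF assms(4)]]) (rule rep_X[OF e_in[OF assms(4)]])

lemma R_frame_co_order:
  assumes "s \<le> n" "i \<in> I"
  shows "sdop X (\<lambda>x p. \<psi>1 p (x p)) (\<kappa> s + 0) (\<lambda>x p. \<psi>1 p (R s (e i) (co i x) p))"
  by (rule sdop_subst[OF R_frame_order[OF assms(1) t1 W1 assms(2)] co_order[OF assms(2)] co_in[OF assms(2)] rep_X])

text \<open>Composite cochains of orders \<open>n - s\<close> and \<open>s\<close> in \<lambda> have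
  differential order at most the sum of their bounds, which superadditivity keeps below
  \<open>\<kappa> n\<close>. The frame elements are frozen, and the coframe has order zero.\<close>

lemma defect_homotopy_chart_order:
  assumes t3: "(U3, \<psi>3) \<in> triv" "W \<subseteq> U3"
  shows "bdop X (\<lambda>x p. \<psi>1 p (x p)) A (\<lambda>f. f) (\<kappa> n) (\<kappa> n) (\<lambda>x f p. \<psi>3 p ((- defect_homotopy R n x f) p))"
proof -
  note RA = section_bilin_in[OF R] and CA = section_bilin_in[OF C_bilin]
  have in3: "p \<in> U3" if "p \<in> W" for p using that t3(2) by auto
  let ?a = "\<lambda>i s x f. R (n - s) (R s (e i) (co i x)) f"
  let ?b = "\<lambda>i s x f. R (n - s) (e i) (C s (co i x) f)"
  have a: "bdop X (\<lambda>x p. \<psi>1 p (x p)) A (\<lambda>f. f) (\<kappa> n) (\<kappa> n) (\<lambda>x f p. \<psi>3 p (?a i s x f p))"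
    if i: "i \<in> I" and s: "s \<le> n" for i s
  proof (rule bdop_mono)
    show "bdop X (\<lambda>x p. \<psi>1 p (x p)) A (\<lambda>f. f) (\<kappa> (n - s) + (\<kappa> s + 0)) (\<kappa> (n - s)) (\<lambda>x f p. \<psi>3 p (?a i s x f p))"
      by (rule bdop_subst_left[OF R_chart_order[OF diff_le_self t3] R_frame_co_order[OF s i]
            RA[OF e_in[OF i] co_in[OF i]] rep_X])
  qed (use \<kappa>_diff[OF s] in simp_all)
  have b: "bdop X (\<lambda>x p. \<psi>1 p (x p)) A (\<lambda>f. f) (\<kappa> n) (\<kappa> n) (\<lambda>x f p. \<psi>3 p (?b i s x f p))"
    if i: "i \<in> I" and s: "s \<le> n" for i s
  proof (rule bdop_mono)
    show "bdop X (\<lambda>x p. \<psi>1 p (x p)) A (\<lambda>f. f) (\<kappa> (n - s) + (\<kappa> s + 0)) (\<kappa> (n - s) + \<kappa> s) (\<lambda>x f p. \<psi>3 p (?b i s x f p))"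
      by (rule bdop_subst_out[OF R_frame_order[OF diff_le_self t3 i]
            bdop_subst_left[OF C_chart_order co_order[OF i] co_in[OF i] rep_X] CA[OF co_in[OF i]] rep_X rep_A])
  qed (use \<kappa>_diff[OF s] in simp_all)
  have "bdop X (\<lambda>x p. \<psi>1 p (x p)) A (\<lambda>f. f) (\<kappa> n) (\<kappa> n)
    (\<lambda>x f p. \<Sum>i\<in>I. (\<Sum>s\<le>n. \<psi>3 p (?b i s x f p)) + (\<Sum>s\<le>n. - \<psi>3 p (?a i s x f p)))"
  proof (intro bdop_sum bdop_add)
    fix i s assume i: "i \<in> I" and "s \<in> {..n}"
    then have s: "s \<le> n" by simp
    show "bdop X (\<lambda>x p. \<psi>1 p (x p)) A (\<lambda>f. f) (\<kappa> n) (\<kappa> n) (\<lambda>x f p. \<psi>3 p (?b i s x f p))" by (rule b[OF i s])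
    show "bdop X (\<lambda>x p. \<psi>1 p (x p)) A (\<lambda>f. f) (\<kappa> n) (\<kappa> n) (\<lambda>x f p. - \<psi>3 p (?a i s x f p))"
      by (rule bdop_scale[OF a[OF i s], where c = "\<lambda>p. uminus"])
        (simp_all add: linear_uminus smooth_const)
  qed
  then show ?thesis
  proof (rule bdop_cong)
    fix x f p assume x: "x \<in> X" and f: "f \<in> A" and p: "p \<in> W"
    have aE: "?a i s x f p \<in> E p" if "i \<in> I" for i s
      by (rule X_fibre[OF RA[OF RA[OF e_in[OF that] co_in[OF that x]] f]])
    have bE: "?b i s x f p \<in> E p" if "i \<in> I" for i s
      by (rule X_fibre[OF RA[OF e_in[OF that] CA[OF co_in[OF that x] f]]])
    note t = t3(1) in3[OF p]
    have aS: "(\<Sum>s\<le>n. ?a i s x f p) \<in> E p" if "i \<in> I" for i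
      by (rule E_closed(6)) (rule aE[OF that])
    have bS: "(\<Sum>s\<le>n. ?b i s x f p) \<in> E p" if "i \<in> I" for i
      by (rule E_closed(6)) (rule bE[OF that])
    have "(- defect_homotopy R n x f) p = (\<Sum>i\<in>I. (\<Sum>s\<le>n. ?b i s x f p) - (\<Sum>s\<le>n. ?a i s x f p))"
      by (simp add: defect_homotopy_def assoc_defect_def sum_fun_apply sum_negf[symmetric])
    then have "\<psi>3 p ((- defect_homotopy R n x f) p) = \<psi>3 p (\<Sum>i\<in>I. (\<Sum>s\<le>n. ?b i s x f p) - (\<Sum>s\<le>n. ?a i s x f p))"
      by (rule arg_cong)
    also have "\<dots> = (\<Sum>i\<in>I. \<psi>3 p ((\<Sum>s\<le>n. ?b i s x f p) - (\<Sum>s\<le>n. ?a i s x f p)))"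
      by (rule psi_sum[OF t]) (rule E_closed(5)[OF bS aS])
    also have "\<dots> = (\<Sum>i\<in>I. (\<Sum>s\<le>n. \<psi>3 p (?b i s x f p)) - (\<Sum>s\<le>n. \<psi>3 p (?a i s x f p)))"
    proof (rule sum.cong[OF refl])
      fix i assume i: "i \<in> I"
      show "\<psi>3 p ((\<Sum>s\<le>n. ?b i s x f p) - (\<Sum>s\<le>n. ?a i s x f p)) =
          (\<Sum>s\<le>n. \<psi>3 p (?b i s x f p)) - (\<Sum>s\<le>n. \<psi>3 p (?a i s x f p))"
        unfolding psi_diff[OF t bS[OF i] aS[OF i]]
        by (intro arg_cong2[where f = minus] psi_sum[OF t] aE[OF i] bE[OF i])
    qed
    finally show "\<psi>3 p ((- defect_homotopy R n x f) p) =
        (\<Sum>i\<in>I. (\<Sum>s\<le>n. \<psi>3 p (?b i s x f p)) + (\<Sum>s\<le>n. - \<psi>3 p (?a i s x f p)))"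
      by (simp only: sum_negf diff_conv_add_uminus)
  qed
qed

text \<open>The functions \<open>T s (e i)\<close> are fixed, so the first kind of term is a
  partially evaluated cochain in \<open>co i x\<close>; the second kind is a composition whose
  orders add.\<close>

lemma morphism_homotopy_chart_order:
  assumes T: "\<And>s. section_lin sc (*) X A (T s)"
    and T_order: "\<And>s. s \<le> n \<Longrightarrow> sdop X (\<lambda>x p. \<psi>1 p (x p)) (\<kappa> s) (T s)"
  shows "sdop X (\<lambda>x p. \<psi>1 p (x p)) (\<kappa> n) (\<lambda>x. \<Sum>i\<in>I. morphism_defect R C T n (e i) (co i x))"
proof -
  note RA = section_bilin_in[OF R] and TA = section_lin_in[OF T]
  let ?a = "\<lambda>i s x. C (n - s) (T s (e i)) (co i x)"
  let ?b = "\<lambda>i s x. T (n - s) (R s (e i) (co i x))"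
  have a: "sdop X (\<lambda>x p. \<psi>1 p (x p)) (\<kappa> n) (?a i s)" if i: "i \<in> I" and s: "s \<le> n" for i s
  proof (rule sdop_mono)
    show "sdop X (\<lambda>x p. \<psi>1 p (x p)) (\<kappa> (n - s) + 0) (?a i s)"
      by (rule sdop_subst[OF C_partial_order[OF TA[OF e_in[OF i]]] co_order[OF i] co_in[OF i] rep_X])
  qed (simp add: \<kappa>_mono)
  have b: "sdop X (\<lambda>x p. \<psi>1 p (x p)) (\<kappa> n) (?b i s)" if i: "i \<in> I" and s: "s \<le> n" for i s
  proof (rule sdop_mono)
    show "sdop X (\<lambda>x p. \<psi>1 p (x p)) (\<kappa> (n - s) + (\<kappa> s + 0)) (?b i s)"
      by (rule sdop_subst[OF T_order[OF diff_le_self] R_frame_co_order[OF s i] RA[OF e_in[OF i] co_in[OF i]] rep_X])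
  qed (use \<kappa>_diff[OF s] in simp)
  have "sdop X (\<lambda>x p. \<psi>1 p (x p)) (\<kappa> n) (\<lambda>x p. \<Sum>i\<in>I. (\<Sum>s\<le>n. ?a i s x p) + (\<Sum>s\<le>n. - ?b i s x p))"
  proof (intro sdop_sum sdop_add)
    fix i s assume i: "i \<in> I" and "s \<in> {..n}"
    then have s: "s \<le> n" by simp
    show "sdop X (\<lambda>x p. \<psi>1 p (x p)) (\<kappa> n) (?a i s)" by (rule a[OF i s])
    show "sdop X (\<lambda>x p. \<psi>1 p (x p)) (\<kappa> n) (\<lambda>x p. - ?b i s x p)"
      by (rule sdop_scale[OF b[OF i s], where c = "\<lambda>p. uminus"]) (simp_all add: linear_uminus smooth_const)
  qed
  then show ?thesis
    by (rule sdop_cong) (simp add: morphism_defect_def sum_fun_apply sum_negf)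
qed

end

end

lemma defect_homotopy_order:
  assumes R: "\<And>s. section_bilin sc (*) sc X A X (R s)"
    and R_order: "\<And>s. s \<le> n \<Longrightarrow> chart_bidiff_op triv fun_triv triv X A (\<kappa> s) (R s)"
  shows "chart_bidiff_op triv fun_triv triv X A (\<kappa> n) (\<lambda>x f. - defect_homotopy R n x f)"
  unfolding chart_bidiff_op_def
proof (intro allI impI)
  fix U \<phi> W U1 \<psi>1 U2 and \<psi>2 :: "'m \<Rightarrow> complex \<Rightarrow> complex" and U3 \<psi>3
  assume "chart_domain atlas U \<phi> W" "(U1, \<psi>1) \<in> triv" and t2: "(U2, \<psi>2) \<in> fun_triv"
    and "(U3, \<psi>3) \<in> triv" "W \<subseteq> U1" "W \<subseteq> U2" "W \<subseteq> U3"
  then show "chart_domain.bdop atlas U \<phi> W X (\<lambda>x p. \<psi>1 p (x p)) A (\<lambda>f p. \<psi>2 p (f p)) (\<kappa> n) (\<kappa> n)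
      (\<lambda>x f p. \<psi>3 p ((- defect_homotopy R n x f) p))"
    using fun_trivD[OF t2] by (simp only:) (rule defect_homotopy_chart_order[OF _ _ _ R R_order])
qed

lemma morphism_homotopy_order:
  assumes R: "\<And>s. section_bilin sc (*) sc X A X (R s)"
    and R_order: "\<And>s. chart_bidiff_op triv fun_triv triv X A (\<kappa> s) (R s)"
    and T: "\<And>s. section_lin sc (*) X A (T s)"
    and T_order: "\<And>s. s \<le> n \<Longrightarrow> chart_diff_op triv fun_triv X (\<kappa> s) (T s)"
  shows "chart_diff_op triv fun_triv X (\<kappa> n) (\<lambda>x. \<Sum>i\<in>I. morphism_defect R C T n (e i) (co i x))"
  unfolding chart_diff_op_def
proof (intro allI impI)
  fix U \<phi> W U1 \<psi>1 U3 and \<psi>3 :: "'m \<Rightarrow> complex \<Rightarrow> complex"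
  assume *: "chart_domain atlas U \<phi> W" "(U1, \<psi>1) \<in> triv" and t3: "(U3, \<psi>3) \<in> fun_triv"
    and W: "W \<subseteq> U1" "W \<subseteq> U3"
  have T': "chart_domain.sdop atlas U \<phi> W X (\<lambda>x p. \<psi>1 p (x p)) (\<kappa> s) (T s)" if "s \<le> n" for s
    by (rule chart_diff_opD[OF T_order[OF that] * (1,2) fun_triv_UNIV W(1) subset_UNIV])
  have "chart_domain.sdop atlas U \<phi> W X (\<lambda>x p. \<psi>1 p (x p)) (\<kappa> n)
      (\<lambda>x. \<Sum>i\<in>I. morphism_defect R C T n (e i) (co i x))"
    by (rule morphism_homotopy_chart_order[OF * W(1) R R_order T T'])
  then show "chart_domain.sdop atlas U \<phi> W X (\<lambda>x p. \<psi>1 p (x p)) (\<kappa> n)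
      (\<lambda>x p. \<psi>3 p ((\<Sum>i\<in>I. morphism_defect R C T n (e i) (co i x)) p))"
    using fun_trivD[OF t3] by simp
qed

theorem graded_deformation_exists:
  "\<exists>R. bundle_deformation A C sc X R \<and> (\<forall>r. chart_bidiff_op triv fun_triv triv X A (\<kappa> r) (R r))"
proof (rule deformation_exists[where Q = "\<lambda>r. chart_bidiff_op triv fun_triv triv X A (\<kappa> r)"])
  show "chart_bidiff_op triv fun_triv triv X A (\<kappa> 0) (act sc)" by (rule chart_bidiff_op_act)
next
  fix R :: "nat \<Rightarrow> ('m \<Rightarrow> 'v) \<Rightarrow> ('m \<Rightarrow> complex) \<Rightarrow> 'm \<Rightarrow> 'v" and r
  assume R: "\<And>s. section_bilin sc (*) sc X A X (R s)"
    and Q: "\<And>s. s \<le> r \<Longrightarrow> chart_bidiff_op triv fun_triv triv X A (\<kappa> s) (R s)"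
    and zero: "\<And>x f. R (Suc r) x f = 0"
  \<comment> \<open>As in the local case, the homotopy mentions the next cochain, which is still
    zero and satisfies every bound.\<close>
  have "chart_bidiff_op triv fun_triv triv X A (\<kappa> s) (R s)" if s: "s \<le> Suc r" for s
  proof (cases "s = Suc r")
    case True
    show ?thesis
      unfolding chart_bidiff_op_def True zero
    proof (intro allI impI)
      fix U \<phi> W U1 \<psi>1 U2 and \<psi>2 :: "'m \<Rightarrow> complex \<Rightarrow> complex" and U3 \<psi>3
      assume cd: "chart_domain atlas U \<phi> W" and t: "(U3, \<psi>3) \<in> triv" and W: "W \<subseteq> U3"
      have "\<psi>3 p ((0 :: 'm \<Rightarrow> 'v) p) = 0" if "p \<in> W" for p
        using psi_0[OF t subsetD[OF W that]] by simp
      then show "chart_domain.bdop atlas U \<phi> W X (\<lambda>x p. \<psi>1 p (x p)) A (\<lambda>f p. \<psi>2 p (f p)) (\<kappa> (Suc r)) (\<kappa> (Suc r))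
          (\<lambda>x f p. \<psi>3 p ((0 :: 'm \<Rightarrow> 'v) p))"
        by (rule chart_domain.bdop.zero[OF cd])
    qed
  qed (use s Q in simp)
  then show "chart_bidiff_op triv fun_triv triv X A (\<kappa> (Suc r)) (\<lambda>x f. - defect_homotopy R (Suc r) x f)"
    by (rule defect_homotopy_order[OF R])
qed

end

lemma fsupp_fcnj: "fsupp (fcnj f) = fsupp f"
  by (simp add: fsupp_def fcnj_def)

context framed_bundle
begin

lemma chart_bidiff_op_mult: "chart_bidiff_op fun_triv fun_triv fun_triv A A k (\<lambda>f g. f * g)"
  unfolding chart_bidiff_op_def
proof (intro allI impI)
  fix U \<phi> W U1 U2 U3 and \<psi>1 \<psi>2 \<psi>3 :: "'m \<Rightarrow> complex \<Rightarrow> complex"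
  assume cd: "chart_domain atlas U \<phi> W"
    and t: "(U1, \<psi>1) \<in> fun_triv" "(U2, \<psi>2) \<in> fun_triv" "(U3, \<psi>3) \<in> fun_triv"
  interpret chart_domain atlas U \<phi> W by (rule cd)
  have b: "sdop A (\<lambda>f. f) k (\<lambda>f. f)" by (rule sdop_base)
  have "bdop A (\<lambda>f. f) A (\<lambda>f. f) k k (\<lambda>f g p. f p * g p)"
  proof (rule bdop_bilinear[OF b b, where c = "\<lambda>p. (*)"])
    show "bilinear ((*) :: complex \<Rightarrow> complex \<Rightarrow> complex)"
      by (simp only: bilinear_conv_bounded_bilinear bounded_bilinear_mult)
  qed (rule smooth_const)
  then show "bdop A (\<lambda>x p. \<psi>1 p (x p)) A (\<lambda>y p. \<psi>2 p (y p)) k k (\<lambda>x y p. \<psi>3 p ((x * y) p))"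
    using fun_trivD[OF t(1)] fun_trivD[OF t(2)] fun_trivD[OF t(3)] by simp
qed

text \<open>The orders \<open>k r\<close> themselves need not be superadditive; \<open>r * (k 0 + \<dots> + k r)\<close> is, and it is at
  least \<open>k r\<close> unless \<open>r = 0\<close>, where \<open>C 0\<close> is the product and has order \<open>0\<close>.\<close>

lemma graded_of_differential:
  assumes "\<forall>r. \<exists>k. bidiff_op atlas fun_triv fun_triv fun_triv A A k (C r)"
  shows "\<exists>\<kappa>. graded_framed_bundle atlas sc E triv C I e l \<kappa>"
proof -
  obtain k where k: "\<forall>r. bidiff_op atlas fun_triv fun_triv fun_triv A A (k r) (C r)"
    using choice[OF assms] by (elim exE)
  define \<kappa> where "\<kappa> r = r * (\<Sum>i\<le>r. k i)" for r
  have "\<kappa> r + \<kappa> s \<le> \<kappa> (r + s)" for r s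
  proof -
    have "(\<Sum>i\<le>r. k i) \<le> (\<Sum>i\<le>r + s. k i)" "(\<Sum>i\<le>s. k i) \<le> (\<Sum>i\<le>r + s. k i)"
      by (auto intro!: sum_mono2)
    then have "r * (\<Sum>i\<le>r. k i) + s * (\<Sum>i\<le>s. k i) \<le> r * (\<Sum>i\<le>r + s. k i) + s * (\<Sum>i\<le>r + s. k i)"
      by (intro add_mono mult_le_mono2)
    then show ?thesis by (simp only: \<kappa>_def distrib_right)
  qed
  moreover have "chart_bidiff_op fun_triv fun_triv fun_triv A A (\<kappa> r) (C r)" for r
  proof (cases "r = 0")
    case True
    show ?thesis
      unfolding chart_bidiff_op_def True
    proof (intro allI impI)
      fix U \<phi> W U1 U2 U3 and \<psi>1 \<psi>2 \<psi>3 :: "'m \<Rightarrow> complex \<Rightarrow> complex"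
      assume *: "chart_domain atlas U \<phi> W" "(U1, \<psi>1) \<in> fun_triv" "(U2, \<psi>2) \<in> fun_triv" "(U3, \<psi>3) \<in> fun_triv"
        "W \<subseteq> U1" "W \<subseteq> U2" "W \<subseteq> U3"
      show "chart_domain.bdop atlas U \<phi> W A (\<lambda>x p. \<psi>1 p (x p)) A (\<lambda>y p. \<psi>2 p (y p)) (\<kappa> 0) (\<kappa> 0)
          (\<lambda>x y p. \<psi>3 p (C 0 x y p))"
        by (rule chart_domain.bdop_cong[OF *(1) chart_bidiff_opD[OF chart_bidiff_op_mult *]]) (simp add: C_0)
    qed
  next
    case False
    have "k r \<le> (\<Sum>i\<le>r. k i)" by (rule member_le_sum) simp_all
    also have "\<dots> \<le> \<kappa> r" using False by (simp add: \<kappa>_def)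
    finally show ?thesis
      by (rule chart_bidiff_op_mono[OF bidiff_op_imp_chart[OF smooth_reps_A smooth_reps_A spec[OF k]]])
  qed
  ultimately have "graded_framed_bundle atlas sc E triv C I e l \<kappa>"
    by (intro graded_framed_bundle.intro graded_framed_bundle_axioms.intro framed_bundle_axioms)
  then show ?thesis by (rule exI[of _ \<kappa>])
qed

lemma graded_of_Vey:
  assumes "\<forall>r. bidiff_op atlas fun_triv fun_triv fun_triv A A r (C r)"
  shows "graded_framed_bundle atlas sc E triv C I e l (\<lambda>r. r)"
  by (intro graded_framed_bundle.intro graded_framed_bundle_axioms.intro framed_bundle_axioms
      bidiff_op_imp_chart[OF smooth_reps_A smooth_reps_A spec[OF assms]]) simp

lemmas chart_imp_bidiff_op_XA = chart_imp_bidiff_op[OF smooth_reps_X smooth_reps_A smooth_reps_X]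

lemmas chart_imp_bidiff_op_XX = chart_imp_bidiff_op[OF smooth_reps_X smooth_reps_X smooth_reps_A]

end

section \<open>Deformations of Hermitian bundles\<close>

locale hermitian_framed_bundle = framed_bundle atlas sc E triv C I e l + hermitian_bundle atlas sc E triv H
  for atlas :: "('m::{t2_space,second_countable_topology}, 'e::real_inner) atlas"
    and sc :: "complex \<Rightarrow> 'v::ab_group_add \<Rightarrow> 'v" and E :: "'m \<Rightarrow> 'v set"
    and triv :: "('m, 'v, complex ^ 'n) trivializations"
    and C :: "'m cochains" and I :: "'i set" and e l H +
  assumes hermitian: "hermitian_star A C"
    and Parseval: "i \<in> I \<Longrightarrow> v \<in> E p \<Longrightarrow> l i p v = H p (e i p) v"
begin

sublocale hermitian_frame A sc X C I e co H "\<lambda>x y p. H p (x p) (y p)"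
proof (intro hermitian_frame.intro hermitian_frame_axioms.intro framed_star_module_axioms)
  show "fcnj f \<in> A" if "f \<in> A" for f
    using that unfolding smooth_functions_iff fcnj_def by (rule smooth_linear[OF open_UNIV bounded_linear_cnj])
  show "hermitian_star A C" by (rule hermitian)
  show "section_lin sc (*) X A (\<lambda>y p. H p (x p) (y p))" if x: "x \<in> X" for x
    unfolding section_lin_def clinear_on_def
  proof (intro conjI ballI allI)
    show "(\<lambda>p. H p (x p) (y p)) \<in> A" if "y \<in> X" for y
      using x that unfolding smooth_functions_iff smooth_sections_iff by (rule H_apply[OF open_UNIV])
    show "(\<lambda>p. H p (x p) ((y + z) p)) = (\<lambda>p. H p (x p) (y p)) + (\<lambda>p. H p (x p) (z p))"
      if "y \<in> X" "z \<in> X" for y z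
      by (simp add: fun_eq_iff H_props(1) X_fibre x that)
    show "(\<lambda>p. H p (x p) (fscale sc c y p)) = fscale (*) c (\<lambda>p. H p (x p) (y p))" if "y \<in> X" for c y
      by (simp add: fun_eq_iff fscale_def H_props(2) X_fibre x that)
  qed
  show "(\<lambda>p. H p (x p) (act sc y f p)) = (\<lambda>p. H p (x p) (y p)) * f" if "x \<in> X" "y \<in> X" "f \<in> A" for x y f
    by (simp add: fun_eq_iff act_def H_props(2) X_fibre that mult.commute)
  show "fcnj (\<lambda>p. H p (x p) (y p)) = (\<lambda>p. H p (y p) (x p))" if "x \<in> X" "y \<in> X" for x y
    by (simp add: fun_eq_iff fcnj_def H_props(3) X_fibre that)
  show "x = 0" if x: "x \<in> X" and 0: "(\<lambda>p. H p (x p) (x p)) = 0" for x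
  proof
    fix p
    show "x p = 0 p"
    proof (rule ccontr)
      assume "x p \<noteq> 0 p"
      then have "Re (H p (x p) (x p)) > 0" by (intro H_props(4) X_fibre[OF x]) simp
      then show False using fun_cong[OF 0, of p] by simp
    qed
  qed
  show "co i x = (\<lambda>p. H p (e i p) (x p))" if "i \<in> I" "x \<in> X" for i x
    by (simp add: fun_eq_iff Parseval X_fibre that)
qed

text \<open>The coframe elements are lifted to module maps into the star algebra. The predicate
  \<open>P\<close> records a property of the components of these lifts, from which the same property
  of the metric is derived afterwards.\<close>

lemma hermitian_deformation_of:
  assumes R: "bundle_deformation A C sc X R"
    and P0: "\<And>i. i \<in> I \<Longrightarrow> P 0 (co i)"
    and PS: "\<And>T r. (\<And>s. section_lin sc (*) X A (T s)) \<Longrightarrow> (\<And>s. s \<le> r \<Longrightarrow> P s (T s)) \<Longrightarrow>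
      (\<And>x. T (Suc r) x = 0) \<Longrightarrow> P (Suc r) (\<lambda>x. \<Sum>i\<in>I. morphism_defect R C T (Suc r) (e i) (co i x))"
  shows "\<exists>\<Phi>. hermitian_deformation A C sc X H R (metric_of \<Phi>) \<and>
    (\<forall>i\<in>I. \<forall>r. section_lin sc (*) X A (\<Phi> i r) \<and> P r (\<Phi> i r))"
proof -
  interpret L: star_lift A sc X C I e co "(*)" A R C
    by (intro star_lift.intro framed_star_module_axioms star_module_self star_lift_axioms.intro R self_deformation)
  let ?good = "\<lambda>i T. T 0 = co i \<and> (\<forall>r. section_lin sc (*) X A (T r)) \<and> (\<forall>r. P r (T r)) \<and>
      (\<forall>x\<in>series_in X. \<forall>F\<in>series_in A.
         series_map T (series_bimap R x F) = series_bimap C (series_map T x) F)"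
  have "\<forall>i\<in>I. \<exists>T. ?good i T"
  proof (intro ballI L.lift_exists[where Q = P])
    fix i assume i: "i \<in> I"
    show "section_lin sc (*) X A (co i)" by (rule co_lin[OF i])
    show "co i (act sc x f) = act (*) (co i x) f" if "x \<in> X" "f \<in> A" for x f
      by (simp only: co_act[OF i that] act_times)
    show "P 0 (co i)" by (rule P0[OF i])
    show "P (Suc r) (L.lift_homotopy T (Suc r))"
      if "\<And>s. section_lin sc (*) X A (T s)" "\<And>s. s \<le> r \<Longrightarrow> P s (T s)" "\<And>x. T (Suc r) x = 0" for T r
    proof -
      have "L.lift_homotopy T (Suc r) = (\<lambda>x. \<Sum>i\<in>I. morphism_defect R C T (Suc r) (e i) (co i x))"
        by (rule ext) (simp only: L.lift_homotopy_def[OF that(1)])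
      then show ?thesis using PS[OF that] by (simp only:)
    qed
  qed
  from bchoice[OF this] obtain \<Phi> where \<Phi>: "\<forall>i\<in>I. ?good i (\<Phi> i)"
    by (elim exE)
  have "hermitian_deformation A C sc X H R (metric_of \<Phi>)"
    by (rule metric_of_hermitian_deformation[OF R]) (use \<Phi> in simp_all)
  then show ?thesis using \<Phi> by (intro exI[of _ \<Phi>]) simp
qed

theorem hermitian_exists: "\<exists>R h. hermitian_deformation A C sc X H R h"
proof -
  obtain R where R: "bundle_deformation A C sc X R"
    using deformation_exists[where Q = "\<lambda>_ _. True"] by auto
  show ?thesis using hermitian_deformation_of[OF R, where P = "\<lambda>_ _. True"] by auto
qed

theorem local_hermitian_exists:
  assumes C: "\<And>r. local_op A A (C r)"
  shows "\<exists>R h. hermitian_deformation A C sc X H R h \<and> (\<forall>r. local_op X A (R r)) \<and> (\<forall>r. local_op X X (h r))"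
proof -
  obtain R where R: "bundle_deformation A C sc X R" and loc: "\<forall>r. local_op X A (R r)"
    using local_deformation_exists[OF C] by (elim exE conjE) (rule that)
  let ?P = "\<lambda>_ T. \<forall>x\<in>X. fsupp (T x) \<subseteq> fsupp x"
  have "\<exists>\<Phi>. hermitian_deformation A C sc X H R (metric_of \<Phi>) \<and>
    (\<forall>i\<in>I. \<forall>r::nat. section_lin sc (*) X A (\<Phi> i r) \<and> ?P r (\<Phi> i r))"
  proof (rule hermitian_deformation_of[OF R])
    show "\<forall>x\<in>X. fsupp (co i x) \<subseteq> fsupp x" if "i \<in> I" for i by (intro ballI fsupp_co that)
  next
    fix T :: "nat \<Rightarrow> ('m \<Rightarrow> 'v) \<Rightarrow> 'm \<Rightarrow> complex" and r
    assume T: "\<And>s. section_lin sc (*) X A (T s)" and P: "\<And>s. s \<le> r \<Longrightarrow> \<forall>x\<in>X. fsupp (T s x) \<subseteq> fsupp x"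
      and zero: "\<And>x. T (Suc r) x = 0"
    have "fsupp (T s y) \<subseteq> fsupp y" if s: "s \<le> Suc r" and y: "y \<in> X" for s y
    proof (cases "s = Suc r")
      case True
      show ?thesis unfolding True zero by (simp add: fsupp_def)
    next
      case False
      then have "s \<le> r" using s by simp
      then show ?thesis by (rule bspec[OF P y])
    qed
    then show "\<forall>x\<in>X. fsupp (\<Sum>i\<in>I. morphism_defect R C T (Suc r) (e i) (co i x)) \<subseteq> fsupp x"
      by (intro ballI local_morphism_homotopy[OF C bundle_deformationD(1)[OF R] spec[OF loc] T])
  qed
  then obtain \<Phi> where h: "hermitian_deformation A C sc X H R (metric_of \<Phi>)"
    and \<Phi>: "\<forall>i\<in>I. \<forall>r. section_lin sc (*) X A (\<Phi> i r) \<and> (\<forall>x\<in>X. fsupp (\<Phi> i r x) \<subseteq> fsupp x)"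
    by (elim exE conjE) (rule that)
  have "local_op X X (metric_of \<Phi> r)" for r
    unfolding local_op_def metric_of_def
  proof (intro ballI fsupp_sum)
    fix x y i a b assume x: "x \<in> X" and y: "y \<in> X" and i: "i \<in> I"
    have \<Phi>i: "section_lin sc (*) X A (\<Phi> i s)" "z \<in> X \<Longrightarrow> fsupp (\<Phi> i s z) \<subseteq> fsupp z" for s z
      using \<Phi> i by simp_all
    \<comment> \<open>Conjugation preserves supports, the lifted coframe does not enlarge them, and
      \<open>C\<close> is local in both arguments.\<close>
    show "fsupp (C (r - a - b) (fcnj (\<Phi> i a x)) (\<Phi> i b y)) \<subseteq> fsupp x \<inter> fsupp y"
      using local_opD[OF C cnj_in[OF section_lin_in[OF \<Phi>i(1) x]] section_lin_in[OF \<Phi>i(1) y], of "r - a - b" a b]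
        \<Phi>i(2)[OF x, of a] \<Phi>i(2)[OF y, of b] by (auto simp: fsupp_fcnj)
  qed
  then show ?thesis using h loc by (intro exI[of _ R] exI[of _ "metric_of \<Phi>"]) simp
qed

theorem graded_hermitian_exists:
  assumes "graded_framed_bundle atlas sc E triv C I e l \<kappa>"
  shows "\<exists>R h. hermitian_deformation A C sc X H R h \<and>
    (\<forall>r. bidiff_op atlas triv fun_triv triv X A (\<kappa> r) (R r)) \<and>
    (\<forall>r. bidiff_op atlas triv triv fun_triv X X (\<kappa> r) (h r))"
proof -
  interpret G: graded_framed_bundle atlas sc E triv C I e l \<kappa> by (rule assms)
  obtain R where R: "bundle_deformation A C sc X R"
    and ord: "\<forall>r. chart_bidiff_op triv fun_triv triv X A (\<kappa> r) (R r)"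
    using G.graded_deformation_exists by (elim exE conjE) (rule that)
  have "\<exists>\<Phi>. hermitian_deformation A C sc X H R (metric_of \<Phi>) \<and>
    (\<forall>i\<in>I. \<forall>r. section_lin sc (*) X A (\<Phi> i r) \<and> chart_diff_op triv fun_triv X (\<kappa> r) (\<Phi> i r))"
  proof (rule hermitian_deformation_of[OF R])
    \<comment> \<open>Superadditivity at zero forces \<open>\<kappa> 0 = 0\<close>, which is the
      order of the coframe.\<close>
    show "chart_diff_op triv fun_triv X (\<kappa> 0) (co i)" if "i \<in> I" for i
      using chart_diff_op_co[OF that] G.\<kappa>_add[of 0 0] by simp
  next
    fix T :: "nat \<Rightarrow> ('m \<Rightarrow> 'v) \<Rightarrow> 'm \<Rightarrow> complex" and r
    assume T: "\<And>s. section_lin sc (*) X A (T s)"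
      and P: "\<And>s. s \<le> r \<Longrightarrow> chart_diff_op triv fun_triv X (\<kappa> s) (T s)" and zero: "\<And>x. T (Suc r) x = 0"
    have "chart_diff_op triv fun_triv X (\<kappa> s) (T s)" if s: "s \<le> Suc r" for s
    proof (cases "s = Suc r")
      case True
      show ?thesis
        unfolding chart_diff_op_def True zero
      proof (intro allI impI)
        fix U \<phi> W U1 \<psi>1 U3 and \<psi>3 :: "'m \<Rightarrow> complex \<Rightarrow> complex"
        assume cd: "chart_domain atlas U \<phi> W" and t: "(U3, \<psi>3) \<in> fun_triv"
        have "\<psi>3 p ((0 :: 'm \<Rightarrow> complex) p) = 0" for p using fun_trivD[OF t] by simp
        then show "chart_domain.sdop atlas U \<phi> W X (\<lambda>x p. \<psi>1 p (x p)) (\<kappa> (Suc r)) (\<lambda>x p. \<psi>3 p ((0 :: 'm \<Rightarrow> complex) p))"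
          by (rule chart_domain.sdop.zero[OF cd])
      qed
    qed (use s P in simp)
    then show "chart_diff_op triv fun_triv X (\<kappa> (Suc r)) (\<lambda>x. \<Sum>i\<in>I. morphism_defect R C T (Suc r) (e i) (co i x))"
      by (rule G.morphism_homotopy_order[OF bundle_deformationD(1)[OF R] spec[OF ord] T])
  qed
  then obtain \<Phi> where h: "hermitian_deformation A C sc X H R (metric_of \<Phi>)"
    and \<Phi>: "\<forall>i\<in>I. \<forall>r. section_lin sc (*) X A (\<Phi> i r) \<and> chart_diff_op triv fun_triv X (\<kappa> r) (\<Phi> i r)"
    by (elim exE conjE) (rule that)
  have "chart_bidiff_op triv triv fun_triv X X (\<kappa> r) (metric_of \<Phi> r)" for r
    unfolding chart_bidiff_op_def
  proof (intro allI impI)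
    fix U \<phi> W U1 \<psi>1 U2 \<psi>2 U3 and \<psi>3 :: "'m \<Rightarrow> complex \<Rightarrow> complex"
    assume cd: "chart_domain atlas U \<phi> W" and t1: "(U1, \<psi>1) \<in> triv" and t2: "(U2, \<psi>2) \<in> triv"
      and t3: "(U3, \<psi>3) \<in> fun_triv" and W: "W \<subseteq> U1" "W \<subseteq> U2"
    interpret chart_domain atlas U \<phi> W by (rule cd)
    have main: "bdop X (\<lambda>x p. \<psi>1 p (x p)) X (\<lambda>x p. \<psi>2 p (x p)) (\<kappa> r) (\<kappa> r)
        (\<lambda>x y. C (r - a - b) (fcnj (\<Phi> i a x)) (\<Phi> i b y))"
      if i: "i \<in> I" and ab: "a \<le> r" "b \<le> r - a" for i a b
    proof (rule bdop_mono)
      have lin: "section_lin sc (*) X A (\<Phi> i s)" and op: "chart_diff_op triv fun_triv X (\<kappa> s) (\<Phi> i s)" for s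
        using \<Phi> i by simp_all
      have 1: "sdop X (\<lambda>x p. \<psi>1 p (x p)) (\<kappa> a) (\<Phi> i a)"
        by (rule chart_diff_opD[OF op cd t1 fun_triv_UNIV W(1) subset_UNIV])
      have 2: "sdop X (\<lambda>x p. \<psi>2 p (x p)) (\<kappa> b) (\<Phi> i b)"
        by (rule chart_diff_opD[OF op cd t2 fun_triv_UNIV W(2) subset_UNIV])
      have 3: "sdop X (\<lambda>x p. \<psi>1 p (x p)) (\<kappa> a) (\<lambda>x. fcnj (\<Phi> i a x))"
        unfolding fcnj_def
        by (rule sdop_scale[OF 1, where c = "\<lambda>_. cnj"]) (simp_all add: bounded_linear.linear[OF bounded_linear_cnj] smooth_const)
      \<comment> \<open>Each argument passes through one lifted coframe map and one cochain. Since
        \<open>a + b \<le> r\<close>, superadditivity and monotonicity bound both sums of orders by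
        \<open>\<kappa> r\<close>.\<close>
      show "bdop X (\<lambda>x p. \<psi>1 p (x p)) X (\<lambda>x p. \<psi>2 p (x p)) (\<kappa> (r - a - b) + \<kappa> a) (\<kappa> (r - a - b) + \<kappa> b)
          (\<lambda>x y. C (r - a - b) (fcnj (\<Phi> i a x)) (\<Phi> i b y))"
        by (rule bdop_subst_right[OF bdop_subst_left[OF G.C_chart_order[OF cd t1 W(1)] 3
              cnj_in[OF section_lin_in[OF lin]] G.rep_X[OF cd t1 W(1)]] 2 section_lin_in[OF lin] G.rep_X[OF cd t2 W(2)]])
      show "\<kappa> (r - a - b) + \<kappa> a \<le> \<kappa> r"
        using G.\<kappa>_add[of "r - a - b" a] G.\<kappa>_mono[of "r - a - b + a" r] ab by simp
      show "\<kappa> (r - a - b) + \<kappa> b \<le> \<kappa> r"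
        using G.\<kappa>_add[of "r - a - b" b] G.\<kappa>_mono[of "r - a - b + b" r] ab by simp
    qed
    have "bdop X (\<lambda>x p. \<psi>1 p (x p)) X (\<lambda>x p. \<psi>2 p (x p)) (\<kappa> r) (\<kappa> r)
        (\<lambda>x y p. \<Sum>i\<in>I. \<Sum>a\<le>r. \<Sum>b\<le>r - a. C (r - a - b) (fcnj (\<Phi> i a x)) (\<Phi> i b y) p)"
      by (intro bdop_sum main) simp_all
    then have "bdop X (\<lambda>x p. \<psi>1 p (x p)) X (\<lambda>x p. \<psi>2 p (x p)) (\<kappa> r) (\<kappa> r) (metric_of \<Phi> r)"
      by (rule bdop_cong) (simp only: metric_of_def sum_fun_apply)
    then show "bdop X (\<lambda>x p. \<psi>1 p (x p)) X (\<lambda>y p. \<psi>2 p (y p)) (\<kappa> r) (\<kappa> r) (\<lambda>x y p. \<psi>3 p (metric_of \<Phi> r x y p))"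
      using fun_trivD[OF t3] by simp
  qed
  then show ?thesis using h ord
    by (intro exI[of _ R] exI[of _ "metric_of \<Phi>"] conjI allI chart_imp_bidiff_op_XA chart_imp_bidiff_op_XX) simp_all
qed

end

section \<open>Existence of frames and the conclusion\<close>

lemma (in complex_bundle) framed_bundle_exists:
  assumes "formal_deformation (smooth_functions atlas) C"
  shows "\<exists>(I :: ((nat \<times> 'e set) \<times> 'n) set) e l. framed_bundle atlas sc E triv C I e l"
proof -
  let ?S = "{(W, s, m). local_frame W s m}"
  have "\<exists>(I :: ((nat \<times> 'e set) \<times> 'n) set) e l. finite I \<and> (\<forall>i\<in>I. sections_on UNIV (e i)) \<and>
    (\<forall>i\<in>I. cosections_on UNIV (l i)) \<and> (\<forall>p. \<forall>v\<in>E p. (\<Sum>i\<in>I. sc (l i p v) (e i p)) = v) \<and>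
    (\<forall>i\<in>I. \<forall>p. \<exists>W s m k t. (W, s, m) \<in> ?S \<and> p \<in> W \<and> e i p = sc (of_real t) (s k p) \<and>
       (\<forall>v\<in>E p. l i p v = of_real t * m k p v))"
  proof (rule global_frame)
    show "\<exists>W s m. (W, s, m) \<in> ?S \<and> p \<in> W" for p
    proof -
      obtain U \<psi> where U: "(U, \<psi>) \<in> triv" "p \<in> U" using triv_at[of p] by (elim exE conjE) (rule that)
      from triv_frame[OF U(1)] U(2) show ?thesis by (intro exI conjI) simp_all
    qed
  qed simp
  then obtain I :: "((nat \<times> 'e set) \<times> 'n) set" and e l where fr: "finite I" "\<forall>i\<in>I. sections_on UNIV (e i)"
    "\<forall>i\<in>I. cosections_on UNIV (l i)" "\<forall>p. \<forall>v\<in>E p. (\<Sum>i\<in>I. sc (l i p v) (e i p)) = v"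
    by (elim exE conjE) (rule that)
  have "framed_bundle atlas sc E triv C I e l"
    by (intro framed_bundle.intro framed_bundle_axioms.intro complex_bundle_axioms assms) (use fr in simp_all)
  then show ?thesis by (intro exI)
qed

lemma (in hermitian_bundle) hermitian_framed_bundle_exists:
  assumes C: "formal_deformation (smooth_functions atlas) C" "hermitian_star (smooth_functions atlas) C"
  shows "\<exists>(I :: ((nat \<times> 'e set) \<times> 'n) set) e l. hermitian_framed_bundle atlas sc E triv C I e l H"
proof -
  let ?S = "{(W, u, m). local_frame W u m \<and> m = (\<lambda>k p. H p (u k p))}"
  have "\<exists>(I :: ((nat \<times> 'e set) \<times> 'n) set) e l. finite I \<and> (\<forall>i\<in>I. sections_on UNIV (e i)) \<and>
    (\<forall>i\<in>I. cosections_on UNIV (l i)) \<and> (\<forall>p. \<forall>v\<in>E p. (\<Sum>i\<in>I. sc (l i p v) (e i p)) = v) \<and>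
    (\<forall>i\<in>I. \<forall>p. \<exists>W s m k t. (W, s, m) \<in> ?S \<and> p \<in> W \<and> e i p = sc (of_real t) (s k p) \<and>
       (\<forall>v\<in>E p. l i p v = of_real t * m k p v))"
  proof (rule global_frame)
    show "\<exists>W s m. (W, s, m) \<in> ?S \<and> p \<in> W" for p
    proof -
      obtain U \<psi> where U: "(U, \<psi>) \<in> triv" "p \<in> U" using triv_at[of p] by (elim exE conjE) (rule that)
      obtain u where "local_frame U u (\<lambda>k p. H p (u k p))"
        using orthonormal_frame[OF U(1)] by (elim exE)
      with U(2) show ?thesis by (intro exI[of _ U] exI[of _ u] exI[of _ "\<lambda>k p. H p (u k p)"]) simp
    qed
  qed simp
  then obtain I :: "((nat \<times> 'e set) \<times> 'n) set" and e l where fr: "finite I" "\<forall>i\<in>I. sections_on UNIV (e i)"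
    "\<forall>i\<in>I. cosections_on UNIV (l i)" "\<forall>p. \<forall>v\<in>E p. (\<Sum>i\<in>I. sc (l i p v) (e i p)) = v"
    and loc: "\<forall>i\<in>I. \<forall>p. \<exists>W s m k t. (W, s, m) \<in> ?S \<and> p \<in> W \<and> e i p = sc (of_real t) (s k p) \<and>
       (\<forall>v\<in>E p. l i p v = of_real t * m k p v)"
    by (elim exE conjE) (rule that)
  have "framed_bundle atlas sc E triv C I e l"
    by (intro framed_bundle.intro framed_bundle_axioms.intro complex_bundle_axioms C) (use fr in simp_all)
  moreover have "l i p v = H p (e i p) v" if i: "i \<in> I" and v: "v \<in> E p" for i p v
  proof -
    from bspec[OF loc i] obtain W s m k t where *: "(W, s, m) \<in> ?S" "p \<in> W" "e i p = sc (of_real t) (s k p)"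
      "\<forall>v\<in>E p. l i p v = of_real t * m k p v"
      by (elim allE[of _ p] exE conjE) (rule that)
    have sm: "local_frame W s m \<and> m = (\<lambda>k p. H p (s k p))" by (rule iffD1[OF _ *(1)]) simp
    note m = conjunct2[OF sm]
    have "s k p \<in> E p" using conjunct1[OF sm] *(2) unfolding local_frame_def by (auto dest: sections_onD(1))
    \<comment> \<open>The common factor \<open>t\<close> is real, so it passes unchanged through the
      antilinear first argument of \<open>H\<close>.\<close>
    then show ?thesis using *(4) v by (simp add: *(3) m H_left(2))
  qed
  ultimately have "hermitian_framed_bundle atlas sc E triv C I e l H"
    by (intro hermitian_framed_bundle.intro hermitian_framed_bundle_axioms.intro hermitian_bundle_axioms C(2))
  then show ?thesis by (intro exI)
qed

theorem theorem3p2: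
  fixes atlas :: "('m::{t2_space,second_countable_topology}, 'e::real_inner) atlas"
    and pb :: "('m \<Rightarrow> complex) \<Rightarrow> ('m \<Rightarrow> complex) \<Rightarrow> 'm \<Rightarrow> complex"
    and sc :: "complex \<Rightarrow> 'v::ab_group_add \<Rightarrow> 'v"
    and E :: "'m \<Rightarrow> 'v set"
    and triv :: "('m, 'v, complex ^ 'n) trivializations"
    and A :: "('m \<Rightarrow> complex) set"
    and X :: "('m \<Rightarrow> 'v) set"
    and C :: "'m cochains"
  assumes "poisson_manifold atlas pb"
    and "complex_vector_bundle atlas sc E triv"
    and "A = smooth_functions atlas"
    and "X = smooth_sections atlas E triv"
    and "star_product atlas pb C"
  shows
    "(\<exists>R. bundle_deformation A C sc X R) \<and>
     (\<forall>R R'. bundle_deformation A C sc X R \<and> bundle_deformation A C sc X R' \<longrightarrow>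
        equivalent_deformations A sc X R R') \<and>
     ((\<forall>r. local_op A A (C r)) \<longrightarrow>
        (\<exists>R. bundle_deformation A C sc X R \<and> (\<forall>r. local_op X A (R r)))) \<and>
     ((\<forall>r. \<exists>k. bidiff_op atlas fun_triv fun_triv fun_triv A A k (C r)) \<longrightarrow>
        (\<exists>R. bundle_deformation A C sc X R \<and>
           (\<forall>r. \<exists>k. bidiff_op atlas triv fun_triv triv X A k (R r)))) \<and>
     ((\<forall>r. bidiff_op atlas fun_triv fun_triv fun_triv A A r (C r)) \<longrightarrow>
        (\<exists>R. bundle_deformation A C sc X R \<and>
           (\<forall>r. bidiff_op atlas triv fun_triv triv X A r (R r)))) \<and>
     (\<forall>H. hermitian_fibre_metric atlas sc E triv H \<and> hermitian_star A C \<longrightarrow>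
        (\<exists>R h. hermitian_deformation A C sc X H R h) \<and>
        (\<forall>R h R' h'.
           hermitian_deformation A C sc X H R h \<and> hermitian_deformation A C sc X H R' h' \<longrightarrow>
           equivalent_hermitian_deformations A sc X R h R' h') \<and>
        ((\<forall>r. local_op A A (C r)) \<longrightarrow>
           (\<exists>R h. hermitian_deformation A C sc X H R h \<and>
              (\<forall>r. local_op X A (R r)) \<and> (\<forall>r. local_op X X (h r)))) \<and>
        ((\<forall>r. \<exists>k. bidiff_op atlas fun_triv fun_triv fun_triv A A k (C r)) \<longrightarrow>
           (\<exists>R h. hermitian_deformation A C sc X H R h \<and>
              (\<forall>r. \<exists>k. bidiff_op atlas triv fun_triv triv X A k (R r)) \<and>
              (\<forall>r. \<exists>k. bidiff_op atlas triv triv fun_triv X X k (h r)))) \<and>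
        ((\<forall>r. bidiff_op atlas fun_triv fun_triv fun_triv A A r (C r)) \<longrightarrow>
           (\<exists>R h. hermitian_deformation A C sc X H R h \<and>
              (\<forall>r. bidiff_op atlas triv fun_triv triv X A r (R r)) \<and>
              (\<forall>r. bidiff_op atlas triv triv fun_triv X X r (h r)))))"
proof -
  interpret complex_bundle atlas sc E triv
    using assms(1,2) by unfold_locales (simp_all add: poisson_manifold_def)
  have formal: "formal_deformation (smooth_functions atlas) C"
    using assms(5) by (simp add: star_product_def)
  obtain I :: "((nat \<times> 'e set) \<times> 'n) set" and e l where "framed_bundle atlas sc E triv C I e l"
    using framed_bundle_exists[OF formal] by (elim exE)
  then interpret F: framed_bundle atlas sc E triv C I e l .
  have plain: "\<exists>R. bundle_deformation A C sc X R"
    unfolding assms(3,4) using F.deformation_exists[where Q = "\<lambda>_ _. True"] by auto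
  have unique: "\<forall>R R'. bundle_deformation A C sc X R \<and> bundle_deformation A C sc X R' \<longrightarrow>
      equivalent_deformations A sc X R R'"
    unfolding assms(3,4) by (intro allI impI, elim conjE) (rule F.deformation_unique)
  have loc: "(\<forall>r. local_op A A (C r)) \<longrightarrow>
      (\<exists>R. bundle_deformation A C sc X R \<and> (\<forall>r. local_op X A (R r)))"
    unfolding assms(3,4) by (rule impI, rule F.local_deformation_exists, erule spec)
  have graded: "\<exists>R. bundle_deformation A C sc X R \<and> (\<forall>r. bidiff_op atlas triv fun_triv triv X A (\<kappa> r) (R r))"
    if "graded_framed_bundle atlas sc E triv C I e l \<kappa>" for \<kappa>
  proof -
    interpret G: graded_framed_bundle atlas sc E triv C I e l \<kappa> by (rule that)
    obtain R where R: "bundle_deformation F.A C sc F.X R"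
      "\<forall>r. chart_bidiff_op triv fun_triv triv F.X F.A (\<kappa> r) (R r)"
      using G.graded_deformation_exists by (elim exE conjE) (rule that)
    show ?thesis
      unfolding assms(3,4) by (intro exI[of _ R] conjI allI R(1) F.chart_imp_bidiff_op_XA spec[OF R(2)])
  qed
  have diff: "(\<forall>r. \<exists>k. bidiff_op atlas fun_triv fun_triv fun_triv A A k (C r)) \<longrightarrow>
      (\<exists>R. bundle_deformation A C sc X R \<and> (\<forall>r. \<exists>k. bidiff_op atlas triv fun_triv triv X A k (R r)))"
  proof
    assume "\<forall>r. \<exists>k. bidiff_op atlas fun_triv fun_triv fun_triv A A k (C r)"
    from F.graded_of_differential[OF this[unfolded assms(3)]]
    obtain \<kappa> where "graded_framed_bundle atlas sc E triv C I e l \<kappa>" by (elim exE)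
    from graded[OF this] show "\<exists>R. bundle_deformation A C sc X R \<and> (\<forall>r. \<exists>k. bidiff_op atlas triv fun_triv triv X A k (R r))"
      by (elim exE conjE) (intro exI conjI allI, assumption, erule spec)
  qed
  have vey: "(\<forall>r. bidiff_op atlas fun_triv fun_triv fun_triv A A r (C r)) \<longrightarrow>
      (\<exists>R. bundle_deformation A C sc X R \<and> (\<forall>r. bidiff_op atlas triv fun_triv triv X A r (R r)))"
    unfolding assms(3) by (rule impI, rule graded[unfolded assms(3)], rule F.graded_of_Vey)
  have herm: "(\<exists>R h. hermitian_deformation A C sc X H R h) \<and>
        (\<forall>R h R' h'.
           hermitian_deformation A C sc X H R h \<and> hermitian_deformation A C sc X H R' h' \<longrightarrow>
           equivalent_hermitian_deformations A sc X R h R' h') \<and>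
        ((\<forall>r. local_op A A (C r)) \<longrightarrow>
           (\<exists>R h. hermitian_deformation A C sc X H R h \<and>
              (\<forall>r. local_op X A (R r)) \<and> (\<forall>r. local_op X X (h r)))) \<and>
        ((\<forall>r. \<exists>k. bidiff_op atlas fun_triv fun_triv fun_triv A A k (C r)) \<longrightarrow>
           (\<exists>R h. hermitian_deformation A C sc X H R h \<and>
              (\<forall>r. \<exists>k. bidiff_op atlas triv fun_triv triv X A k (R r)) \<and>
              (\<forall>r. \<exists>k. bidiff_op atlas triv triv fun_triv X X k (h r)))) \<and>
        ((\<forall>r. bidiff_op atlas fun_triv fun_triv fun_triv A A r (C r)) \<longrightarrow>
           (\<exists>R h. hermitian_deformation A C sc X H R h \<and>
              (\<forall>r. bidiff_op atlas triv fun_triv triv X A r (R r)) \<and>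
              (\<forall>r. bidiff_op atlas triv triv fun_triv X X r (h r))))"
    (is "_ \<and> _ \<and> _ \<and> (?D \<longrightarrow> ?D') \<and> (?V \<longrightarrow> ?V')")
    if H: "hermitian_fibre_metric atlas sc E triv H \<and> hermitian_star A C" for H
  proof -
    interpret hermitian_bundle atlas sc E triv H
      using conjunct1[OF H] by unfold_locales
    \<comment> \<open>The Hermitian case takes a frame of its own, since the coframe has to be the
      metric dual with respect to the given \<open>H\<close>.\<close>
    obtain I :: "((nat \<times> 'e set) \<times> 'n) set" and e l where "hermitian_framed_bundle atlas sc E triv C I e l H"
      using hermitian_framed_bundle_exists[OF formal conjunct2[OF H, unfolded assms(3)]] by (elim exE)
    then interpret HF: hermitian_framed_bundle atlas sc E triv C I e l H .
    show ?thesis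
    proof (intro conjI)
      show "\<exists>R h. hermitian_deformation A C sc X H R h"
        unfolding assms(3,4) by (rule HF.hermitian_exists)
      show "\<forall>R h R' h'. hermitian_deformation A C sc X H R h \<and> hermitian_deformation A C sc X H R' h' \<longrightarrow>
          equivalent_hermitian_deformations A sc X R h R' h'"
        unfolding assms(3,4) by (intro allI impI, elim conjE) (rule HF.hermitian_deformation_unique)
      show "(\<forall>r. local_op A A (C r)) \<longrightarrow>
          (\<exists>R h. hermitian_deformation A C sc X H R h \<and> (\<forall>r. local_op X A (R r)) \<and> (\<forall>r. local_op X X (h r)))"
        unfolding assms(3,4) by (rule impI, rule HF.local_hermitian_exists, erule spec)
      show "?D \<longrightarrow> ?D'"
      proof
        assume ?D
        from HF.graded_of_differential[OF this[unfolded assms(3)]]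
        obtain \<kappa> where "graded_framed_bundle atlas sc E triv C I e l \<kappa>" by (elim exE)
        from HF.graded_hermitian_exists[OF this] show ?D'
          unfolding assms(3,4) by (elim exE conjE) (intro exI conjI allI, assumption, erule spec, erule spec)
      qed
      show "?V \<longrightarrow> ?V'"
        unfolding assms(3,4) by (rule impI, rule HF.graded_hermitian_exists, rule HF.graded_of_Vey)
    qed
  qed
  show ?thesis
    by (intro conjI plain unique loc diff vey) (rule allI, rule impI, rule herm)
qed

end
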